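(* Let $p\ge 1$ and $m\ge 1$ be integers. There exists a constant $C_{p,m}>0$, depending only on $p$ and $m$, such that for every $F$ in the $p$-th Wiener chaos $\mathcal{W}_p$ with $\mathbb{E}[F^2]=1$, $$ d_{\mathrm{TV}}(\mathbf{P}_F,\boldsymbol{\gamma}_{F,m}) \le C_{p,m}\,\bigl(\operatorname{Var}\Gamma(F,F)\bigr)^{\frac{m+1}{2}}, $$ where $\mathbf{P}_F$ is the law of $F$ and $\boldsymbol{\gamma}_{F,m}$ is the signed measure on $\mathbb{R}$ with Lebesgue density $$ x\longmapsto \frac{e^{-x^2/2}}{\sqrt{2\pi}}\left(1+\sum_{k=3}^{4m-1}\frac{\mathbb{E}[H_k(F)]}{k!}H_k(x)\right). $$
   Context: Let $\gamma$ be the standard Gaussian measure on $\mathbb{R}$ and $(\Omega,\mathscr{F},\mathbf{P})=(\mathbb{R},\mathscr{B}(\mathbb{R}),\gamma)^{\mathbb{N}}$ with coordinate functions $N_i$ (i.i.d. standard Gaussian). Hermite polynomials: $H_k(x)=(-1)^k e^{x^2/2}\frac{d^k}{dx^k}e^{-x^2/2}$. The $p$-th Wiener chaos $\mathcal{W}_p$ is the $L^2(\mathbf{P})$-closure of the linear span of the products $\prod_{i\ge0}H_{k_i}(N_i)$ with $\sum_i k_i=p$; $L^2(\mathbf{P})=\bigoplus_{q\ge0}\mathcal{W}_q$, and $J_q$ is the orthogonal projection onto $\mathcal{W}_q$. The carr\'e-du-champ operator is $\Gamma(\phi,\psi)=\sum_k\partial_{x_k}\phi\,\partial_{x_k}\psi$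 for $C^2$ functions $\phi,\psi$ of finitely many coordinates whose derivatives up to order 2 have polynomial growth, extended by closability to $\{H\in L^2(\mathbf{P}):\sum_q q\|J_q(H)\|_2^2<\infty\}$ (which contains every $\mathcal{W}_q$). For finite signed measures $\mu,\nu$ on $\mathbb{R}$, $d_{\mathrm{TV}}(\mu,\nu)=\frac12\sup\{|\int h\,d\mu-\int h\,d\nu| : h:\mathbb{R}\to\mathbb{R}\text{ continuous},\ \|h\|_\infty\le1\}$. *)

theory Defs
  imports "HOL-Probability.Probability"
begin

section \<open>Gaussian space and Hermite polynomials\<close>

definition std_gaussian :: "real measure" where
  "std_gaussian = density lborel (\<lambda>x. ennreal (std_normal_density x))"

definition gauss_space :: "(nat \<Rightarrow> real) measure" where
  "gauss_space = Pi\<^sub>M UNIV (\<lambda>_. std_gaussian)"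

abbreviation E :: "((nat \<Rightarrow> real) \<Rightarrow> real) \<Rightarrow> real" where
  "E X \<equiv> prob_space.expectation gauss_space X"

abbreviation Var :: "((nat \<Rightarrow> real) \<Rightarrow> real) \<Rightarrow> real" where
  "Var X \<equiv> prob_space.variance gauss_space X"

definition hermite :: "nat \<Rightarrow> real \<Rightarrow> real" where
  "hermite k x = (- 1) ^ k * exp (x\<^sup>2 / 2) * (deriv ^^ k) (\<lambda>t. exp (- (t\<^sup>2 / 2))) x"


section \<open>Wiener chaos\<close>

text \<open>Elements of \<open>L\<^sup>2\<close> are represented by functions rather than by classes modulo almost sure
  equality; the sets defined below are closed under almost sure equality of measurable functions.\<close>

definition L2 :: "((nat \<Rightarrow> real) \<Rightarrow> real) set" where
  "L2 = {F. F \<in> borel_measurable gauss_space \<and> integrable gauss_space (\<lambda>\<omega>. (F \<omega>)\<^sup>2)}"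

definition hermite_products :: "nat \<Rightarrow> ((nat \<Rightarrow> real) \<Rightarrow> real) set" where
  "hermite_products p =
    {(\<lambda>\<omega>. \<Prod>i | k i \<noteq> 0. hermite (k i) (\<omega> i)) |k :: nat \<Rightarrow> nat.
       finite {i. k i \<noteq> 0} \<and> (\<Sum>i | k i \<noteq> 0. k i) = p}"

definition lin_span :: "('a \<Rightarrow> real) set \<Rightarrow> ('a \<Rightarrow> real) set" where
  "lin_span S = {(\<lambda>\<omega>. \<Sum>\<Phi>\<in>A. c \<Phi> * \<Phi> \<omega>) |A c. finite A \<and> A \<subseteq> S}"

definition wiener_chaos :: "nat \<Rightarrow> ((nat \<Rightarrow> real) \<Rightarrow> real) set" where
  "wiener_chaos p = {F \<in> L2. \<exists>G. (\<forall>n. G n \<in> lin_span (hermite_products p)) \<and>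
     (\<lambda>n. E (\<lambda>\<omega>. (G n \<omega> - F \<omega>)\<^sup>2)) \<longlonglongrightarrow> 0}"

text \<open>The projection is determined up to almost sure equality; \<open>SOME\<close> selects a version.\<close>

definition chaos_proj :: "nat \<Rightarrow> ((nat \<Rightarrow> real) \<Rightarrow> real) \<Rightarrow> ((nat \<Rightarrow> real) \<Rightarrow> real)" where
  "chaos_proj q H = (SOME G. G \<in> wiener_chaos q \<and>
     (\<forall>K\<in>wiener_chaos q. E (\<lambda>\<omega>. (H \<omega> - G \<omega>) * K \<omega>) = 0))"


section \<open>The carre-du-champ operator\<close>

definition pderiv_coord :: "nat \<Rightarrow> ((nat \<Rightarrow> real) \<Rightarrow> real) \<Rightarrow> ((nat \<Rightarrow> real) \<Rightarrow> real)" where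
  "pderiv_coord k \<phi> \<omega> = deriv (\<lambda>t. \<phi> (fun_upd \<omega> k t)) (\<omega> k)"

definition coord_differentiable :: "nat \<Rightarrow> ((nat \<Rightarrow> real) \<Rightarrow> real) \<Rightarrow> bool" where
  "coord_differentiable k \<phi> \<longleftrightarrow> (\<forall>\<omega>. (\<lambda>t. \<phi> (fun_upd \<omega> k t)) differentiable (at (\<omega> k)))"

definition poly_growth :: "nat \<Rightarrow> ((nat \<Rightarrow> real) \<Rightarrow> real) \<Rightarrow> bool" where
  "poly_growth n \<phi> \<longleftrightarrow> (\<exists>C N. \<forall>\<omega>. \<bar>\<phi> \<omega>\<bar> \<le> C * (1 + (\<Sum>i<n. \<bar>\<omega> i\<bar>)) ^ N)"

text \<open>\<open>C\<^sup>2\<close> functions of the first \<open>n\<close> coordinates for some \<open>n\<close>, with derivatives of order 0, 1, 2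
  of polynomial growth. A function of the first \<open>n\<close> coordinates is continuous for the product
  topology of \<^typ>\<open>nat \<Rightarrow> real\<close> iff it is continuous as a function of \<open>n\<close> real variables, and
  it is \<open>C\<^sup>2\<close> iff its partial derivatives up to order 2 exist and are continuous.\<close>

definition test_functions :: "((nat \<Rightarrow> real) \<Rightarrow> real) set" where
  "test_functions = {\<phi>. \<exists>n.
     (\<forall>\<omega> \<omega>'. (\<forall>i<n. \<omega> i = \<omega>' i) \<longrightarrow> \<phi> \<omega> = \<phi> \<omega>') \<and>
     continuous_on UNIV \<phi> \<and> poly_growth n \<phi> \<and>
     (\<forall>i. coord_differentiable i \<phi> \<and>
          continuous_on UNIV (pderiv_coord i \<phi>) \<and> poly_growth n (pderiv_coord i \<phi>)) \<and>
     (\<forall>i j. coord_differentiable j (pderiv_coord i \<phi>) \<and>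
          continuous_on UNIV (pderiv_coord j (pderiv_coord i \<phi>)) \<and>
          poly_growth n (pderiv_coord j (pderiv_coord i \<phi>)))}"

text \<open>Only finitely many terms of the series are nonzero for test functions.\<close>

definition carre_test ::
  "((nat \<Rightarrow> real) \<Rightarrow> real) \<Rightarrow> ((nat \<Rightarrow> real) \<Rightarrow> real) \<Rightarrow> ((nat \<Rightarrow> real) \<Rightarrow> real)" where
  "carre_test \<phi> \<psi> \<omega> = (\<Sum>k. pderiv_coord k \<phi> \<omega> * pderiv_coord k \<psi> \<omega>)"

definition carre_domain :: "((nat \<Rightarrow> real) \<Rightarrow> real) set" where
  "carre_domain = {H \<in> L2. summable (\<lambda>q. real q * E (\<lambda>\<omega>. (chaos_proj q H \<omega>)\<^sup>2))}"

text \<open>Convergence in \<open>L\<^sup>2\<close> together with the Cauchy property for the energy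
  \<open>\<phi> \<mapsto> E (\<Gamma> (\<phi>, \<phi>))\<close>: this is the convergence defining the closure of the closable form.\<close>

definition closure_approx ::
  "(nat \<Rightarrow> (nat \<Rightarrow> real) \<Rightarrow> real) \<Rightarrow> ((nat \<Rightarrow> real) \<Rightarrow> real) \<Rightarrow> bool" where
  "closure_approx \<phi> F \<longleftrightarrow>
     (\<forall>n. \<phi> n \<in> test_functions) \<and>
     (\<lambda>n. E (\<lambda>\<omega>. (\<phi> n \<omega> - F \<omega>)\<^sup>2)) \<longlonglongrightarrow> 0 \<and>
     (\<forall>e>0. \<exists>N. \<forall>i\<ge>N. \<forall>j\<ge>N.
        E (carre_test (\<lambda>\<omega>. \<phi> i \<omega> - \<phi> j \<omega>) (\<lambda>\<omega>. \<phi> i \<omega> - \<phi> j \<omega>)) < e)"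

text \<open>The extension of \<^const>\<open>carre_test\<close>, an element of \<open>L\<^sup>1\<close>, hence again determined only up to
  almost sure equality. It is meaningful for arguments in \<^const>\<open>carre_domain\<close>.\<close>

definition is_carre_du_champ ::
  "((nat \<Rightarrow> real) \<Rightarrow> real) \<Rightarrow> ((nat \<Rightarrow> real) \<Rightarrow> real) \<Rightarrow> ((nat \<Rightarrow> real) \<Rightarrow> real) \<Rightarrow> bool" where
  "is_carre_du_champ F G Z \<longleftrightarrow>
     F \<in> carre_domain \<and> G \<in> carre_domain \<and> integrable gauss_space Z \<and>
     (\<exists>\<phi> \<psi>. closure_approx \<phi> F \<and> closure_approx \<psi> G \<and>
        (\<lambda>n. E (\<lambda>\<omega>. \<bar>carre_test (\<phi> n) (\<psi> n) \<omega> - Z \<omega>\<bar>)) \<longlonglongrightarrow> 0)"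

definition carre_du_champ ::
  "((nat \<Rightarrow> real) \<Rightarrow> real) \<Rightarrow> ((nat \<Rightarrow> real) \<Rightarrow> real) \<Rightarrow> ((nat \<Rightarrow> real) \<Rightarrow> real)" where
  "carre_du_champ F G = (SOME Z. is_carre_du_champ F G Z)"


section \<open>Finite signed measures and total variation distance\<close>

text \<open>A finite signed measure on the Borel sets of the real line is given by its set function
  \<open>\<mu> :: real set \<Rightarrow> real\<close> (values outside the Borel sets are irrelevant). Integration goes through the
  Jordan decomposition: the positive part is \<open>\<mu>\<^sup>+(A) = sup {\<mu>(B) | B \<subseteq> A Borel}\<close>, and \<open>\<mu>\<^sup>- = (-\<mu>)\<^sup>+\<close>.\<close>

definition jordan_pos :: "(real set \<Rightarrow> real) \<Rightarrow> real measure" where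
  "jordan_pos \<mu> = measure_of UNIV (sets borel)
     (\<lambda>A. ennreal (SUP B\<in>{B \<in> sets borel. B \<subseteq> A}. \<mu> B))"

definition signed_integral :: "(real set \<Rightarrow> real) \<Rightarrow> (real \<Rightarrow> real) \<Rightarrow> real" where
  "signed_integral \<mu> h =
     (\<integral>x. h x \<partial>jordan_pos \<mu>) - (\<integral>x. h x \<partial>jordan_pos (\<lambda>A. - \<mu> A))"

definition d_TV :: "(real set \<Rightarrow> real) \<Rightarrow> (real set \<Rightarrow> real) \<Rightarrow> real" where
  "d_TV \<mu> \<nu> = 1 / 2 * (SUP h\<in>{h. continuous_on UNIV h \<and> (\<forall>x. \<bar>h x\<bar> \<le> 1)}.
     \<bar>signed_integral \<mu> h - signed_integral \<nu> h\<bar>)"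

definition law :: "((nat \<Rightarrow> real) \<Rightarrow> real) \<Rightarrow> real set \<Rightarrow> real" where
  "law F = measure (distr gauss_space borel F)"

definition edgeworth_density :: "((nat \<Rightarrow> real) \<Rightarrow> real) \<Rightarrow> nat \<Rightarrow> real \<Rightarrow> real" where
  "edgeworth_density F m x = exp (- (x\<^sup>2 / 2)) / sqrt (2 * pi) *
     (1 + (\<Sum>k = 3..4 * m - 1. E (\<lambda>\<omega>. hermite k (F \<omega>)) / fact k * hermite k x))"

definition edgeworth_measure :: "((nat \<Rightarrow> real) \<Rightarrow> real) \<Rightarrow> nat \<Rightarrow> real set \<Rightarrow> real" where
  "edgeworth_measure F m A = (LINT x:A|lborel. edgeworth_density F m x)"

end

theory Submission
  imports Defs "HOL-Real_Asymp.Real_Asymp"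
begin

text \<open>Let \<open>F\<close> be a polynomial in finitely many Gaussians that lies in chaos \<open>p\<close> with \<open>E[F\<^sup>2] = 1\<close>,
  and put \<open>g = \<Gamma>(F, F) / p - 1\<close>, \<open>D = \<Gamma>(F, \<cdot>)\<close> and \<open>\<delta> = \<parallel>g\<parallel>\<close>. If \<open>u\<close> solves Stein's equation
  \<open>u'(x) = x u(x) - f(x)\<close>, then integration by parts gives
  \<open>E[X f(F)] = E[DX u(F)] / p + E[g X u'(F)]\<close>. Starting from the part of the test function that is
  orthogonal to the first \<open>4 m\<close> Hermite polynomials, this identity can be iterated until only products
  of the \<open>D\<^sup>k g\<close> remain, whose norms are small powers of \<open>\<delta>\<close>.

  The smallness of \<open>D\<^sup>k g\<close> has the following source. On a fixed chaos, multiplication by \<open>F\<close> is, up to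
  \<open>O(\<delta>\<^bsup>1/2\<^esup>)\<close>, the sum of an operator raising the degree by \<open>p\<close> and an operator \<open>A\<close> lowering it
  by \<open>p\<close>; consequently \<open>D = p A + O(\<delta>\<^bsup>1/2\<^esup>)\<close>, while \<open>A\<close> and \<open>D\<close> commute up to \<open>O(\<delta>)\<close>. Since \<open>A\<close> is
  nilpotent on bounded degrees, iterating \<open>D\<close> gains powers of \<open>\<delta>\<close>. All constants are independent of
  the number of variables because Poincare's inequality makes moments of polynomials of bounded
  degree comparable. A general \<open>F\<close> is reached by approximation.\<close>

section \<open>Hermite polynomials and one-dimensional Gaussian calculus\<close>

text \<open>The number \<open>4 * m\<close> is a budget. Give a factor D^k g the weight k + 2. A
  Stein step spends one orthogonality relation when D falls on a factor, whose weight then rises by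
  1, and two relations when a new factor g of weight 2 appears. Hence weight plus remaining
  relations never drops below 4m, and the products left at the end have weight at least 4m. With eta
  = \<delta>^(1/2), the target is eta^(2m + 2), whereas half of the weight only accounts for
  eta^(2m); two more powers must be found. Since g has degree below 2p, two applications of A kill
  it, and splitting every D into p A plus a remainder gives D^k g the order k div 2 + 2. Moving A to
  the right, where it meets the low degree of g at once, costs a commutator of order eta^2 per
  crossing and improves this to k div 2 + 3 for k >= 3. The count then closes for every product
  except D^2 g alone with m = 1, which is treated separately. All operator bounds are stated on
  polynomials of bounded degree, because only there is the norm of a product controlled by the norms
  of its factors.\<close>

lemma prob_space_std_gaussian: "prob_space std_gaussian"
  unfolding std_gaussian_def by (rule prob_space_normal_density) simp

lemma sets_std_gaussian [simp, measurable_cong]: "sets std_gaussian = sets borel"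
  and space_std_gaussian [simp]: "space std_gaussian = UNIV"
  by (simp_all add: std_gaussian_def)

lemma std_normal_density_eq: "std_normal_density x = exp (- (x\<^sup>2 / 2)) / sqrt (2 * pi)"
  by (simp add: normal_density_def field_simps)

lemma integral_std_gaussian:
  fixes f :: "real \<Rightarrow> real"
  assumes "f \<in> borel_measurable borel"
  shows "(\<integral>x. f x \<partial>std_gaussian) = (\<integral>x. std_normal_density x * f x \<partial>lborel)"
  unfolding std_gaussian_def using assms
  by (subst integral_density) auto

lemma integrable_std_gaussian_iff:
  fixes f :: "real \<Rightarrow> real"
  assumes "f \<in> borel_measurable borel"
  shows "integrable std_gaussian f \<longleftrightarrow> integrable lborel (\<lambda>x. std_normal_density x * f x)"
  unfolding std_gaussian_def using assms
  by (subst integrable_density) auto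

text \<open>Exponent and constant are explicit arguments because the final bound must be uniform
  over all continuous test functions bounded by 1; each operation below records how they
  change.\<close>

definition growth :: "nat \<Rightarrow> real \<Rightarrow> (real \<Rightarrow> real) \<Rightarrow> bool" where
  "growth N C f \<longleftrightarrow> (\<forall>x. \<bar>f x\<bar> \<le> C * (1 + \<bar>x\<bar>) ^ N)"

lemma growthD: "growth N C f \<Longrightarrow> \<bar>f x\<bar> \<le> C * (1 + \<bar>x\<bar>) ^ N"
  by (auto simp: growth_def)

lemma growth_nonneg: "growth N C f \<Longrightarrow> 0 \<le> C"
  using growthD[of N C f 0] by simp

lemma growth_mono:
  assumes "growth N C f" "N \<le> N'" "C \<le> C'"
  shows "growth N' C' f"
  unfolding growth_def
proof
  fix x
  have "C * (1 + \<bar>x\<bar>) ^ N \<le> C' * (1 + \<bar>x\<bar>) ^ N'"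
    using assms growth_nonneg[OF assms(1)] by (intro mult_mono power_increasing) auto
  then show "\<bar>f x\<bar> \<le> C' * (1 + \<bar>x\<bar>) ^ N'" using growthD[OF assms(1), of x] by linarith
qed

lemma growth_add:
  assumes "growth N C f" "growth N D g"
  shows "growth N (C + D) (\<lambda>x. f x + g x)"
  unfolding growth_def
proof
  fix x
  show "\<bar>f x + g x\<bar> \<le> (C + D) * (1 + \<bar>x\<bar>) ^ N"
    using growthD[OF assms(1), of x] growthD[OF assms(2), of x] by (simp add: algebra_simps)
qed

lemma growth_mult:
  assumes "growth N C f" "growth M D g"
  shows "growth (N + M) (C * D) (\<lambda>x. f x * g x)"
  unfolding growth_def
proof
  fix x
  have "\<bar>f x * g x\<bar> \<le> (C * (1 + \<bar>x\<bar>) ^ N) * (D * (1 + \<bar>x\<bar>) ^ M)"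
    unfolding abs_mult using growthD[OF assms(1), of x] growthD[OF assms(2), of x]
    by (intro mult_mono) auto
  then show "\<bar>f x * g x\<bar> \<le> C * D * (1 + \<bar>x\<bar>) ^ (N + M)"
    by (simp add: power_add algebra_simps)
qed

lemma growth_cmult: "growth N C f \<Longrightarrow> growth N (\<bar>c\<bar> * C) (\<lambda>x. c * f x)"
  using growth_mult[of 0 "\<bar>c\<bar>" "\<lambda>_. c" N C f] by (simp add: growth_def)

lemma growth_uminus: "growth N C f \<Longrightarrow> growth N C (\<lambda>x. - f x)"
  by (simp add: growth_def)

lemma growth_const: "growth 0 \<bar>c\<bar> (\<lambda>x. c)"
  by (simp add: growth_def)

lemma growth_id: "growth 1 1 (\<lambda>x. x)"
  by (simp add: growth_def)

lemma growth_diff: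
  assumes "growth N C f" "growth N D g"
  shows "growth N (C + D) (\<lambda>x. f x - g x)"
  using growth_add[OF assms(1) growth_uminus[OF assms(2)]] by simp

section \<open>Gaussian integrals of functions of polynomial growth, and integration by parts on the
  line\<close>

lemma integrable_std_gaussian_power: "integrable std_gaussian (\<lambda>x. (1 + \<bar>x\<bar>) ^ N)"
proof -
  have "(1 + \<bar>x\<bar>) ^ N = (\<Sum>k\<le>N. real (N choose k) * \<bar>x\<bar> ^ k)" for x :: real
    using binomial_ring[of "\<bar>x\<bar>" 1 N] by (simp add: add.commute)
  moreover have "integrable std_gaussian (\<lambda>x. \<bar>x\<bar> ^ k)" for k
    using integrable_std_normal_moment_abs[of k]
    by (subst integrable_std_gaussian_iff) auto
  ultimately show ?thesis by simp
qed

lemma growth_integrable: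
  assumes "f \<in> borel_measurable borel" "growth N C f"
  shows "integrable std_gaussian f"
proof (rule Bochner_Integration.integrable_bound)
  show "integrable std_gaussian (\<lambda>x. C * (1 + \<bar>x\<bar>) ^ N)"
    using integrable_std_gaussian_power by auto
  show "f \<in> borel_measurable std_gaussian" using assms(1) by simp
  show "AE x in std_gaussian. norm (f x) \<le> norm (C * (1 + \<bar>x\<bar>) ^ N)"
    using growthD[OF assms(2)] by (intro AE_I2) (smt (verit) real_norm_def)
qed

definition gmom :: "nat \<Rightarrow> real" where
  "gmom N = (\<integral>x. (1 + \<bar>x\<bar>) ^ N \<partial>std_gaussian)"

lemma gmom_nonneg: "0 \<le> gmom N"
  unfolding gmom_def by (intro integral_nonneg_AE AE_I2) auto

lemma growth_integral_bound:
  assumes "f \<in> borel_measurable borel" "growth N C f"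
  shows "\<bar>\<integral>x. f x \<partial>std_gaussian\<bar> \<le> C * gmom N"
proof -
  have "\<bar>\<integral>x. f x \<partial>std_gaussian\<bar> \<le> (\<integral>x. C * (1 + \<bar>x\<bar>) ^ N \<partial>std_gaussian)"
    using growthD[OF assms(2)] growth_integrable[OF assms] integrable_std_gaussian_power
    by (intro integral_abs_bound[THEN order_trans] integral_mono) auto
  then show ?thesis by (simp add: gmom_def)
qed

text \<open>Supplies the boundary terms for integration by parts. Only the limit at
  \<open>at_top\<close> is computed; reflection gives the other, since the growth condition and the
  density are even.\<close>

lemma gauss_decay:
  assumes "growth N C f"
  shows "((\<lambda>x. std_normal_density x * f x) \<longlongrightarrow> 0) at_top"
    and "((\<lambda>x. std_normal_density x * f x) \<longlongrightarrow> 0) at_bot"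
proof -
  have 1: "((\<lambda>x::real. exp (- (x\<^sup>2 / 2)) * (1 + x) ^ N) \<longlongrightarrow> 0) at_top"
    by real_asymp
  have b: "\<forall>\<^sub>F x in at_top. norm (std_normal_density x * f x) \<le> C * (exp (- (x\<^sup>2 / 2)) * (1 + x) ^ N)" if "growth N C f" for f
    using eventually_ge_at_top[of 0]
  proof eventually_elim
    case (elim x)
    have "sqrt (2 * pi) \<ge> 1" using pi_gt3 by simp
    then have "std_normal_density x \<le> exp (- (x\<^sup>2 / 2))"
      unfolding std_normal_density_eq by (simp add: field_simps)
    then have "std_normal_density x * \<bar>f x\<bar> \<le> exp (- (x\<^sup>2 / 2)) * (C * (1 + \<bar>x\<bar>) ^ N)"
      using growthD[OF that, of x] by (intro mult_mono) auto
    then show ?case using elim by (simp add: abs_mult algebra_simps)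
  qed
  have 2: "((\<lambda>x. std_normal_density x * f x) \<longlongrightarrow> 0) at_top" if "growth N C f" for f
    by (rule Lim_null_comparison[OF b[OF that]]) (use tendsto_mult_right_zero[OF 1] in auto)
  show "((\<lambda>x. std_normal_density x * f x) \<longlongrightarrow> 0) at_top" using 2 assms by blast
  have "growth N C (\<lambda>x. f (- x))"
    using assms unfolding growth_def by (metis abs_minus_cancel)
  from 2[OF this] show "((\<lambda>x. std_normal_density x * f x) \<longlongrightarrow> 0) at_bot"
    by (subst at_bot_mirror) (simp add: filterlim_filtermap normal_density_def)
qed

lemma std_normal_density_deriv:
  "(std_normal_density has_real_derivative - x * std_normal_density x) (at x)"
proof -
  have "((\<lambda>x::real. exp (- (x\<^sup>2 / 2))) has_real_derivative - x * exp (- (x\<^sup>2 / 2))) (at x)"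
    by (auto intro!: derivative_eq_intros)
  from DERIV_cdivide[OF this, of "sqrt (2 * pi)"] show ?thesis
    by (simp add: std_normal_density_eq[abs_def])
qed

text \<open>The product \<open>std_normal_density x * u x\<close> has derivative
  \<open>std_normal_density x * (u' x - x * u x)\<close>, so the fundamental theorem of calculus on
  the whole line leaves only boundary limits, which vanish by \<open>gauss_decay\<close>.\<close>

lemma gauss_ibp:
  assumes u: "\<And>x. (u has_real_derivative u' x) (at x)" and c: "continuous_on UNIV u'"
    and g: "growth N C u" "growth N' C' u'"
  shows "(\<integral>x. x * u x \<partial>std_gaussian) = (\<integral>x. u' x \<partial>std_gaussian)"
proof -
  have cu: "continuous_on UNIV u"
    by (rule DERIV_continuous_on) (rule u)
  have m [measurable]: "u \<in> borel_measurable borel" "u' \<in> borel_measurable borel"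
    using cu c by (auto intro: borel_measurable_continuous_onI)
  have gi: "growth (1 + N) (1 * C) (\<lambda>x. x * u x)" by (rule growth_mult[OF growth_id g(1)])
  have i1: "integrable std_gaussian (\<lambda>x. x * u x)" by (rule growth_integrable[OF _ gi]) simp
  have i2: "integrable std_gaussian u'" by (rule growth_integrable[OF _ g(2)]) simp
  let ?f = "\<lambda>x. std_normal_density x * (u' x - x * u x)"
  have "(LBINT x=-\<infinity>..\<infinity>. ?f x) = 0 - 0"
  proof (rule interval_integral_FTC_integrable[where F = "\<lambda>x. std_normal_density x * u x"])
    show "((\<lambda>x. std_normal_density x * u x) has_vector_derivative ?f x) (at x)" for x
      unfolding has_real_derivative_iff_has_vector_derivative[symmetric]
      by (rule derivative_eq_intros std_normal_density_deriv u refl | simp add: algebra_simps)+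
    show "isCont ?f x" for x
      using c cu DERIV_isCont[OF std_normal_density_deriv, of x]
      by (intro continuous_intros) (auto simp: continuous_on_eq_continuous_at)
    have "integrable std_gaussian (\<lambda>x. u' x - x * u x)" using i1 i2 by simp
    then show "set_integrable lborel (einterval (-\<infinity>) \<infinity>) ?f"
      by (subst (asm) integrable_std_gaussian_iff) (auto simp: set_integrable_def)
    show "(((\<lambda>x. std_normal_density x * u x) \<circ> real_of_ereal) \<longlongrightarrow> 0) (at_right (-\<infinity>))"
      unfolding ereal_tendsto_simps by (rule gauss_decay[OF g(1)])
    show "(((\<lambda>x. std_normal_density x * u x) \<circ> real_of_ereal) \<longlongrightarrow> 0) (at_left \<infinity>)"
      unfolding ereal_tendsto_simps by (rule gauss_decay[OF g(1)])
  qed simp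
  then have "(\<integral>x. ?f x \<partial>lborel) = 0"
    by (simp add: interval_lebesgue_integral_def set_lebesgue_integral_def)
  then have "(\<integral>x. u' x - x * u x \<partial>std_gaussian) = 0"
    by (subst integral_std_gaussian) auto
  then show ?thesis using i1 i2 by simp
qed

text \<open>A copy of \<open>hermite\<close> given by the three-term recurrence, which suits
  induction better than iterated \<open>deriv\<close>; \<open>hermite_eq_he\<close> identifies the
  two.\<close>

fun he :: "nat \<Rightarrow> real \<Rightarrow> real" where
  "he 0 x = 1"
| "he (Suc 0) x = x"
| "he (Suc (Suc k)) x = x * he (Suc k) x - real (Suc k) * he k x"

text \<open>For \<open>k = 0\<close> the truncated index \<open>k - 1\<close> is harmless because
  its coefficient is \<open>real k\<close>.\<close>

lemma he_Suc: "he (Suc k) x = x * he k x - real k * he (k - 1) x"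
  by (cases k) auto

lemma he_deriv: "(he k has_real_derivative real k * he (k - 1) x) (at x)"
proof (induction k rule: less_induct)
  case (less k)
  consider "k = 0" | "k = 1" | j where "k = Suc (Suc j)" by (metis One_nat_def old.nat.exhaust)
  then show ?case
  proof cases
    case 1 then show ?thesis by (simp add: fun_eq_iff[THEN iffD2, of "he 0" "\<lambda>_. 1"])
  next
    case 2
    have "he 1 = (\<lambda>x. x)" by auto
    then show ?thesis using 2 by (auto intro!: derivative_eq_intros)
  next
    case 3
    have e: "he k = (\<lambda>x. x * he (Suc j) x - real (Suc j) * he j x)" using 3 by auto
    have d: "(he (Suc j) has_real_derivative real (Suc j) * he j x) (at x)"
       "(he j has_real_derivative real j * he (j - 1) x) (at x)"
      using less[of "Suc j"] less[of j] 3 by auto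
    have "(he k has_real_derivative (he (Suc j) x + x * (real (Suc j) * he j x) - real (Suc j) * (real j * he (j - 1) x))) (at x)"
      unfolding e by (rule derivative_eq_intros d refl | simp)+
    moreover have "he (Suc j) x + x * (real (Suc j) * he j x) - real (Suc j) * (real j * he (j - 1) x)
       = real k * he (k - 1) x"
      using 3 by (simp add: he_Suc[of j x] algebra_simps)
    ultimately show ?thesis by simp
  qed
qed

lemma deriv_funpow_gauss:
  "(deriv ^^ k) (\<lambda>t. exp (- (t\<^sup>2 / 2))) = (\<lambda>x. (- 1) ^ k * he k x * exp (- (x\<^sup>2 / 2)))"
proof (induction k)
  case (Suc k)
  have "((\<lambda>x. (- 1) ^ k * he k x * exp (- (x\<^sup>2 / 2))) has_real_derivative
     (- 1) ^ Suc k * he (Suc k) x * exp (- (x\<^sup>2 / 2))) (at x)" for x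
    unfolding he_Suc by (rule derivative_eq_intros he_deriv refl | simp add: algebra_simps)+
  then have "deriv (\<lambda>x. (- 1) ^ k * he k x * exp (- (x\<^sup>2 / 2))) = (\<lambda>x. (- 1) ^ Suc k * he (Suc k) x * exp (- (x\<^sup>2 / 2)))"
    by (intro ext DERIV_imp_deriv)
  then show ?case by (simp only: funpow.simps o_apply Suc.IH)
qed simp

lemma hermite_eq_he: "hermite k = he k"
proof
  fix x
  have "hermite k x = ((- 1) ^ k * (- 1) ^ k) * (exp (x\<^sup>2 / 2) * exp (- (x\<^sup>2 / 2))) * he k x"
    unfolding hermite_def deriv_funpow_gauss by simp
  also have "\<dots> = he k x" by (simp add: exp_minus flip: power_mult_distrib)
  finally show "hermite k x = he k x" .
qed

lemma hermite_0 [simp]: "hermite 0 x = 1"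
  by (simp add: hermite_eq_he)

lemma hermite_Suc: "hermite (Suc k) x = x * hermite k x - real k * hermite (k - 1) x"
  by (simp add: hermite_eq_he he_Suc)

lemma hermite_deriv: "(hermite k has_real_derivative real k * hermite (k - 1) x) (at x)"
  using he_deriv by (simp add: hermite_eq_he)

lemma hermite_continuous: "continuous_on UNIV (hermite k)"
  by (rule DERIV_continuous_on) (rule hermite_deriv)

lemma hermite_measurable [measurable]: "hermite k \<in> borel_measurable borel"
  by (rule borel_measurable_continuous_onI[OF hermite_continuous])

lemma hermite_growth: "\<exists>C. growth k C (hermite k)"
proof (induction k rule: less_induct)
  case (less k)
  consider "k = 0" | "k = 1" | j where "k = Suc (Suc j)" by (metis One_nat_def old.nat.exhaust)
  then show ?case
  proof cases
    case 1 then show ?thesis using growth_const[of 1] by (auto simp: hermite_eq_he fun_eq_iff growth_def)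
  next
    case 2 then show ?thesis using growth_id by (auto simp: hermite_eq_he growth_def intro!: exI[of _ 1])
  next
    case 3
    obtain C D where g: "growth (Suc j) C (hermite (Suc j))" "growth j D (hermite j)"
      using less[of "Suc j"] less[of j] 3 by auto
    have a: "growth (Suc (Suc j)) C (\<lambda>x. x * hermite (Suc j) x)"
      using growth_mult[OF growth_id g(1)] by simp
    have b: "growth (Suc (Suc j)) (real (Suc j) * D) (\<lambda>x. real (Suc j) * hermite j x)"
      using growth_mono[OF growth_cmult[OF g(2), of "real (Suc j)"], of "Suc (Suc j)"] by simp
    show ?thesis
      using growth_diff[OF a b] 3 by (auto simp: hermite_eq_he)
  qed
qed

text \<open>Since \<open>H_(k+1) = x H_k - H_k'\<close>, integrating \<open>u H_k\<close> by parts
  makes the terms with \<open>H_k'\<close> cancel and leaves \<open>u' H_k\<close>.\<close>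

lemma hermite_adjoint:
  assumes "\<And>x. (u has_real_derivative u' x) (at x)" "continuous_on UNIV u'" "growth N C u" "growth N' C' u'"
  shows "(\<integral>x. u x * hermite (Suc k) x \<partial>std_gaussian) = (\<integral>x. u' x * hermite k x \<partial>std_gaussian)"
proof -
  obtain D where D: "growth k D (hermite k)" using hermite_growth by blast
  obtain D' where D': "growth (k - 1) D' (hermite (k - 1))" using hermite_growth by blast
  have cu: "continuous_on UNIV u"
    by (rule DERIV_continuous_on) (rule assms(1))
  have m [measurable]: "u \<in> borel_measurable borel" "u' \<in> borel_measurable borel"
    using cu assms by (auto intro: borel_measurable_continuous_onI)
  let ?v = "\<lambda>x. u' x * hermite k x + u x * (real k * hermite (k - 1) x)"
  have g1: "growth (N' + k) (C' * D) (\<lambda>x. u' x * hermite k x)" by (rule growth_mult[OF assms(4) D])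
  have g2: "growth (N + (k - 1)) (C * (real k * D')) (\<lambda>x. u x * (real k * hermite (k - 1) x))"
    using growth_mult[OF assms(3) growth_cmult[OF D', of "real k"]] by simp
  have g3: "growth (1 + (N + k)) (1 * (C * D)) (\<lambda>x. x * (u x * hermite k x))"
    by (intro growth_mult growth_id assms D)
  have d: "((\<lambda>x. u x * hermite k x) has_real_derivative ?v x) (at x)" for x
    by (rule derivative_eq_intros assms hermite_deriv refl | simp)+
  have "(\<integral>x. x * (u x * hermite k x) \<partial>std_gaussian) = (\<integral>x. ?v x \<partial>std_gaussian)"
  proof (rule gauss_ibp[OF d])
    show "continuous_on UNIV ?v" by (intro continuous_intros assms cu hermite_continuous)
    show "growth (N + k) (C * D) (\<lambda>x. u x * hermite k x)" by (rule growth_mult[OF assms(3) D])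
    show "growth (max (N' + k) (N + (k - 1))) (C' * D + C * (real k * D')) ?v"
      by (intro growth_add growth_mono[OF g1] growth_mono[OF g2]) auto
  qed
  moreover have "integrable std_gaussian (\<lambda>x. u' x * hermite k x)"
    "integrable std_gaussian (\<lambda>x. u x * (real k * hermite (k - 1) x))"
    "integrable std_gaussian (\<lambda>x. x * (u x * hermite k x))"
    by (rule growth_integrable[OF _ g1] growth_integrable[OF _ g2] growth_integrable[OF _ g3]; measurable)+
  ultimately have "(\<integral>x. x * (u x * hermite k x) - u x * (real k * hermite (k - 1) x) \<partial>std_gaussian) = (\<integral>x. u' x * hermite k x \<partial>std_gaussian)"
    by simp
  moreover have "(\<lambda>x. u x * hermite (Suc k) x) = (\<lambda>x. x * (u x * hermite k x) - u x * (real k * hermite (k - 1) x))"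
    by (simp add: hermite_Suc fun_eq_iff algebra_simps)
  ultimately show ?thesis by simp
qed

text \<open>Each use of \<open>hermite_adjoint\<close> lowers both indices by one and produces a
  factor \<open>k\<close>; these factors build the factorial.\<close>

lemma hermite_orthogonal:
  "(\<integral>x. hermite j x * hermite k x \<partial>std_gaussian) = (if j = k then fact k else 0)"
proof (induction j arbitrary: k)
  case 0
  show ?case
  proof (cases k)
    case 0
    then show ?thesis using prob_space.prob_space[OF prob_space_std_gaussian] by simp
  next
    case (Suc k')
    have "(\<integral>x. 1 * hermite (Suc k') x \<partial>std_gaussian) = (\<integral>x. 0 * hermite k' x \<partial>std_gaussian)"
      by (rule hermite_adjoint[where N = 0 and C = 1 and N' = 0 and C' = 0])
        (auto intro!: derivative_eq_intros simp: growth_def)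
    then show ?thesis using Suc by simp
  qed
next
  case (Suc j)
  obtain C where C: "growth k C (hermite k)" using hermite_growth by blast
  obtain D where D: "growth (k - 1) D (hermite (k - 1))" using hermite_growth by blast
  have "(\<integral>x. hermite k x * hermite (Suc j) x \<partial>std_gaussian) = (\<integral>x. (real k * hermite (k - 1) x) * hermite j x \<partial>std_gaussian)"
    by (rule hermite_adjoint[OF hermite_deriv _ C growth_cmult[OF D]])
       (intro continuous_intros hermite_continuous)
  also have "\<dots> = real k * (\<integral>x. hermite j x * hermite (k - 1) x \<partial>std_gaussian)"
    by (subst integral_mult_right_zero[symmetric]) (simp add: mult_ac)
  also have "\<dots> = (if Suc j = k then fact k else 0)"
    using Suc[of "k - 1"] by (cases k) auto
  finally show ?case by (simp add: mult.commute)
qed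

section \<open>Stein's equation\<close>

text \<open>The constant of the tail estimate below. It depends on the growth exponent only, so the
  growth constant of a Stein solution is linear in that of the data.\<close>

definition tailc :: "nat \<Rightarrow> real" where
  "tailc N = (\<integral>s. indicator {0..} s * ((1 + \<bar>s\<bar>) ^ N * exp (- (s\<^sup>2 / 2))) \<partial>lborel)"

lemma integrable_gauss_weight:
  assumes "f \<in> borel_measurable borel" "growth N C f"
  shows "integrable lborel (\<lambda>t. f t * exp (- (t\<^sup>2 / 2)))"
proof -
  have "integrable lborel (\<lambda>x. std_normal_density x * f x)"
    using growth_integrable[OF assms] integrable_std_gaussian_iff[OF assms(1)] by simp
  then have "integrable lborel (\<lambda>x. sqrt (2 * pi) * (std_normal_density x * f x))" by simp
  then show ?thesis by (simp add: std_normal_density_eq mult.commute)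
qed

lemma integrable_indicator_mult:
  fixes f :: "real \<Rightarrow> real"
  assumes "integrable lborel f" "S \<in> sets borel"
  shows "integrable lborel (\<lambda>x. indicator S x * f x)"
  using integrable_real_mult_indicator[OF _ assms(1), of S] assms(2) by (simp add: mult.commute)

lemma tailc_nonneg: "0 \<le> tailc N"
  unfolding tailc_def by (intro integral_nonneg_AE AE_I2) auto

text \<open>With \<open>t = x + s\<close> and \<open>s >= 0\<close> one has
  \<open>x^2 / 2 - t^2 / 2 <= - s^2 / 2\<close> and \<open>1 + t <= (1 + x) * (1 + s)\<close>, so
  the growth exponent is preserved. The set \<open>S\<close> is general because
  \<open>stein_solution\<close> uses an open half line for \<open>x >= 0\<close> and, after
  reflection, a closed one for \<open>x < 0\<close>.\<close>

lemma gauss_tail_bound: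
  assumes m [measurable]: "f \<in> borel_measurable borel" and g: "growth N C f" and x: "0 \<le> x"
    and S [measurable]: "S \<in> sets borel" and Sx: "S \<subseteq> {x..}"
  shows "\<bar>exp (x\<^sup>2 / 2) * (\<integral>t. indicator S t * (f t * exp (- (t\<^sup>2 / 2))) \<partial>lborel)\<bar> \<le> tailc N * C * (1 + \<bar>x\<bar>) ^ N"
proof -
  have C: "0 \<le> C" using g by (rule growth_nonneg)
  let ?h = "\<lambda>s::real. indicator {0..} s * ((1 + \<bar>s\<bar>) ^ N * exp (- (s\<^sup>2 / 2)))"
  have ih: "integrable lborel ?h"
    using integrable_gauss_weight[of "\<lambda>s. (1 + \<bar>s\<bar>) ^ N" N 1]
    by (intro integrable_indicator_mult) (auto simp: growth_def)
  have iw: "integrable lborel (\<lambda>t. indicator S t * (f t * exp (- (t\<^sup>2 / 2))))"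
    using integrable_gauss_weight[OF m g]
    by (intro integrable_indicator_mult) auto
  have sh: "integrable lborel (\<lambda>s. indicator S (x + 1 * s) * (f (x + 1 * s) * exp (- ((x + 1 * s)\<^sup>2 / 2))))"
    by (rule lborel_integrable_real_affine[OF iw]) simp
  have "(\<integral>t. indicator S t * (f t * exp (- (t\<^sup>2 / 2))) \<partial>lborel)
     = (\<integral>s. indicator S (x + 1 * s) * (f (x + 1 * s) * exp (- ((x + 1 * s)\<^sup>2 / 2))) \<partial>lborel)"
    by (subst lborel_integral_real_affine[of 1 _ x]) auto
  then have "exp (x\<^sup>2 / 2) * (\<integral>t. indicator S t * (f t * exp (- (t\<^sup>2 / 2))) \<partial>lborel)
     = (\<integral>s. exp (x\<^sup>2 / 2) * (indicator S (x + s) * (f (x + s) * exp (- ((x + s)\<^sup>2 / 2)))) \<partial>lborel)" (is "?L = ?R")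
    by simp
  moreover have "\<bar>?R\<bar> \<le> (\<integral>s. C * (1 + \<bar>x\<bar>) ^ N * ?h s \<partial>lborel)"
  proof (rule integral_abs_bound[THEN order_trans], rule integral_mono)
    show "integrable lborel (\<lambda>s. \<bar>exp (x\<^sup>2 / 2) * (indicator S (x + s) * (f (x + s) * exp (- ((x + s)\<^sup>2 / 2))))\<bar>)"
      using sh by simp
    show "integrable lborel (\<lambda>s. C * (1 + \<bar>x\<bar>) ^ N * ?h s)" using ih by simp
    fix s :: real
    show "\<bar>exp (x\<^sup>2 / 2) * (indicator S (x + s) * (f (x + s) * exp (- ((x + s)\<^sup>2 / 2))))\<bar> \<le> C * (1 + \<bar>x\<bar>) ^ N * ?h s"
    proof (cases "x + s \<in> S")
      case True
      then have s: "0 \<le> s" using Sx by auto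
      have e: "exp (x\<^sup>2 / 2) * exp (- ((x + s)\<^sup>2 / 2)) \<le> exp (- (s\<^sup>2 / 2))"
        unfolding exp_add[symmetric] exp_le_cancel_iff using x s by (simp add: power2_eq_square field_simps)
      have "1 + \<bar>x + s\<bar> \<le> (1 + \<bar>x\<bar>) * (1 + \<bar>s\<bar>)" using x s by (simp add: algebra_simps)
      then have "(1 + \<bar>x + s\<bar>) ^ N \<le> (1 + \<bar>x\<bar>) ^ N * (1 + \<bar>s\<bar>) ^ N"
        unfolding power_mult_distrib[symmetric] by (intro power_mono) auto
      then have "\<bar>f (x + s)\<bar> \<le> C * ((1 + \<bar>x\<bar>) ^ N * (1 + \<bar>s\<bar>) ^ N)"
        using growthD[OF g, of "x + s"] C by (meson mult_left_mono order_trans)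
      then have "(exp (x\<^sup>2 / 2) * exp (- ((x + s)\<^sup>2 / 2))) * \<bar>f (x + s)\<bar> \<le> exp (- (s\<^sup>2 / 2)) * (C * ((1 + \<bar>x\<bar>) ^ N * (1 + \<bar>s\<bar>) ^ N))"
        using e by (intro mult_mono) auto
      then show ?thesis using True s by (simp add: abs_mult algebra_simps)
    qed (use C in auto)
  qed
  moreover have "(\<integral>s. C * (1 + \<bar>x\<bar>) ^ N * ?h s \<partial>lborel) = tailc N * C * (1 + \<bar>x\<bar>) ^ N"
    by (simp add: tailc_def)
  ultimately show ?thesis by metis
qed

lemma greaterThan_subseteq_atLeast: "{x<..} \<subseteq> {x::real..}"
  by (auto intro: less_imp_le)

text \<open>Variation of constants: \<open>u\<close> is minus \<open>exp (x^2 / 2)\<close> times the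
  integral \<open>G\<close> of the weighted data up to \<open>x\<close>. The vanishing mean turns
  \<open>G\<close> into minus the upper tail, so for either sign of \<open>x\<close> the integral
  over the tail away from the origin can be used, and \<open>gauss_tail_bound\<close>
  applies.\<close>

lemma stein_solution:
  assumes c: "continuous_on UNIV f" and g: "growth N C f" and z: "(\<integral>x. f x \<partial>std_gaussian) = 0"
  shows "\<exists>u. (\<forall>x. (u has_real_derivative x * u x - f x) (at x)) \<and> growth N (tailc N * C) u"
proof -
  have m [measurable]: "f \<in> borel_measurable borel" by (rule borel_measurable_continuous_onI[OF c])
  define w where "w t = f t * exp (- (t\<^sup>2 / 2))" for t
  have wm [measurable]: "w \<in> borel_measurable borel" unfolding w_def by measurable
  have wi: "integrable lborel w" unfolding w_def by (rule integrable_gauss_weight[OF m g])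
  have wc: "continuous_on UNIV w" unfolding w_def by (intro continuous_intros c) auto
  have wI: "integrable lborel (\<lambda>t. indicator S t * w t)" if [measurable]: "S \<in> sets borel" for S
    by (rule integrable_indicator_mult[OF wi that])
  have "(\<integral>x. f x \<partial>std_gaussian) = (\<integral>x. w x / sqrt (2 * pi) \<partial>lborel)"
    unfolding w_def by (subst integral_std_gaussian) (auto simp: std_normal_density_eq mult.commute)
  then have z': "(\<integral>x. w x \<partial>lborel) = 0" using z by simp
  define G where "G x = (\<integral>t. indicator {..x} t * w t \<partial>lborel)" for x
  have Gdiff: "G y = G x + integral {x..y} w" if "x \<le> y" for x y
  proof -
    have "G y = (\<integral>t. indicator {..x} t * w t + indicator {x<..y} t * w t \<partial>lborel)"
      unfolding G_def using that by (intro Bochner_Integration.integral_cong) (auto simp: indicator_def)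
    also have "\<dots> = G x + (\<integral>t. indicator {x<..y} t * w t \<partial>lborel)"
      unfolding G_def by (intro Bochner_Integration.integral_add wI) auto
    also have "(\<integral>t. indicator {x<..y} t * w t \<partial>lborel) = (\<integral>t. indicator {x..y} t * w t \<partial>lborel)"
    proof (rule integral_cong_AE)
      show "AE t in lborel. indicator {x<..y} t * w t = indicator {x..y} t * w t"
        using AE_lborel_singleton[of x] by eventually_elim (auto simp: indicator_def)
    qed auto
    also have "\<dots> = integral {x..y} w"
    proof -
      have "set_integrable lborel {x..y} w"
        using wI[of "{x..y}"] by (simp add: set_integrable_def)
      from set_borel_integral_eq_integral(2)[OF this] show ?thesis
        by (simp add: set_lebesgue_integral_def)
    qed
    finally show ?thesis .
  qed
  have Gd: "(G has_real_derivative w x) (at x)" for x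
  proof -
    \<comment> \<open>The base point \<open>x - 1\<close> only places \<open>x\<close> in the
      interior of a compact interval, where the fundamental theorem of calculus is
      available.\<close>
    have "((\<lambda>y. integral {x - 1..y} w) has_real_derivative w x) (at x within {x - 1..x + 1})"
      by (rule integral_has_real_derivative) (auto intro: continuous_on_subset[OF wc])
    then have "((\<lambda>y. integral {x - 1..y} w) has_real_derivative w x) (at x)"
      by (simp add: at_within_Icc_at)
    then have "((\<lambda>y. G (x - 1) + integral {x - 1..y} w) has_real_derivative w x) (at x)"
      by (auto intro!: derivative_eq_intros)
    moreover have "\<forall>\<^sub>F y in nhds x. G y = G (x - 1) + integral {x - 1..y} w"
      unfolding eventually_nhds
      by (rule exI[of _ "{x - 1<..}"]) (auto intro!: Gdiff)
    ultimately show ?thesis by (subst DERIV_cong_ev[OF refl _ refl])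
  qed
  define u where "u x = - (exp (x\<^sup>2 / 2) * G x)" for x
  have d: "(u has_real_derivative x * u x - f x) (at x)" for x
  proof -
    have "exp (x\<^sup>2 / 2) * w x = f x" unfolding w_def by (simp add: exp_minus)
    then have e: "- (exp (x\<^sup>2 / 2) * x * G x + exp (x\<^sup>2 / 2) * w x) = x * u x - f x"
      by (simp add: u_def algebra_simps)
    have "(u has_real_derivative - (exp (x\<^sup>2 / 2) * x * G x + exp (x\<^sup>2 / 2) * w x)) (at x)"
      unfolding u_def[abs_def] by (auto intro!: derivative_eq_intros Gd)
    then show ?thesis unfolding e .
  qed
  have G2: "G x = - (\<integral>t. indicator {x<..} t * w t \<partial>lborel)" for x
  proof -
    have "0 = (\<integral>t. indicator {..x} t * w t + indicator {x<..} t * w t \<partial>lborel)"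
      unfolding z'[symmetric] by (intro Bochner_Integration.integral_cong) (auto simp: indicator_def)
    also have "\<dots> = G x + (\<integral>t. indicator {x<..} t * w t \<partial>lborel)"
      unfolding G_def by (intro Bochner_Integration.integral_add wI) auto
    finally show ?thesis by simp
  qed
  have "\<bar>u x\<bar> \<le> tailc N * C * (1 + \<bar>x\<bar>) ^ N" for x
  proof (cases "0 \<le> x")
    case True
    show ?thesis
      using gauss_tail_bound[OF m g True, of "{x<..}", OF _ greaterThan_subseteq_atLeast] unfolding u_def G2 w_def by auto
  next
    case False
    have g': "growth N C (\<lambda>t. f (- t))" using g unfolding growth_def by (metis abs_minus_cancel)
    have "G x = (\<integral>t. indicator {- x..} t * (f (- t) * exp (- (t\<^sup>2 / 2))) \<partial>lborel)"
      unfolding G_def w_def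
      by (subst lborel_integral_real_affine[of "-1" _ 0]) (auto simp: indicator_def intro!: Bochner_Integration.integral_cong)
    then show ?thesis
      using gauss_tail_bound[OF _ g', of "- x" "{- x..}"] False unfolding u_def by auto
  qed
  then show ?thesis using d unfolding growth_def by blast
qed

text \<open>The number \<open>r\<close> is the stock of orthogonality relations that the iteration
  of Stein's equation consumes.\<close>

definition gorth :: "nat \<Rightarrow> nat \<Rightarrow> real \<Rightarrow> (real \<Rightarrow> real) \<Rightarrow> bool" where
  "gorth r N C f \<longleftrightarrow> continuous_on UNIV f \<and> growth N C f \<and>
     (\<forall>k<r. (\<integral>x. f x * hermite k x \<partial>std_gaussian) = 0)"

text \<open>Testing the equation against Hermite polynomials gives
  \<open>E[f H_k] = k E[u H_(k-1)]\<close>, and adjointness gives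
  \<open>E[u' H_k] = E[u H_(k+1)]\<close>. So \<open>u\<close> loses one relation and
  \<open>u'\<close> loses two. The factor \<open>x\<close> in \<open>u'\<close> raises the growth
  exponent by one.\<close>

lemma gorth_stein:
  assumes f: "gorth r N C f" and r: "1 \<le> r"
  shows "\<exists>u. (\<forall>x. (u has_real_derivative x * u x - f x) (at x)) \<and>
     gorth (r - 1) N (tailc N * C) u \<and> gorth (r - 2) (Suc N) ((tailc N + 1) * C) (\<lambda>x. x * u x - f x)"
proof -
  have c: "continuous_on UNIV f" and g: "growth N C f"
    and o: "\<And>k. k < r \<Longrightarrow> (\<integral>x. f x * hermite k x \<partial>std_gaussian) = 0"
    using f by (auto simp: gorth_def)
  have fm [measurable]: "f \<in> borel_measurable borel" by (rule borel_measurable_continuous_onI[OF c])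
  obtain u where u: "\<And>x. (u has_real_derivative x * u x - f x) (at x)" and gu: "growth N (tailc N * C) u"
    using stein_solution[OF c g] o[of 0] r by auto
  have cu: "continuous_on UNIV u"
    by (rule DERIV_continuous_on) (rule u)
  have um [measurable]: "u \<in> borel_measurable borel" by (rule borel_measurable_continuous_onI[OF cu])
  let ?u' = "\<lambda>x. x * u x - f x"
  have cu': "continuous_on UNIV ?u'" by (intro continuous_intros cu c)
  have gu': "growth (Suc N) ((tailc N + 1) * C) ?u'"
  proof -
    have "growth (Suc N) (tailc N * C) (\<lambda>x. x * u x)" using growth_mult[OF growth_id gu] by simp
    moreover have "growth (Suc N) C f" by (rule growth_mono[OF g]) auto
    ultimately show ?thesis using growth_diff by (fastforce simp: algebra_simps)
  qed
  have o': "(\<integral>x. ?u' x * hermite k x \<partial>std_gaussian) = (\<integral>x. u x * hermite (Suc k) x \<partial>std_gaussian)" for k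
    by (rule hermite_adjoint[OF u cu' gu gu', symmetric])
  have o1: "(\<integral>x. f x * hermite k x \<partial>std_gaussian) = real k * (\<integral>x. u x * hermite (k - 1) x \<partial>std_gaussian)" for k
  proof -
    obtain D where D: "growth k D (hermite k)" using hermite_growth by blast
    obtain D' where D': "growth (k - 1) D' (hermite (k - 1))" using hermite_growth by blast
    have [simp]: "integrable std_gaussian (\<lambda>x. f x * hermite k x)"
      by (rule growth_integrable[OF _ growth_mult[OF g D]]) measurable
    have [simp]: "integrable std_gaussian (\<lambda>x. x * (u x * hermite k x))"
      by (rule growth_integrable[OF _ growth_mult[OF growth_id growth_mult[OF gu D]]]) measurable
    have [simp]: "integrable std_gaussian (\<lambda>x. u x * (real k * hermite (k - 1) x))"
      by (rule growth_integrable[OF _ growth_mult[OF gu growth_cmult[OF D']]]) measurable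
    have "(\<integral>x. x * (u x * hermite k x) - f x * hermite k x \<partial>std_gaussian)
        = (\<integral>x. ?u' x * hermite k x \<partial>std_gaussian)"
      by (intro Bochner_Integration.integral_cong) (auto simp: algebra_simps)
    also have "\<dots> = (\<integral>x. u x * hermite (Suc k) x \<partial>std_gaussian)" by (rule o')
    also have "\<dots> = (\<integral>x. x * (u x * hermite k x) - u x * (real k * hermite (k - 1) x) \<partial>std_gaussian)"
      by (intro Bochner_Integration.integral_cong) (auto simp: hermite_Suc algebra_simps)
    also have "\<dots> = (\<integral>x. x * (u x * hermite k x) \<partial>std_gaussian) - (\<integral>x. u x * (real k * hermite (k - 1) x) \<partial>std_gaussian)"
      by (rule Bochner_Integration.integral_diff) fact+
    also have "(\<integral>x. x * (u x * hermite k x) - f x * hermite k x \<partial>std_gaussian)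
        = (\<integral>x. x * (u x * hermite k x) \<partial>std_gaussian) - (\<integral>x. f x * hermite k x \<partial>std_gaussian)"
      by (rule Bochner_Integration.integral_diff) fact+
    finally have "(\<integral>x. f x * hermite k x \<partial>std_gaussian) = (\<integral>x. u x * (real k * hermite (k - 1) x) \<partial>std_gaussian)"
      by simp
    also have "\<dots> = real k * (\<integral>x. u x * hermite (k - 1) x \<partial>std_gaussian)"
      by (subst integral_mult_right_zero[symmetric]) (simp add: mult_ac)
    finally show ?thesis .
  qed
  have ou: "(\<integral>x. u x * hermite k x \<partial>std_gaussian) = 0" if "k < r - 1" for k
    using o1[of "Suc k"] o[of "Suc k"] that by auto
  have ou': "(\<integral>x. ?u' x * hermite k x \<partial>std_gaussian) = 0" if "k < r - 2" for k
    using o' ou[of "Suc k"] that by auto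
  show ?thesis using u cu gu cu' gu' ou ou' unfolding gorth_def by blast
qed

text \<open>The Hermite coefficients are estimated through the bound 1 on \<open>h\<close> alone,
  hence the growth constant is the same for all test functions.\<close>

lemma gorth_project:
  assumes c: "continuous_on UNIV h" and b: "\<And>x. \<bar>h x\<bar> \<le> 1"
    and C: "\<And>k. k < r \<Longrightarrow> growth k (C k) (hermite k)"
  shows "gorth r r (1 + (\<Sum>k<r. C k * gmom k / fact k * C k))
     (\<lambda>x. h x - (\<Sum>k<r. (\<integral>y. h y * hermite k y \<partial>std_gaussian) / fact k * hermite k x))"
proof -
  have hm [measurable]: "h \<in> borel_measurable borel" by (rule borel_measurable_continuous_onI[OF c])
  have gh: "growth 0 1 h" using b by (simp add: growth_def)
  let ?a = "\<lambda>k. (\<integral>y. h y * hermite k y \<partial>std_gaussian)"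
  have a: "\<bar>?a k\<bar> \<le> C k * gmom k" if "k < r" for k
    using growth_integral_bound[OF _ growth_mult[OF gh C[OF that]]] by simp
  have gi: "integrable std_gaussian (\<lambda>x. h x * hermite k x)" for k
  proof -
    obtain D where D: "growth k D (hermite k)" using hermite_growth by blast
    show ?thesis by (rule growth_integrable[OF _ growth_mult[OF gh D]]) measurable
  qed
  have gi2: "integrable std_gaussian (\<lambda>x. hermite j x * hermite k x)" for j k
  proof -
    obtain D where D: "growth k D (hermite k)" using hermite_growth by blast
    obtain D' where D': "growth j D' (hermite j)" using hermite_growth by blast
    show ?thesis by (rule growth_integrable[OF _ growth_mult[OF D' D]]) measurable
  qed
  have "(\<integral>x. (h x - (\<Sum>k<r. ?a k / fact k * hermite k x)) * hermite j x \<partial>std_gaussian) = 0" if "j < r" for j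
  proof -
    have "(\<integral>x. (h x - (\<Sum>k<r. ?a k / fact k * hermite k x)) * hermite j x \<partial>std_gaussian)
      = (\<integral>x. h x * hermite j x - (\<Sum>k<r. ?a k / fact k * (hermite k x * hermite j x)) \<partial>std_gaussian)"
      by (intro Bochner_Integration.integral_cong) (auto simp: algebra_simps sum_distrib_left)
    also have "\<dots> = ?a j - (\<Sum>k<r. ?a k / fact k * (\<integral>x. hermite k x * hermite j x \<partial>std_gaussian))"
      using gi gi2 by (subst Bochner_Integration.integral_diff) (auto simp: Bochner_Integration.integral_sum)
    also have "\<dots> = ?a j - (\<Sum>k<r. if k = j then ?a j else 0)"
      by (intro arg_cong2[where f = minus] sum.cong) (auto simp: hermite_orthogonal)
    also have "\<dots> = 0" using that by simp
    finally show ?thesis .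
  qed
  moreover have "growth r (1 + (\<Sum>k<r. C k * gmom k / fact k * C k)) (\<lambda>x. h x - (\<Sum>k<r. ?a k / fact k * hermite k x))"
  proof (rule growth_diff)
    show "growth r 1 h" by (rule growth_mono[OF gh]) auto
    show "growth r (\<Sum>k<r. C k * gmom k / fact k * C k) (\<lambda>x. \<Sum>k<r. ?a k / fact k * hermite k x)"
      unfolding growth_def
    proof
      fix x
      have "\<bar>\<Sum>k<r. ?a k / fact k * hermite k x\<bar> \<le> (\<Sum>k<r. \<bar>?a k / fact k * hermite k x\<bar>)" by (rule sum_abs)
      also have "\<dots> \<le> (\<Sum>k<r. (C k * gmom k / fact k * C k) * (1 + \<bar>x\<bar>) ^ r)"
      proof (rule sum_mono)
        fix k assume "k \<in> {..<r}"
        then have k: "k < r" by simp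
        have Ck: "0 \<le> C k" using growth_nonneg[OF C[OF k]] .
        have "\<bar>?a k / fact k\<bar> \<le> C k * gmom k / fact k"
          using a[OF k] by (simp add: divide_right_mono)
        moreover have "\<bar>hermite k x\<bar> \<le> C k * (1 + \<bar>x\<bar>) ^ r"
          using growthD[OF growth_mono[OF C[OF k], of r "C k"], of x] k by simp
        ultimately have "\<bar>?a k / fact k\<bar> * \<bar>hermite k x\<bar> \<le> (C k * gmom k / fact k) * (C k * (1 + \<bar>x\<bar>) ^ r)"
          using Ck gmom_nonneg[of k] by (intro mult_mono) auto
        then show "\<bar>?a k / fact k * hermite k x\<bar> \<le> (C k * gmom k / fact k * C k) * (1 + \<bar>x\<bar>) ^ r"
          by (simp add: abs_mult mult.assoc)
      qed
      finally show "\<bar>\<Sum>k<r. ?a k / fact k * hermite k x\<bar> \<le> (\<Sum>k<r. C k * gmom k / fact k * C k) * (1 + \<bar>x\<bar>) ^ r"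
        by (simp add: sum_distrib_right)
    qed
  qed
  ultimately show ?thesis unfolding gorth_def
    by (auto intro!: continuous_intros c hermite_continuous)
qed

section \<open>Integration by parts on Gaussian space\<close>

lemma prob_space_gauss_space: "prob_space gauss_space"
  unfolding gauss_space_def by (intro prob_space_PiM prob_space_std_gaussian)

interpretation GS: prob_space gauss_space
  by (rule prob_space_gauss_space)

lemma space_gauss_space [simp]: "space gauss_space = UNIV"
  by (simp add: gauss_space_def space_PiM PiE_def)

text \<open>Allows measurability to be read off from continuity in the product topology.\<close>

lemma sets_gauss_space [measurable_cong]: "sets gauss_space = sets borel"
proof -
  have "sets gauss_space = sets (Pi\<^sub>M UNIV (\<lambda>_::nat. borel :: real measure))"
    unfolding gauss_space_def by (rule sets_PiM_cong) simp_all
  then show ?thesis using sets_PiM_equal_borel by simp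
qed

lemma continuous_measurable_gauss:
  fixes u :: "(nat \<Rightarrow> real) \<Rightarrow> real"
  assumes "continuous_on UNIV u"
  shows "u \<in> borel_measurable gauss_space"
proof -
  have "u \<in> borel_measurable borel" using assms by (rule borel_measurable_continuous_onI)
  then show ?thesis using measurable_cong_sets[OF sets_gauss_space refl] by blast
qed

lemma continuous_coordinate: "continuous_on UNIV (\<lambda>\<omega>::nat \<Rightarrow> real. \<omega> i)"
  by simp

lemma continuous_update: "continuous_on UNIV (\<lambda>s::real. (fun_upd \<omega> i s))" for \<omega> :: "nat \<Rightarrow> real"
proof (rule continuous_on_coordinatewise_then_product)
  fix j show "continuous_on UNIV (\<lambda>s. (fun_upd \<omega> i s) j)" by (cases "j = i") (auto intro: continuous_intros)
qed

lemma coordinate_moment_integrable: "integrable gauss_space (\<lambda>\<omega>. \<bar>\<omega> i\<bar> ^ N)"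
proof -
  have "distr gauss_space std_gaussian (\<lambda>\<omega>. \<omega> i) = std_gaussian"
    unfolding gauss_space_def by (rule distr_PiM_component) (auto intro: prob_space_std_gaussian)
  moreover have "integrable std_gaussian (\<lambda>x. \<bar>x\<bar> ^ N)"
    by (rule growth_integrable[of _ N 1]) (auto simp: growth_def intro!: power_mono)
  ultimately have "integrable (distr gauss_space std_gaussian (\<lambda>\<omega>. \<omega> i)) (\<lambda>x. \<bar>x\<bar> ^ N)" by simp
  then show ?thesis
    by (subst (asm) integrable_distr_eq)
      (auto intro!: continuous_measurable_gauss[OF continuous_coordinate, simplified measurable_cong_sets[OF refl sets_std_gaussian[symmetric]]])
qed

section \<open>Polynomial growth in finitely many coordinates\<close>

lemma poly_growth_mono:
  assumes "poly_growth n u" "n \<le> n'"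
  shows "poly_growth n' u"
proof -
  obtain C N where b: "\<And>\<omega>. \<bar>u \<omega>\<bar> \<le> C * (1 + (\<Sum>i<n. \<bar>\<omega> i\<bar>)) ^ N"
    using assms by (auto simp: poly_growth_def)
  have C: "0 \<le> C" using b[of "\<lambda>_. 0"] by simp
  have "(\<Sum>i<n. \<bar>\<omega> i\<bar>) \<le> (\<Sum>i<n'. \<bar>\<omega> i\<bar>)" for \<omega> :: "nat \<Rightarrow> real"
    using assms(2) by (intro sum_mono2) auto
  then have "C * (1 + (\<Sum>i<n. \<bar>\<omega> i\<bar>)) ^ N \<le> C * (1 + (\<Sum>i<n'. \<bar>\<omega> i\<bar>)) ^ N" for \<omega> :: "nat \<Rightarrow> real"
    using C by (intro mult_left_mono power_mono add_left_mono) (auto intro: add_nonneg_nonneg sum_nonneg)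
  then show ?thesis unfolding poly_growth_def using b order_trans by blast
qed

text \<open>The bound is offered at every larger exponent so that two functions can be brought to a
  common one.\<close>

lemma poly_growth_exponent:
  assumes "poly_growth n u"
  obtains C N where "0 \<le> C" "\<And>\<omega> M. N \<le> M \<Longrightarrow> \<bar>u \<omega>\<bar> \<le> C * (1 + (\<Sum>i<n. \<bar>\<omega> i\<bar>)) ^ M"
proof -
  obtain C N where b: "\<And>\<omega>. \<bar>u \<omega>\<bar> \<le> C * (1 + (\<Sum>i<n. \<bar>\<omega> i\<bar>)) ^ N"
    using assms by (auto simp: poly_growth_def)
  have C: "0 \<le> C" using b[of "\<lambda>_. 0"] by simp
  have "\<bar>u \<omega>\<bar> \<le> C * (1 + (\<Sum>i<n. \<bar>\<omega> i\<bar>)) ^ M" if "N \<le> M" for \<omega> M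
  proof -
    have "(1 + (\<Sum>i<n. \<bar>\<omega> i\<bar>)) ^ N \<le> (1 + (\<Sum>i<n. \<bar>\<omega> i\<bar>)) ^ M"
      using that by (intro power_increasing) (auto intro: sum_nonneg)
    then show ?thesis using b[of \<omega>] C by (meson mult_left_mono order_trans)
  qed
  then show ?thesis using C that by blast
qed

lemma poly_growth_add:
  assumes "poly_growth n u" "poly_growth n v"
  shows "poly_growth n (\<lambda>\<omega>. u \<omega> + v \<omega>)"
proof -
  obtain C N where C: "\<And>\<omega> M. N \<le> M \<Longrightarrow> \<bar>u \<omega>\<bar> \<le> C * (1 + (\<Sum>i<n. \<bar>\<omega> i\<bar>)) ^ M"
    using poly_growth_exponent[OF assms(1)] by metis
  obtain D N' where D: "\<And>\<omega> M. N' \<le> M \<Longrightarrow> \<bar>v \<omega>\<bar> \<le> D * (1 + (\<Sum>i<n. \<bar>\<omega> i\<bar>)) ^ M"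
    using poly_growth_exponent[OF assms(2)] by metis
  have "\<bar>u \<omega> + v \<omega>\<bar> \<le> (C + D) * (1 + (\<Sum>i<n. \<bar>\<omega> i\<bar>)) ^ (max N N')" for \<omega>
    using C[of "max N N'" \<omega>] D[of "max N N'" \<omega>] by (simp add: algebra_simps)
  then show ?thesis unfolding poly_growth_def by blast
qed

lemma poly_growth_mult:
  assumes "poly_growth n u" "poly_growth n v"
  shows "poly_growth n (\<lambda>\<omega>. u \<omega> * v \<omega>)"
proof -
  obtain C N where C: "0 \<le> C" "\<And>\<omega>. \<bar>u \<omega>\<bar> \<le> C * (1 + (\<Sum>i<n. \<bar>\<omega> i\<bar>)) ^ N"
    using poly_growth_exponent[OF assms(1)] by (metis order_refl)
  obtain D N' where D: "0 \<le> D" "\<And>\<omega>. \<bar>v \<omega>\<bar> \<le> D * (1 + (\<Sum>i<n. \<bar>\<omega> i\<bar>)) ^ N'"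
    using poly_growth_exponent[OF assms(2)] by (metis order_refl)
  have "\<bar>u \<omega> * v \<omega>\<bar> \<le> (C * D) * (1 + (\<Sum>i<n. \<bar>\<omega> i\<bar>)) ^ (N + N')" for \<omega>
  proof -
    have "\<bar>u \<omega> * v \<omega>\<bar> \<le> (C * (1 + (\<Sum>i<n. \<bar>\<omega> i\<bar>)) ^ N) * (D * (1 + (\<Sum>i<n. \<bar>\<omega> i\<bar>)) ^ N')"
      unfolding abs_mult using C D
      by (intro mult_mono) (auto intro!: mult_nonneg_nonneg zero_le_power add_nonneg_nonneg sum_nonneg)
    then show ?thesis by (simp add: power_add algebra_simps)
  qed
  then show ?thesis unfolding poly_growth_def by blast
qed

lemma poly_growth_const: "poly_growth n (\<lambda>_. c)"
  unfolding poly_growth_def by (rule exI[of _ "\<bar>c\<bar>"], rule exI[of _ 0]) simp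

lemma poly_growth_coordinate:
  assumes "i < n" shows "poly_growth n (\<lambda>\<omega>. \<omega> i)"
proof -
  have "\<bar>\<omega> i\<bar> \<le> 1 * (1 + (\<Sum>i<n. \<bar>\<omega> i\<bar>)) ^ 1" for \<omega> :: "nat \<Rightarrow> real"
    using member_le_sum[of i "{..<n}" "\<lambda>i. \<bar>\<omega> i\<bar>"] assms by simp
  then show ?thesis unfolding poly_growth_def by blast
qed

text \<open>Reduction to moments of single coordinates: if some coordinate has modulus at least 1,
  the largest one dominates \<open>1 + sum\<close> up to the factor \<open>1 + n\<close>; otherwise
  the sum is at most \<open>n\<close>.\<close>

lemma poly_growth_integrable:
  assumes m: "u \<in> borel_measurable gauss_space" and g: "poly_growth n u"
  shows "integrable gauss_space u"
proof -
  obtain C N where b: "0 \<le> C" "\<And>\<omega>. \<bar>u \<omega>\<bar> \<le> C * (1 + (\<Sum>i<n. \<bar>\<omega> i\<bar>)) ^ N"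
    using poly_growth_exponent[OF g] by (metis order_refl)
  have le: "(1 + (\<Sum>i<n. \<bar>\<omega> i\<bar>)) ^ N \<le> (1 + real n) ^ N * (1 + (\<Sum>i<n. \<bar>\<omega> i\<bar> ^ N))" for \<omega> :: "nat \<Rightarrow> real"
  proof (cases "\<exists>i<n. 1 \<le> \<bar>\<omega> i\<bar>")
    case False
    then have "(\<Sum>i<n. \<bar>\<omega> i\<bar>) \<le> (\<Sum>i<n. 1)" by (intro sum_mono) (auto simp: not_le intro: less_imp_le)
    then have "(1 + (\<Sum>i<n. \<bar>\<omega> i\<bar>)) ^ N \<le> (1 + real n) ^ N * 1"
      by (simp, intro power_mono) (auto intro!: add_nonneg_nonneg sum_nonneg)
    also have "\<dots> \<le> (1 + real n) ^ N * (1 + (\<Sum>i<n. \<bar>\<omega> i\<bar> ^ N))"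
      by (intro mult_left_mono) (auto intro!: sum_nonneg)
    finally show ?thesis .
  next
    case True
    have fin: "finite ((\<lambda>i. \<bar>\<omega> i\<bar>) ` {..<n})" "(\<lambda>i. \<bar>\<omega> i\<bar>) ` {..<n} \<noteq> {}" using True by auto
    from Max_in[OF fin] obtain k where k: "Max ((\<lambda>i. \<bar>\<omega> i\<bar>) ` {..<n}) = \<bar>\<omega> k\<bar>" "k \<in> {..<n}"
      by (rule imageE)
    have mx: "\<bar>\<omega> i\<bar> \<le> \<bar>\<omega> k\<bar>" if "i < n" for i using that fin k(1)[symmetric] by auto
    have k1: "1 \<le> \<bar>\<omega> k\<bar>" using True mx by force
    have "(\<Sum>i<n. \<bar>\<omega> i\<bar>) \<le> (\<Sum>i<n. \<bar>\<omega> k\<bar>)" by (intro sum_mono) (auto intro: mx)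
    then have "1 + (\<Sum>i<n. \<bar>\<omega> i\<bar>) \<le> (1 + real n) * \<bar>\<omega> k\<bar>" using k1 by (simp add: algebra_simps)
    then have "(1 + (\<Sum>i<n. \<bar>\<omega> i\<bar>)) ^ N \<le> ((1 + real n) * \<bar>\<omega> k\<bar>) ^ N"
      by (intro power_mono) (auto intro!: add_nonneg_nonneg sum_nonneg)
    also have "\<dots> = (1 + real n) ^ N * \<bar>\<omega> k\<bar> ^ N" by (rule power_mult_distrib)
    also have "\<dots> \<le> (1 + real n) ^ N * (1 + (\<Sum>i<n. \<bar>\<omega> i\<bar> ^ N))"
      using member_le_sum[of k "{..<n}" "\<lambda>i. \<bar>\<omega> i\<bar> ^ N"] k by (intro mult_left_mono) auto
    finally show ?thesis .
  qed
  show ?thesis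
  proof (rule Bochner_Integration.integrable_bound[OF _ m])
    show "integrable gauss_space (\<lambda>\<omega>. C * ((1 + real n) ^ N * (1 + (\<Sum>i<n. \<bar>\<omega> i\<bar> ^ N))))"
      by (intro integrable_mult_right Bochner_Integration.integrable_add Bochner_Integration.integrable_sum coordinate_moment_integrable) auto
    have "\<bar>u \<omega>\<bar> \<le> \<bar>C * ((1 + real n) ^ N * (1 + (\<Sum>i<n. \<bar>\<omega> i\<bar> ^ N)))\<bar>" for \<omega>
      using b(2)[of \<omega>] mult_left_mono[OF le[of \<omega>] b(1)] by linarith
    then show "AE \<omega> in gauss_space. norm (u \<omega>) \<le> norm (C * ((1 + real n) ^ N * (1 + (\<Sum>i<n. \<bar>\<omega> i\<bar> ^ N))))"
      by simp
  qed
qed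

text \<open>Replacing one coordinate by an independent copy preserves the product measure; Fubini's
  theorem then isolates that coordinate.\<close>

lemma gauss_space_update:
  fixes u :: "(nat \<Rightarrow> real) \<Rightarrow> real"
  assumes i: "integrable gauss_space u"
  shows "E u = E (\<lambda>\<omega>. \<integral>t. u (fun_upd \<omega> i t) \<partial>std_gaussian)"
proof -
  interpret S: prob_space std_gaussian by (rule prob_space_std_gaussian)
  interpret P: pair_sigma_finite std_gaussian gauss_space ..
  have d: "distr (std_gaussian \<Otimes>\<^sub>M gauss_space) gauss_space (\<lambda>(x, X). X(i := x)) = gauss_space"
    using distr_pair_PiM_eq_PiM[of UNIV "\<lambda>_. std_gaussian" i]
    by (simp add: gauss_space_def prob_space_std_gaussian)
  have mm: "(\<lambda>(x, X). X(i := x)) \<in> measurable (std_gaussian \<Otimes>\<^sub>M gauss_space) gauss_space"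
    unfolding gauss_space_def case_prod_beta
    by (rule measurable_PiM_single') (auto simp: fun_upd_apply cong: measurable_cong_sets, measurable)
  have "integrable (distr (std_gaussian \<Otimes>\<^sub>M gauss_space) gauss_space (\<lambda>(x, X). X(i := x))) u"
    unfolding d by (rule i)
  then have ii: "integrable (std_gaussian \<Otimes>\<^sub>M gauss_space) (\<lambda>(x, X). u (X(i := x)))"
    by (subst (asm) integrable_distr_eq[OF mm]) (use i in \<open>auto simp: case_prod_beta'\<close>)
  have "E u = (\<integral>\<omega>. u \<omega> \<partial>(distr (std_gaussian \<Otimes>\<^sub>M gauss_space) gauss_space (\<lambda>(x, X). X(i := x))))"
    unfolding d ..
  also have "\<dots> = (\<integral>z. u ((\<lambda>(x, X). X(i := x)) z) \<partial>(std_gaussian \<Otimes>\<^sub>M gauss_space))"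
    by (rule integral_distr[OF mm]) (use i in auto)
  also have "\<dots> = (\<integral>(x, X). u (X(i := x)) \<partial>(std_gaussian \<Otimes>\<^sub>M gauss_space))"
    by (simp add: case_prod_beta')
  also have "\<dots> = E (\<lambda>\<omega>. \<integral>t. u (fun_upd \<omega> i t) \<partial>std_gaussian)"
    by (rule P.integral_snd[OF ii, symmetric])
  finally show ?thesis .
qed

lemma poly_growth_section:
  assumes "poly_growth n u"
  shows "\<exists>N C. growth N C (\<lambda>t. u (fun_upd \<omega> i t))"
proof -
  obtain C N where b: "0 \<le> C" "\<And>\<omega>. \<bar>u \<omega>\<bar> \<le> C * (1 + (\<Sum>i<n. \<bar>\<omega> i\<bar>)) ^ N"
    using poly_growth_exponent[OF assms] by (metis order_refl)
  define S where "S = (\<Sum>j<n. \<bar>\<omega> j\<bar>)"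
  have S: "0 \<le> S" unfolding S_def by (rule sum_nonneg) simp
  have "\<bar>u (fun_upd \<omega> i t)\<bar> \<le> C * (1 + S) ^ N * (1 + \<bar>t\<bar>) ^ N" for t
  proof -
    have "(\<Sum>j<n. \<bar>(fun_upd \<omega> i t) j\<bar>) \<le> (\<Sum>j<n. \<bar>\<omega> j\<bar> + (if j = i then \<bar>t\<bar> else 0))"
      by (intro sum_mono) auto
    also have "\<dots> \<le> S + \<bar>t\<bar>" by (simp add: sum.distrib S_def)
    finally have "1 + (\<Sum>j<n. \<bar>(fun_upd \<omega> i t) j\<bar>) \<le> (1 + S) * (1 + \<bar>t\<bar>)" using mult_nonneg_nonneg[OF S abs_ge_zero[of t]] by (simp add: algebra_simps)
    then have "(1 + (\<Sum>j<n. \<bar>(fun_upd \<omega> i t) j\<bar>)) ^ N \<le> ((1 + S) * (1 + \<bar>t\<bar>)) ^ N"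
      by (intro power_mono) (auto intro!: add_nonneg_nonneg sum_nonneg)
    then show ?thesis using b(2)[of "(fun_upd \<omega> i t)"] b(1)
      by (smt (verit, best) mult.assoc mult_left_mono power_mult_distrib)
  qed
  then show ?thesis unfolding growth_def by blast
qed

text \<open>Integration by parts in one coordinate with the others frozen, averaged by
  \<open>gauss_space_update\<close>. The derivative is required along whole coordinate lines,
  because the inner integral runs over all of them.\<close>

lemma E_ibp:
  assumes c: "continuous_on UNIV u" "continuous_on UNIV u'" and g: "poly_growth n u" "poly_growth n u'"
    and d: "\<And>\<omega> s. ((\<lambda>t. u (fun_upd \<omega> i t)) has_real_derivative u' (fun_upd \<omega> i s)) (at s)"
  shows "E (\<lambda>\<omega>. \<omega> i * u \<omega>) = E u'"
proof -
  have "poly_growth (max n (Suc i)) (\<lambda>\<omega>. \<omega> i * u \<omega>)"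
    by (intro poly_growth_mult poly_growth_coordinate poly_growth_mono[OF g(1)]) auto
  then have i1: "integrable gauss_space (\<lambda>\<omega>. \<omega> i * u \<omega>)"
    by (intro poly_growth_integrable continuous_measurable_gauss continuous_on_mult continuous_coordinate c)
  have i2: "integrable gauss_space u'"
    by (intro poly_growth_integrable[OF _ g(2)] continuous_measurable_gauss c)
  have "(\<integral>t. t * u (fun_upd \<omega> i t) \<partial>std_gaussian) = (\<integral>t. u' (fun_upd \<omega> i t) \<partial>std_gaussian)" for \<omega>
  proof -
    obtain N C N' C' where "growth N C (\<lambda>t. u (fun_upd \<omega> i t))" "growth N' C' (\<lambda>t. u' (fun_upd \<omega> i t))"
      using poly_growth_section g by meson
    then show ?thesis
      by (rule gauss_ibp[OF d, rotated 1]) (rule continuous_on_compose2[OF c(2) continuous_update], simp)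
  qed
  then show ?thesis
    by (simp add: gauss_space_update[OF i1, of i] gauss_space_update[OF i2, of i])
qed

section \<open>The algebra of polynomial functionals\<close>

inductive_set polyfun :: "((nat \<Rightarrow> real) \<Rightarrow> real) set" where
  const: "(\<lambda>_. c) \<in> polyfun"
| coord: "(\<lambda>\<omega>. \<omega> i) \<in> polyfun"
| add: "f \<in> polyfun \<Longrightarrow> g \<in> polyfun \<Longrightarrow> (\<lambda>\<omega>. f \<omega> + g \<omega>) \<in> polyfun"
| mult: "f \<in> polyfun \<Longrightarrow> g \<in> polyfun \<Longrightarrow> (\<lambda>\<omega>. f \<omega> * g \<omega>) \<in> polyfun"

text \<open>A type instead of a set lets ring and vector space simplification run without membership
  conditions. Elements remain functions, so equality is tested pointwise.\<close>

typedef pf = "polyfun" morphisms ev Abs_pf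
  using polyfun.const by blast

setup_lifting type_definition_pf

instantiation pf :: real_vector
begin

lift_definition zero_pf :: pf is "\<lambda>_. 0" by (rule polyfun.const)
lift_definition plus_pf :: "pf \<Rightarrow> pf \<Rightarrow> pf" is "\<lambda>f g \<omega>. f \<omega> + g \<omega>" by (rule polyfun.add)
lift_definition uminus_pf :: "pf \<Rightarrow> pf" is "\<lambda>f \<omega>. (- 1) * f \<omega>"
  by (intro polyfun.mult polyfun.const)
lift_definition minus_pf :: "pf \<Rightarrow> pf \<Rightarrow> pf" is "\<lambda>f g \<omega>. f \<omega> + (- 1) * g \<omega>"
  by (intro polyfun.mult polyfun.add polyfun.const)
lift_definition scaleR_pf :: "real \<Rightarrow> pf \<Rightarrow> pf" is "\<lambda>c f \<omega>. c * f \<omega>"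
  by (intro polyfun.mult polyfun.const)

instance by standard (transfer; simp add: fun_eq_iff algebra_simps)+

end

instantiation pf :: comm_ring_1
begin

lift_definition one_pf :: pf is "\<lambda>_. 1" by (rule polyfun.const)
lift_definition times_pf :: "pf \<Rightarrow> pf \<Rightarrow> pf" is "\<lambda>f g \<omega>. f \<omega> * g \<omega>" by (rule polyfun.mult)

instance by standard (transfer; simp add: fun_eq_iff algebra_simps)+

end

instance pf :: real_algebra_1
  by standard (transfer; simp add: fun_eq_iff algebra_simps)+

lift_definition co :: "nat \<Rightarrow> pf" is "\<lambda>i \<omega>. \<omega> i" by (rule polyfun.coord)

lemma pf_eqI: "(\<And>\<omega>. ev X \<omega> = ev Y \<omega>) \<Longrightarrow> X = Y"
  by (simp add: ev_inject[symmetric] fun_eq_iff)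

lemma ev_add [simp]: "ev (X + Y) \<omega> = ev X \<omega> + ev Y \<omega>" by transfer simp
lemma ev_diff [simp]: "ev (X - Y) \<omega> = ev X \<omega> - ev Y \<omega>" by transfer simp
lemma ev_minus [simp]: "ev (- X) \<omega> = - ev X \<omega>" by transfer simp
lemma ev_mult [simp]: "ev (X * Y) \<omega> = ev X \<omega> * ev Y \<omega>" by transfer simp
lemma ev_scaleR [simp]: "ev (c *\<^sub>R X) \<omega> = c * ev X \<omega>" by transfer simp
lemma ev_0 [simp]: "ev 0 \<omega> = 0" by transfer simp
lemma ev_1 [simp]: "ev 1 \<omega> = 1" by transfer simp
lemma ev_co [simp]: "ev (co i) \<omega> = \<omega> i" by transfer simp
lemma ev_of_real [simp]: "ev (of_real c) \<omega> = c" by (simp add: of_real_def)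
lemma ev_sum [simp]: "ev (sum f A) \<omega> = (\<Sum>a\<in>A. ev (f a) \<omega>)"
  by (induction A rule: infinite_finite_induct) auto
lemma ev_power [simp]: "ev (X ^ k) \<omega> = ev X \<omega> ^ k" by (induction k) auto

lemma pf_induct [case_names const coord add mult]:
  assumes "\<And>c. P (of_real c)" "\<And>i. P (co i)" "\<And>X Y. P X \<Longrightarrow> P Y \<Longrightarrow> P (X + Y)" "\<And>X Y. P X \<Longrightarrow> P Y \<Longrightarrow> P (X * Y)"
  shows "P X"
proof -
  have "\<exists>X. f = ev X \<and> P X" if "f \<in> polyfun" for f
    using that
  proof (induction rule: polyfun.induct)
    case (const c)
    have "(\<lambda>_. c) = ev (of_real c)" by (simp add: fun_eq_iff)
    then show ?case using assms(1) by blast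
  next
    case (coord i)
    have "(\<lambda>\<omega>. \<omega> i) = ev (co i)" by (simp add: fun_eq_iff)
    then show ?case using assms(2) by blast
  next
    case (add f g)
    then obtain X Y where "f = ev X" "P X" "g = ev Y" "P Y" by blast
    then have "(\<lambda>\<omega>. f \<omega> + g \<omega>) = ev (X + Y)" "P (X + Y)" using assms(3) by (auto simp: fun_eq_iff)
    then show ?case by blast
  next
    case (mult f g)
    then obtain X Y where "f = ev X" "P X" "g = ev Y" "P Y" by blast
    then have "(\<lambda>\<omega>. f \<omega> * g \<omega>) = ev (X * Y)" "P (X * Y)" using assms(4) by (auto simp: fun_eq_iff)
    then show ?case by blast
  qed
  from this[OF ev[of X]] show ?thesis by (auto simp: ev_inject)
qed

lemma ev_continuous: "continuous_on UNIV (ev X)"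
proof (induction X rule: pf_induct)
  case (const c)
  have "ev (of_real c) = (\<lambda>_. c)" by (simp add: fun_eq_iff)
  then show ?case by simp
next
  case (coord i)
  have "ev (co i) = (\<lambda>\<omega>. \<omega> i)" by (simp add: fun_eq_iff)
  then show ?case using continuous_coordinate by simp
next
  case (add X Y)
  have "ev (X + Y) = (\<lambda>\<omega>. ev X \<omega> + ev Y \<omega>)" by (simp add: fun_eq_iff)
  then show ?case using add by (simp add: continuous_on_add)
next
  case (mult X Y)
  have "ev (X * Y) = (\<lambda>\<omega>. ev X \<omega> * ev Y \<omega>)" by (simp add: fun_eq_iff)
  then show ?case using mult by (simp add: continuous_on_mult)
qed

lemma ev_finite_dim:
  "\<exists>n. poly_growth n (ev X) \<and> (\<forall>\<omega> \<omega>'. (\<forall>i<n. \<omega> i = \<omega>' i) \<longrightarrow> ev X \<omega> = ev X \<omega>')"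
proof (induction X rule: pf_induct)
  case (const c)
  have "ev (of_real c) = (\<lambda>_. c)" by (simp add: fun_eq_iff)
  then show ?case using poly_growth_const by auto
next
  case (coord i)
  have "ev (co i) = (\<lambda>\<omega>. \<omega> i)" by (simp add: fun_eq_iff)
  then show ?case using poly_growth_coordinate[of i "Suc i"] by (intro exI[of _ "Suc i"]) auto
next
  case (add X Y)
  then obtain n m where n: "poly_growth n (ev X)" "\<And>\<omega> \<omega>'. (\<forall>i<n. \<omega> i = \<omega>' i) \<Longrightarrow> ev X \<omega> = ev X \<omega>'"
    "poly_growth m (ev Y)" "\<And>\<omega> \<omega>'. (\<forall>i<m. \<omega> i = \<omega>' i) \<Longrightarrow> ev Y \<omega> = ev Y \<omega>'" by blast
  have "ev (X + Y) = (\<lambda>\<omega>. ev X \<omega> + ev Y \<omega>)" by (simp add: fun_eq_iff)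
  then have "poly_growth (max n m) (ev (X + Y))"
    using n by (auto intro!: poly_growth_add poly_growth_mono[OF n(1), of "max n m"] poly_growth_mono[OF n(3), of "max n m"])
  moreover have "ev (X + Y) \<omega> = ev (X + Y) \<omega>'" if "\<forall>i<max n m. \<omega> i = \<omega>' i" for \<omega> \<omega>'
    using n(2,4)[of \<omega> \<omega>'] that by simp
  ultimately show ?case by blast
next
  case (mult X Y)
  then obtain n m where n: "poly_growth n (ev X)" "\<And>\<omega> \<omega>'. (\<forall>i<n. \<omega> i = \<omega>' i) \<Longrightarrow> ev X \<omega> = ev X \<omega>'"
    "poly_growth m (ev Y)" "\<And>\<omega> \<omega>'. (\<forall>i<m. \<omega> i = \<omega>' i) \<Longrightarrow> ev Y \<omega> = ev Y \<omega>'" by blast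
  have "ev (X * Y) = (\<lambda>\<omega>. ev X \<omega> * ev Y \<omega>)" by (simp add: fun_eq_iff)
  then have "poly_growth (max n m) (ev (X * Y))"
    using n by (auto intro!: poly_growth_mult poly_growth_mono[OF n(1), of "max n m"] poly_growth_mono[OF n(3), of "max n m"])
  moreover have "ev (X * Y) \<omega> = ev (X * Y) \<omega>'" if "\<forall>i<max n m. \<omega> i = \<omega>' i" for \<omega> \<omega>'
    using n(2,4)[of \<omega> \<omega>'] that by simp
  ultimately show ?case by blast
qed

lemma ev_measurable [measurable]: "ev X \<in> borel_measurable gauss_space"
  by (rule continuous_measurable_gauss[OF ev_continuous])

lemma ev_integrable [simp]: "integrable gauss_space (ev X)"
  using ev_finite_dim poly_growth_integrable[OF ev_measurable] by blast

section \<open>Partial derivatives and creation operators on polynomial functionals\<close>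

definition is_pd :: "nat \<Rightarrow> pf \<Rightarrow> pf \<Rightarrow> bool" where
  "is_pd i X Y \<longleftrightarrow> (\<forall>\<omega> s. ((\<lambda>t. ev X (fun_upd \<omega> i t)) has_real_derivative ev Y (fun_upd \<omega> i s)) (at s))"

lemma is_pd_unique:
  assumes "is_pd i X Y" "is_pd i X Z" shows "Y = Z"
proof (rule pf_eqI)
  fix \<omega>
  have a: "((\<lambda>t. ev X (fun_upd \<omega> i t)) has_real_derivative ev Y (fun_upd \<omega> i (\<omega> i))) (at (\<omega> i))"
    "((\<lambda>t. ev X (fun_upd \<omega> i t)) has_real_derivative ev Z (fun_upd \<omega> i (\<omega> i))) (at (\<omega> i))"
    using assms unfolding is_pd_def by blast+
  show "ev Y \<omega> = ev Z \<omega>" using DERIV_unique[OF a] by simp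
qed

lemma is_pd_const: "is_pd i (of_real c) 0"
  by (simp add: is_pd_def)
lemma is_pd_coord: "is_pd i (co j) (if i = j then 1 else 0)"
  by (auto simp: is_pd_def)
lemma is_pd_add: "is_pd i X X' \<Longrightarrow> is_pd i Y Y' \<Longrightarrow> is_pd i (X + Y) (X' + Y')"
  unfolding is_pd_def by (auto intro!: derivative_eq_intros)
lemma is_pd_mult: "is_pd i X X' \<Longrightarrow> is_pd i Y Y' \<Longrightarrow> is_pd i (X * Y) (X' * Y + X * Y')"
  unfolding is_pd_def by (auto intro!: derivative_eq_intros)

lemma is_pd_exists: "\<exists>Y. is_pd i X Y"
  by (induction X rule: pf_induct) (use is_pd_const is_pd_coord is_pd_add is_pd_mult in blast)+

text \<open>Elements of \<open>pf\<close> are functions without a normal form, so the derivative is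
  characterised analytically: induction over the generators gives existence inside
  \<open>pf\<close>, and uniqueness of derivatives makes the description definite.\<close>

definition pd :: "nat \<Rightarrow> pf \<Rightarrow> pf" where "pd i X = (THE Y. is_pd i X Y)"

lemma is_pd_pd: "is_pd i X (pd i X)"
  unfolding pd_def by (rule theI') (use is_pd_exists is_pd_unique in blast)

lemma pdI: "is_pd i X Y \<Longrightarrow> pd i X = Y"
  using is_pd_unique is_pd_pd by blast

lemma pd_deriv: "((\<lambda>t. ev X (fun_upd \<omega> i t)) has_real_derivative ev (pd i X) (fun_upd \<omega> i s)) (at s)"
  using is_pd_pd unfolding is_pd_def by blast

lemma pd_const [simp]: "pd i (of_real c) = 0" by (rule pdI[OF is_pd_const])
lemma pd_co: "pd i (co j) = (if i = j then 1 else 0)" by (rule pdI[OF is_pd_coord])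
lemma pd_add [simp]: "pd i (X + Y) = pd i X + pd i Y" by (intro pdI is_pd_add is_pd_pd)
lemma pd_mult: "pd i (X * Y) = pd i X * Y + X * pd i Y" by (intro pdI is_pd_mult is_pd_pd)
lemma pd_0 [simp]: "pd i 0 = 0" using pd_const[of i 0] by simp
lemma pd_1 [simp]: "pd i 1 = 0" using pd_const[of i 1] by simp
lemma pd_scaleR [simp]: "pd i (c *\<^sub>R X) = c *\<^sub>R pd i X"
  using pd_mult[of i "of_real c" X] by (simp add: scaleR_conv_of_real)
lemma pd_minus [simp]: "pd i (- X) = - pd i X"
  using pd_scaleR[of i "- 1" X] by simp
lemma pd_diff [simp]: "pd i (X - Y) = pd i X - pd i Y"
  using pd_add[of i X "- Y"] by simp
lemma pd_sum [simp]: "pd i (sum f A) = (\<Sum>a\<in>A. pd i (f a))"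
  by (induction A rule: infinite_finite_induct) auto

lemma pd_commute: "pd i (pd j X) = pd j (pd i X)"
  by (induction X rule: pf_induct) (auto simp: pd_mult pd_co algebra_simps)

text \<open>The creation operator, adjoint to \<open>pd i\<close> under the Gaussian measure
  (\<open>Em_cr\<close>). With \<open>pd\<close> it satisfies the canonical commutation relations
  (\<open>pd_cr\<close>), and its powers generate the Hermite polynomials.\<close>

definition cr :: "nat \<Rightarrow> pf \<Rightarrow> pf" where "cr i X = co i * X - pd i X"

lemma cr_add: "cr i (X + Y) = cr i X + cr i Y" by (simp add: cr_def algebra_simps)
lemma cr_scaleR: "cr i (c *\<^sub>R X) = c *\<^sub>R cr i X" by (simp add: cr_def algebra_simps)
lemma cr_0 [simp]: "cr i 0 = 0" by (simp add: cr_def)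
lemma cr_sum: "cr i (sum f A) = (\<Sum>a\<in>A. cr i (f a))"
  by (induction A rule: infinite_finite_induct) (auto simp: cr_add)
lemma pd_cr: "pd j (cr i X) = cr i (pd j X) + (if i = j then X else 0)"
  by (simp add: cr_def pd_mult pd_co pd_commute[of i j])
lemma cr_commute: "cr i (cr j X) = cr j (cr i X)"
  by (simp add: cr_def pd_mult pd_co pd_commute[of i j] algebra_simps)
lemma cr_mult: "cr i (X * Y) = cr i X * Y - X * pd i Y"
  by (simp add: cr_def pd_mult algebra_simps)

section \<open>Expectation, adjointness and the norm of polynomial functionals\<close>

definition Em :: "pf \<Rightarrow> real" where "Em X = E (ev X)"

lemma ev_numeral [simp]: "ev (numeral k) \<omega> = numeral k"
  using ev_of_real[of "numeral k" \<omega>] by simp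

lemma ev_fun_simps:
  "ev (X + Y) = (\<lambda>\<omega>. ev X \<omega> + ev Y \<omega>)" "ev (c *\<^sub>R X) = (\<lambda>\<omega>. c * ev X \<omega>)"
  "ev (X * Y) = (\<lambda>\<omega>. ev X \<omega> * ev Y \<omega>)" "ev (X - Y) = (\<lambda>\<omega>. ev X \<omega> - ev Y \<omega>)"
  by (simp_all add: fun_eq_iff)

lemma Em_add [simp]: "Em (X + Y) = Em X + Em Y" by (simp add: Em_def ev_fun_simps)
lemma Em_diff [simp]: "Em (X - Y) = Em X - Em Y" by (simp add: Em_def ev_fun_simps)
lemma Em_scaleR [simp]: "Em (c *\<^sub>R X) = c * Em X" by (simp add: Em_def ev_fun_simps)
lemma Em_0 [simp]: "Em 0 = 0" using Em_scaleR[of 0 0] by simp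
lemma Em_minus [simp]: "Em (- X) = - Em X" using Em_scaleR[of "- 1" X] by simp
lemma Em_of_real [simp]: "Em (of_real c) = c"
proof -
  have "ev (of_real c) = (\<lambda>_. c)" by (simp add: fun_eq_iff)
  then show ?thesis using GS.prob_space by (simp add: Em_def)
qed
lemma Em_1 [simp]: "Em 1 = 1" using Em_of_real[of 1] by simp
lemma Em_sum [simp]: "Em (sum f A) = (\<Sum>a\<in>A. Em (f a))"
  by (induction A rule: infinite_finite_induct) auto
lemma Em_mono: "(\<And>\<omega>. ev X \<omega> \<le> ev Y \<omega>) \<Longrightarrow> Em X \<le> Em Y"
  unfolding Em_def by (intro integral_mono) auto
lemma Em_nonneg: "(\<And>\<omega>. 0 \<le> ev X \<omega>) \<Longrightarrow> 0 \<le> Em X"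
  using Em_mono[of 0 X] by simp
lemma Em_square_nonneg [simp]: "0 \<le> Em (X * X)" by (rule Em_nonneg) simp

text \<open>The second factor is not restricted to polynomials: Stein's method needs it for
  compositions of a general smooth function with \<open>F\<close>.\<close>

lemma E_cr:
  assumes c: "continuous_on UNIV u" "continuous_on UNIV u'" and g: "poly_growth n u" "poly_growth n u'"
    and d: "\<And>\<omega> s. ((\<lambda>t. u (fun_upd \<omega> i t)) has_real_derivative u' (fun_upd \<omega> i s)) (at s)"
  shows "E (\<lambda>\<omega>. ev (cr i X) \<omega> * u \<omega>) = E (\<lambda>\<omega>. ev X \<omega> * u' \<omega>)"
proof -
  obtain m where m: "poly_growth m (ev X)" using ev_finite_dim by blast
  obtain m' where m': "poly_growth m' (ev (pd i X))" using ev_finite_dim by blast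
  obtain m'' where m'': "poly_growth m'' (ev (cr i X))" using ev_finite_dim by blast
  define M where "M = max n (max m (max m' m''))"
  note pg = poly_growth_mono[OF g(1), of M] poly_growth_mono[OF g(2), of M] poly_growth_mono[OF m, of M]
    poly_growth_mono[OF m', of M] poly_growth_mono[OF m'', of M]
  let ?v = "\<lambda>\<omega>. ev X \<omega> * u \<omega>" and ?v' = "\<lambda>\<omega>. ev (pd i X) \<omega> * u \<omega> + ev X \<omega> * u' \<omega>"
  have "E (\<lambda>\<omega>. \<omega> i * ?v \<omega>) = E ?v'"
  proof (rule E_ibp)
    show "continuous_on UNIV ?v" "continuous_on UNIV ?v'" by (intro continuous_intros ev_continuous c)+
    show "poly_growth M ?v" "poly_growth M ?v'"
      by (intro poly_growth_mult poly_growth_add pg; simp add: M_def)+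
    show "((\<lambda>t. ?v (fun_upd \<omega> i t)) has_real_derivative ?v' (fun_upd \<omega> i s)) (at s)" for \<omega> s
      by (rule derivative_eq_intros pd_deriv d refl)+ simp
  qed
  moreover have i: "integrable gauss_space (\<lambda>\<omega>. ev (cr i X) \<omega> * u \<omega>)" "integrable gauss_space (\<lambda>\<omega>. ev (pd i X) \<omega> * u \<omega>)"
    "integrable gauss_space (\<lambda>\<omega>. ev X \<omega> * u' \<omega>)"
    by (rule poly_growth_integrable[of _ M]; intro continuous_measurable_gauss continuous_intros ev_continuous c poly_growth_mult pg; simp add: M_def)+
  moreover have "(\<lambda>\<omega>. \<omega> i * ?v \<omega>) = (\<lambda>\<omega>. ev (cr i X) \<omega> * u \<omega> + ev (pd i X) \<omega> * u \<omega>)"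
    by (simp add: cr_def fun_eq_iff algebra_simps)
  ultimately show ?thesis by simp
qed

lemma Em_cr: "Em (cr i X * Y) = Em (X * pd i Y)"
proof -
  obtain m where m: "poly_growth m (ev Y)" using ev_finite_dim by blast
  obtain m' where m': "poly_growth m' (ev (pd i Y))" using ev_finite_dim by blast
  show ?thesis unfolding Em_def ev_fun_simps(3)
    by (rule E_cr[of _ _ "max m m'"]) (auto intro: ev_continuous pd_deriv poly_growth_mono[OF m] poly_growth_mono[OF m'])
qed

definition nrm :: "pf \<Rightarrow> real" where "nrm X = sqrt (Em (X * X))"

lemma nrm_sq: "nrm X ^ 2 = Em (X * X)" by (simp add: nrm_def)
lemma nrm_nonneg [simp]: "0 \<le> nrm X" by (simp add: nrm_def)
lemma nrm_0 [simp]: "nrm 0 = 0" by (simp add: nrm_def)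

lemma nrm_scaleR: "nrm (c *\<^sub>R X) = \<bar>c\<bar> * nrm X"
  by (simp add: nrm_def real_sqrt_mult mult.assoc[symmetric])

lemma Em_numeral_mult [simp]: "Em (numeral k * X) = numeral k * Em X"
  using Em_scaleR[of "numeral k" X] by (simp add: scaleR_conv_of_real)

lemma Em_add_square: "Em ((X + Y) * (X + Y)) = Em (X * X) + 2 * Em (X * Y) + Em (Y * Y)"
  by (simp add: distrib_left distrib_right mult.commute[of Y X])

lemma Em_CS: "\<bar>Em (X * Y)\<bar> \<le> nrm X * nrm Y"
proof (cases "Em (Y * Y) = 0")
  case False
  define a where "a = Em (X * X)" define b where "b = Em (X * Y)" define c where "c = Em (Y * Y)"
  have c: "c > 0" using False Em_square_nonneg[of Y] unfolding c_def by linarith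
  have "0 \<le> Em ((c *\<^sub>R X - b *\<^sub>R Y) * (c *\<^sub>R X - b *\<^sub>R Y))" by simp
  also have "\<dots> = c * (c * a - b * b)"
    using Em_add_square[of "c *\<^sub>R X" "- (b *\<^sub>R Y)"]
    by (simp add: a_def[symmetric] b_def[symmetric] c_def[symmetric]) (simp add: algebra_simps)
  finally have "b\<^sup>2 \<le> a * c" using c by (simp add: zero_le_mult_iff power2_eq_square mult.commute)
  then show ?thesis unfolding nrm_def a_def[symmetric] b_def[symmetric] c_def[symmetric]
    by (metis real_sqrt_abs real_sqrt_le_iff real_sqrt_mult)
next
  case True
  have q: "0 \<le> Em (X * X) + 2 * t * Em (X * Y)" for t
  proof -
    have "0 \<le> Em ((X + t *\<^sub>R Y) * (X + t *\<^sub>R Y))" by simp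
    also have "\<dots> = Em (X * X) + 2 * t * Em (X * Y)"
      using True unfolding Em_add_square by simp
    finally show ?thesis .
  qed
  have "Em (X * Y) = 0"
  proof (rule ccontr)
    assume n: "Em (X * Y) \<noteq> 0"
    \<comment> \<open>At this \<open>t\<close> the right-hand side of \<open>q\<close> equals
      -1.\<close>
    define t where "t = - (Em (X * X) + 1) / (2 * Em (X * Y))"
    have "2 * t * Em (X * Y) = - (Em (X * X) + 1)" using n by (simp add: t_def)
    then show False using q[of t] by linarith
  qed
  then show ?thesis by simp
qed

lemma nrm_triangle: "nrm (X + Y) \<le> nrm X + nrm Y"
proof (rule power2_le_imp_le)
  have "Em (X * Y) \<le> nrm X * nrm Y" using Em_CS[of X Y] by linarith
  then show "(nrm (X + Y))\<^sup>2 \<le> (nrm X + nrm Y)\<^sup>2"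
    by (simp add: nrm_sq power2_sum Em_add_square)
qed simp

lemma nrm_sum: "nrm (sum f A) \<le> (\<Sum>a\<in>A. nrm (f a))"
  by (induction A rule: infinite_finite_induct) (auto intro: order_trans[OF nrm_triangle])

lemma nrm_minus [simp]: "nrm (- X) = nrm X" by (simp add: nrm_def)

lemma nrm_diff: "nrm (X - Y) \<le> nrm X + nrm Y"
  using nrm_triangle[of X "- Y"] by simp

section \<open>Chaos decomposition of polynomial functionals\<close>

inductive W :: "nat \<Rightarrow> nat \<Rightarrow> pf \<Rightarrow> bool" for n where
  W_const: "W n 0 (of_real c)"
| W_cr: "W n q X \<Longrightarrow> i < n \<Longrightarrow> W n (Suc q) (cr i X)"
| W_add: "W n q X \<Longrightarrow> W n q Y \<Longrightarrow> W n q (X + Y)"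
| W_scaleR: "W n q X \<Longrightarrow> W n q (c *\<^sub>R X)"
| W_0: "W n q 0"

lemma W_minus: "W n q X \<Longrightarrow> W n q (- X)"
  using W_scaleR[of n q X "- 1"] by simp

lemma W_diff: "W n q X \<Longrightarrow> W n q Y \<Longrightarrow> W n q (X - Y)"
  using W_add[of n q X "- Y"] W_minus by simp

lemma W_sum: "(\<And>a. a \<in> A \<Longrightarrow> W n q (f a)) \<Longrightarrow> W n q (sum f A)"
  by (induction A rule: infinite_finite_induct) (auto intro: W_0 W_add)

lemma W_degree_0: assumes "W n 0 X" shows "\<exists>c. X = of_real c"
proof -
  have "q = 0 \<longrightarrow> (\<exists>c. X = of_real c)" if "W n q X" for q
    using that
  proof induction
    case (W_add q X Y)
    then show ?case by (metis of_real_add)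
  next
    case (W_scaleR q X c)
    then show ?case by (metis of_real_mult scaleR_conv_of_real)
  next
    case (W_0 q)
    then show ?case by (metis of_real_0)
  qed auto
  then show ?thesis using assms by blast
qed

lemma W_0_pd: "W n 0 X \<Longrightarrow> pd i X = 0"
  using W_degree_0 by fastforce

lemma W_pd: "W n q X \<Longrightarrow> W n (q - 1) (pd j X)"
proof (induction rule: W.induct)
  case (W_cr q X i)
  show ?case
  proof (cases q)
    case 0
    then have "pd j X = 0" using W_cr W_0_pd by blast
    then show ?thesis using W_cr 0 by (auto simp: pd_cr intro: W.W_0)
  next
    case (Suc q')
    then have "W n q (cr i (pd j X))" using W_cr W.W_cr[of n q' "pd j X" i] by simp
    then show ?thesis using W_cr Suc by (auto simp: pd_cr intro: W.intros)
  qed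
qed (auto intro: W.intros)

text \<open>The number operator, that is, minus the Ornstein-Uhlenbeck generator. By
  \<open>W_Num\<close> it acts on degree \<open>q\<close> as multiplication by
  \<open>q\<close>.\<close>

definition Num :: "nat \<Rightarrow> pf \<Rightarrow> pf" where "Num n X = (\<Sum>i<n. cr i (pd i X))"

definition Gam :: "nat \<Rightarrow> pf \<Rightarrow> pf \<Rightarrow> pf" where "Gam n X Y = (\<Sum>i<n. pd i X * pd i Y)"

lemma Num_add: "Num n (X + Y) = Num n X + Num n Y"
  by (simp add: Num_def cr_add sum.distrib)
lemma Num_scaleR: "Num n (c *\<^sub>R X) = c *\<^sub>R Num n X"
  by (simp add: Num_def cr_scaleR scaleR_sum_right)
lemma Num_0 [simp]: "Num n 0 = 0" by (simp add: Num_def)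
lemma Num_sum: "Num n (sum f A) = (\<Sum>a\<in>A. Num n (f a))"
  by (induction A rule: infinite_finite_induct) (auto simp: Num_add)

lemma Gam_add_right: "Gam n X (Y + Z) = Gam n X Y + Gam n X Z"
  by (simp add: Gam_def algebra_simps sum.distrib)
lemma Gam_scaleR_right: "Gam n X (c *\<^sub>R Y) = c *\<^sub>R Gam n X Y"
  by (simp add: Gam_def scaleR_sum_right)
lemma Gam_0_right [simp]: "Gam n X 0 = 0" by (simp add: Gam_def)
lemma Gam_1_right [simp]: "Gam n X 1 = 0" by (simp add: Gam_def)
lemma Gam_sum_right: "Gam n X (sum f A) = (\<Sum>a\<in>A. Gam n X (f a))"
  by (induction A rule: infinite_finite_induct) (auto simp: Gam_add_right)
lemma Gam_commute: "Gam n X Y = Gam n Y X" by (simp add: Gam_def mult.commute)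
lemma Gam_mult_right: "Gam n X (Y * Z) = Gam n X Y * Z + Y * Gam n X Z"
  by (simp add: Gam_def pd_mult algebra_simps sum.distrib sum_distrib_left sum_distrib_right)

lemma Num_cr: assumes "j < n" shows "Num n (cr j X) = cr j (Num n X) + cr j X"
proof -
  have "Num n (cr j X) = (\<Sum>i<n. cr j (cr i (pd i X)) + (if i = j then cr j X else 0))"
    unfolding Num_def by (intro sum.cong) (auto simp: pd_cr cr_add cr_commute[of j])
  then show ?thesis using assms by (simp add: sum.distrib cr_sum Num_def)
qed

lemma W_Num: "W n q X \<Longrightarrow> Num n X = real q *\<^sub>R X"
proof (induction rule: W.induct)
  case (W_const c)
  then show ?case by (simp add: Num_def)
next
  case (W_cr q X i)
  then show ?case by (simp add: Num_cr cr_scaleR algebra_simps)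
qed (auto simp: Num_add Num_scaleR algebra_simps)

text \<open>The diffusion identity. It expresses \<open>Gam\<close> through products and
  \<open>Num\<close>, and \<open>Num\<close> is diagonal in the chaos decomposition.\<close>

lemma Num_mult: "Num n (X * Y) = X * Num n Y + Num n X * Y - 2 * Gam n X Y"
proof -
  have "cr i (pd i (X * Y)) = X * cr i (pd i Y) + cr i (pd i X) * Y - 2 * (pd i X * pd i Y)" for i
  proof -
    have "cr i (pd i (X * Y)) = cr i (pd i X * Y) + cr i (pd i Y * X)"
      by (simp add: pd_mult cr_add mult.commute)
    then show ?thesis unfolding cr_mult by (simp add: algebra_simps)
  qed
  then show ?thesis
    by (simp add: Num_def Gam_def sum.distrib sum_subtractf sum_distrib_left sum_distrib_right)
qed

lemma Em_Num: "Em (Num n X * Y) = Em (Gam n X Y)"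
  by (simp add: Num_def Gam_def sum_distrib_right Em_cr)

text \<open>\<open>Num\<close> is symmetric, being represented by the symmetric form
  \<open>Gam\<close>, and the two eigenvalues differ.\<close>

lemma W_orth: assumes "W n p X" "W n q Y" "p \<noteq> q" shows "Em (X * Y) = 0"
proof -
  have "real p * Em (X * Y) = Em (Num n X * Y)" using W_Num[OF assms(1)] by simp
  also have "\<dots> = Em (Num n Y * X)" by (simp add: Em_Num Gam_commute)
  also have "\<dots> = real q * Em (X * Y)" using W_Num[OF assms(2)] by (simp add: mult.commute)
  finally show ?thesis using assms(3) by simp
qed

text \<open>Subtracting \<open>Num\<close> from the top degree times the identity removes the top
  component and multiplies the others by nonzero factors, so induction on the number of components
  applies.\<close>

lemma W_indep:
  assumes "\<And>k. W n k (e k)" "(\<Sum>k\<le>d. e k) = 0" "k \<le> d"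
  shows "e k = 0"
  using assms
proof (induction d arbitrary: e k)
  case (Suc d)
  have "0 = real (Suc d) *\<^sub>R (\<Sum>k\<le>Suc d. e k) - Num n (\<Sum>k\<le>Suc d. e k)"
    unfolding Suc.prems(2) by simp
  also have "\<dots> = (\<Sum>k\<le>Suc d. (real (Suc d) - real k) *\<^sub>R e k)"
    unfolding Num_sum W_Num[OF Suc.prems(1)] scaleR_sum_right sum_subtractf[symmetric]
    by (simp add: algebra_simps)
  also have "\<dots> = (\<Sum>k\<le>d. (real (Suc d) - real k) *\<^sub>R e k)" by simp
  finally have z: "(\<Sum>k\<le>d. (real (Suc d) - real k) *\<^sub>R e k) = 0" by simp
  have "(real (Suc d) - real k) *\<^sub>R e k = 0" if "k \<le> d" for k
    by (rule Suc.IH[OF _ z that]) (intro W_scaleR Suc.prems(1))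
  then have e0: "e k = 0" if "k \<le> d" for k using that by fastforce
  then have "e (Suc d) = 0" using Suc.prems(2) by simp
  then show ?case using e0 Suc.prems(3) le_Suc_eq by auto
qed auto

text \<open>Components above \<open>d\<close> must vanish so that the whole sequence
  \<open>c\<close> is determined by \<open>X\<close>, whichever bound \<open>d\<close> is
  used.\<close>

definition isdec :: "nat \<Rightarrow> pf \<Rightarrow> (nat \<Rightarrow> pf) \<Rightarrow> nat \<Rightarrow> bool" where
  "isdec n X c d \<longleftrightarrow> (\<forall>k. W n k (c k)) \<and> (\<forall>k>d. c k = 0) \<and> X = (\<Sum>k\<le>d. c k)"

definition Pd :: "nat \<Rightarrow> nat \<Rightarrow> pf \<Rightarrow> bool" where "Pd n d X \<longleftrightarrow> (\<exists>c. isdec n X c d)"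

text \<open>The degree bound is quantified away, so that the projection onto degree \<open>k\<close>
  carries no extra parameter.\<close>

definition J :: "nat \<Rightarrow> nat \<Rightarrow> pf \<Rightarrow> pf" where "J n k X = (SOME c. \<exists>d. isdec n X c d) k"

lemma isdec_mono:
  assumes "isdec n X c d" "d \<le> d'" shows "isdec n X c d'"
proof -
  have "(\<Sum>k\<le>d. c k) = (\<Sum>k\<le>d'. c k)"
    by (rule sum.mono_neutral_left) (use assms in \<open>auto simp: isdec_def\<close>)
  then show ?thesis using assms unfolding isdec_def by auto
qed

lemma isdec_unique:
  assumes "isdec n X c d" "isdec n X c' d'" shows "c = c'"
proof
  fix k
  define D where "D = max k (max d d')"
  have 1: "isdec n X c D" "isdec n X c' D" using assms isdec_mono unfolding D_def by auto
  have z: "(\<Sum>k\<le>D. c k - c' k) = 0" using 1 by (auto simp: isdec_def sum_subtractf)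
  have "c k - c' k = 0"
    by (rule W_indep[OF _ z]) (use 1 in \<open>auto simp: isdec_def D_def intro: W_diff\<close>)
  then show "c k = c' k" by simp
qed

lemma isdec_J: assumes "isdec n X c d" shows "J n k X = c k"
proof -
  have "\<exists>d. isdec n X (SOME c. \<exists>d. isdec n X c d) d"
    by (rule someI_ex[of "\<lambda>c. \<exists>d. isdec n X c d"]) (use assms in blast)
  then show ?thesis unfolding J_def using isdec_unique assms by blast
qed

lemma Pd_isdec: assumes "Pd n d X" shows "isdec n X (\<lambda>k. J n k X) d"
proof -
  obtain c where c: "isdec n X c d" using assms Pd_def by blast
  then have "(\<lambda>k. J n k X) = c" using isdec_J by blast
  then show ?thesis using c by simp
qed

lemma W_J: "Pd n d X \<Longrightarrow> W n k (J n k X)"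
  and J_zero: "Pd n d X \<Longrightarrow> d < k \<Longrightarrow> J n k X = 0"
  and J_expand: "Pd n d X \<Longrightarrow> X = (\<Sum>k\<le>d. J n k X)"
  using Pd_isdec unfolding isdec_def by blast+

lemma Pd_mono: "Pd n d X \<Longrightarrow> d \<le> d' \<Longrightarrow> Pd n d' X"
  unfolding Pd_def using isdec_mono by blast

lemma isdec_add: "isdec n X c d \<Longrightarrow> isdec n Y c' d \<Longrightarrow> isdec n (X + Y) (\<lambda>k. c k + c' k) d"
  by (auto simp: isdec_def sum.distrib intro: W_add)

lemma isdec_scaleR: "isdec n X c d \<Longrightarrow> isdec n (a *\<^sub>R X) (\<lambda>k. a *\<^sub>R c k) d"
  by (auto simp: isdec_def scaleR_sum_right intro: W_scaleR)

lemma isdec_W: "W n q X \<Longrightarrow> isdec n X (\<lambda>k. if k = q then X else 0) q"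
  by (auto simp: isdec_def intro: W_0)

lemma Pd_add: "Pd n d X \<Longrightarrow> Pd n d Y \<Longrightarrow> Pd n d (X + Y)"
  unfolding Pd_def using isdec_add by blast
lemma Pd_scaleR: "Pd n d X \<Longrightarrow> Pd n d (a *\<^sub>R X)"
  unfolding Pd_def using isdec_scaleR by blast
lemma W_Pd: "W n q X \<Longrightarrow> Pd n q X"
  unfolding Pd_def using isdec_W by blast
lemma Pd_0 [simp]: "Pd n d 0"
  using Pd_mono[OF W_Pd[OF W_0[of n 0]]] by simp
lemma Pd_of_real [simp]: "Pd n d (of_real c)"
  using Pd_mono[OF W_Pd[OF W_const]] by simp
lemma Pd_1 [simp]: "Pd n d 1" using Pd_of_real[of n d 1] by simp
lemma Pd_minus: "Pd n d X \<Longrightarrow> Pd n d (- X)" using Pd_scaleR[of n d X "- 1"] by simp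
lemma Pd_diff: "Pd n d X \<Longrightarrow> Pd n d Y \<Longrightarrow> Pd n d (X - Y)"
  using Pd_add[of n d X "- Y"] Pd_minus by simp
lemma Pd_sum: "(\<And>a. a \<in> A \<Longrightarrow> Pd n d (f a)) \<Longrightarrow> Pd n d (sum f A)"
  by (induction A rule: infinite_finite_induct) (auto intro: Pd_add)

lemma J_add: assumes "Pd n d X" "Pd n d' Y" shows "J n k (X + Y) = J n k X + J n k Y"
proof -
  have "isdec n X (\<lambda>k. J n k X) (max d d')" "isdec n Y (\<lambda>k. J n k Y) (max d d')"
    using Pd_isdec assms isdec_mono by (meson max.cobounded1 max.cobounded2)+
  from isdec_J[OF isdec_add[OF this]] show ?thesis .
qed

lemma J_scaleR: assumes "Pd n d X" shows "J n k (a *\<^sub>R X) = a *\<^sub>R J n k X"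
  using isdec_J[OF isdec_scaleR[OF Pd_isdec[OF assms]]] .

lemma J_W: "W n q X \<Longrightarrow> J n k X = (if k = q then X else 0)"
  using isdec_J[OF isdec_W] .

lemma J_0 [simp]: "J n k 0 = 0" using J_W[OF W_0[of n k], of k] by simp

lemma J_diff: assumes "Pd n d X" "Pd n d' Y" shows "J n k (X - Y) = J n k X - J n k Y"
  using J_add[OF assms(1) Pd_scaleR[OF assms(2), of "- 1"]] J_scaleR[OF assms(2), of k "- 1"] by simp

lemma J_sum: "(\<And>a. a \<in> A \<Longrightarrow> Pd n d (f a)) \<Longrightarrow> J n k (sum f A) = (\<Sum>a\<in>A. J n k (f a))"
proof (induction A rule: infinite_finite_induct)
  case (insert a A)
  have "Pd n d (sum f A)" using insert by (intro Pd_sum) auto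
  then show ?case using insert J_add[of n d "f a" d "sum f A" k] by simp
qed auto

lemma Pd_pd: assumes "Pd n d X" shows "Pd n (d - 1) (pd i X)"
proof -
  have "pd i X = (\<Sum>k\<le>d. pd i (J n k X))" using arg_cong[OF J_expand[OF assms], of "pd i"] by (simp only: pd_sum)
  moreover have "Pd n (d - 1) (pd i (J n k X))" if "k \<le> d" for k
    using Pd_mono[OF W_Pd[OF W_pd[OF W_J[OF assms]]], of k "d - 1" i] that by simp
  ultimately show ?thesis by (auto intro: Pd_sum)
qed

lemma Pd_0_const: assumes "Pd n 0 X" shows "\<exists>c. X = of_real c"
  using J_expand[OF assms] W_degree_0[OF W_J[OF assms, of 0]] by simp

lemma Pd_cr: assumes "Pd n d X" "i < n" shows "Pd n (Suc d) (cr i X)"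
proof -
  have "cr i X = (\<Sum>k\<le>d. cr i (J n k X))" using arg_cong[OF J_expand[OF assms(1)], of "cr i"] by (simp only: cr_sum)
  moreover have "Pd n (Suc d) (cr i (J n k X))" if "k \<le> d" for k
    using Pd_mono[OF W_Pd[OF W_cr[OF W_J[OF assms(1)] assms(2)]], of k "Suc d"] that by simp
  ultimately show ?thesis by (auto intro: Pd_sum)
qed

lemma J_cr: assumes "Pd n d X" "i < n" shows "J n (Suc k) (cr i X) = cr i (J n k X)"
proof -
  have "cr i X = (\<Sum>k\<le>d. cr i (J n k X))" using arg_cong[OF J_expand[OF assms(1)], of "cr i"] by (simp only: cr_sum)
  moreover have "J n (Suc k) (\<Sum>k\<le>d. cr i (J n k X)) = (\<Sum>l\<le>d. J n (Suc k) (cr i (J n l X)))"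
    by (rule J_sum[of _ n "Suc d"]) (use Pd_mono[OF W_Pd[OF W_cr[OF W_J[OF assms(1)] assms(2)]]] in auto)
  moreover have "\<dots> = (\<Sum>l\<le>d. if k = l then cr i (J n l X) else 0)"
    by (intro sum.cong) (auto simp: J_W[OF W_cr[OF W_J[OF assms(1)] assms(2)]])
  ultimately show ?thesis using J_zero[OF assms(1)] by (auto simp: not_le)
qed

text \<open>Induction on the creations in \<open>X\<close>, using
  \<open>cr i X * Y = cr i (X * Y) + X * pd i Y\<close>, where the last term has lower
  degree.\<close>

lemma W_mult_Pd: "W n a X \<Longrightarrow> Pd n b Y \<Longrightarrow> Pd n (a + b) (X * Y)"
proof (induction arbitrary: b Y rule: W.induct)
  case (W_const c)
  then show ?case using Pd_scaleR[of n b Y c] by (simp add: scaleR_conv_of_real)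
next
  case (W_cr q X i)
  have e: "cr i X * Y = cr i (X * Y) + X * pd i Y" by (simp add: cr_mult)
  have "Pd n (q + (b - 1)) (X * pd i Y)" using W_cr.IH[OF Pd_pd[OF W_cr.prems]] .
  then have "Pd n (Suc q + b) (X * pd i Y)" by (rule Pd_mono) simp
  moreover have "Pd n (Suc q + b) (cr i (X * Y))" using Pd_cr[OF W_cr.IH[OF W_cr.prems] W_cr.hyps(2)] by simp
  ultimately show ?case unfolding e by (rule Pd_add[rotated])
next
  case (W_add q X Y')
  then show ?case by (simp add: distrib_right Pd_add)
next
  case (W_scaleR q X c)
  then show ?case by (simp add: Pd_scaleR)
qed auto

lemma Pd_mult: assumes "Pd n a X" "Pd n b Y" shows "Pd n (a + b) (X * Y)"
proof -
  have "X * Y = (\<Sum>k\<le>a. J n k X * Y)" using arg_cong[OF J_expand[OF assms(1)], of "\<lambda>Z. Z * Y"] by (simp only: sum_distrib_right)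
  moreover have "Pd n (a + b) (J n k X * Y)" if "k \<le> a" for k
    by (rule Pd_mono[OF W_mult_Pd[OF W_J[OF assms(1)] assms(2)]]) (use that in simp)
  ultimately show ?thesis by (auto intro: Pd_sum)
qed

lemma Pd_Gam: assumes "Pd n a X" "Pd n b Y" shows "Pd n (a - 1 + (b - 1)) (Gam n X Y)"
  unfolding Gam_def by (intro Pd_sum Pd_mult Pd_pd assms)

section \<open>Orthogonality of the components and spectral estimates\<close>

lemma Em_J: assumes "Pd n d X" "W n k Y" shows "Em (X * Y) = Em (J n k X * Y)"
proof -
  have "X * Y = (\<Sum>l\<le>d. J n l X * Y)" using arg_cong[OF J_expand[OF assms(1)], of "\<lambda>Z. Z * Y"] by (simp only: sum_distrib_right)
  then have "Em (X * Y) = (\<Sum>l\<le>d. Em (J n l X * Y))" by (simp only: Em_sum)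
  also have "\<dots> = (\<Sum>l\<le>d. if k = l then Em (J n l X * Y) else 0)"
    by (intro sum.cong) (auto simp: W_orth[OF W_J[OF assms(1)] assms(2)])
  also have "\<dots> = Em (J n k X * Y)" using J_zero[OF assms(1)] by (auto simp: not_le)
  finally show ?thesis .
qed

lemma Em_J_sum:
  assumes "Pd n d X" "Pd n d' Y" shows "Em (X * Y) = (\<Sum>k\<le>d. Em (J n k X * J n k Y))"
proof -
  have "X * Y = (\<Sum>l\<le>d. J n l X * Y)" using arg_cong[OF J_expand[OF assms(1)], of "\<lambda>Z. Z * Y"] by (simp only: sum_distrib_right)
  then have "Em (X * Y) = (\<Sum>l\<le>d. Em (J n l X * Y))" by (simp only: Em_sum)
  also have "\<dots> = (\<Sum>l\<le>d. Em (Y * J n l X))" by (simp add: mult.commute)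
  also have "\<dots> = (\<Sum>l\<le>d. Em (J n l Y * J n l X))"
    by (intro sum.cong refl Em_J[OF assms(2) W_J[OF assms(1)]])
  also have "\<dots> = (\<Sum>l\<le>d. Em (J n l X * J n l Y))" by (simp add: mult.commute)
  finally show ?thesis .
qed

lemma nrm_sq_J: assumes "Pd n d X" shows "(nrm X)\<^sup>2 = (\<Sum>k\<le>d. (nrm (J n k X))\<^sup>2)"
  using Em_J_sum[OF assms assms] by (simp add: nrm_sq)

lemma nrm_J_le: assumes "Pd n d X" shows "nrm (J n k X) \<le> nrm X"
proof (cases "k \<le> d")
  case True
  have "(nrm (J n k X))\<^sup>2 \<le> (nrm X)\<^sup>2"
    unfolding nrm_sq_J[OF assms] using True by (intro member_le_sum) auto
  then show ?thesis by (rule power2_le_imp_le) simp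
next
  case False
  then show ?thesis using J_zero[OF assms] by simp
qed

lemma Num_J: assumes "Pd n d X" shows "Num n X = (\<Sum>k\<le>d. real k *\<^sub>R J n k X)"
proof -
  have "Num n X = (\<Sum>k\<le>d. Num n (J n k X))" using arg_cong[OF J_expand[OF assms], of "Num n"] by (simp only: Num_sum)
  then show ?thesis using W_Num[OF W_J[OF assms]] by simp
qed

lemma Pd_Num: assumes "Pd n d X" shows "Pd n d (Num n X)"
  unfolding Num_J[OF assms]
  by (intro Pd_sum Pd_scaleR) (use Pd_mono[OF W_Pd[OF W_J[OF assms]]] in auto)

lemma J_Num: assumes "Pd n d X" shows "J n k (Num n X) = real k *\<^sub>R J n k X"
proof -
  have "isdec n (Num n X) (\<lambda>k. real k *\<^sub>R J n k X) d"
    unfolding isdec_def using Num_J[OF assms] W_J[OF assms] J_zero[OF assms] by (auto intro: W_scaleR)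
  from isdec_J[OF this] show ?thesis .
qed

lemma Em_Gam_J: assumes "Pd n d X" shows "Em (Gam n X X) = (\<Sum>k\<le>d. real k * (nrm (J n k X))\<^sup>2)"
  unfolding Em_Num[symmetric] Em_J_sum[OF Pd_Num[OF assms] assms] J_Num[OF assms] nrm_sq by simp

lemma Em_Gam_le: assumes "Pd n d X" shows "Em (Gam n X X) \<le> real d * Em (X * X)"
  unfolding Em_Gam_J[OF assms] nrm_sq[symmetric] nrm_sq_J[OF assms] sum_distrib_left
  by (intro sum_mono mult_right_mono) auto

lemma J_0_eq: assumes "Pd n d X" shows "J n 0 X = of_real (Em X)"
proof -
  obtain c where c: "J n 0 X = of_real c" using W_degree_0[OF W_J[OF assms]] by blast
  have "Em X = Em (X * 1)" by simp
  also have "\<dots> = Em (J n 0 X * 1)" by (rule Em_J[OF assms]) (use W_const[of n 1] in simp)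
  finally show ?thesis using c by simp
qed

text \<open>The energy weights the component of degree \<open>k\<close> by \<open>k\<close>, which
  is at least 1 except for the constant part.\<close>

lemma poincare: assumes "Pd n d X" shows "Em (X * X) \<le> (Em X)\<^sup>2 + Em (Gam n X X)"
proof -
  have 0: "(nrm (J n 0 X))\<^sup>2 = (Em X)\<^sup>2"
    unfolding J_0_eq[OF assms] nrm_sq by (simp add: power2_eq_square flip: of_real_mult)
  have "(\<Sum>k\<le>d. (nrm (J n k X))\<^sup>2) = (nrm (J n 0 X))\<^sup>2 + (\<Sum>k=1..d. (nrm (J n k X))\<^sup>2)"
    by (simp add: sum.atMost_shift sum.atLeast1_atMost_eq atLeast0LessThan[symmetric] lessThan_atLeast0)
  also have "\<dots> \<le> (nrm (J n 0 X))\<^sup>2 + (\<Sum>k=1..d. real k * (nrm (J n k X))\<^sup>2)"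
  proof (intro add_left_mono sum_mono)
    fix k assume "k \<in> {1..d}"
    then have "1 * (nrm (J n k X))\<^sup>2 \<le> real k * (nrm (J n k X))\<^sup>2" by (intro mult_right_mono) auto
    then show "(nrm (J n k X))\<^sup>2 \<le> real k * (nrm (J n k X))\<^sup>2" by simp
  qed
  also have "(\<Sum>k=1..d. real k * (nrm (J n k X))\<^sup>2) \<le> (\<Sum>k\<le>d. real k * (nrm (J n k X))\<^sup>2)"
    by (intro sum_mono2) auto
  finally show ?thesis unfolding Em_Gam_J[OF assms] nrm_sq[symmetric] nrm_sq_J[OF assms] 0 by simp
qed

lemma Em_young: "2 * Em (X * Y) \<le> Em (X * X) + Em (Y * Y)"
proof -
  have "Em ((X - Y) * (X - Y)) = Em (X * X) - 2 * Em (X * Y) + Em (Y * Y)"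
    using Em_add_square[of X "- Y"] by simp
  then show ?thesis using Em_square_nonneg[of "X - Y"] by linarith
qed

text \<open>Commuting \<open>pd\<close> past \<open>cr\<close> writes the squared norm of the
  divergence as the sum of \<open>E[Y_i^2]\<close> plus the double sum of
  \<open>E[d_j Y_i d_i Y_j]\<close>. Young's inequality and an exchange of indices bound the latter
  by the total energy, hence by \<open>d\<close> times the squared norms. No factor \<open>n\<close>
  arises.\<close>

lemma nrm_sum_cr:
  assumes Y: "\<And>i. i < n \<Longrightarrow> Pd n d (Y i)"
  shows "(nrm (\<Sum>i<n. cr i (Y i)))\<^sup>2 \<le> (real d + 1) * (\<Sum>i<n. (nrm (Y i))\<^sup>2)"
proof -
  have "(nrm (\<Sum>i<n. cr i (Y i)))\<^sup>2 = (\<Sum>i<n. \<Sum>j<n. Em (cr i (Y i) * cr j (Y j)))"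
    by (simp add: nrm_sq sum_product)
  also have "\<dots> = (\<Sum>i<n. \<Sum>j<n. Em (pd j (Y i) * pd i (Y j)) + (if j = i then Em (Y i * Y i) else 0))"
  proof (intro sum.cong refl)
    fix i j
    have "Em (cr i (Y i) * cr j (Y j)) = Em (Y i * cr j (pd i (Y j))) + (if j = i then Em (Y i * Y i) else 0)"
      by (simp add: Em_cr pd_cr distrib_left)
    also have "Em (Y i * cr j (pd i (Y j))) = Em (pd j (Y i) * pd i (Y j))"
      using Em_cr[of j "pd i (Y j)" "Y i"] by (simp add: mult.commute)
    finally show "Em (cr i (Y i) * cr j (Y j)) = Em (pd j (Y i) * pd i (Y j)) + (if j = i then Em (Y i * Y i) else 0)" .
  qed
  also have "\<dots> = (\<Sum>i<n. \<Sum>j<n. Em (pd j (Y i) * pd i (Y j))) + (\<Sum>i<n. Em (Y i * Y i))"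
    by (simp add: sum.distrib)
  also have "(\<Sum>i<n. \<Sum>j<n. Em (pd j (Y i) * pd i (Y j)))
     \<le> (\<Sum>i<n. \<Sum>j<n. (Em (pd j (Y i) * pd j (Y i)) + Em (pd i (Y j) * pd i (Y j))) / 2)"
    by (intro sum_mono) (use Em_young in \<open>simp add: field_simps\<close>)
  also have "\<dots> = (\<Sum>i<n. \<Sum>j<n. Em (pd j (Y i) * pd j (Y i)))"
  proof -
    have "(\<Sum>i<n. \<Sum>j<n. Em (pd i (Y j) * pd i (Y j))) = (\<Sum>i<n. \<Sum>j<n. Em (pd j (Y i) * pd j (Y i)))"
      by (rule sum.swap)
    then show ?thesis by (simp add: sum_divide_distrib[symmetric] sum.distrib)
  qed
  also have "\<dots> = (\<Sum>i<n. Em (Gam n (Y i) (Y i)))" by (simp add: Gam_def)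
  also have "\<dots> \<le> (\<Sum>i<n. real d * Em (Y i * Y i))" by (intro sum_mono Em_Gam_le Y) auto
  finally show ?thesis by (simp add: nrm_sq sum_distrib_left sum.distrib distrib_right algebra_simps)
qed

section \<open>Equivalence of moments\<close>

text \<open>For a vector of polynomials of degree at most \<open>d\<close>, Poincare's inequality for the square of
  its Euclidean norm bounds the fourth moment by that of the gradient, which has degree \<open>d - 1\<close>.
  Indices are lists so that taking gradients does not change their type.\<close>

lemma vector_fourth_moment:
  "\<exists>C\<ge>0. \<forall>n (I :: nat list set) X. finite I \<longrightarrow> (\<forall>j\<in>I. Pd n d (X j)) \<longrightarrow>
     Em ((\<Sum>j\<in>I. X j * X j) * (\<Sum>j\<in>I. X j * X j)) \<le> C * (Em (\<Sum>j\<in>I. X j * X j))\<^sup>2"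
proof (induction d)
  case 0
  have "Em ((\<Sum>j\<in>I. X j * X j) * (\<Sum>j\<in>I. X j * X j)) \<le> 1 * (Em (\<Sum>j\<in>I. X j * X j))\<^sup>2"
    if I: "\<forall>j\<in>I. Pd n 0 (X j)" for n and I :: "nat list set" and X
  proof -
    have "Pd n 0 (\<Sum>j\<in>I. X j * X j)" using Pd_mult[of n 0 _ 0] I by (intro Pd_sum) fastforce
    then obtain c where c: "(\<Sum>j\<in>I. X j * X j) = of_real c" using Pd_0_const by blast
    show ?thesis unfolding c by (simp add: power2_eq_square flip: of_real_mult)
  qed
  then show ?case by (intro exI[of _ 1]) auto
next
  case (Suc d)
  then obtain C where C: "0 \<le> C" "\<And>n (I :: nat list set) X. finite I \<Longrightarrow> (\<forall>j\<in>I. Pd n d (X j)) \<Longrightarrow>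
     Em ((\<Sum>j\<in>I. X j * X j) * (\<Sum>j\<in>I. X j * X j)) \<le> C * (Em (\<Sum>j\<in>I. X j * X j))\<^sup>2" by blast
  \<comment> \<open>\<open>b\<close> collects the factor 4 from the gradient of a sum of squares,
    the constant of the induction hypothesis and the loss \<open>Suc d\<close> of
    \<open>Em_Gam_le\<close>. The mixed term it multiplies is absorbed at the end by Young's
    inequality.\<close>
  define b where "b = 4 * sqrt C * real (Suc d)"
  have "Em ((\<Sum>j\<in>I. X j * X j) * (\<Sum>j\<in>I. X j * X j)) \<le> (2 + b\<^sup>2) * (Em (\<Sum>j\<in>I. X j * X j))\<^sup>2"
    if fin: "finite I" and I: "\<forall>j\<in>I. Pd n (Suc d) (X j)" for n and I :: "nat list set" and X
  proof -
    define S where "S = (\<Sum>j\<in>I. X j * X j)"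
    define T where "T = (\<Sum>i<n. \<Sum>j\<in>I. pd i (X j) * pd i (X j))"
    have PS: "Pd n (Suc d + Suc d) S" unfolding S_def by (intro Pd_sum Pd_mult) (use I in auto)
    define X' where "X' l = pd (hd l) (X (tl l))" for l
    define I' where "I' = (\<lambda>(i, j). i # j) ` ({..<n} \<times> I)"
    have T': "T = (\<Sum>l\<in>I'. X' l * X' l)"
    proof -
      have "(\<Sum>l\<in>I'. X' l * X' l) = (\<Sum>(i, j)\<in>{..<n} \<times> I. pd i (X j) * pd i (X j))"
        unfolding I'_def by (subst sum.reindex) (auto simp: inj_on_def X'_def case_prod_beta)
      then show ?thesis unfolding T_def by (simp add: sum.cartesian_product)
    qed
    have "Pd n d (X' l)" if "l \<in> I'" for l
      using that Pd_pd[of n "Suc d"] I unfolding I'_def X'_def by auto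
    then have "Em (T * T) \<le> C * (Em T)\<^sup>2" unfolding T' by (intro C(2)) (auto simp: I'_def fin)
    moreover have T0: "0 \<le> Em T" unfolding T_def by (auto intro!: sum_nonneg)
    ultimately have nT: "nrm T \<le> sqrt C * Em T"
      unfolding nrm_def by (metis abs_of_nonneg real_sqrt_abs real_sqrt_le_iff real_sqrt_mult)
    have "Em T = (\<Sum>j\<in>I. Em (Gam n (X j) (X j)))"
      unfolding T_def Gam_def Em_sum by (rule sum.swap)
    also have "\<dots> \<le> (\<Sum>j\<in>I. real (Suc d) * Em (X j * X j))" by (intro sum_mono Em_Gam_le) (use I in auto)
    also have "\<dots> = real (Suc d) * Em S" by (simp add: S_def sum_distrib_left)
    finally have TS: "Em T \<le> real (Suc d) * Em S" .
    have S0: "0 \<le> Em S" unfolding S_def by (auto intro!: sum_nonneg)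
    have "Em (Gam n S S) \<le> Em (4 * (S * T))"
    proof (rule Em_mono)
      fix \<omega>
      have "ev (Gam n S S) \<omega> = (\<Sum>i<n. (2 * (\<Sum>j\<in>I. ev (X j) \<omega> * ev (pd i (X j)) \<omega>))\<^sup>2)"
        by (simp add: Gam_def S_def pd_mult power2_eq_square sum_distrib_left algebra_simps sum.distrib)
      also have "\<dots> \<le> (\<Sum>i<n. 4 * ((\<Sum>j\<in>I. (ev (X j) \<omega>)\<^sup>2) * (\<Sum>j\<in>I. (ev (pd i (X j)) \<omega>)\<^sup>2)))"
        unfolding power_mult_distrib using Cauchy_Schwarz_ineq_sum by (intro sum_mono) simp
      also have "\<dots> = ev (4 * (S * T)) \<omega>"
        by (simp add: S_def T_def power2_eq_square sum_distrib_left ev_numeral)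
      finally show "ev (Gam n S S) \<omega> \<le> ev (4 * (S * T)) \<omega>" .
    qed
    also have "\<dots> \<le> 4 * (nrm S * nrm T)" using Em_CS[of S T] by simp
    also have "\<dots> \<le> 4 * (nrm S * (sqrt C * (real (Suc d) * Em S)))"
      using nT TS C(1) by (intro mult_left_mono order_trans[OF nT]) auto
    also have "\<dots> = b * (nrm S * Em S)" by (simp add: b_def)
    finally have "(nrm S)\<^sup>2 \<le> (Em S)\<^sup>2 + b * (nrm S * Em S)" using poincare[OF PS] by (simp add: nrm_sq)
    moreover have "2 * (b * (nrm S * Em S)) \<le> (nrm S)\<^sup>2 + b\<^sup>2 * (Em S)\<^sup>2"
      using sum_squares_ge_zero[of "nrm S - b * Em S" 0] by (simp add: power2_eq_square algebra_simps)
    ultimately have "(nrm S)\<^sup>2 \<le> (2 + b\<^sup>2) * (Em S)\<^sup>2" by (simp add: algebra_simps)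
    then show ?thesis unfolding S_def nrm_sq .
  qed
  then show ?case by (intro exI[of _ "2 + b\<^sup>2"]) (auto intro: add_nonneg_nonneg)
qed

lemma fourth_moment_le:
  "\<exists>C\<ge>0. \<forall>n X. Pd n d X \<longrightarrow> nrm (X * X) \<le> C * (nrm X)\<^sup>2"
proof -
  obtain C where C: "0 \<le> C" "\<And>n (I :: nat list set) X. finite I \<Longrightarrow> (\<forall>j\<in>I. Pd n d (X j)) \<Longrightarrow>
     Em ((\<Sum>j\<in>I. X j * X j) * (\<Sum>j\<in>I. X j * X j)) \<le> C * (Em (\<Sum>j\<in>I. X j * X j))\<^sup>2"
    using vector_fourth_moment by blast
  have "nrm (X * X) \<le> sqrt C * (nrm X)\<^sup>2" if "Pd n d X" for n X
  proof -
    have "Em ((X * X) * (X * X)) \<le> C * (Em (X * X))\<^sup>2"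
      using C(2)[of "{[]}" n "\<lambda>_. X"] that by simp
    then have "nrm (X * X) \<le> sqrt (C * (Em (X * X))\<^sup>2)" unfolding nrm_def by simp
    then show ?thesis by (simp add: real_sqrt_mult nrm_sq)
  qed
  then show ?thesis using C(1) by (intro exI[of _ "sqrt C"]) auto
qed

text \<open>Cauchy-Schwarz for \<open>X * X\<close> and \<open>Y * Y\<close> reduces the claim to
  fourth moments. The constant depends on the degrees only, not on \<open>n\<close>.\<close>

lemma nrm_mult_le:
  "\<exists>K\<ge>0. \<forall>n X Y. Pd n a X \<longrightarrow> Pd n b Y \<longrightarrow> nrm (X * Y) \<le> K * nrm X * nrm Y"
proof -
  obtain C where C: "0 \<le> C" "\<And>n X. Pd n a X \<Longrightarrow> nrm (X * X) \<le> C * (nrm X)\<^sup>2" using fourth_moment_le by blast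
  obtain D where D: "0 \<le> D" "\<And>n X. Pd n b X \<Longrightarrow> nrm (X * X) \<le> D * (nrm X)\<^sup>2" using fourth_moment_le by blast
  have "nrm (X * Y) \<le> sqrt (C * D) * nrm X * nrm Y" if "Pd n a X" "Pd n b Y" for n X Y
  proof -
    have "Em ((X * Y) * (X * Y)) = Em ((X * X) * (Y * Y))" by (simp add: mult_ac)
    also have "\<dots> \<le> nrm (X * X) * nrm (Y * Y)" using Em_CS abs_le_iff by blast
    also have "\<dots> \<le> (C * (nrm X)\<^sup>2) * (D * (nrm Y)\<^sup>2)"
      using C D that by (intro mult_mono) auto
    also have "\<dots> = (C * D) * (nrm X * nrm Y)\<^sup>2" by (simp add: power_mult_distrib)
    finally have "nrm (X * Y) \<le> sqrt ((C * D) * (nrm X * nrm Y)\<^sup>2)" unfolding nrm_def[of "X * Y"] by simp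
    then show ?thesis by (simp add: real_sqrt_mult mult.assoc)
  qed
  then show ?thesis using C(1) D(1) by (intro exI[of _ "sqrt (C * D)"]) auto
qed

section \<open>Multiplication and differentiation by an element of a chaos\<close>

definition adm :: "nat \<Rightarrow> nat \<Rightarrow> pf \<Rightarrow> bool" where
  "adm p n F \<longleftrightarrow> W n p F \<and> Em (F * F) = 1"

definition gg :: "nat \<Rightarrow> nat \<Rightarrow> pf \<Rightarrow> pf" where
  "gg p n F = (1 / real p) *\<^sub>R Gam n F F - 1"

text \<open>Orders are counted in powers of this square root, because a single middle component of a
  product with \<open>F\<close> has order \<open>eta\<close> (\<open>mid_bound\<close>) and the
  commutator of lowering and differentiation has order \<open>eta^2\<close>.\<close>

definition eta :: "nat \<Rightarrow> nat \<Rightarrow> pf \<Rightarrow> real" where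
  "eta p n F = sqrt (nrm (gg p n F))"

lemma eta_nonneg [simp]: "0 \<le> eta p n F" by (simp add: eta_def)
lemma eta_sq: "(eta p n F)\<^sup>2 = nrm (gg p n F)" by (simp add: eta_def)

lemma nrm_sum_bound:
  assumes "\<And>a. a \<in> A \<Longrightarrow> nrm (f a) \<le> b"
  shows "nrm (sum f A) \<le> real (card A) * b"
  using order_trans[OF nrm_sum sum_bounded_above[of A "\<lambda>a. nrm (f a)" b]] assms by simp

lemma nrm_Num_le: assumes "Pd n d X" shows "nrm (Num n X) \<le> real d * nrm X"
proof (rule power2_le_imp_le)
  have "(nrm (Num n X))\<^sup>2 = (\<Sum>k\<le>d. (real k)\<^sup>2 * (nrm (J n k X))\<^sup>2)"
    unfolding nrm_sq_J[OF Pd_Num[OF assms]] J_Num[OF assms] nrm_scaleR by (simp add: power_mult_distrib)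
  also have "\<dots> \<le> (\<Sum>k\<le>d. (real d)\<^sup>2 * (nrm (J n k X))\<^sup>2)"
    by (intro sum_mono mult_right_mono power_mono) auto
  also have "\<dots> = (real d * nrm X)\<^sup>2"
    by (simp add: power_mult_distrib nrm_sq_J[OF assms] sum_distrib_left)
  finally show "(nrm (Num n X))\<^sup>2 \<le> (real d * nrm X)\<^sup>2" .
qed simp

lemma J_0_cr: assumes "Pd n d X" "i < n" shows "J n 0 (cr i X) = 0"
proof -
  have e: "cr i X = (\<Sum>k\<le>d. cr i (J n k X))"
    using arg_cong[OF J_expand[OF assms(1)], of "cr i"] by (simp only: cr_sum)
  have "J n 0 (\<Sum>k\<le>d. cr i (J n k X)) = (\<Sum>l\<le>d. J n 0 (cr i (J n l X)))"
    by (rule J_sum[of _ n "Suc d"]) (use Pd_mono[OF W_Pd[OF W_cr[OF W_J[OF assms(1)] assms(2)]]] in auto)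
  also have "\<dots> = 0"
    by (intro sum.neutral) (auto simp: J_W[OF W_cr[OF W_J[OF assms(1)] assms(2)]])
  finally show ?thesis using e by simp
qed

text \<open>In \<open>cr i F * X = cr i (F * X) + F * pd i X\<close> the first term raises the
  degree and the second takes one degree away from \<open>X\<close>. So each creation in
  \<open>F\<close> lowers the degree by at most one.\<close>

lemma J_mult_vanish: "W n p F \<Longrightarrow> W n q X \<Longrightarrow> k + p < q \<Longrightarrow> J n k (F * X) = 0"
proof (induction arbitrary: q X k rule: W.induct)
  case (W_const c)
  then show ?case
    using J_W[OF W_scaleR[OF W_const(1), of c], of k] by (simp add: scaleR_conv_of_real)
next
  case (W_cr p F i)
  have P: "Pd n (p + q) (F * X)" by (rule W_mult_Pd[OF W_cr(1) W_Pd[OF W_cr.prems(1)]])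
  have P2: "Pd n (p + (q - 1)) (F * pd i X)" by (rule W_mult_Pd[OF W_cr(1) W_Pd[OF W_pd[OF W_cr.prems(1)]]])
  have "J n k (cr i (F * X)) = 0"
  proof (cases k)
    case 0
    then show ?thesis using J_0_cr[OF P W_cr(2)] by simp
  next
    case (Suc k')
    then show ?thesis using J_cr[OF P W_cr(2), of k'] W_cr.IH[OF W_cr.prems(1), of k'] W_cr.prems(2) by simp
  qed
  moreover have "J n k (F * pd i X) = 0"
    by (rule W_cr.IH[OF W_pd[OF W_cr.prems(1)]]) (use W_cr.prems(2) in simp)
  moreover have "cr i F * X = cr i (F * X) + F * pd i X" by (simp add: cr_mult)
  ultimately show ?case using J_add[OF Pd_cr[OF P W_cr(2)] P2, of k] by simp
next
  case (W_add p F G)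
  then show ?case
    using J_add[OF W_mult_Pd[OF W_add(1) W_Pd[OF W_add.prems(1)]] W_mult_Pd[OF W_add(2) W_Pd[OF W_add.prems(1)]], of k]
    by (simp add: distrib_right)
next
  case (W_scaleR p F c)
  then show ?case
    using J_scaleR[OF W_mult_Pd[OF W_scaleR(1) W_Pd[OF W_scaleR.prems(1)]], of k c] by simp
qed auto

lemma Gam_W:
  assumes "W n p F" "W n q X"
  shows "2 *\<^sub>R Gam n F X = real (p + q) *\<^sub>R (F * X) - Num n (F * X)"
  unfolding Num_mult W_Num[OF assms(1)] W_Num[OF assms(2)]
  by (simp add: scaleR_conv_of_real algebra_simps)

text \<open>The diffusion identity read degree by degree. The weight is 0 in the top degree
  \<open>p + q\<close> and equals \<open>p\<close> in degree \<open>q - p\<close>; this separates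
  the two extreme parts of the product.\<close>

lemma J_Gam:
  assumes F: "W n p F" and X: "W n q X"
  shows "J n k (Gam n F X) = ((real (p + q) - real k) / 2) *\<^sub>R J n k (F * X)"
proof -
  have P: "Pd n (p + q) (F * X)" by (rule W_mult_Pd[OF F W_Pd[OF X]])
  have G: "Gam n F X = (1/2) *\<^sub>R (real (p + q) *\<^sub>R (F * X) - Num n (F * X))"
    unfolding Gam_W[OF assms, symmetric] by simp
  show ?thesis
    unfolding G J_scaleR[OF Pd_diff[OF Pd_scaleR[OF P] Pd_Num[OF P]]] J_diff[OF Pd_scaleR[OF P] Pd_Num[OF P]]
      J_scaleR[OF P] J_Num[OF P]
    by (simp add: scaleR_diff_left[symmetric])
qed

lemma adm_W: "adm p n F \<Longrightarrow> W n p F" and adm_1: "adm p n F \<Longrightarrow> Em (F * F) = 1"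
  and adm_nrm: "adm p n F \<Longrightarrow> nrm F = 1"
  by (auto simp: adm_def nrm_def)

lemma Pd_gg: "adm p n F \<Longrightarrow> Pd n (p - 1 + (p - 1)) (gg p n F)"
  unfolding gg_def
  by (rule Pd_diff[OF Pd_scaleR[OF Pd_Gam[OF W_Pd[OF adm_W] W_Pd[OF adm_W]]] Pd_1])

lemma Gam_FF: "1 \<le> p \<Longrightarrow> Gam n F F = real p *\<^sub>R (1 + gg p n F)"
  by (simp add: gg_def)

lemma Em_gg: assumes "1 \<le> p" "adm p n F" shows "Em (gg p n F) = 0"
proof -
  have "Em (Gam n F F) = real p"
    unfolding Em_Num[symmetric] W_Num[OF adm_W[OF assms(2)]] using adm_1[OF assms(2)] by simp
  then show ?thesis using assms by (simp add: gg_def)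
qed

text \<open>In positive degree the constant in \<open>gg\<close> disappears and the two components
  become proportional. Avoiding division keeps \<open>k = 2 * p\<close> included.\<close>

lemma J_FF:
  assumes p: "1 \<le> p" and F: "adm p n F" and k: "1 \<le> k"
  shows "(real (2 * p) - real k) *\<^sub>R J n k (F * F) = real (2 * p) *\<^sub>R J n k (gg p n F)"
proof -
  have "J n k (gg p n F) = J n k ((1 / real p) *\<^sub>R Gam n F F) - J n k 1"
    unfolding gg_def by (rule J_diff[OF Pd_scaleR[OF Pd_Gam[OF W_Pd W_Pd]] Pd_1[of n 0]]) (rule adm_W[OF F])+
  also have "J n k 1 = 0" using J_zero[OF Pd_1[of n 0], of k] k by simp
  also have "J n k ((1 / real p) *\<^sub>R Gam n F F) = (1 / real p) *\<^sub>R ((real (p + p) - real k) / 2) *\<^sub>R J n k (F * F)"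
    by (simp add: J_scaleR[OF Pd_Gam[OF W_Pd[OF adm_W[OF F]] W_Pd[OF adm_W[OF F]]]] J_Gam[OF adm_W[OF F] adm_W[OF F]])
  finally have e: "J n k (gg p n F) = (1 / real p) *\<^sub>R ((real (p + p) - real k) / 2) *\<^sub>R J n k (F * F)" by simp
  have "real (2 * p) * ((1 / real p) * ((real (p + p) - real k) / 2)) = real (2 * p) - real k"
    using p by (simp add: field_simps)
  then show ?thesis unfolding e scaleR_scaleR by (simp only:)
qed

lemma nrm_J_FF:
  assumes p: "1 \<le> p" and F: "adm p n F" and k: "1 \<le> k" "k < 2 * p"
  shows "nrm (J n k (F * F)) \<le> real (2 * p) * (eta p n F)\<^sup>2"
proof -
  have "1 * nrm (J n k (F * F)) \<le> (real (2 * p) - real k) * nrm (J n k (F * F))"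
    using k by (intro mult_right_mono) auto
  also have "\<dots> = nrm ((real (2 * p) - real k) *\<^sub>R J n k (F * F))" using k by (simp add: nrm_scaleR)
  also have "\<dots> = real (2 * p) * nrm (J n k (gg p n F))" unfolding J_FF[OF p F k(1)] by (simp add: nrm_scaleR)
  also have "\<dots> \<le> real (2 * p) * (eta p n F)\<^sup>2"
    unfolding eta_sq by (intro mult_left_mono nrm_J_le[OF Pd_gg[OF F]]) auto
  finally show ?thesis by simp
qed

text \<open>Moment equivalence bounds \<open>F * F\<close>, hence Gamma(F, F) and \<open>gg\<close>,
  by a constant depending on \<open>p\<close> only. This lets higher powers of \<open>eta\<close> be
  estimated by lower ones.\<close>

lemma eta_bounded:
  assumes p: "1 \<le> p"
  shows "\<exists>B\<ge>1. \<forall>n F. adm p n F \<longrightarrow> eta p n F \<le> B"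
proof -
  obtain K where K: "0 \<le> K" "\<And>n X. Pd n p X \<Longrightarrow> nrm (X * X) \<le> K * (nrm X)\<^sup>2"
    using fourth_moment_le by blast
  define B where "B = 2 * K + 1"
  have "eta p n F \<le> B" if F: "adm p n F" for n F
  proof -
    have P: "Pd n (p + p) (F * F)" by (rule W_mult_Pd[OF adm_W[OF F] W_Pd[OF adm_W[OF F]]])
    have a: "nrm (F * F) \<le> K" using K(2)[OF W_Pd[OF adm_W[OF F]]] adm_nrm[OF F] by simp
    have "2 * nrm (Gam n F F) = nrm (2 *\<^sub>R Gam n F F)" by (simp add: nrm_scaleR)
    also have "\<dots> \<le> real (p + p) * nrm (F * F) + real (p + p) * nrm (F * F)"
      unfolding Gam_W[OF adm_W[OF F] adm_W[OF F]]
      by (rule order_trans[OF nrm_diff add_mono]) (simp_all only: nrm_scaleR abs_of_nat nrm_Num_le[OF P] order_refl)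
    finally have "nrm (Gam n F F) \<le> real p * (2 * nrm (F * F))" by (simp add: algebra_simps)
    also have "\<dots> \<le> real p * (2 * K)" using a by (intro mult_left_mono) auto
    finally have "nrm (Gam n F F) / real p \<le> 2 * K" using p by (simp add: field_simps)
    moreover have "nrm (gg p n F) \<le> nrm (Gam n F F) / real p + nrm 1"
      unfolding gg_def using nrm_diff[of "(1 / real p) *\<^sub>R Gam n F F" 1] by (simp add: nrm_scaleR)
    moreover have "nrm 1 = 1" by (simp add: nrm_def)
    ultimately have "nrm (gg p n F) \<le> B" by (simp add: B_def)
    also have "B \<le> B\<^sup>2" using K(1) by (simp add: B_def power2_eq_square algebra_simps)
    finally show ?thesis unfolding eta_def using K(1) by (auto simp: B_def intro: real_le_lsqrt)
  qed
  then show ?thesis using K(1) by (intro exI[of _ B]) (auto simp: B_def)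
qed

text \<open>In the limit only the extreme degrees \<open>p + q\<close> and \<open>q - p\<close> survive in the product of \<open>F\<close> with an
  element of chaos \<open>q\<close>. For \<open>q < p\<close> this comes from
  \<open>2 E[F X \<Gamma>(F, X)] = E[\<Gamma>(F\<^sup>2, X\<^sup>2)] / 2\<close>, and the general case
  follows by differentiating \<open>X\<close>.\<close>

lemma mid_bound:
  assumes p: "1 \<le> p"
  shows "\<exists>C\<ge>0. \<forall>n F X k. adm p n F \<longrightarrow> W n q X \<longrightarrow> q < k + p \<longrightarrow> k < p + q \<longrightarrow>
    nrm (J n k (F * X)) \<le> C * eta p n F * nrm X"
proof (induction q rule: less_induct)
  case (less q)
  show ?case
  proof (cases "q < p")
    case True
    obtain K where K: "0 \<le> K" "\<And>n X. Pd n q X \<Longrightarrow> nrm (X * X) \<le> K * (nrm X)\<^sup>2"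
      using fourth_moment_le by blast
    define C where "C = real (Suc (2 * q)) * (real q * (K * real (2 * p)))"
    have C0: "0 \<le> C" using K by (simp add: C_def)
    have "nrm (J n k (F * X)) \<le> sqrt C * eta p n F * nrm X"
      if F: "adm p n F" and X: "W n q X" and k: "k < p + q" for n F X k
    proof -
      define Y where "Y = F * X"
      have PY: "Pd n (p + q) Y" unfolding Y_def by (rule W_mult_Pd[OF adm_W[OF F] W_Pd[OF X]])
      have PX: "Pd n (q + q) (X * X)" by (rule W_mult_Pd[OF X W_Pd[OF X]])
      have PF: "Pd n (p + p) (F * F)" by (rule W_mult_Pd[OF adm_W[OF F] W_Pd[OF adm_W[OF F]]])
      \<comment> \<open>In the decomposition of \<open>Y\<close> this expectation is a sum of
        nonnegative terms with weight at least 1/2 in each degree below \<open>p + q\<close>, so one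
        upper bound controls all those degrees.\<close>
      have "2 * Em (Y * Gam n F X) = Em (Y * (2 *\<^sub>R Gam n F X))" by simp
      also have "\<dots> = real (p + q) * Em (Y * Y) - Em (Num n Y * Y)"
        unfolding Gam_W[OF adm_W[OF F] X] Y_def[symmetric] by (simp add: right_diff_distrib mult.commute)
      also have "\<dots> = (\<Sum>k\<le>p + q. (real (p + q) - real k) * (nrm (J n k Y))\<^sup>2)"
        unfolding Em_Num Em_Gam_J[OF PY] nrm_sq[symmetric] nrm_sq_J[OF PY]
        by (simp only: sum_distrib_left sum_subtractf[symmetric] left_diff_distrib)
      finally have 1: "2 * Em (Y * Gam n F X) = \<dots>" .
      have "4 * Em (Y * Gam n F X) = Em (Gam n (X * X) (F * F))"
      proof -
        have "Gam n (X * X) (F * F) = 4 * (Y * Gam n F X)"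
          unfolding Gam_mult_right Gam_commute[of n "X * X" F] Y_def Gam_commute[of n X] by (simp add: algebra_simps)
        then show ?thesis by simp
      qed
      also have "\<dots> = (\<Sum>k\<le>q + q. real k * Em (J n k (X * X) * J n k (F * F)))"
        unfolding Em_Num[symmetric] Em_J_sum[OF Pd_Num[OF PX] PF] J_Num[OF PX] by simp
      \<comment> \<open>As \<open>q < p\<close>, only degrees \<open>k <= 2 * q < 2 * p\<close> of
        \<open>F * F\<close> meet \<open>X * X\<close>. These are of order \<open>eta^2\<close> by
        \<open>nrm_J_FF\<close> for positive \<open>k\<close>, and degree 0 has weight 0.\<close>
      also have "\<dots> \<le> (\<Sum>k\<le>q + q. real (2 * q) * ((K * (nrm X)\<^sup>2) * (real (2 * p) * (eta p n F)\<^sup>2)))"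
      proof (rule sum_mono)
        fix k assume k: "k \<in> {..q + q}"
        show "real k * Em (J n k (X * X) * J n k (F * F)) \<le> real (2 * q) * ((K * (nrm X)\<^sup>2) * (real (2 * p) * (eta p n F)\<^sup>2))"
        proof (cases "k = 0")
          case True
          then show ?thesis using K(1) by simp
        next
          case False
          have "Em (J n k (X * X) * J n k (F * F)) \<le> nrm (J n k (X * X)) * nrm (J n k (F * F))"
            using Em_CS abs_le_iff by blast
          also have "\<dots> \<le> (K * (nrm X)\<^sup>2) * (real (2 * p) * (eta p n F)\<^sup>2)"
            using K(2)[OF W_Pd[OF X]] nrm_J_le[OF PX, of k] nrm_J_FF[OF p F, of k] False k True K(1)
            by (intro mult_mono) auto
          finally have "real k * Em (J n k (X * X) * J n k (F * F)) \<le> real k * ((K * (nrm X)\<^sup>2) * (real (2 * p) * (eta p n F)\<^sup>2))"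
            by (intro mult_left_mono) auto
          also have "\<dots> \<le> real (2 * q) * ((K * (nrm X)\<^sup>2) * (real (2 * p) * (eta p n F)\<^sup>2))"
          proof (rule mult_right_mono)
            show "real k \<le> real (2 * q)" using k by simp
            show "0 \<le> (K * (nrm X)\<^sup>2) * (real (2 * p) * (eta p n F)\<^sup>2)" using K(1) by simp
          qed
          finally show ?thesis .
        qed
      qed
      also have "\<dots> = 2 * (C * (eta p n F)\<^sup>2 * (nrm X)\<^sup>2)"
      proof -
        have c: "real (card {..q + q}) = real (Suc (2 * q))" by simp
        show ?thesis unfolding sum_constant C_def c by (simp only: of_nat_mult of_nat_numeral mult_ac)
      qed
      finally have 2: "2 * Em (Y * Gam n F X) \<le> C * (eta p n F)\<^sup>2 * (nrm X)\<^sup>2" by (simp add: mult_ac)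
      have "(nrm (J n k Y))\<^sup>2 = 1 * (nrm (J n k Y))\<^sup>2" by simp
      also have "\<dots> \<le> (real (p + q) - real k) * (nrm (J n k Y))\<^sup>2" using k by (intro mult_right_mono) auto
      also have "\<dots> \<le> (\<Sum>k\<le>p + q. (real (p + q) - real k) * (nrm (J n k Y))\<^sup>2)"
        using k by (intro member_le_sum[of k _ "\<lambda>k. (real (p + q) - real k) * (nrm (J n k Y))\<^sup>2"]) auto
      also have "\<dots> \<le> C * (eta p n F)\<^sup>2 * (nrm X)\<^sup>2" using 1 2 by simp
      finally have "nrm (J n k Y) \<le> sqrt (C * (eta p n F)\<^sup>2 * (nrm X)\<^sup>2)"
        using real_le_rsqrt by blast
      then show ?thesis by (simp add: real_sqrt_mult Y_def)
    qed
    then show ?thesis using C0 by (intro exI[of _ "sqrt C"]) auto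
  next
    case False
    then have pq: "p \<le> q" by simp
    have q1: "q - 1 < q" using pq p by simp
    from less[OF q1] obtain C where C: "0 \<le> C" "\<And>n F X k. adm p n F \<Longrightarrow> W n (q - 1) X \<Longrightarrow> q - 1 < k + p \<Longrightarrow> k < p + (q - 1) \<Longrightarrow>
      nrm (J n k (F * X)) \<le> C * eta p n F * nrm X" by blast
    define D where "D = 2 * (sqrt (real (p + q) * real q) * C)"
    have "nrm (J n k (F * X)) \<le> D * eta p n F * nrm X"
      if F: "adm p n F" and X: "W n q X" and k: "q < k + p" "k < p + q" for n F X k
    proof -
      obtain l where l: "k = Suc l" using k pq by (cases k) auto
      have PX: "Pd n (p + q) (F * X)" by (rule W_mult_Pd[OF adm_W[OF F] W_Pd[OF X]])
      have PFi: "Pd n (p + (q - 1)) (F * pd i X)" for i by (rule W_mult_Pd[OF adm_W[OF F] W_Pd[OF W_pd[OF X]]])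
      define Y where "Y i = J n l (F * pd i X)" for i
      have YW: "W n l (Y i)" for i unfolding Y_def by (rule W_J[OF PFi])
      have Yb: "nrm (Y i) \<le> C * eta p n F * nrm (pd i X)" for i
        unfolding Y_def by (rule C(2)[OF F W_pd[OF X]]) (use k l pq p in auto)
      \<comment> \<open>The induction hypothesis controls each \<open>F * pd i X\<close>. The
        degree-\<open>k\<close> part of their divergence \<open>S\<close> is
        \<open>(q + k - p) / 2\<close> times that of \<open>F * X\<close>, and this factor is
        positive because \<open>p <= q\<close> and \<open>1 <= k\<close>.\<close>
      define S where "S = (\<Sum>i<n. cr i (F * pd i X))"
      have S1: "2 *\<^sub>R S = (real q - real p) *\<^sub>R (F * X) + Num n (F * X)"
      proof -
        have "S = Num n X * F - Gam n X F"
          unfolding S_def Num_def Gam_def sum_distrib_right sum_subtractf[symmetric]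
          by (intro sum.cong refl) (simp only: mult.commute[of F] cr_mult)
        then have s: "2 *\<^sub>R S = (2 * real q) *\<^sub>R (F * X) - 2 *\<^sub>R Gam n F X"
          unfolding W_Num[OF X] Gam_commute[of n X] by (simp add: scaleR_diff_right mult.commute)
        have c: "2 * real q = (real q - real p) + real (p + q)" by simp
        show ?thesis unfolding s Gam_W[OF adm_W[OF F] X] c scaleR_left_distrib by simp
      qed
      have "J n k S = (\<Sum>i<n. J n k (cr i (F * pd i X)))"
        unfolding S_def by (rule J_sum[of _ n "Suc (p + (q - 1))"]) (use Pd_cr[OF PFi] in auto)
      then have S2: "J n k S = (\<Sum>i<n. cr i (Y i))"
        unfolding l Y_def using J_cr[OF PFi] by simp
      have PS: "Pd n (Suc (p + (q - 1))) S" unfolding S_def by (intro Pd_sum Pd_cr PFi) auto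
      have "2 *\<^sub>R J n k S = (real q - real p) *\<^sub>R J n k (F * X) + real k *\<^sub>R J n k (F * X)"
        unfolding J_scaleR[OF PS, symmetric] S1 J_add[OF Pd_scaleR[OF PX] Pd_Num[OF PX]] J_scaleR[OF PX] J_Num[OF PX] ..
      then have e: "(real q + real k - real p) *\<^sub>R J n k (F * X) = 2 *\<^sub>R (\<Sum>i<n. cr i (Y i))"
        unfolding S2 by (simp add: algebra_simps)
      have "1 * nrm (J n k (F * X)) \<le> (real q + real k - real p) * nrm (J n k (F * X))"
        using k l pq by (intro mult_right_mono) auto
      also have "\<dots> = 2 * nrm (\<Sum>i<n. cr i (Y i))"
        using arg_cong[OF e, of nrm] k l pq by (simp add: nrm_scaleR)
      finally have a: "nrm (J n k (F * X)) \<le> 2 * nrm (\<Sum>i<n. cr i (Y i))" by simp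
      \<comment> \<open>\<open>nrm_sum_cr\<close> turns the sum over coordinates into the energy of
        \<open>X\<close>, which is \<open>q\<close> times its squared norm; hence the bound is free
        of \<open>n\<close>.\<close>
      have "(nrm (\<Sum>i<n. cr i (Y i)))\<^sup>2 \<le> (real l + 1) * (\<Sum>i<n. (nrm (Y i))\<^sup>2)"
        by (rule nrm_sum_cr) (rule W_Pd[OF YW])
      also have "\<dots> \<le> real (p + q) * (\<Sum>i<n. (C * eta p n F * nrm (pd i X))\<^sup>2)"
        using l k Yb by (intro mult_mono sum_mono power_mono) (auto intro: sum_nonneg)
      also have "(\<Sum>i<n. (C * eta p n F * nrm (pd i X))\<^sup>2) = (C * eta p n F)\<^sup>2 * Em (Gam n X X)"
        by (simp add: power_mult_distrib sum_distrib_left nrm_sq Gam_def)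
      also have "Em (Gam n X X) = real q * (nrm X)\<^sup>2"
        unfolding Em_Num[symmetric] W_Num[OF X] by (simp add: nrm_sq)
      finally have "nrm (\<Sum>i<n. cr i (Y i)) \<le> sqrt (real (p + q) * ((C * eta p n F)\<^sup>2 * (real q * (nrm X)\<^sup>2)))"
        using real_le_rsqrt by blast
      also have "real (p + q) * ((C * eta p n F)\<^sup>2 * (real q * (nrm X)\<^sup>2)) = (real (p + q) * real q) * (C * eta p n F * nrm X)\<^sup>2"
        by (simp add: power_mult_distrib)
      also have "sqrt \<dots> = sqrt (real (p + q) * real q) * (C * eta p n F * nrm X)"
        unfolding real_sqrt_mult[of _ "(C * eta p n F * nrm X)\<^sup>2"] using C(1) by simp
      finally show ?thesis using a by (simp add: D_def)
    qed
    then show ?thesis using C(1) by (intro exI[of _ D]) (auto simp: D_def)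
  qed
qed

text \<open>The operator A: the part of multiplication by \<open>F\<close> that lowers the degree by
  exactly \<open>p\<close>. Restricting the index set to nonzero components makes the sum finite for
  every polynomial with a chaos decomposition, without a degree argument.\<close>

definition lowA :: "nat \<Rightarrow> nat \<Rightarrow> pf \<Rightarrow> pf \<Rightarrow> pf" where
  "lowA p n F X = (\<Sum>k | J n k X \<noteq> 0 \<and> p \<le> k. J n (k - p) (F * J n k X))"

definition resR :: "nat \<Rightarrow> nat \<Rightarrow> pf \<Rightarrow> pf \<Rightarrow> pf" where
  "resR p n F X = Gam n F X - real p *\<^sub>R lowA p n F X"

definition comAD :: "nat \<Rightarrow> nat \<Rightarrow> pf \<Rightarrow> pf \<Rightarrow> pf" where
  "comAD p n F X = lowA p n F (Gam n F X) - Gam n F (lowA p n F X)"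

lemma lowA_eq: assumes "Pd n d X" shows "lowA p n F X = (\<Sum>k=p..d. J n (k - p) (F * J n k X))"
  unfolding lowA_def
  by (rule sum.mono_neutral_left) (use J_zero[OF assms] in \<open>auto simp: not_less[symmetric]\<close>)

lemma Pd_F_J: assumes "W n p F" "Pd n d X" shows "Pd n (p + k) (F * J n k X)"
  by (rule W_mult_Pd[OF assms(1) W_Pd[OF W_J[OF assms(2)]]])

lemma Pd_lowA: assumes "W n p F" "Pd n d X" shows "Pd n (d - p) (lowA p n F X)"
  unfolding lowA_eq[OF assms(2)]
  by (intro Pd_sum) (use Pd_mono[OF W_Pd[OF W_J[OF Pd_F_J[OF assms]]]] in auto)

lemma lowA_small: "Pd n d X \<Longrightarrow> d < p \<Longrightarrow> lowA p n F X = 0"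
  by (simp add: lowA_eq)

lemma lowA_add: assumes F: "W n p F" and X: "Pd n d X" and Y: "Pd n d Y"
  shows "lowA p n F (X + Y) = lowA p n F X + lowA p n F Y"
  unfolding lowA_eq[OF X] lowA_eq[OF Y] lowA_eq[OF Pd_add[OF X Y]] sum.distrib[symmetric]
  by (intro sum.cong refl) (simp add: J_add[OF X Y] distrib_left J_add[OF Pd_F_J[OF F X] Pd_F_J[OF F Y]])

lemma lowA_scaleR: assumes F: "W n p F" and X: "Pd n d X"
  shows "lowA p n F (c *\<^sub>R X) = c *\<^sub>R lowA p n F X"
  unfolding lowA_eq[OF X] lowA_eq[OF Pd_scaleR[OF X]] scaleR_sum_right
  by (intro sum.cong refl) (simp add: J_scaleR[OF X] J_scaleR[OF Pd_F_J[OF F X]])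

lemma lowA_W: assumes "W n q X" shows "lowA p n F X = (if p \<le> q then J n (q - p) (F * X) else 0)"
  unfolding lowA_eq[OF W_Pd[OF assms]] using J_W[OF assms]
  by (auto simp: if_distrib[of "\<lambda>Z. F * Z"] if_distrib[of "\<lambda>Z. J n _ Z"] cong: if_cong)

lemma lowA_0 [simp]: "lowA p n F 0 = 0" using lowA_W[OF W_0[of n 0]] by simp

lemma resR_add: assumes F: "W n p F" and X: "Pd n d X" and Y: "Pd n d Y"
  shows "resR p n F (X + Y) = resR p n F X + resR p n F Y"
  unfolding resR_def lowA_add[OF assms] Gam_add_right by (simp add: algebra_simps)

lemma resR_0 [simp]: "resR p n F 0 = 0" by (simp add: resR_def)

lemma comAD_add: assumes F: "W n p F" and X: "Pd n d X" and Y: "Pd n d Y"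
  shows "comAD p n F (X + Y) = comAD p n F X + comAD p n F Y"
  unfolding comAD_def lowA_add[OF assms] Gam_add_right
    lowA_add[OF F Pd_Gam[OF W_Pd[OF F] X] Pd_Gam[OF W_Pd[OF F] Y]] by (simp add: algebra_simps)

lemma comAD_0 [simp]: "comAD p n F 0 = 0" by (simp add: comAD_def)

lemma Pd_resR: assumes p: "1 \<le> p" and F: "W n p F" and X: "Pd n d X" shows "Pd n (d + p - 1) (resR p n F X)"
  unfolding resR_def
  by (intro Pd_diff Pd_scaleR Pd_mono[OF Pd_Gam[OF W_Pd[OF F] X]] Pd_mono[OF Pd_lowA[OF F X]]) (use p in auto)

lemma Pd_comAD: assumes p: "1 \<le> p" and F: "W n p F" and X: "Pd n d X" shows "Pd n d (comAD p n F X)"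
proof -
  have "Pd n d (lowA p n F (Gam n F X))"
    by (rule Pd_mono[OF Pd_lowA[OF F Pd_Gam[OF W_Pd[OF F] X]]]) auto
  moreover have "Pd n d (Gam n F (lowA p n F X))"
  \<comment> \<open>For \<open>d < p\<close> truncated subtraction would only give the degree bound
    \<open>p - 1\<close>, which may exceed \<open>d\<close>; in that case \<open>lowA\<close>
    returns zero.\<close>
  proof (cases "d < p")
    case True
    then show ?thesis using lowA_small[OF X] by simp
  next
    case False
    then show ?thesis
      by (intro Pd_mono[OF Pd_Gam[OF W_Pd[OF F] Pd_lowA[OF F X]]]) auto
  qed
  ultimately show ?thesis unfolding comAD_def by (rule Pd_diff)
qed

text \<open>Projections do not increase the norm, so the constants of the finitely many homogeneous
  degrees add up. Additivity is asked for on bounded degrees, where it is available for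
  \<open>lowA\<close>.\<close>

lemma bound_from_W:
  assumes W: "\<And>q. \<exists>C\<ge>0. \<forall>n F X. adm p n F \<longrightarrow> W n q X \<longrightarrow> nrm (T n F X) \<le> C * (e n F :: real) * nrm X"
    and add: "\<And>n F d X Y. adm p n F \<Longrightarrow> Pd n d X \<Longrightarrow> Pd n d Y \<Longrightarrow> T n F (X + Y) = T n F X + T n F Y"
    and T0: "\<And>n F. T n F 0 = 0" and e: "\<And>n F. 0 \<le> e n F"
  shows "\<exists>C\<ge>0. \<forall>n F X. adm p n F \<longrightarrow> Pd n d X \<longrightarrow> nrm (T n F X) \<le> C * e n F * nrm X"
proof -
  obtain C where C: "\<And>q. 0 \<le> C q" "\<And>q n F X. adm p n F \<Longrightarrow> W n q X \<Longrightarrow> nrm (T n F X) \<le> C q * e n F * nrm X"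
    using W by metis
  have "nrm (T n F X) \<le> (\<Sum>k\<le>d. C k) * e n F * nrm X" if F: "adm p n F" and X: "Pd n d X" for n F X
  proof -
    have WJ: "Pd n d (J n k X)" if "k \<le> d" for k using Pd_mono[OF W_Pd[OF W_J[OF X]] that] .
    have "T n F (\<Sum>k\<in>A. J n k X) = (\<Sum>k\<in>A. T n F (J n k X))" if "A \<subseteq> {..d}" "finite A" for A
      using that(2,1)
    proof induction
      case empty
      then show ?case by (simp add: T0)
    next
      case (insert a A)
      have "Pd n d (\<Sum>k\<in>A. J n k X)" by (intro Pd_sum WJ) (use insert in auto)
      then show ?case using insert add[OF F WJ, of a] by auto
    qed
    from this[of "{..d}"] have "T n F X = (\<Sum>k\<le>d. T n F (J n k X))" using J_expand[OF X] by simp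
    then have "nrm (T n F X) \<le> (\<Sum>k\<le>d. nrm (T n F (J n k X)))" using nrm_sum by simp
    also have "\<dots> \<le> (\<Sum>k\<le>d. C k * e n F * nrm X)"
      by (intro sum_mono order_trans[OF C(2)[OF F W_J[OF X]]] mult_left_mono nrm_J_le[OF X] mult_nonneg_nonneg C(1) e)
    finally show ?thesis by (simp add: sum_distrib_right)
  qed
  then show ?thesis using C(1) by (intro exI[of _ "\<Sum>k\<le>d. C k"]) (auto intro: sum_nonneg)
qed

lemma Gam_expand:
  assumes F: "W n p F" and X: "W n q X"
  shows "Gam n F X = (\<Sum>k\<le>p + q. ((real (p + q) - real k) / 2) *\<^sub>R J n k (F * X))"
proof -
  have "Gam n F X = (\<Sum>k\<le>p + q. J n k (Gam n F X))"
    by (rule J_expand[OF Pd_mono[OF Pd_Gam[OF W_Pd[OF F] W_Pd[OF X]]]]) auto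
  then show ?thesis unfolding J_Gam[OF assms] .
qed

text \<open>By the weights in \<open>J_Gam\<close> the top degree contributes nothing, degrees below
  \<open>q - p\<close> vanish, and degree \<open>q - p\<close> is exactly \<open>p\<close> times
  \<open>lowA\<close>. Only middle degrees survive the subtraction.\<close>

lemma resR_W:
  assumes p: "1 \<le> p" and F: "W n p F" and X: "W n q X"
  shows "resR p n F X = (\<Sum>k | k < p + q \<and> q < k + p. ((real (p + q) - real k) / 2) *\<^sub>R J n k (F * X))"
proof -
  let ?f = "\<lambda>k. ((real (p + q) - real k) / 2) *\<^sub>R J n k (F * X)"
  let ?M = "{k. k < p + q \<and> q < k + p}"
  have "Gam n F X = sum ?f {..p + q}" by (rule Gam_expand[OF F X])
  also have "{..p + q} = ?M \<union> {k. k \<le> p + q \<and> (k = p + q \<or> k + p \<le> q)}" by auto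
  also have "sum ?f \<dots> = sum ?f ?M + sum ?f {k. k \<le> p + q \<and> (k = p + q \<or> k + p \<le> q)}"
    by (rule sum.union_disjoint) (use p in auto)
  also have "sum ?f {k. k \<le> p + q \<and> (k = p + q \<or> k + p \<le> q)} = sum ?f (if p \<le> q then {q - p} else {})"
  proof (rule sum.mono_neutral_right)
    show "\<forall>k\<in>{k. k \<le> p + q \<and> (k = p + q \<or> k + p \<le> q)} - (if p \<le> q then {q - p} else {}). ?f k = 0"
    proof
      fix k assume k: "k \<in> {k. k \<le> p + q \<and> (k = p + q \<or> k + p \<le> q)} - (if p \<le> q then {q - p} else {})"
      then have "k = p + q \<or> k + p < q" by (auto split: if_splits)
      then show "?f k = 0" using J_mult_vanish[OF F X, of k] by auto
    qed
  qed auto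
  also have "\<dots> = real p *\<^sub>R lowA p n F X"
    unfolding lowA_W[OF X] by auto
  finally show ?thesis unfolding resR_def by simp
qed

lemma resR_bound:
  assumes p: "1 \<le> p"
  shows "\<exists>C\<ge>0. \<forall>n F X. adm p n F \<longrightarrow> Pd n d X \<longrightarrow> nrm (resR p n F X) \<le> C * eta p n F * nrm X"
proof (rule bound_from_W)
  fix q
  obtain C where C: "0 \<le> C" "\<And>n F X k. adm p n F \<Longrightarrow> W n q X \<Longrightarrow> q < k + p \<Longrightarrow> k < p + q \<Longrightarrow>
    nrm (J n k (F * X)) \<le> C * eta p n F * nrm X" using mid_bound[OF p] by metis
  define D where "D = real (card {k. k < p + q \<and> q < k + p}) * (real (p + q) * C)"
  have "nrm (resR p n F X) \<le> D * eta p n F * nrm X" if F: "adm p n F" and X: "W n q X" for n F X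
  proof -
    have "nrm (resR p n F X) \<le> real (card {k. k < p + q \<and> q < k + p}) * (real (p + q) * (C * eta p n F * nrm X))"
      unfolding resR_W[OF p adm_W[OF F] X]
    proof (rule nrm_sum_bound)
      fix k assume k: "k \<in> {k. k < p + q \<and> q < k + p}"
      have "\<bar>(real (p + q) - real k) / 2\<bar> \<le> real (p + q)" using k by auto
      then show "nrm (((real (p + q) - real k) / 2) *\<^sub>R J n k (F * X)) \<le> real (p + q) * (C * eta p n F * nrm X)"
        unfolding nrm_scaleR using C(2)[OF F X] k by (intro mult_mono) auto
    qed
    then show ?thesis by (simp add: D_def mult_ac)
  qed
  then show "\<exists>C\<ge>0. \<forall>n F X. adm p n F \<longrightarrow> W n q X \<longrightarrow> nrm (resR p n F X) \<le> C * eta p n F * nrm X"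
    using C(1) by (intro exI[of _ D]) (auto simp: D_def)
qed (use resR_add adm_W in auto)

text \<open>The commutator bound is the part of degree \<open>t < q\<close> of
  \<open>\<Gamma>(F, F X) - F \<Gamma>(F, X) = \<Gamma>(F, F) X\<close>: apart from the two extreme terms, whose difference is the
  commutator, the left-hand side consists of products of two middle terms.\<close>

lemma comAD_J:
  assumes p: "1 \<le> p" and F: "W n p F" and X: "W n q X"
  shows "J n t (comAD p n F X) = ((real q - real t) / 2) *\<^sub>R
     (J n t (F * J n (t + p) (F * X)) - (if p \<le> q then J n t (F * J n (q - p) (F * X)) else 0))"
proof -
  have PX: "Pd n (p + q) (F * X)" by (rule W_mult_Pd[OF F W_Pd[OF X]])
  have PG: "Pd n (p + q) (Gam n F X)" by (rule Pd_mono[OF Pd_Gam[OF W_Pd[OF F] W_Pd[OF X]]]) auto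
  have PL: "Pd n q (lowA p n F (Gam n F X))" using Pd_lowA[OF F PG] by simp
  have PL2: "Pd n (q - p) (lowA p n F X)" using Pd_lowA[OF F W_Pd[OF X]] .
  have "lowA p n F (Gam n F X) = (\<Sum>k=p..p + q. J n (k - p) (F * J n k (Gam n F X)))"
    by (rule lowA_eq[OF PG])
  then have "J n t (lowA p n F (Gam n F X)) = J n t (\<Sum>k=p..p + q. J n (k - p) (F * J n k (Gam n F X)))" by simp
  also have "\<dots> = (\<Sum>k=p..p + q. J n t (J n (k - p) (F * J n k (Gam n F X))))"
    by (rule J_sum[of _ n q]) (use Pd_mono[OF W_Pd[OF W_J[OF Pd_F_J[OF F PG]]]] in auto)
  also have "\<dots> = (\<Sum>k=p..p + q. if k = t + p then J n t (F * J n (t + p) (Gam n F X)) else 0)"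
    by (intro sum.cong refl) (auto simp: J_W[OF W_J[OF Pd_F_J[OF F PG]]])
  also have "\<dots> = J n t (F * J n (t + p) (Gam n F X))"
    using J_zero[OF PG, of "t + p"] by auto
  also have "\<dots> = ((real q - real t) / 2) *\<^sub>R J n t (F * J n (t + p) (F * X))"
    using J_scaleR[OF Pd_F_J[OF F PX, of "t + p"], of t] by (simp add: J_Gam[OF F X])
  finally have 1: "J n t (lowA p n F (Gam n F X)) = \<dots>" .
  have 2: "J n t (Gam n F (lowA p n F X)) = ((real q - real t) / 2) *\<^sub>R (if p \<le> q then J n t (F * J n (q - p) (F * X)) else 0)"
    unfolding lowA_W[OF X] using J_Gam[OF F W_J[OF PX, of "q - p"], of t] by simp
  show ?thesis
    unfolding comAD_def J_diff[OF PL Pd_Gam[OF W_Pd[OF F] PL2]] 1 2 by (simp add: scaleR_diff_right)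
qed

text \<open>Expanding both products over the components of \<open>F * X\<close> gives the weights
  \<open>(p + k - t) / 2\<close> and \<open>(p + q - k) / 2\<close>, whose difference is the
  coefficient shown. The summand 1 in Gamma(F, F) = p (1 + g) contributes \<open>p X\<close>, which
  has no part of degree \<open>t < q\<close>.\<close>

lemma comAD_identity:
  assumes p: "1 \<le> p" and F: "W n p F" and X: "W n q X" and t: "t < q"
  shows "(\<Sum>k\<le>p + q. ((2 * real k - real q - real t) / 2) *\<^sub>R J n t (F * J n k (F * X))) = real p *\<^sub>R J n t (gg p n F * X)"
proof -
  have PX: "Pd n (p + q) (F * X)" by (rule W_mult_Pd[OF F W_Pd[OF X]])
  have PG: "Pd n (p + q) (Gam n F X)" by (rule Pd_mono[OF Pd_Gam[OF W_Pd[OF F] W_Pd[OF X]]]) auto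
  have Pgg: "Pd n (2 * p) (gg p n F)" unfolding gg_def
    by (intro Pd_diff Pd_scaleR Pd_mono[OF Pd_Gam[OF W_Pd[OF F] W_Pd[OF F]]]) auto
  have PgX: "Pd n (2 * p + q) (gg p n F * X)" by (rule Pd_mult[OF Pgg W_Pd[OF X]])
  have id: "Gam n F (F * X) - F * Gam n F X = real p *\<^sub>R X + real p *\<^sub>R (gg p n F * X)"
    unfolding Gam_mult_right Gam_FF[OF p] by (simp add: algebra_simps)
  have "J n t (Gam n F (F * X)) = J n t (\<Sum>k\<le>p + q. Gam n F (J n k (F * X)))"
    using arg_cong[OF J_expand[OF PX], of "Gam n F"] by (simp only: Gam_sum_right)
  also have "\<dots> = (\<Sum>k\<le>p + q. J n t (Gam n F (J n k (F * X))))"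
    by (rule J_sum[of _ n "p - 1 + (p + q - 1)"])
       (use Pd_mono[OF Pd_Gam[OF W_Pd[OF F] W_Pd[OF W_J[OF PX]]]] in auto)
  finally have a: "J n t (Gam n F (F * X)) = (\<Sum>k\<le>p + q. ((real (p + k) - real t) / 2) *\<^sub>R J n t (F * J n k (F * X)))"
    unfolding J_Gam[OF F W_J[OF PX]] .
  have "F * Gam n F X = (\<Sum>k\<le>p + q. ((real (p + q) - real k) / 2) *\<^sub>R (F * J n k (F * X)))"
    unfolding Gam_expand[OF F X] sum_distrib_left by simp
  then have "J n t (F * Gam n F X) = J n t (\<Sum>k\<le>p + q. ((real (p + q) - real k) / 2) *\<^sub>R (F * J n k (F * X)))"
    by simp
  also have "\<dots> = (\<Sum>k\<le>p + q. J n t (((real (p + q) - real k) / 2) *\<^sub>R (F * J n k (F * X))))"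
    by (rule J_sum[of _ n "p + (p + q)"]) (use Pd_mono[OF Pd_scaleR[OF Pd_F_J[OF F PX]]] in auto)
  finally have b: "J n t (F * Gam n F X) = (\<Sum>k\<le>p + q. ((real (p + q) - real k) / 2) *\<^sub>R J n t (F * J n k (F * X)))"
    unfolding J_scaleR[OF Pd_F_J[OF F PX]] .
  have "J n t (Gam n F (F * X)) - J n t (F * Gam n F X) = J n t (real p *\<^sub>R X + real p *\<^sub>R (gg p n F * X))"
    unfolding id[symmetric] by (rule J_diff[symmetric, OF Pd_Gam[OF W_Pd[OF F] PX] W_mult_Pd[OF F PG]])
  also have "\<dots> = real p *\<^sub>R J n t X + real p *\<^sub>R J n t (gg p n F * X)"
    unfolding J_add[OF Pd_scaleR[OF W_Pd[OF X]] Pd_scaleR[OF PgX]] J_scaleR[OF W_Pd[OF X]] J_scaleR[OF PgX] ..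
  also have "J n t X = 0" using J_W[OF X, of t] t by simp
  finally have "(\<Sum>k\<le>p + q. ((real (p + k) - real t) / 2) *\<^sub>R J n t (F * J n k (F * X)) - ((real (p + q) - real k) / 2) *\<^sub>R J n t (F * J n k (F * X)))
     = real p *\<^sub>R J n t (gg p n F * X)" unfolding a b by (simp add: sum_subtractf)
  moreover have "((real (p + k) - real t) / 2) *\<^sub>R Z - ((real (p + q) - real k) / 2) *\<^sub>R Z = ((2 * real k - real q - real t) / 2) *\<^sub>R Z" for k and Z :: pf
    unfolding scaleR_diff_left[symmetric] by (simp add: field_simps)
  ultimately show ?thesis by simp
qed

lemma comAD_bound:
  assumes p: "1 \<le> p"
  shows "\<exists>C\<ge>0. \<forall>n F X. adm p n F \<longrightarrow> Pd n d X \<longrightarrow> nrm (comAD p n F X) \<le> C * (eta p n F)\<^sup>2 * nrm X"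
proof (rule bound_from_W)
  fix q
  obtain C where C: "\<And>q. 0 \<le> C q" "\<And>q n F X k. adm p n F \<Longrightarrow> W n q X \<Longrightarrow> q < k + p \<Longrightarrow> k < p + q \<Longrightarrow>
    nrm (J n k (F * X)) \<le> C q * eta p n F * nrm X" using mid_bound[OF p] by metis
  obtain K where K: "0 \<le> K" "\<And>n X Y. Pd n (2 * p) X \<Longrightarrow> Pd n q Y \<Longrightarrow> nrm (X * Y) \<le> K * nrm X * nrm Y"
    using nrm_mult_le by metis
  define M where "M = (\<Sum>k\<le>p + q. C k)"
  have M: "C k \<le> M" if "k \<le> p + q" for k
    unfolding M_def using that C(1) by (intro member_le_sum) auto
  have M0: "0 \<le> M" unfolding M_def by (intro sum_nonneg C(1))
  define D where "D = real (p + q + 1) * (2 * real (p + q)) * (M * C q) + real p * K"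
  have D0: "0 \<le> D" using C(1) K(1) M0 by (simp add: D_def)
  have "nrm (comAD p n F X) \<le> (real (card {..q}) * (real q * (2 * D))) * (eta p n F)\<^sup>2 * nrm X" if F: "adm p n F" and X: "W n q X" for n F X
  proof -
    note FW = adm_W[OF F]
    have PX: "Pd n (p + q) (F * X)" by (rule W_mult_Pd[OF FW W_Pd[OF X]])
    let ?Y = "\<lambda>k. J n k (F * X)"
    let ?Z = "\<lambda>t k. J n t (F * ?Y k)"
    \<comment> \<open>The difference of the two extreme terms, which is the degree-\<open>t\<close>
      part of the commutator without its factor \<open>(q - t) / 2\<close>.\<close>
    define Kt where "Kt t = ?Z t (t + p) - (if p \<le> q then ?Z t (q - p) else 0)" for t
    have WY: "W n k (?Y k)" for k by (rule W_J[OF PX])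
    have Kb: "nrm (Kt t) \<le> 2 * D * (eta p n F)\<^sup>2 * nrm X" if t: "t < q" for t
    proof -
      have R0: "0 \<le> 2 * D * (eta p n F)\<^sup>2 * nrm X" using D0 by simp
      \<comment> \<open>The extreme terms sit at the indices \<open>t + p\<close> and
        \<open>q - p\<close>. In the first case both vanish, in the second they coincide and cancel,
        and only the third requires the identity.\<close>
      consider "t + 2 * p < q" | "t + 2 * p = q" | "q < t + 2 * p" by linarith
      then show ?thesis
      proof cases
        case 1
        have "?Y (t + p) = 0" by (rule J_mult_vanish[OF FW X]) (use 1 in simp)
        moreover have "?Z t (q - p) = 0" by (rule J_mult_vanish[OF FW WY]) (use 1 in simp)
        ultimately show ?thesis using R0 by (simp add: Kt_def)
      next
        case 2
        then have "q - p = t + p" "p \<le> q" by auto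
        then show ?thesis using R0 by (simp add: Kt_def)
      next
        case 3
        let ?c = "\<lambda>k. (2 * real k - real q - real t) / 2"
        let ?M = "{k. q < k + p \<and> k < t + p}"
        let ?E = "insert (t + p) (if p \<le> q then {q - p} else {})"
        have ne: "t + p \<noteq> q - p" if "p \<le> q" using 3 that by auto
        have "(\<Sum>k\<le>p + q. ?c k *\<^sub>R ?Z t k) = (\<Sum>k\<in>?M \<union> ?E. ?c k *\<^sub>R ?Z t k)"
        proof (rule sum.mono_neutral_right)
          show "?M \<union> ?E \<subseteq> {..p + q}" using t by auto
          show "\<forall>k\<in>{..p + q} - (?M \<union> ?E). ?c k *\<^sub>R ?Z t k = 0"
          proof
            fix k assume "k \<in> {..p + q} - (?M \<union> ?E)"
            then have "k + p < q \<or> t + p < k" by (auto split: if_splits)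
            then show "?c k *\<^sub>R ?Z t k = 0"
              using J_mult_vanish[OF FW X, of k] J_mult_vanish[OF FW WY, of t k] by auto
          qed
        qed simp
        also have "\<dots> = (\<Sum>k\<in>?M. ?c k *\<^sub>R ?Z t k) + (\<Sum>k\<in>?E. ?c k *\<^sub>R ?Z t k)"
        proof (rule sum.union_disjoint)
          have "?M \<subseteq> {..p + q}" using t by auto
          then show "finite ?M" using finite_subset by blast
          show "?M \<inter> ?E = {}" by auto
        qed simp
        \<comment> \<open>The two extreme coefficients are opposite, so the extreme terms combine
          into a multiple of \<open>Kt t\<close>. Its factor is at least 1/2 here and can be divided
          out.\<close>
        also have "(\<Sum>k\<in>?E. ?c k *\<^sub>R ?Z t k) = ((real t + 2 * real p - real q) / 2) *\<^sub>R Kt t"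
        proof (cases "p \<le> q")
          case True
          have "?c (q - p) = - ((real t + 2 * real p - real q) / 2)" "?c (t + p) = (real t + 2 * real p - real q) / 2"
            using True by (auto simp: of_nat_diff field_simps)
          note c = this
          have "(\<Sum>k\<in>?E. ?c k *\<^sub>R ?Z t k) = ?c (t + p) *\<^sub>R ?Z t (t + p) + ?c (q - p) *\<^sub>R ?Z t (q - p)"
            using True ne by simp
          then show ?thesis unfolding c using True by (simp only: Kt_def scaleR_diff_right scaleR_minus_left if_True) simp
        next
          case False
          have "?c (t + p) = (real t + 2 * real p - real q) / 2" by (auto simp: field_simps)
          then show ?thesis using False by (simp add: Kt_def)
        qed
        finally have e: "((real t + 2 * real p - real q) / 2) *\<^sub>R Kt t = real p *\<^sub>R J n t (gg p n F * X) - (\<Sum>k\<in>?M. ?c k *\<^sub>R ?Z t k)"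
          unfolding comAD_identity[OF p FW X t] by (simp add: algebra_simps)
        have Pgg: "Pd n (2 * p) (gg p n F)" by (rule Pd_mono[OF Pd_gg[OF F]]) auto
        have g: "nrm (real p *\<^sub>R J n t (gg p n F * X)) \<le> real p * (K * (eta p n F)\<^sup>2 * nrm X)"
        proof -
          have "nrm (J n t (gg p n F * X)) \<le> nrm (gg p n F * X)" by (rule nrm_J_le[OF Pd_mult[OF Pgg W_Pd[OF X]]])
          also have "\<dots> \<le> K * (eta p n F)\<^sup>2 * nrm X" using K(2)[OF Pgg W_Pd[OF X]] by (simp add: eta_sq)
          finally show ?thesis by (simp add: nrm_scaleR mult_left_mono)
        qed
        \<comment> \<open>Both the passage from degree \<open>q\<close> to \<open>k\<close> and that
          from \<open>k\<close> to \<open>t\<close> lie in the range of \<open>mid_bound\<close>,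
          because \<open>t < q < k + p\<close> and \<open>k < t + p\<close>.\<close>
        have "nrm (\<Sum>k\<in>?M. ?c k *\<^sub>R ?Z t k) \<le> real (card ?M) * (2 * real (p + q) * ((M * eta p n F) * (C q * eta p n F * nrm X)))"
        proof (rule nrm_sum_bound)
          fix k assume k: "k \<in> ?M"
          have c: "\<bar>?c k\<bar> \<le> 2 * real (p + q)" using k t by auto
          have "nrm (?Z t k) \<le> C k * eta p n F * nrm (?Y k)"
            by (rule C(2)[OF F WY]) (use k t in auto)
          also have "\<dots> \<le> (M * eta p n F) * (C q * eta p n F * nrm X)"
            by (intro mult_mono M C(2)[OF F X]) (use k t M0 in auto)
          finally show "nrm (?c k *\<^sub>R ?Z t k) \<le> 2 * real (p + q) * ((M * eta p n F) * (C q * eta p n F * nrm X))"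
            unfolding nrm_scaleR using c by (intro mult_mono) auto
        qed
        also have "\<dots> \<le> real (p + q + 1) * (2 * real (p + q) * ((M * eta p n F) * (C q * eta p n F * nrm X)))"
        proof (rule mult_right_mono)
          have "?M \<subseteq> {..p + q}" using t by auto
          then have "card ?M \<le> card {..p + q}" by (intro card_mono) auto
          then show "real (card ?M) \<le> real (p + q + 1)" by simp
        qed (use M0 C(1) in simp)
        finally have s: "nrm (\<Sum>k\<in>?M. ?c k *\<^sub>R ?Z t k) \<le> \<dots>" .
        have "(1/2) * nrm (Kt t) \<le> ((real t + 2 * real p - real q) / 2) * nrm (Kt t)"
          using 3 by (intro mult_right_mono) auto
        also have "\<dots> = nrm (((real t + 2 * real p - real q) / 2) *\<^sub>R Kt t)"
          using 3 by (simp add: nrm_scaleR)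
        also have "\<dots> \<le> real p * (K * (eta p n F)\<^sup>2 * nrm X) + real (p + q + 1) * (2 * real (p + q) * ((M * eta p n F) * (C q * eta p n F * nrm X)))"
          unfolding e by (rule order_trans[OF nrm_diff add_mono[OF g s]])
        also have "\<dots> = D * (eta p n F)\<^sup>2 * nrm X"
          by (simp add: D_def power2_eq_square algebra_simps)
        finally show ?thesis by simp
      qed
    qed
    have Pc: "Pd n q (comAD p n F X)" by (rule Pd_comAD[OF p FW W_Pd[OF X]])
    have "nrm (comAD p n F X) = nrm (\<Sum>t\<le>q. J n t (comAD p n F X))" using J_expand[OF Pc] by simp
    also have "\<dots> \<le> real (card {..q}) * (real q * (2 * D * (eta p n F)\<^sup>2 * nrm X))"
    proof (rule nrm_sum_bound)
      fix t assume "t \<in> {..q}"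
      \<comment> \<open>The identity does not reach degree \<open>q\<close>, but there the factor
        \<open>(q - t) / 2\<close> is zero.\<close>
      then consider "t = q" | "t < q" by fastforce
      then show "nrm (J n t (comAD p n F X)) \<le> real q * (2 * D * (eta p n F)\<^sup>2 * nrm X)"
      proof cases
        case 1
        then show ?thesis unfolding comAD_J[OF p FW X] using D0 by simp
      next
        case 2
        have "\<bar>(real q - real t) / 2\<bar> \<le> real q" using 2 by auto
        then show ?thesis
          unfolding comAD_J[OF p FW X] nrm_scaleR Kt_def[symmetric] using Kb[OF 2] by (intro mult_mono) auto
      qed
    qed
    finally show ?thesis by (simp only: mult_ac)
  qed
  then show "\<exists>C\<ge>0. \<forall>n F X. adm p n F \<longrightarrow> W n q X \<longrightarrow> nrm (comAD p n F X) \<le> C * (eta p n F)\<^sup>2 * nrm X"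
    using D0 by (intro exI[of _ "real (card {..q}) * (real q * (2 * D))"]) auto
qed (use comAD_add adm_W in auto)

section \<open>Iterated derivatives in the direction of \<open>F\<close>\<close>

lemma eta_power_le:
  assumes "1 \<le> p" "b \<le> a"
  shows "\<exists>C\<ge>0. \<forall>n F. adm p n F \<longrightarrow> eta p n F ^ a \<le> C * eta p n F ^ b"
proof -
  obtain B where B: "1 \<le> B" "\<And>n F. adm p n F \<Longrightarrow> eta p n F \<le> B" using eta_bounded[OF assms(1)] by blast
  have "eta p n F ^ a \<le> B ^ (a - b) * eta p n F ^ b" if "adm p n F" for n F
  proof -
    have "eta p n F ^ a = eta p n F ^ (a - b) * eta p n F ^ b"
      using assms(2) by (simp flip: power_add)
    also have "\<dots> \<le> B ^ (a - b) * eta p n F ^ b"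
      using B(2)[OF that] by (intro mult_right_mono power_mono) auto
    finally show ?thesis .
  qed
  then show ?thesis using B(1) by (intro exI[of _ "B ^ (a - b)"]) auto
qed

text \<open>Operators take \<open>n\<close> and \<open>F\<close> as arguments so that a single
  constant serves all dimensions and all admissible \<open>F\<close>.\<close>

definition obound :: "nat \<Rightarrow> (nat \<Rightarrow> pf \<Rightarrow> pf \<Rightarrow> pf) \<Rightarrow> nat \<Rightarrow> nat \<Rightarrow> bool" where
  "obound p T d e \<longleftrightarrow> (\<exists>C\<ge>0. \<forall>n F X. adm p n F \<longrightarrow> Pd n d X \<longrightarrow> nrm (T n F X) \<le> C * eta p n F ^ e * nrm X)"

lemma oboundD:
  assumes "obound p T d e"
  obtains C where "0 \<le> C" "\<And>n F X. adm p n F \<Longrightarrow> Pd n d X \<Longrightarrow> nrm (T n F X) \<le> C * eta p n F ^ e * nrm X"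
  using assms unfolding obound_def by blast

lemma obound_weaken:
  assumes p: "1 \<le> p" and T: "obound p T d e" and e: "e' \<le> e"
  shows "obound p T d e'"
proof -
  obtain C where C: "0 \<le> C" "\<And>n F X. adm p n F \<Longrightarrow> Pd n d X \<Longrightarrow> nrm (T n F X) \<le> C * eta p n F ^ e * nrm X"
    using oboundD[OF T] by metis
  obtain D where D: "0 \<le> D" "\<And>n F. adm p n F \<Longrightarrow> eta p n F ^ e \<le> D * eta p n F ^ e'"
    using eta_power_le[OF p e] by blast
  have "nrm (T n F X) \<le> (C * D) * eta p n F ^ e' * nrm X" if F: "adm p n F" and X: "Pd n d X" for n F X
  proof -
    have "C * eta p n F ^ e * nrm X \<le> C * (D * eta p n F ^ e') * nrm X"
      using D(2)[OF F] C(1) by (intro mult_right_mono mult_left_mono) auto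
    then show ?thesis using C(2)[OF F X] by (simp add: mult_ac)
  qed
  then show ?thesis unfolding obound_def using C(1) D(1) by (intro exI[of _ "C * D"]) auto
qed

lemma obound_add:
  assumes "obound p S d e" "obound p T d e"
  shows "obound p (\<lambda>n F X. S n F X + T n F X) d e"
proof -
  obtain C where C: "0 \<le> C" "\<And>n F X. adm p n F \<Longrightarrow> Pd n d X \<Longrightarrow> nrm (S n F X) \<le> C * eta p n F ^ e * nrm X"
    using oboundD[OF assms(1)] by metis
  obtain D where D: "0 \<le> D" "\<And>n F X. adm p n F \<Longrightarrow> Pd n d X \<Longrightarrow> nrm (T n F X) \<le> D * eta p n F ^ e * nrm X"
    using oboundD[OF assms(2)] by metis
  have "nrm (S n F X + T n F X) \<le> (C + D) * eta p n F ^ e * nrm X" if F: "adm p n F" and X: "Pd n d X" for n F X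
    using nrm_triangle[of "S n F X" "T n F X"] C(2)[OF that] D(2)[OF that] by (simp add: algebra_simps)
  then show ?thesis unfolding obound_def using C(1) D(1) by (intro exI[of _ "C + D"]) auto
qed

lemma obound_scaleR:
  assumes "obound p T d e" shows "obound p (\<lambda>n F X. c *\<^sub>R T n F X) d e"
proof -
  obtain C where C: "0 \<le> C" "\<And>n F X. adm p n F \<Longrightarrow> Pd n d X \<Longrightarrow> nrm (T n F X) \<le> C * eta p n F ^ e * nrm X"
    using oboundD[OF assms] by metis
  have "nrm (c *\<^sub>R T n F X) \<le> (\<bar>c\<bar> * C) * eta p n F ^ e * nrm X" if F: "adm p n F" and X: "Pd n d X" for n F X
    using mult_left_mono[OF C(2)[OF that], of "\<bar>c\<bar>"] by (simp add: nrm_scaleR mult_ac)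
  then show ?thesis unfolding obound_def using C(1) by (intro exI[of _ "\<bar>c\<bar> * C"]) auto
qed

lemma obound_sum:
  assumes "\<And>i. i < (k::nat) \<Longrightarrow> obound p (T i) d e"
  shows "obound p (\<lambda>n F X. \<Sum>i<k. T i n F X) d e"
  using assms
proof (induction k)
  case 0
  then show ?case unfolding obound_def by (intro exI[of _ 0]) auto
next
  case (Suc k)
  then show ?case using obound_add[of p "\<lambda>n F X. \<Sum>i<k. T i n F X" d e "T k"] by simp
qed

lemma obound_comp:
  assumes T: "obound p T d' e'" and S: "obound p S d e"
    and P: "\<And>n F X. adm p n F \<Longrightarrow> Pd n d X \<Longrightarrow> Pd n d' (S n F X)"
  shows "obound p (\<lambda>n F X. T n F (S n F X)) d (e' + e)"
proof -
  obtain C where C: "0 \<le> C" "\<And>n F X. adm p n F \<Longrightarrow> Pd n d' X \<Longrightarrow> nrm (T n F X) \<le> C * eta p n F ^ e' * nrm X"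
    using oboundD[OF T] by metis
  obtain D where D: "0 \<le> D" "\<And>n F X. adm p n F \<Longrightarrow> Pd n d X \<Longrightarrow> nrm (S n F X) \<le> D * eta p n F ^ e * nrm X"
    using oboundD[OF S] by metis
  have "nrm (T n F (S n F X)) \<le> (C * D) * eta p n F ^ (e' + e) * nrm X" if F: "adm p n F" and X: "Pd n d X" for n F X
  proof -
    have "nrm (T n F (S n F X)) \<le> C * eta p n F ^ e' * nrm (S n F X)" by (rule C(2)[OF F P[OF F X]])
    also have "\<dots> \<le> C * eta p n F ^ e' * (D * eta p n F ^ e * nrm X)"
      using D(2)[OF F X] C(1) by (intro mult_left_mono) auto
    finally show ?thesis by (simp add: power_add mult_ac)
  qed
  then show ?thesis unfolding obound_def using C(1) D(1) by (intro exI[of _ "C * D"]) auto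
qed

lemma obound_cong:
  assumes "obound p T d e" "\<And>n F X. adm p n F \<Longrightarrow> Pd n d X \<Longrightarrow> S n F X = T n F X"
  shows "obound p S d e"
  using assms unfolding obound_def by metis

lemma obound_resR: "1 \<le> p \<Longrightarrow> obound p (resR p) d 1"
  unfolding obound_def using resR_bound by simp

lemma obound_comAD: "1 \<le> p \<Longrightarrow> obound p (comAD p) d 2"
  unfolding obound_def using comAD_bound by simp

lemma obound_lowA: assumes "1 \<le> p" shows "obound p (lowA p) d 0"
proof -
  have "\<exists>C\<ge>0. \<forall>n F X. adm p n F \<longrightarrow> Pd n d X \<longrightarrow> nrm (lowA p n F X) \<le> C * 1 * nrm X"
  proof (rule bound_from_W)
    fix q
    obtain K where K: "0 \<le> K" "\<And>n X Y. Pd n p X \<Longrightarrow> Pd n q Y \<Longrightarrow> nrm (X * Y) \<le> K * nrm X * nrm Y"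
      using nrm_mult_le by metis
    have "nrm (lowA p n F X) \<le> K * 1 * nrm X" if F: "adm p n F" and X: "W n q X" for n F X
    proof (cases "p \<le> q")
      case True
      have "nrm (J n (q - p) (F * X)) \<le> nrm (F * X)"
        by (rule nrm_J_le[OF W_mult_Pd[OF adm_W[OF F] W_Pd[OF X]]])
      also have "\<dots> \<le> K * 1 * nrm X" using K(2)[OF W_Pd[OF adm_W[OF F]] W_Pd[OF X]] adm_nrm[OF F] by simp
      finally show ?thesis using True lowA_W[OF X] by simp
    next
      case False
      then show ?thesis using K(1) lowA_W[OF X] by simp
    qed
    then show "\<exists>C\<ge>0. \<forall>n F X. adm p n F \<longrightarrow> W n q X \<longrightarrow> nrm (lowA p n F X) \<le> C * 1 * nrm X"
      using K(1) by blast
  qed (use lowA_add adm_W in auto)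
  then show ?thesis unfolding obound_def by simp
qed

section \<open>Counting powers of \<open>eta\<close> for iterated derivatives\<close>

definition linop :: "nat \<Rightarrow> (nat \<Rightarrow> pf \<Rightarrow> pf \<Rightarrow> pf) \<Rightarrow> bool" where
  "linop p T \<longleftrightarrow> (\<forall>n F d X Y c. adm p n F \<longrightarrow> Pd n d X \<longrightarrow> Pd n d Y \<longrightarrow>
     T n F (X + Y) = T n F X + T n F Y \<and> T n F (c *\<^sub>R X) = c *\<^sub>R T n F X)"

lemma Pd_Gam_W: "adm p n F \<Longrightarrow> Pd n d X \<Longrightarrow> Pd n (p + d) (Gam n F X)"
  using Pd_mono[OF Pd_Gam[OF W_Pd[OF adm_W]]] by fastforce

lemma linop_Gam: "linop p T \<Longrightarrow> linop p (\<lambda>n F X. T n F (Gam n F X))"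
  unfolding linop_def using Pd_Gam_W by (auto simp: Gam_add_right Gam_scaleR_right) blast+

lemma linop_funpow: "linop p (\<lambda>n F X. (Gam n F ^^ k) X)"
proof (induction k)
  case 0
  then show ?case by (simp add: linop_def)
next
  case (Suc k)
  from linop_Gam[OF this] show ?case by (simp add: funpow_swap1)
qed

lemma linop_comAD: assumes p: "1 \<le> p" and T: "linop p T"
  shows "linop p (\<lambda>n F X. T n F (comAD p n F X))"
proof -
  have s: "comAD p n F (c *\<^sub>R X) = c *\<^sub>R comAD p n F X" if "adm p n F" "Pd n d X" for n F X c d
    unfolding comAD_def Gam_scaleR_right lowA_scaleR[OF adm_W[OF that(1)] that(2)]
      lowA_scaleR[OF adm_W[OF that(1)] Pd_Gam_W[OF that]] by (simp add: scaleR_diff_right)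
  show ?thesis
    using T unfolding linop_def by (auto simp: comAD_add[OF adm_W] s Pd_comAD[OF p adm_W]) (blast intro: Pd_comAD[OF p adm_W])+
qed

text \<open>An element of degree below \<open>(l + 1) p\<close> is annihilated by \<open>l + 1\<close> applications of \<open>lowA\<close>;
  a factor \<open>eta\<close> has to be paid for each unit by which \<open>resR\<close> raises this level.\<close>

definition lev :: "nat \<Rightarrow> (nat \<Rightarrow> pf \<Rightarrow> pf \<Rightarrow> pf) \<Rightarrow> nat \<Rightarrow> nat \<Rightarrow> bool" where
  "lev p T e k \<longleftrightarrow> (\<forall>d l. d < (l + 1) * p \<longrightarrow> obound p T d (e + ((k - l) + 1) div 2))"

lemma lev_id: "lev p (\<lambda>n F X. X) 0 0"
  unfolding lev_def obound_def by (intro allI impI exI[of _ 1]) auto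

text \<open>Split D into \<open>resR\<close> and \<open>p\<close> times \<open>lowA\<close>. After
  \<open>resR\<close> the level is at most \<open>Suc l\<close>, and
  \<open>(k - Suc l + 1) div 2 + 1\<close> reaches the required
  \<open>(Suc k - l + 1) div 2\<close>. After \<open>lowA\<close> the level is \<open>l - 1\<close>
  and the exponents agree; at level 0 it gives zero.\<close>

lemma lev_Gam:
  assumes p: "1 \<le> p" and lin: "linop p T" and T: "lev p T e k"
  shows "lev p (\<lambda>n F X. T n F (Gam n F X)) e (Suc k)"
  unfolding lev_def
proof (intro allI impI)
  fix d l assume d: "d < (l + 1) * p"
  let ?e = "e + ((Suc k - l) + 1) div 2"
  have dd: "d + p - 1 < (Suc l + 1) * p" using d p by simp
  have 1: "obound p (\<lambda>n F X. T n F (resR p n F X)) d ?e"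
  proof -
    have "obound p T (d + p - 1) (e + ((k - Suc l) + 1) div 2)"
      using T dd unfolding lev_def by blast
    from obound_comp[OF this obound_resR[OF p], of d]
    have "obound p (\<lambda>n F X. T n F (resR p n F X)) d (e + ((k - Suc l) + 1) div 2 + 1)"
      using Pd_resR[OF p adm_W] by blast
    then show ?thesis by (rule obound_weaken[OF p]) auto
  qed
  have 2: "obound p (\<lambda>n F X. T n F (lowA p n F X)) d ?e"
  proof (cases l)
    case 0
    then have "d < p" using d by simp
    moreover have "T n F 0 = 0" if "adm p n F" for n F
      using lin that unfolding linop_def using Pd_0[of n 0] by (metis scaleR_zero_left)
    ultimately have "T n F (lowA p n F X) = 0" if "adm p n F" "Pd n d X" for n F X
      using lowA_small that by metis
    then show ?thesis unfolding obound_def by (intro exI[of _ 0]) auto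
  next
    case (Suc l')
    have "d - p < (l' + 1) * p" using d Suc by (simp add: less_diff_conv2)
    then have "obound p T (d - p) (e + ((k - l') + 1) div 2)" using T unfolding lev_def by blast
    from obound_comp[OF this obound_lowA[OF p], of d]
    have "obound p (\<lambda>n F X. T n F (lowA p n F X)) d (e + ((k - l') + 1) div 2)"
      using Pd_lowA[OF adm_W] by auto
    then show ?thesis using Suc by simp
  qed
  show "obound p (\<lambda>n F X. T n F (Gam n F X)) d ?e"
  proof (rule obound_cong[OF obound_add[OF 1 obound_scaleR[OF 2, of "real p"]]])
    fix n F X assume F: "adm p n F" and X: "Pd n d X"
    have a: "Pd n (d + p) (resR p n F X)" "Pd n (d + p) (lowA p n F X)"
      using Pd_mono[OF Pd_resR[OF p adm_W[OF F] X]] Pd_mono[OF Pd_lowA[OF adm_W[OF F] X]] by auto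
    have "Gam n F X = resR p n F X + real p *\<^sub>R lowA p n F X" by (simp add: resR_def)
    then show "T n F (Gam n F X) = T n F (resR p n F X) + real p *\<^sub>R T n F (lowA p n F X)"
      using lin F a Pd_scaleR[OF a(2)] unfolding linop_def by metis
  qed
qed

lemma lev_comAD:
  assumes p: "1 \<le> p" and T: "lev p T e k"
  shows "lev p (\<lambda>n F X. T n F (comAD p n F X)) (e + 2) k"
  unfolding lev_def
proof (intro allI impI)
  fix d l assume "d < (l + 1) * p"
  then have "obound p T d (e + ((k - l) + 1) div 2)" using T unfolding lev_def by blast
  from obound_comp[OF this obound_comAD[OF p], of d]
  show "obound p (\<lambda>n F X. T n F (comAD p n F X)) d (e + 2 + ((k - l) + 1) div 2)"
    using Pd_comAD[OF p adm_W] by (simp add: ac_simps)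
qed

lemma lev_funpow: assumes "1 \<le> p" shows "lev p (\<lambda>n F X. (Gam n F ^^ k) X) 0 k"
proof (induction k)
  case 0
  then show ?case using lev_id by simp
next
  case (Suc k)
  from lev_Gam[OF assms linop_funpow this] show ?case by (simp add: funpow_swap1)
qed

lemma lev_funpow_comAD:
  assumes p: "1 \<le> p"
  shows "lev p (\<lambda>n F X. (Gam n F ^^ i) (comAD p n F ((Gam n F ^^ l) X))) 2 (i + l) \<and>
    linop p (\<lambda>n F X. (Gam n F ^^ i) (comAD p n F ((Gam n F ^^ l) X)))"
proof (induction l)
  case 0
  show ?case using lev_comAD[OF p lev_funpow[OF p, of i]] linop_comAD[OF p linop_funpow] by (simp add: numeral_2_eq_2)
next
  case (Suc l)
  then show ?case
    using lev_Gam[OF p, of "\<lambda>n F X. (Gam n F ^^ i) (comAD p n F ((Gam n F ^^ l) X))" 2 "i + l"]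
      linop_Gam[of p "\<lambda>n F X. (Gam n F ^^ i) (comAD p n F ((Gam n F ^^ l) X))"]
    by (simp add: funpow_swap1)
qed

text \<open>Moving A to the right through D^k leaves one commutator per crossing. On the far right A
  acts on \<open>X\<close> itself, whose degree is still low.\<close>

lemma lowA_funpow:
  "lowA p n F ((Gam n F ^^ k) X) = (Gam n F ^^ k) (lowA p n F X) +
     (\<Sum>i<k. (Gam n F ^^ (k - 1 - i)) (comAD p n F ((Gam n F ^^ i) X)))"
proof (induction k)
  case (Suc k)
  have "(\<Sum>i<k. Gam n F ((Gam n F ^^ (k - 1 - i)) (comAD p n F ((Gam n F ^^ i) X))))
      = (\<Sum>i<k. (Gam n F ^^ (k - i)) (comAD p n F ((Gam n F ^^ i) X)))"
  proof (intro sum.cong refl)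
    fix i assume "i \<in> {..<k}"
    then have "k - i = Suc (k - 1 - i)" by auto
    then show "Gam n F ((Gam n F ^^ (k - 1 - i)) (comAD p n F ((Gam n F ^^ i) X))) = (Gam n F ^^ (k - i)) (comAD p n F ((Gam n F ^^ i) X))"
      by simp
  qed
  moreover have "lowA p n F ((Gam n F ^^ Suc k) X) = Gam n F (lowA p n F ((Gam n F ^^ k) X)) + comAD p n F ((Gam n F ^^ k) X)"
    by (simp add: comAD_def)
  ultimately show ?case unfolding Suc by (simp add: Gam_add_right Gam_sum_right)
qed simp

lemma obound_commutator_sum:
  assumes p: "1 \<le> p" and d: "d < (l + 1) * p"
  shows "obound p (\<lambda>n F X. \<Sum>i<k. (Gam n F ^^ (k - 1 - i)) (comAD p n F ((Gam n F ^^ i) X))) d (2 + ((k - 1 - l) + 1) div 2)"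
proof (rule obound_sum)
  fix i assume "i < k"
  then have e: "k - 1 - i + i = k - 1" by simp
  show "obound p (\<lambda>n F X. (Gam n F ^^ (k - 1 - i)) (comAD p n F ((Gam n F ^^ i) X))) d (2 + ((k - 1 - l) + 1) div 2)"
    using lev_funpow_comAD[OF p, of "k - 1 - i" i, THEN conjunct1, unfolded lev_def, rule_format, OF d]
    by (simp only: e)
qed

lemma Pd_funpow: "adm p n F \<Longrightarrow> Pd n d X \<Longrightarrow> Pd n (k * p + d) ((Gam n F ^^ k) X)"
proof (induction k)
  case (Suc k)
  then show ?case using Pd_Gam_W[of p n F "k * p + d"] by (simp add: add.assoc)
qed simp

text \<open>Here the outermost D is split into \<open>resR\<close> and \<open>p\<close> times
  \<open>lowA\<close>, whereas \<open>lev_Gam\<close> splits the innermost one. The remainder then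
  gains one power over D^k, and \<open>lowA_funpow\<close> rewrites the other term.\<close>

lemma obound_Suc:
  assumes p: "1 \<le> p"
    and 1: "obound p (\<lambda>n F X. (Gam n F ^^ k) (lowA p n F X)) d e"
    and 2: "obound p (\<lambda>n F X. \<Sum>i<k. (Gam n F ^^ (k - 1 - i)) (comAD p n F ((Gam n F ^^ i) X))) d e"
    and 3: "obound p (\<lambda>n F X. (Gam n F ^^ k) X) d e'" "e \<le> Suc e'"
  shows "obound p (\<lambda>n F X. (Gam n F ^^ Suc k) X) d e"
proof -
  have "obound p (\<lambda>n F X. resR p n F ((Gam n F ^^ k) X)) d (1 + e')"
    by (rule obound_comp[OF obound_resR[OF p] 3(1) Pd_funpow])
  then have R: "obound p (\<lambda>n F X. resR p n F ((Gam n F ^^ k) X)) d e"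
    by (rule obound_weaken[OF p]) (use 3(2) in simp)
  show ?thesis
    by (rule obound_cong[OF obound_add[OF obound_scaleR[OF obound_add[OF 1 2], of "real p"] R]])
      (simp only: lowA_funpow[symmetric] resR_def funpow.simps o_apply, simp)
qed

lemma obound_zero:
  assumes "\<And>n F X. adm p n F \<Longrightarrow> Pd n d X \<Longrightarrow> T n F X = 0" shows "obound p T d e"
  unfolding obound_def using assms by (intro exI[of _ 0]) auto

lemma Gam_funpow_0: "(Gam n F ^^ k) 0 = 0"
  by (induction k) auto

text \<open>In degree below \<open>p\<close> the term with A acting on \<open>X\<close> vanishes.
  What remains are commutators, with \<open>eta^2\<close> from the commutator itself and the usual
  count for the other \<open>k - 1\<close> derivatives. The result is one power better than
  \<open>lev_funpow\<close>.\<close>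

lemma obound_level0:
  assumes p: "1 \<le> p" and d: "d < p" and k: "1 \<le> k"
  shows "obound p (\<lambda>n F X. (Gam n F ^^ Suc k) X) d (k div 2 + 2)"
  using k
proof (induction k rule: dec_induct)
  have low: "obound p (\<lambda>n F X. (Gam n F ^^ k) (lowA p n F X)) d e" for k e
    by (rule obound_zero) (simp add: lowA_small[OF _ d] Gam_funpow_0)
  have com: "obound p (\<lambda>n F X. \<Sum>i<k. (Gam n F ^^ (k - 1 - i)) (comAD p n F ((Gam n F ^^ i) X))) d (k div 2 + 2)"
    if "1 \<le> k" for k
    using obound_commutator_sum[OF p, of d 0 k] d that by (simp add: add.commute)
  case base
  have "obound p (\<lambda>n F X. (Gam n F ^^ 1) X) d 1"
    using lev_funpow[OF p, of 1, unfolded lev_def, rule_format, of d 0] d by simp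
  from obound_Suc[OF p low com[of 1] this] show ?case by simp
next
  have low: "obound p (\<lambda>n F X. (Gam n F ^^ k) (lowA p n F X)) d e" for k e
    by (rule obound_zero) (simp add: lowA_small[OF _ d] Gam_funpow_0)
  have com: "obound p (\<lambda>n F X. \<Sum>i<k. (Gam n F ^^ (k - 1 - i)) (comAD p n F ((Gam n F ^^ i) X))) d (k div 2 + 2)"
    if "1 \<le> k" for k
    using obound_commutator_sum[OF p, of d 0 k] d that by (simp add: add.commute)
  case (step k)
  from obound_Suc[OF p low com[of "Suc k"] step.IH] show ?case by auto
qed

text \<open>\<open>lowA\<close> brings the degree below \<open>p\<close>, where
  \<open>obound_level0\<close> estimates D^k. The induction starts at \<open>k = 2\<close> from the
  order 1 that \<open>lev_funpow\<close> gives for D^2, and again one power is gained.\<close>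

lemma obound_level1:
  assumes p: "1 \<le> p" and d: "d < 2 * p" and k: "2 \<le> k"
  shows "obound p (\<lambda>n F X. (Gam n F ^^ Suc k) X) d ((k + 1) div 2 + 1)"
  using k
proof (induction k rule: less_induct)
  case (less k)
  have dp: "d - p < p" using d p by linarith
  obtain k' where k': "k = Suc k'" "1 \<le> k'" using less.prems by (cases k) auto
  have low: "obound p (\<lambda>n F X. (Gam n F ^^ k) (lowA p n F X)) d ((k + 1) div 2 + 1)"
  proof -
    have "obound p (\<lambda>n F X. (Gam n F ^^ k) (lowA p n F X)) d (k' div 2 + 2 + 0)"
      unfolding k'(1) by (rule obound_comp[OF obound_level0[OF p dp k'(2)] obound_lowA[OF p] Pd_lowA[OF adm_W]])
    then show ?thesis by (rule obound_weaken[OF p]) (use k' in simp)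
  qed
  have com: "obound p (\<lambda>n F X. \<Sum>i<k. (Gam n F ^^ (k - 1 - i)) (comAD p n F ((Gam n F ^^ i) X))) d ((k + 1) div 2 + 1)"
  proof -
    have "2 + ((k - 1 - 1) + 1) div 2 = (k + 1) div 2 + 1" using less.prems by presburger
    then show ?thesis using obound_commutator_sum[OF p, of d 1 k] d by (simp add: mult.commute)
  qed
  show ?case
  proof (cases "k = 2")
    case True
    have "obound p (\<lambda>n F X. (Gam n F ^^ 2) X) d (0 + ((2 - 1) + 1) div 2)"
      using lev_funpow[OF p, of 2, unfolded lev_def, rule_format, of d 1] d by simp
    from obound_Suc[OF p low[unfolded True] com[unfolded True] this] show ?thesis unfolding True by simp
  next
    case False
    then have "obound p (\<lambda>n F X. (Gam n F ^^ Suc k') X) d ((k' + 1) div 2 + 1)"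
      by (intro less.IH) (use k' less.prems in auto)
    then have "obound p (\<lambda>n F X. (Gam n F ^^ k) X) d ((k' + 1) div 2 + 1)" using k' by simp
    from obound_Suc[OF p low com this] show ?thesis using k' by auto
  qed
qed

definition gk :: "nat \<Rightarrow> nat \<Rightarrow> pf \<Rightarrow> nat \<Rightarrow> pf" where
  "gk p n F k = (Gam n F ^^ k) (gg p n F)"

text \<open>The order of magnitude of \<open>D\<^sup>k g\<close> as a power of \<open>eta = \<delta>\<^bsup>1/2\<^esup>\<close>.\<close>

definition gord :: "nat \<Rightarrow> nat" where
  "gord k = (if k \<le> 1 then 2 else if k = 2 then 3 else k div 2 + 3)"

lemma Pd_gk: "adm p n F \<Longrightarrow> Pd n (k * p + 2 * p) (gk p n F k)"
  unfolding gk_def by (rule Pd_funpow) (auto intro: Pd_mono[OF Pd_gg])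

text \<open>The degree of \<open>gg\<close> is at most \<open>2 * p - 2\<close>, so it starts at
  level 1, and its own norm \<open>eta^2\<close> supplies the 2 subtracted from
  \<open>gord k\<close>.\<close>

lemma gk_bound:
  assumes p: "1 \<le> p"
  shows "\<exists>C\<ge>0. \<forall>n F. adm p n F \<longrightarrow> nrm (gk p n F k) \<le> C * eta p n F ^ gord k"
proof -
  define d where "d = p - 1 + (p - 1)"
  have d: "d < (1 + 1) * p" using p by (simp add: d_def)
  have "obound p (\<lambda>n F X. (Gam n F ^^ k) X) d (gord k - 2)"
  proof (cases "k \<le> 2")
    case True
    have "obound p (\<lambda>n F X. (Gam n F ^^ k) X) d (0 + ((k - 1) + 1) div 2)"
      using lev_funpow[OF p, of k] d unfolding lev_def by blast
    then show ?thesis by (rule obound_weaken[OF p]) (use True in \<open>auto simp: gord_def le_Suc_eq numeral_2_eq_2\<close>)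
  next
    case False
    then obtain j where j: "k = Suc j" "2 \<le> j" by (cases k) auto
    have "obound p (\<lambda>n F X. (Gam n F ^^ k) X) d ((j + 1) div 2 + 1)"
      unfolding j(1) by (rule obound_level1[OF p _ j(2)]) (use d in simp)
    then show ?thesis using j by (simp add: gord_def)
  qed
  then obtain C where C: "0 \<le> C" "\<And>n F X. adm p n F \<Longrightarrow> Pd n d X \<Longrightarrow> nrm ((Gam n F ^^ k) X) \<le> C * eta p n F ^ (gord k - 2) * nrm X"
    using oboundD by metis
  have "2 \<le> gord k" by (simp add: gord_def)
  then have e: "x ^ (gord k - 2) * x\<^sup>2 = x ^ gord k" for x :: real by (metis le_add_diff_inverse2 power_add)
  have "nrm (gk p n F k) \<le> C * eta p n F ^ gord k" if F: "adm p n F" for n F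
    using C(2)[OF F Pd_gg[OF F, folded d_def]] unfolding gk_def eta_sq[symmetric] by (simp add: e mult.assoc)
  then show ?thesis using C(1) by blast
qed

lemma Em_Gam_W: "adm p n F \<Longrightarrow> Em (Gam n F X) = real p * Em (F * X)"
  by (simp add: Em_Num[symmetric] W_Num[OF adm_W])

text \<open>The mean is one power smaller than the norm bound \<open>eta^3\<close>. Integrating by
  parts twice yields \<open>p^2 (E[g F^2] - E[g^2])\<close>; the constant part of \<open>g\<close>
  is zero, and in each other degree that \<open>g\<close> can have, both \<open>g\<close> and
  \<open>F * F\<close> are of order \<open>eta^2\<close>.\<close>

lemma Em_gk_2:
  assumes p: "1 \<le> p"
  shows "\<exists>C\<ge>0. \<forall>n F. adm p n F \<longrightarrow> \<bar>Em (gk p n F 2)\<bar> \<le> C * eta p n F ^ 4"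
proof -
  define d where "d = p - 1 + (p - 1)"
  define C where "C = (real p)\<^sup>2 * (real (card {..d}) * real (2 * p) + 1)"
  have "\<bar>Em (gk p n F 2)\<bar> \<le> C * eta p n F ^ 4" if F: "adm p n F" for n F
  proof -
    let ?g = "gg p n F"
    have Pg: "Pd n d ?g" using Pd_gg[OF F] by (simp add: d_def)
    have PF: "Pd n (p + p) (F * F)" by (rule W_mult_Pd[OF adm_W[OF F] W_Pd[OF adm_W[OF F]]])
    have "real p * Em (F * (F * ?g)) = Em (Gam n F (F * ?g))" by (simp add: Em_Gam_W[OF F])
    also have "\<dots> = real p * Em ?g + real p * Em (?g * ?g) + Em (F * Gam n F ?g)"
      unfolding Gam_mult_right Gam_FF[OF p] by (simp add: distrib_right distrib_left)
    finally have "Em (F * Gam n F ?g) = real p * (Em (?g * (F * F)) - Em (?g * ?g))"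
      using Em_gg[OF p F] by (simp add: algebra_simps)
    then have x: "Em (gk p n F 2) = (real p)\<^sup>2 * (Em (?g * (F * F)) - Em (?g * ?g))"
      by (simp add: gk_def numeral_2_eq_2 Em_Gam_W[OF F] power2_eq_square)
    have y: "\<bar>Em (?g * (F * F))\<bar> \<le> real (card {..d}) * ((eta p n F)\<^sup>2 * (real (2 * p) * (eta p n F)\<^sup>2))"
    proof -
      have "\<bar>Em (?g * (F * F))\<bar> \<le> (\<Sum>k\<le>d. \<bar>Em (J n k ?g * J n k (F * F))\<bar>)"
        unfolding Em_J_sum[OF Pg PF] by (rule sum_abs)
      also have "\<dots> \<le> real (card {..d}) * ((eta p n F)\<^sup>2 * (real (2 * p) * (eta p n F)\<^sup>2))"
      proof (rule sum_bounded_above)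
        fix k assume k: "k \<in> {..d}"
        show "\<bar>Em (J n k ?g * J n k (F * F))\<bar> \<le> (eta p n F)\<^sup>2 * (real (2 * p) * (eta p n F)\<^sup>2)"
        proof (cases "k = 0")
          case True
          then have "J n k ?g = 0" using J_0_eq[OF Pg] Em_gg[OF p F] by simp
          then show ?thesis by simp
        next
          case False
          have "k < 2 * p" using k p by (simp add: d_def)
          then have "nrm (J n k ?g) * nrm (J n k (F * F)) \<le> (eta p n F)\<^sup>2 * (real (2 * p) * (eta p n F)\<^sup>2)"
            using nrm_J_FF[OF p F, of k] nrm_J_le[OF Pg, of k] False by (intro mult_mono) (auto simp: eta_sq)
          then show ?thesis using Em_CS order_trans by blast
        qed
      qed
      finally show ?thesis .
    qed
    have z: "Em (?g * ?g) = (eta p n F)\<^sup>2 * (eta p n F)\<^sup>2"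
      unfolding eta_sq using nrm_sq[of ?g] by (simp add: power2_eq_square)
    have "\<bar>Em (?g * (F * F)) - Em (?g * ?g)\<bar> \<le> \<bar>Em (?g * (F * F))\<bar> + \<bar>Em (?g * ?g)\<bar>"
      by (rule abs_triangle_ineq4)
    also have "\<bar>Em (?g * ?g)\<bar> = (eta p n F)\<^sup>2 * (eta p n F)\<^sup>2" unfolding z by simp
    finally have w: "\<bar>Em (?g * (F * F)) - Em (?g * ?g)\<bar> \<le> real (card {..d}) * ((eta p n F)\<^sup>2 * (real (2 * p) * (eta p n F)\<^sup>2)) + (eta p n F)\<^sup>2 * (eta p n F)\<^sup>2"
      using y by linarith
    have "\<bar>Em (gk p n F 2)\<bar> \<le> (real p)\<^sup>2 * (real (card {..d}) * ((eta p n F)\<^sup>2 * (real (2 * p) * (eta p n F)\<^sup>2)) + (eta p n F)\<^sup>2 * (eta p n F)\<^sup>2)"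
      unfolding x abs_mult abs_of_nonneg[OF zero_le_power2] by (rule mult_left_mono[OF w]) simp
    also have "\<dots> = C * eta p n F ^ 4"
      by (simp only: C_def distrib_left distrib_right mult_1 mult_ac power2_eq_square power4_eq_xxxx)
    finally show ?thesis .
  qed
  then show ?thesis by (intro exI[of _ C]) (auto simp: C_def)
qed

section \<open>The expansion for polynomial functionals\<close>

lemma poly_growth_dominated:
  assumes "poly_growth n v" "\<And>\<omega>. \<bar>u \<omega>\<bar> \<le> \<bar>v \<omega>\<bar>"
  shows "poly_growth n u"
  using assms unfolding poly_growth_def by (meson order_trans)

lemma poly_growth_power: "poly_growth n v \<Longrightarrow> poly_growth n (\<lambda>\<omega>. v \<omega> ^ N)"
  by (induction N) (auto intro: poly_growth_const poly_growth_mult)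

lemma poly_growth_compose:
  assumes "growth N C u" "poly_growth n v"
  shows "poly_growth n (\<lambda>\<omega>. u (v \<omega>))"
proof (rule poly_growth_dominated)
  have "poly_growth n (\<lambda>\<omega>. \<bar>v \<omega>\<bar>)" by (rule poly_growth_dominated[OF assms(2)]) simp
  then show "poly_growth n (\<lambda>\<omega>. C * (1 + \<bar>v \<omega>\<bar>) ^ N)"
    by (intro poly_growth_mult poly_growth_power poly_growth_add poly_growth_const)
  show "\<bar>u (v \<omega>)\<bar> \<le> \<bar>C * (1 + \<bar>v \<omega>\<bar>) ^ N\<bar>" for \<omega>
    using growthD[OF assms(1), of "v \<omega>"] by linarith
qed

text \<open>The best choice is \<open>t = sqrt B / sqrt A\<close>. If \<open>A\<close> or
  \<open>B\<close> vanishes, the infimum over \<open>t\<close> is zero, and a suitable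
  \<open>t\<close> refutes \<open>0 < x\<close>.\<close>

lemma young_optimize:
  fixes x A B :: real
  assumes "\<And>t. 0 < t \<Longrightarrow> 2 * x \<le> t * A + B / t" "0 \<le> A" "0 \<le> B"
  shows "x \<le> sqrt A * sqrt B"
proof -
  consider "A = 0" | "B = 0" | "0 < A" "0 < B" using assms by linarith
  then show ?thesis
  proof cases
    case 1
    have "x \<le> 0"
    proof (rule ccontr)
      assume "\<not> x \<le> 0"
      then have x: "0 < x" by simp
      have "2 * x \<le> B / ((B + 1) / x)" using assms(1)[of "(B + 1) / x"] x assms(3) 1 by simp
      also have "\<dots> = x * (B / (B + 1))" by simp
      also have "\<dots> \<le> x * 1" using x assms(3) by (intro mult_left_mono) auto
      finally show False using x by simp
    qed
    then show ?thesis using 1 by simp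
  next
    case 2
    have "x \<le> 0"
    proof (rule ccontr)
      assume "\<not> x \<le> 0"
      then have x: "0 < x" by simp
      have "2 * x \<le> (x / (A + 1)) * A" using assms(1)[of "x / (A + 1)"] x assms(2) 2 by simp
      also have "\<dots> = x * (A / (A + 1))" by simp
      also have "\<dots> \<le> x * 1" using x assms(2) by (intro mult_left_mono) auto
      finally show False using x by simp
    qed
    then show ?thesis using 2 by simp
  next
    case 3
    have "2 * x \<le> (sqrt B / sqrt A) * A + B / (sqrt B / sqrt A)" using 3 by (intro assms(1)) auto
    also have "(sqrt B / sqrt A) * A = sqrt A * sqrt B"
      using 3 by (simp add: field_simps flip: power2_eq_square)
    also have "B / (sqrt B / sqrt A) = sqrt A * sqrt B"
      using 3 by (simp add: field_simps flip: power2_eq_square)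
    finally show ?thesis by simp
  qed
qed

lemma L2_product_integrable:
  assumes m: "f \<in> borel_measurable gauss_space" "g \<in> borel_measurable gauss_space"
    and i: "integrable gauss_space (\<lambda>\<omega>. (f \<omega> :: real)\<^sup>2)" "integrable gauss_space (\<lambda>\<omega>. (g \<omega> :: real)\<^sup>2)"
  shows "integrable gauss_space (\<lambda>\<omega>. f \<omega> * g \<omega>)"
proof (rule Bochner_Integration.integrable_bound)
  show "integrable gauss_space (\<lambda>\<omega>. (f \<omega>)\<^sup>2 + (g \<omega>)\<^sup>2)" using i by simp
  show "(\<lambda>\<omega>. f \<omega> * g \<omega>) \<in> borel_measurable gauss_space" using m by measurable
  have "\<bar>x * y\<bar> \<le> x\<^sup>2 + y\<^sup>2" for x y :: real
  proof -
    have "2 * (\<bar>x\<bar> * \<bar>y\<bar>) \<le> \<bar>x\<bar>\<^sup>2 + \<bar>y\<bar>\<^sup>2" using sum_squares_bound[of "\<bar>x\<bar>" "\<bar>y\<bar>"] by simp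
    moreover have "0 \<le> \<bar>x\<bar> * \<bar>y\<bar>" by simp
    ultimately show ?thesis unfolding abs_mult by (simp only: power2_abs)
  qed
  then show "AE \<omega> in gauss_space. norm (f \<omega> * g \<omega>) \<le> norm ((f \<omega>)\<^sup>2 + (g \<omega>)\<^sup>2)"
    by (intro AE_I2) (simp add: abs_mult)
qed

lemma L2_cauchy_schwarz:
  assumes m: "f \<in> borel_measurable gauss_space" "g \<in> borel_measurable gauss_space"
    and i: "integrable gauss_space (\<lambda>\<omega>. (f \<omega> :: real)\<^sup>2)" "integrable gauss_space (\<lambda>\<omega>. (g \<omega> :: real)\<^sup>2)"
  shows "E (\<lambda>\<omega>. \<bar>f \<omega> * g \<omega>\<bar>) \<le> sqrt (E (\<lambda>\<omega>. (f \<omega>)\<^sup>2)) * sqrt (E (\<lambda>\<omega>. (g \<omega>)\<^sup>2))"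
proof (rule young_optimize)
  fix t :: real assume t: "0 < t"
  have "2 * \<bar>x * y\<bar> \<le> t * x\<^sup>2 + y\<^sup>2 / t" for x y
  proof -
    have "0 \<le> (t * \<bar>x\<bar> - \<bar>y\<bar>)\<^sup>2 / t" using t by simp
    also have "\<dots> = t * x\<^sup>2 + y\<^sup>2 / t - 2 * \<bar>x * y\<bar>"
      using t by (simp add: power2_diff power_mult_distrib abs_mult power2_eq_square[of t] field_simps)
    finally show ?thesis by simp
  qed
  then have "E (\<lambda>\<omega>. 2 * \<bar>f \<omega> * g \<omega>\<bar>) \<le> E (\<lambda>\<omega>. t * (f \<omega>)\<^sup>2 + (g \<omega>)\<^sup>2 / t)"
    using L2_product_integrable[OF m i] i by (intro integral_mono) auto
  then show "2 * E (\<lambda>\<omega>. \<bar>f \<omega> * g \<omega>\<bar>) \<le> t * E (\<lambda>\<omega>. (f \<omega>)\<^sup>2) + E (\<lambda>\<omega>. (g \<omega>)\<^sup>2) / t"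
    using i by simp
qed (auto intro!: integral_nonneg_AE)

section \<open>Expectations of the form E[X f(F)] and a single Stein step\<close>

definition TT :: "pf \<Rightarrow> (real \<Rightarrow> real) \<Rightarrow> pf \<Rightarrow> real" where
  "TT F f X = E (\<lambda>\<omega>. ev X \<omega> * f (ev F \<omega>))"

lemma continuous_compose_ev: "continuous_on UNIV f \<Longrightarrow> continuous_on UNIV (\<lambda>\<omega>. f (ev F \<omega>))"
  by (rule continuous_on_compose2[OF _ ev_continuous]) auto

lemma TT_integrable:
  assumes "continuous_on UNIV f" "growth N C f"
  shows "integrable gauss_space (\<lambda>\<omega>. ev X \<omega> * f (ev F \<omega>))"
proof -
  obtain a where a: "poly_growth a (ev X)" using ev_finite_dim by blast
  obtain b where b: "poly_growth b (ev F)" using ev_finite_dim by blast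
  have "poly_growth (max a b) (\<lambda>\<omega>. ev X \<omega> * f (ev F \<omega>))"
    by (intro poly_growth_mult poly_growth_compose[OF assms(2)] poly_growth_mono[OF a] poly_growth_mono[OF b]) auto
  then show ?thesis
    by (intro poly_growth_integrable continuous_measurable_gauss continuous_on_mult ev_continuous continuous_compose_ev assms(1))
qed

lemma TT_add:
  assumes "continuous_on UNIV f" "growth N C f"
  shows "TT F f (X + Y) = TT F f X + TT F f Y"
  using TT_integrable[OF assms, of X F] TT_integrable[OF assms, of Y F] by (simp add: TT_def distrib_right)

lemma TT_scaleR: "TT F f (c *\<^sub>R X) = c * TT F f X"
  by (simp add: TT_def mult.assoc)

lemma TT_0: "TT F f 0 = 0" by (simp add: TT_def)

lemma TT_sum:
  assumes "continuous_on UNIV f" "growth N C f"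
  shows "TT F f (sum X A) = (\<Sum>a\<in>A. TT F f (X a))"
  by (induction A rule: infinite_finite_induct) (auto simp: TT_0 TT_add[OF assms])

text \<open>The expectation of \<open>Num n F * X\<close> times \<open>u(F)\<close> is computed
  twice: as \<open>p E[F X u(F)]\<close>, where \<open>x u = f + u'\<close>, and by moving each
  creation operator onto \<open>X u(F)\<close>. Because Gamma(F, F) = p (1 + g), the term
  \<open>p E[X u'(F)]\<close> appears on both sides and cancels.\<close>

lemma TT_stein:
  assumes p: "1 \<le> p" and F: "adm p n F"
    and u: "\<And>x. (u has_real_derivative x * u x - f x) (at x)" and cf: "continuous_on UNIV f"
    and gu: "growth N C u" and gu': "growth N' C' (\<lambda>x. x * u x - f x)" and gf: "growth N'' C'' f"
  shows "TT F f X = TT F u (Gam n F X) / real p + TT F (\<lambda>x. x * u x - f x) (gg p n F * X)"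
proof -
  let ?u' = "\<lambda>x. x * u x - f x"
  have cu: "continuous_on UNIV u" by (rule DERIV_continuous_on) (rule u)
  have cu': "continuous_on UNIV ?u'" by (intro continuous_intros cu cf)
  have i: "TT F u (cr i (pd i F) * X) = TT F u (pd i F * pd i X) + TT F ?u' (pd i F * pd i F * X)" for i
  proof -
    obtain a where a: "poly_growth a (ev X)" using ev_finite_dim by blast
    obtain b where b: "poly_growth b (ev F)" using ev_finite_dim by blast
    obtain c where c: "poly_growth c (ev (pd i F))" using ev_finite_dim by blast
    obtain d where d: "poly_growth d (ev (pd i X))" using ev_finite_dim by blast
    define m where "m = max (max a b) (max c d)"
    note pg = poly_growth_mono[OF a, of m] poly_growth_mono[OF b, of m] poly_growth_mono[OF c, of m] poly_growth_mono[OF d, of m]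
    let ?v = "\<lambda>\<omega>. ev X \<omega> * u (ev F \<omega>)"
    let ?v' = "\<lambda>\<omega>. ev (pd i X) \<omega> * u (ev F \<omega>) + ev X \<omega> * (?u' (ev F \<omega>) * ev (pd i F) \<omega>)"
    have "E (\<lambda>\<omega>. ev (cr i (pd i F)) \<omega> * ?v \<omega>) = E (\<lambda>\<omega>. ev (pd i F) \<omega> * ?v' \<omega>)"
    proof (rule E_cr)
      show "continuous_on UNIV ?v" "continuous_on UNIV ?v'"
        by (intro continuous_on_mult continuous_on_add ev_continuous continuous_compose_ev[OF cu] continuous_compose_ev[OF cu'])+
      show "poly_growth m ?v" "poly_growth m ?v'"
        by (intro poly_growth_mult poly_growth_add poly_growth_compose[OF gu] poly_growth_compose[OF gu'] pg; simp add: m_def)+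
      show "((\<lambda>t. ?v (fun_upd \<omega> i t)) has_real_derivative ?v' (fun_upd \<omega> i s)) (at s)" for \<omega> s
      proof -
        have "((\<lambda>t. u (ev F (fun_upd \<omega> i t))) has_real_derivative ?u' (ev F (fun_upd \<omega> i s)) * ev (pd i F) (fun_upd \<omega> i s)) (at s)"
          by (rule DERIV_chain2[OF u pd_deriv])
        from DERIV_mult[OF pd_deriv[of X \<omega> i s] this] show ?thesis by (simp add: algebra_simps)
      qed
    qed
    also have "\<dots> = E (\<lambda>\<omega>. ev (pd i F * pd i X) \<omega> * u (ev F \<omega>) + ev (pd i F * pd i F * X) \<omega> * ?u' (ev F \<omega>))"
      by (intro Bochner_Integration.integral_cong) (auto simp: algebra_simps)
    also have "\<dots> = TT F u (pd i F * pd i X) + TT F ?u' (pd i F * pd i F * X)"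
      unfolding TT_def by (rule Bochner_Integration.integral_add[OF TT_integrable[OF cu gu] TT_integrable[OF cu' gu']])
    finally show ?thesis by (simp add: TT_def mult.assoc)
  qed
  have "TT F u (Num n F * X) = TT F u (\<Sum>i<n. cr i (pd i F) * X)" by (simp add: Num_def sum_distrib_right)
  also have "\<dots> = (\<Sum>i<n. TT F u (pd i F * pd i X)) + (\<Sum>i<n. TT F ?u' (pd i F * pd i F * X))"
    unfolding TT_sum[OF cu gu] i sum.distrib ..
  also have "\<dots> = TT F u (Gam n F X) + TT F ?u' (Gam n F F * X)"
    unfolding Gam_def sum_distrib_right TT_sum[OF cu gu] TT_sum[OF cu' gu'] ..
  finally have 1: "TT F u (Num n F * X) = TT F u (Gam n F X) + TT F ?u' (Gam n F F * X)" .
  have 2: "TT F u (Num n F * X) = real p * (TT F f X + TT F ?u' X)"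
  proof -
    have "TT F u (Num n F * X) = real p * TT F u (F * X)"
      unfolding W_Num[OF adm_W[OF F]] by (simp add: TT_scaleR)
    also have "TT F u (F * X) = E (\<lambda>\<omega>. ev X \<omega> * f (ev F \<omega>) + ev X \<omega> * ?u' (ev F \<omega>))"
      unfolding TT_def by (intro Bochner_Integration.integral_cong) (auto simp: algebra_simps)
    also have "\<dots> = TT F f X + TT F ?u' X"
      unfolding TT_def by (rule Bochner_Integration.integral_add[OF TT_integrable[OF cf gf] TT_integrable[OF cu' gu']])
    finally show ?thesis .
  qed
  have "Gam n F F * X = real p *\<^sub>R (X + gg p n F * X)" unfolding Gam_FF[OF p] by (simp add: distrib_right)
  then have 3: "TT F ?u' (Gam n F F * X) = real p * (TT F ?u' X + TT F ?u' (gg p n F * X))"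
    by (simp add: TT_scaleR TT_add[OF cu' gu'])
  have "real p * TT F f X = TT F u (Gam n F X) + real p * TT F ?u' (gg p n F * X)"
    using 1 unfolding 2 3 by (simp add: algebra_simps)
  then show ?thesis using p by (simp add: field_simps)
qed

lemma adm_moment_bound:
  "\<exists>K\<ge>0. \<forall>n F. adm p n F \<longrightarrow> Pd n (N * (p + p)) ((1 + F * F) ^ N) \<and> nrm ((1 + F * F) ^ N) \<le> K"
proof (induction N)
  case 0
  have "nrm 1 = 1" by (simp add: nrm_def)
  then show ?case by (intro exI[of _ 1]) auto
next
  case (Suc N)
  then obtain K where K: "0 \<le> K" "\<And>n F. adm p n F \<Longrightarrow> Pd n (N * (p + p)) ((1 + F * F) ^ N)" "\<And>n F. adm p n F \<Longrightarrow> nrm ((1 + F * F) ^ N) \<le> K"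
    by blast
  obtain L where L: "0 \<le> L" "\<And>n X. Pd n p X \<Longrightarrow> nrm (X * X) \<le> L * (nrm X)\<^sup>2" using fourth_moment_le by blast
  obtain M where M: "0 \<le> M" "\<And>n X Y. Pd n (p + p) X \<Longrightarrow> Pd n (N * (p + p)) Y \<Longrightarrow> nrm (X * Y) \<le> M * nrm X * nrm Y"
    using nrm_mult_le by metis
  have "Pd n (Suc N * (p + p)) ((1 + F * F) ^ Suc N) \<and> nrm ((1 + F * F) ^ Suc N) \<le> M * (1 + L) * K" if F: "adm p n F" for n F
  proof
    have P: "Pd n (p + p) (1 + F * F)" by (intro Pd_add Pd_1 W_mult_Pd adm_W[OF F] W_Pd)
    show "Pd n (Suc N * (p + p)) ((1 + F * F) ^ Suc N)" using Pd_mult[OF P K(2)[OF F]] by simp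
    have "nrm (1 + F * F) \<le> nrm 1 + nrm (F * F)" by (rule nrm_triangle)
    moreover have "nrm 1 = 1" by (simp add: nrm_def)
    moreover have "nrm (F * F) \<le> L" using L(2)[OF W_Pd[OF adm_W[OF F]]] adm_nrm[OF F] by simp
    ultimately have a: "nrm (1 + F * F) \<le> 1 + L" by simp
    have "nrm ((1 + F * F) ^ Suc N) \<le> M * nrm (1 + F * F) * nrm ((1 + F * F) ^ N)"
      using M(2)[OF P K(2)[OF F]] by simp
    also have "\<dots> \<le> M * (1 + L) * K" using a K(1) K(3)[OF F] M(1) L(1) by (intro mult_mono) auto
    finally show "nrm ((1 + F * F) ^ Suc N) \<le> M * (1 + L) * K" .
  qed
  then show ?case using M(1) L(1) K(1) by (intro exI[of _ "M * (1 + L) * K"]) auto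
qed

text \<open>From \<open>1 + |y| <= 2 * (1 + y^2)\<close> the polynomial
  \<open>(1 + F * F) ^ N\<close> majorises the growth bound. Its norm is bounded uniformly in
  \<open>F\<close>, and Cauchy-Schwarz leaves the norm of \<open>X\<close>.\<close>

lemma TT_bound:
  "\<exists>K\<ge>0. \<forall>n F f C X. adm p n F \<longrightarrow> continuous_on UNIV f \<longrightarrow> growth N C f \<longrightarrow> \<bar>TT F f X\<bar> \<le> K * C * nrm X"
proof -
  obtain K where K: "0 \<le> K" "\<And>n F. adm p n F \<Longrightarrow> nrm ((1 + F * F) ^ N) \<le> K"
    using adm_moment_bound[of p N] by blast
  have "\<bar>TT F f X\<bar> \<le> (2 ^ N * K) * C * nrm X"
    if F: "adm p n F" and c: "continuous_on UNIV f" and g: "growth N C f" for n F f C X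
  proof -
    let ?Z = "(1 + F * F) ^ N"
    have C: "0 \<le> C" by (rule growth_nonneg[OF g])
    have le: "\<bar>ev X \<omega> * f (ev F \<omega>)\<bar> \<le> C * 2 ^ N * \<bar>ev X \<omega> * ev ?Z \<omega>\<bar>" for \<omega>
    proof -
      define y where "y = ev F \<omega>"
      have "2 * \<bar>y\<bar> \<le> 1 + y * y" using sum_squares_bound[of 1 "\<bar>y\<bar>"] by (simp add: power2_eq_square)
      then have "1 + \<bar>y\<bar> \<le> 2 * (1 + y * y)" by (smt (verit) zero_le_square)
      then have "(1 + \<bar>y\<bar>) ^ N \<le> (2 * (1 + y * y)) ^ N" by (intro power_mono) auto
      then have "\<bar>f y\<bar> \<le> C * (2 ^ N * (1 + y * y) ^ N)"
        using growthD[OF g, of y] C unfolding power_mult_distrib by (meson mult_left_mono order_trans)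
      then have "\<bar>ev X \<omega>\<bar> * \<bar>f y\<bar> \<le> \<bar>ev X \<omega>\<bar> * (C * (2 ^ N * (1 + y * y) ^ N))" by (intro mult_left_mono) auto
      moreover have "\<bar>(1 + y * y) ^ N\<bar> = (1 + y * y) ^ N" by (simp add: add_nonneg_nonneg)
      ultimately show ?thesis by (simp add: y_def[symmetric] abs_mult mult_ac)
    qed
    have ev2: "(\<lambda>\<omega>. (ev Y \<omega>)\<^sup>2) = ev (Y * Y)" for Y by (simp add: fun_eq_iff power2_eq_square)
    have "\<bar>TT F f X\<bar> \<le> E (\<lambda>\<omega>. \<bar>ev X \<omega> * f (ev F \<omega>)\<bar>)" unfolding TT_def by (rule integral_abs_bound)
    also have "\<dots> \<le> E (\<lambda>\<omega>. C * 2 ^ N * \<bar>ev X \<omega> * ev ?Z \<omega>\<bar>)"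
    proof (rule integral_mono)
      have "integrable gauss_space (ev (X * ?Z))" by simp
      then show "integrable gauss_space (\<lambda>\<omega>. C * 2 ^ N * \<bar>ev X \<omega> * ev ?Z \<omega>\<bar>)"
        by (intro integrable_mult_right integrable_abs) (simp only: ev_fun_simps)
    qed (use le TT_integrable[OF c g, of X F] in auto)
    also have "\<dots> = C * 2 ^ N * E (\<lambda>\<omega>. \<bar>ev X \<omega> * ev ?Z \<omega>\<bar>)" by simp
    also have "\<dots> \<le> C * 2 ^ N * (nrm X * nrm ?Z)"
      using L2_cauchy_schwarz[of "ev X" "ev ?Z"] C unfolding ev2
      by (intro mult_left_mono) (auto simp: nrm_def Em_def)
    also have "\<dots> \<le> C * 2 ^ N * (nrm X * K)" using K(2)[OF F] C by (intro mult_left_mono) auto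
    finally show ?thesis by (simp add: mult_ac)
  qed
  then show ?thesis using K(1) by (intro exI[of _ "2 ^ N * K"]) auto
qed

section \<open>Products of iterated derivatives of g, their orders, and the iteration\<close>

definition XX :: "nat \<Rightarrow> nat \<Rightarrow> pf \<Rightarrow> nat list \<Rightarrow> pf" where
  "XX p n F ks = prod_list (map (gk p n F) ks)"

lemma XX_bound:
  assumes p: "1 \<le> p"
  shows "\<exists>K\<ge>0. \<forall>n F. adm p n F \<longrightarrow> Pd n (sum_list (map (\<lambda>k. k * p + 2 * p) ks)) (XX p n F ks) \<and>
     nrm (XX p n F ks) \<le> K * eta p n F ^ sum_list (map gord ks)"
proof (induction ks)
  case Nil
  have "nrm 1 = 1" by (simp add: nrm_def)
  then show ?case by (intro exI[of _ 1]) (auto simp: XX_def)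
next
  case (Cons k ks)
  let ?d = "sum_list (map (\<lambda>k. k * p + 2 * p) ks)"
  obtain K where K: "0 \<le> K" "\<And>n F. adm p n F \<Longrightarrow> Pd n ?d (XX p n F ks)"
     "\<And>n F. adm p n F \<Longrightarrow> nrm (XX p n F ks) \<le> K * eta p n F ^ sum_list (map gord ks)" using Cons by blast
  obtain L where L: "0 \<le> L" "\<And>n F. adm p n F \<Longrightarrow> nrm (gk p n F k) \<le> L * eta p n F ^ gord k" using gk_bound[OF p] by blast
  obtain M where M: "0 \<le> M" "\<And>n X Y. Pd n (k * p + 2 * p) X \<Longrightarrow> Pd n ?d Y \<Longrightarrow> nrm (X * Y) \<le> M * nrm X * nrm Y"
    using nrm_mult_le by metis
  have "Pd n (k * p + 2 * p + ?d) (gk p n F k * XX p n F ks) \<and>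
     nrm (gk p n F k * XX p n F ks) \<le> (M * L * K) * eta p n F ^ (gord k + sum_list (map gord ks))" if F: "adm p n F" for n F
  proof
    show "Pd n (k * p + 2 * p + ?d) (gk p n F k * XX p n F ks)" by (rule Pd_mult[OF Pd_gk[OF F] K(2)[OF F]])
    have "nrm (gk p n F k * XX p n F ks) \<le> M * nrm (gk p n F k) * nrm (XX p n F ks)"
      by (rule M(2)[OF Pd_gk[OF F] K(2)[OF F]])
    also have "\<dots> \<le> M * (L * eta p n F ^ gord k) * (K * eta p n F ^ sum_list (map gord ks))"
      using L(2)[OF F] K(3)[OF F] M(1) L(1) by (intro mult_mono) auto
    finally show "nrm (gk p n F k * XX p n F ks) \<le> (M * L * K) * eta p n F ^ (gord k + sum_list (map gord ks))"
      by (simp add: power_add mult_ac)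
  qed
  then show ?case using M(1) L(1) K(1) by (intro exI[of _ "M * L * K"]) (auto simp: XX_def)
qed

lemma Gam_XX: "Gam n F (XX p n F ks) = (\<Sum>i<length ks. XX p n F (ks[i := Suc (ks ! i)]))"
proof (induction ks)
  case Nil
  then show ?case by (simp add: XX_def)
next
  case (Cons k ks)
  have "Gam n F (gk p n F k) = gk p n F (Suc k)" by (simp add: gk_def)
  moreover have "XX p n F (k # ks) = gk p n F k * XX p n F ks" for k ks by (simp add: XX_def)
  moreover have "(\<Sum>i<length (k # ks). XX p n F ((k # ks)[i := Suc ((k # ks) ! i)]))
      = XX p n F (Suc k # ks) + (\<Sum>i<length ks. XX p n F (k # ks[i := Suc (ks ! i)]))"
    by (simp add: sum.lessThan_Suc_shift del: sum.lessThan_Suc)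
  ultimately show ?case
    by (simp add: Gam_mult_right Cons sum_distrib_left del: sum.lessThan_Suc)
qed

lemma gord_ge: "k + 3 \<le> 2 * gord k"
  by (auto simp: gord_def)

lemma gord_ge': "k + 4 \<le> 2 * gord k \<or> k = 1"
  by (auto simp: gord_def)

lemma gord_sum_ge: "sum_list (map (\<lambda>k. k + 2) ks) + length ks \<le> 2 * sum_list (map gord ks)"
proof (induction ks)
  case (Cons k ks)
  then show ?case using gord_ge[of k] by simp
qed simp

text \<open>Three or more factors suffice by \<open>k + 3 <= 2 * gord k\<close> and parity. Two
  suffice by \<open>k + 4 <= 2 * gord k\<close>, apart from \<open>k = 1\<close>, where parity
  helps. A single factor with \<open>k >= 3\<close> has order \<open>k div 2 + 3\<close>; the
  exceptional D^2 g has order 3 where 4 is wanted.\<close>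

lemma gord_sum:
  assumes ks: "ks \<noteq> []" and m: "1 \<le> m" and s: "4 * m \<le> sum_list (map (\<lambda>k. k + 2) ks)"
  shows "2 * m + 2 \<le> sum_list (map gord ks) \<or> m = 1 \<and> ks = [2]"
proof -
  consider k where "ks = [k]" | j k where "ks = [j, k]" | a b c ks' where "ks = a # b # c # ks'"
    using ks by (metis neq_Nil_conv)
  then show ?thesis
  proof cases
    case 1
    consider "k \<le> 1" | "k = 2" | "3 \<le> k" by linarith
    then show ?thesis using 1 s m by cases (auto simp: gord_def)
  next
    case 2
    have "gord 1 = 2" by (simp add: gord_def)
    moreover have "4 * m \<le> j + k + 4" using s 2 by simp
    ultimately have "2 * m + 2 \<le> gord j + gord k"
      using gord_ge'[of j] gord_ge'[of k] by (elim disjE) auto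
    then show ?thesis using 2 by simp
  next
    case 3
    then show ?thesis using gord_sum_ge[of ks] s by simp
  qed
qed

lemma gorthD: "gorth r N C f \<Longrightarrow> continuous_on UNIV f" "gorth r N C f \<Longrightarrow> growth N C f"
  by (auto simp: gorth_def)

lemma gorth_subtract_mean:
  assumes "gorth 0 N C f"
  shows "gorth 1 N (C + C * gmom N) (\<lambda>x. f x - (\<integral>y. f y \<partial>std_gaussian))"
proof -
  have m [measurable]: "f \<in> borel_measurable borel"
    by (rule borel_measurable_continuous_onI[OF gorthD(1)[OF assms]])
  let ?c = "\<integral>y. f y \<partial>std_gaussian"
  have "\<bar>?c\<bar> \<le> C * gmom N" by (rule growth_integral_bound[OF m gorthD(2)[OF assms]])
  then have "growth N (C * gmom N) (\<lambda>_. ?c)" by (intro growth_mono[OF growth_const]) auto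
  then have "growth N (C + C * gmom N) (\<lambda>x. f x - ?c)" by (rule growth_diff[OF gorthD(2)[OF assms]])
  moreover have "(\<integral>x. f x - ?c \<partial>std_gaussian) = 0"
  proof -
    interpret S: prob_space std_gaussian by (rule prob_space_std_gaussian)
    show ?thesis using growth_integrable[OF m gorthD(2)[OF assms]] S.prob_space by simp
  qed
  ultimately show ?thesis
    unfolding gorth_def using gorthD(1)[OF assms] by (auto intro!: continuous_intros)
qed

text \<open>For \<open>m = 1\<close> the term \<open>E[D\<^sup>2 g f(F)]\<close> is not small enough by itself; after subtracting the
  Gaussian mean of \<open>f\<close> a further integration by parts is available.\<close>

lemma second_derivative_term:
  assumes p: "1 \<le> p"
  shows "\<exists>K\<ge>0. \<forall>n F f C. adm p n F \<longrightarrow> gorth 0 N C f \<longrightarrow> \<bar>TT F f (gk p n F 2)\<bar> \<le> K * C * eta p n F ^ 4"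
proof -
  obtain A where A: "0 \<le> A" "\<And>n F. adm p n F \<Longrightarrow> \<bar>Em (gk p n F 2)\<bar> \<le> A * eta p n F ^ 4" using Em_gk_2[OF p] by blast
  obtain B where B: "0 \<le> B" "\<And>n F f C X. adm p n F \<Longrightarrow> continuous_on UNIV f \<Longrightarrow> growth N C f \<Longrightarrow> \<bar>TT F f X\<bar> \<le> B * C * nrm X"
    using TT_bound by blast
  obtain B' where B': "0 \<le> B'" "\<And>n F f C X. adm p n F \<Longrightarrow> continuous_on UNIV f \<Longrightarrow> growth (Suc N) C f \<Longrightarrow> \<bar>TT F f X\<bar> \<le> B' * C * nrm X"
    using TT_bound by blast
  \<comment> \<open>The extra integration by parts produces D^3 g, of order 4, and g D^2 g, of order
    2 + 3 = 5; the latter is reduced to order 4 by \<open>H\<close>.\<close>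
  obtain D where D: "0 \<le> D" "\<And>n F. adm p n F \<Longrightarrow> nrm (XX p n F [3]) \<le> D * eta p n F ^ 4"
    using XX_bound[OF p, of "[3]"] by (auto simp: gord_def)
  obtain G where G: "0 \<le> G" "\<And>n F. adm p n F \<Longrightarrow> nrm (XX p n F [0, 2]) \<le> G * eta p n F ^ 5"
    using XX_bound[OF p, of "[0, 2]"] by (auto simp: gord_def)
  obtain H where H: "0 \<le> H" "\<And>n F. adm p n F \<Longrightarrow> eta p n F ^ 5 \<le> H * eta p n F ^ 4"
    using eta_power_le[OF p, of 4 5] by auto
  define t where "t = tailc N * (1 + gmom N)"
  define t' where "t' = (tailc N + 1) * (1 + gmom N)"
  have t: "0 \<le> t" "0 \<le> t'" using tailc_nonneg[of N] gmom_nonneg[of N] by (auto simp: t_def t'_def)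
  define K where "K = gmom N * A + B * t * D / real p + B' * t' * (G * H)"
  have "\<bar>TT F f (gk p n F 2)\<bar> \<le> K * C * eta p n F ^ 4" if F: "adm p n F" and f: "gorth 0 N C f" for n F f C
  proof -
    let ?X = "gk p n F 2" let ?c = "\<integral>y. f y \<partial>std_gaussian" let ?f0 = "\<lambda>x. f x - ?c"
    have C: "0 \<le> C" by (rule growth_nonneg[OF gorthD(2)[OF f]])
    have f0: "gorth 1 N (C + C * gmom N) ?f0" by (rule gorth_subtract_mean[OF f])
    obtain u where u: "\<And>x. (u has_real_derivative x * u x - ?f0 x) (at x)"
      "gorth 0 N (tailc N * (C + C * gmom N)) u" "gorth 0 (Suc N) ((tailc N + 1) * (C + C * gmom N)) (\<lambda>x. x * u x - ?f0 x)"
      using gorth_stein[OF f0] by auto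
    have e: "tailc N * (C + C * gmom N) = t * C" "(tailc N + 1) * (C + C * gmom N) = t' * C"
      by (simp_all add: t_def t'_def algebra_simps)
    note gu = gorthD[OF u(2), unfolded e] gorthD[OF u(3), unfolded e]
    have e1: "TT F ?f0 ?X = TT F u (Gam n F ?X) / real p + TT F (\<lambda>x. x * u x - ?f0 x) (gg p n F * ?X)"
      by (rule TT_stein[OF p F u(1) gorthD(1)[OF f0] gu(2,4) gorthD(2)[OF f0]])
    have e2: "Gam n F ?X = XX p n F [3]" by (simp add: XX_def gk_def numeral_3_eq_3 numeral_2_eq_2)
    have e3: "gg p n F * ?X = XX p n F [0, 2]" by (simp add: XX_def gk_def)
    have e4: "TT F f ?X = TT F ?f0 ?X + ?c * Em ?X"
    proof -
      have "TT F f ?X = E (\<lambda>\<omega>. ev ?X \<omega> * ?f0 (ev F \<omega>) + ?c * ev ?X \<omega>)"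
        unfolding TT_def by (intro Bochner_Integration.integral_cong) (auto simp: algebra_simps)
      then show ?thesis
        using TT_integrable[OF gorthD[OF f0], of ?X F] by (simp add: TT_def Em_def)
    qed
    have b1: "\<bar>TT F u (XX p n F [3])\<bar> / real p \<le> B * (t * C) * (D * eta p n F ^ 4) / real p"
    proof -
      have "\<bar>TT F u (XX p n F [3])\<bar> \<le> B * (t * C) * nrm (XX p n F [3])" by (rule B(2)[OF F gu(1,2)])
      also have "\<dots> \<le> B * (t * C) * (D * eta p n F ^ 4)"
        using D(2)[OF F] B(1) t(1) C by (intro mult_left_mono) auto
      finally show ?thesis by (simp add: divide_right_mono)
    qed
    have b2: "\<bar>TT F (\<lambda>x. x * u x - ?f0 x) (XX p n F [0, 2])\<bar> \<le> B' * (t' * C) * (G * (H * eta p n F ^ 4))"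
    proof -
      have "\<bar>TT F (\<lambda>x. x * u x - ?f0 x) (XX p n F [0, 2])\<bar> \<le> B' * (t' * C) * nrm (XX p n F [0, 2])" by (rule B'(2)[OF F gu(3,4)])
      also have "nrm (XX p n F [0, 2]) \<le> G * (H * eta p n F ^ 4)"
        using order_trans[OF G(2)[OF F] mult_left_mono[OF H(2)[OF F] G(1)]] .
      finally show ?thesis using B'(1) t(2) C by (simp add: mult_left_mono)
    qed
    have b3: "\<bar>?c * Em ?X\<bar> \<le> (C * gmom N) * (A * eta p n F ^ 4)"
      unfolding abs_mult using C gmom_nonneg[of N] A(2)[OF F]
        growth_integral_bound[OF borel_measurable_continuous_onI[OF gorthD(1)[OF f]] gorthD(2)[OF f]]
      by (intro mult_mono) auto
    have e5: "K * C * eta p n F ^ 4 = B * (t * C) * (D * eta p n F ^ 4) / real p + B' * (t' * C) * (G * (H * eta p n F ^ 4)) + (C * gmom N) * (A * eta p n F ^ 4)"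
      by (simp add: K_def algebra_simps)
    have tri: "\<bar>a / real p + b + c\<bar> \<le> \<bar>a\<bar> / real p + \<bar>b\<bar> + \<bar>c\<bar>" for a b c :: real
      using abs_triangle_ineq[of "a / real p + b" c] abs_triangle_ineq[of "a / real p" b] by simp
    show ?thesis unfolding e4 e1 e2 e3 e5 by (rule order_trans[OF tri add_mono[OF add_mono[OF b1 b2] b3]])
  qed
  then show ?thesis using A(1) B(1) B'(1) D(1) G(1) H(1) t gmom_nonneg[of N] unfolding K_def
    by (intro exI[of _ "gmom N * A + B * t * D / real p + B' * t' * (G * H)"]) auto
qed

text \<open>The premise is the invariant of the recursion, and the recursion stops at
  \<open>r = 0\<close>, where \<open>gord_sum\<close> takes over. The exponent \<open>N\<close> is
  generalised because the derivative of a Stein solution may grow one power faster.\<close>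

lemma iterated_stein:
  assumes p: "1 \<le> p" and m: "1 \<le> m"
  shows "4 * m \<le> sum_list (map (\<lambda>k. k + 2) ks) + r \<Longrightarrow>
    \<exists>K\<ge>0. \<forall>n F f C. adm p n F \<longrightarrow> gorth r N C f \<longrightarrow> \<bar>TT F f (XX p n F ks)\<bar> \<le> K * C * eta p n F ^ (2 * m + 2)"
proof (induction r arbitrary: ks N rule: less_induct)
  case (less r)
  show ?case
  proof (cases "r = 0")
    case True
    then have s: "4 * m \<le> sum_list (map (\<lambda>k. k + 2) ks)" using less.prems by simp
    then have "ks \<noteq> []" using m by auto
    from gord_sum[OF this m s] show ?thesis
    proof
      assume o: "2 * m + 2 \<le> sum_list (map gord ks)"
      obtain B where B: "0 \<le> B" "\<And>n F f C X. adm p n F \<Longrightarrow> continuous_on UNIV f \<Longrightarrow> growth N C f \<Longrightarrow> \<bar>TT F f X\<bar> \<le> B * C * nrm X"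
        using TT_bound by blast
      obtain D where D: "0 \<le> D" "\<And>n F. adm p n F \<Longrightarrow> nrm (XX p n F ks) \<le> D * eta p n F ^ sum_list (map gord ks)"
        using XX_bound[OF p, of ks] by blast
      obtain H where H: "0 \<le> H" "\<And>n F. adm p n F \<Longrightarrow> eta p n F ^ sum_list (map gord ks) \<le> H * eta p n F ^ (2 * m + 2)"
        using eta_power_le[OF p o] by blast
      have "\<bar>TT F f (XX p n F ks)\<bar> \<le> (B * (D * H)) * C * eta p n F ^ (2 * m + 2)" if F: "adm p n F" and f: "gorth r N C f" for n F f C
      proof -
        have "\<bar>TT F f (XX p n F ks)\<bar> \<le> B * C * nrm (XX p n F ks)" by (rule B(2)[OF F gorthD[OF f]])
        also have "\<dots> \<le> B * C * (D * (H * eta p n F ^ (2 * m + 2)))"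
          using order_trans[OF D(2)[OF F] mult_left_mono[OF H(2)[OF F] D(1)]] B(1) growth_nonneg[OF gorthD(2)[OF f]]
          by (intro mult_left_mono) auto
        finally show ?thesis by (simp add: mult_ac)
      qed
      then show ?thesis using B(1) D(1) H(1) by (intro exI[of _ "B * (D * H)"]) auto
    next
      assume "m = 1 \<and> ks = [2]"
      then show ?thesis using second_derivative_term[OF p, of N] True by (simp add: XX_def)
    qed
  next
    case False
    have "\<exists>K\<ge>0. \<forall>n F f C. adm p n F \<longrightarrow> gorth (r - 1) N C f \<longrightarrow> \<bar>TT F f (XX p n F (ks[i := Suc (ks ! i)]))\<bar> \<le> K * C * eta p n F ^ (2 * m + 2)"
      if i: "i < length ks" for i
    proof (rule less.IH)
      have "sum_list (map (\<lambda>k. k + 2) (ks[i := Suc (ks ! i)])) = Suc (sum_list (map (\<lambda>k. k + 2) ks))"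
        using i by (simp add: map_update sum_list_update)
      then show "4 * m \<le> sum_list (map (\<lambda>k. k + 2) (ks[i := Suc (ks ! i)])) + (r - 1)"
        using less.prems False by simp
    qed (use False in simp)
    then obtain K where K: "\<And>i. i < length ks \<Longrightarrow> 0 \<le> K i" "\<And>i n F f C. i < length ks \<Longrightarrow> adm p n F \<Longrightarrow> gorth (r - 1) N C f \<Longrightarrow>
       \<bar>TT F f (XX p n F (ks[i := Suc (ks ! i)]))\<bar> \<le> K i * C * eta p n F ^ (2 * m + 2)" by metis
    \<comment> \<open>At \<open>r = 1\<close> truncation makes \<open>r - 2\<close> zero while the
      new entry still adds weight 2, so the invariant survives.\<close>
    have "4 * m \<le> sum_list (map (\<lambda>k. k + 2) (0 # ks)) + (r - 2)" using less.prems by simp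
    from less.IH[OF _ this, of "Suc N"] False obtain L where L: "0 \<le> L" "\<And>n F f C. adm p n F \<Longrightarrow> gorth (r - 2) (Suc N) C f \<Longrightarrow>
       \<bar>TT F f (XX p n F (0 # ks))\<bar> \<le> L * C * eta p n F ^ (2 * m + 2)" by auto
    define KK where "KK = (\<Sum>i<length ks. K i) * tailc N / real p + L * (tailc N + 1)"
    have "\<bar>TT F f (XX p n F ks)\<bar> \<le> KK * C * eta p n F ^ (2 * m + 2)" if F: "adm p n F" and f: "gorth r N C f" for n F f C
    proof -
      obtain u where u: "\<And>x. (u has_real_derivative x * u x - f x) (at x)"
        "gorth (r - 1) N (tailc N * C) u" "gorth (r - 2) (Suc N) ((tailc N + 1) * C) (\<lambda>x. x * u x - f x)"
        using gorth_stein[OF f] False by auto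
      have "TT F f (XX p n F ks) = TT F u (Gam n F (XX p n F ks)) / real p + TT F (\<lambda>x. x * u x - f x) (gg p n F * XX p n F ks)"
        by (rule TT_stein[OF p F u(1) gorthD(1)[OF f] gorthD(2)[OF u(2)] gorthD(2)[OF u(3)] gorthD(2)[OF f]])
      also have "TT F u (Gam n F (XX p n F ks)) = (\<Sum>i<length ks. TT F u (XX p n F (ks[i := Suc (ks ! i)])))"
        unfolding Gam_XX by (rule TT_sum[OF gorthD[OF u(2)]])
      also have "gg p n F * XX p n F ks = XX p n F (0 # ks)" by (simp add: XX_def gk_def)
      finally have e: "TT F f (XX p n F ks) = (\<Sum>i<length ks. TT F u (XX p n F (ks[i := Suc (ks ! i)]))) / real p
         + TT F (\<lambda>x. x * u x - f x) (XX p n F (0 # ks))" .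
      have "\<bar>\<Sum>i<length ks. TT F u (XX p n F (ks[i := Suc (ks ! i)]))\<bar> \<le> (\<Sum>i<length ks. K i * (tailc N * C) * eta p n F ^ (2 * m + 2))"
        by (intro order_trans[OF sum_abs] sum_mono K(2)[OF _ F u(2)]) auto
      then have a: "\<bar>(\<Sum>i<length ks. TT F u (XX p n F (ks[i := Suc (ks ! i)]))) / real p\<bar> \<le> (\<Sum>i<length ks. K i) * (tailc N * C) * eta p n F ^ (2 * m + 2) / real p"
        unfolding abs_divide by (simp add: sum_distrib_right divide_right_mono)
      have b: "\<bar>TT F (\<lambda>x. x * u x - f x) (XX p n F (0 # ks))\<bar> \<le> L * ((tailc N + 1) * C) * eta p n F ^ (2 * m + 2)"
        by (rule L(2)[OF F u(3)])
      have "KK * C * eta p n F ^ (2 * m + 2) = (\<Sum>i<length ks. K i) * (tailc N * C) * eta p n F ^ (2 * m + 2) / real p + L * ((tailc N + 1) * C) * eta p n F ^ (2 * m + 2)"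
        by (simp add: KK_def algebra_simps)
      then show ?thesis unfolding e using a b by linarith
    qed
    moreover have "0 \<le> KK" using K(1) L(1) tailc_nonneg[of N] by (auto simp: KK_def intro!: add_nonneg_nonneg mult_nonneg_nonneg divide_nonneg_nonneg sum_nonneg)
    ultimately show ?thesis by blast
  qed
qed

definition hproj :: "nat \<Rightarrow> (real \<Rightarrow> real) \<Rightarrow> real \<Rightarrow> real" where
  "hproj r h x = h x - (\<Sum>k<r. (\<integral>y. h y * hermite k y \<partial>std_gaussian) / fact k * hermite k x)"

lemma hproj_gorth: "\<exists>C\<ge>0. \<forall>h. continuous_on UNIV h \<longrightarrow> (\<forall>x. \<bar>h x\<bar> \<le> 1) \<longrightarrow> gorth r r C (hproj r h)"
proof -
  obtain C where C: "\<And>k. growth k (C k) (hermite k)" using hermite_growth by metis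
  have "0 \<le> C k" for k using growth_nonneg[OF C] .
  then show ?thesis
    unfolding hproj_def using gorth_project[of _ r C] C gmom_nonneg
    by (intro exI[of _ "1 + (\<Sum>k<r. C k * gmom k / fact k * C k)"]) (auto intro!: add_nonneg_nonneg sum_nonneg)
qed

text \<open>The iteration starts from the empty product with all \<open>4 * m\<close> relations, and
  \<open>eta ^ (2 * m + 2)\<close> is the power \<open>m + 1\<close> of the norm of
  \<open>gg\<close>.\<close>

theorem polynomial_expansion:
  assumes p: "1 \<le> p" and m: "1 \<le> m"
  shows "\<exists>K\<ge>0. \<forall>n F h. adm p n F \<longrightarrow> continuous_on UNIV h \<longrightarrow> (\<forall>x. \<bar>h x\<bar> \<le> 1) \<longrightarrow>
     \<bar>E (\<lambda>\<omega>. hproj (4 * m) h (ev F \<omega>))\<bar> \<le> K * nrm (gg p n F) ^ (m + 1)"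
proof -
  obtain C where C: "0 \<le> C" "\<And>h. continuous_on UNIV h \<Longrightarrow> (\<forall>x. \<bar>h x\<bar> \<le> 1) \<Longrightarrow> gorth (4 * m) (4 * m) C (hproj (4 * m) h)"
    using hproj_gorth by blast
  obtain K where K: "0 \<le> K" "\<And>n F f C. adm p n F \<Longrightarrow> gorth (4 * m) (4 * m) C f \<Longrightarrow> \<bar>TT F f (XX p n F [])\<bar> \<le> K * C * eta p n F ^ (2 * m + 2)"
    using iterated_stein[OF p m, of "[]" "4 * m" "4 * m"] by auto
  have "eta p n F ^ (2 * m + 2) = nrm (gg p n F) ^ (m + 1)" for n F
    using power_mult[of "eta p n F" 2 "m + 1"] by (simp add: eta_sq)
  then show ?thesis
    using K(1) C(1) K(2)[OF _ C(2)] by (intro exI[of _ "K * C"]) (auto simp: TT_def XX_def)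
qed

section \<open>Approximation of Wiener chaos by polynomial functionals\<close>

lemma W_mono: "W n q X \<Longrightarrow> n \<le> n' \<Longrightarrow> W n' q X"
  by (induction rule: W.induct) (auto intro: W.intros)

text \<open>Repeated creation from 1 in one coordinate gives its Hermite polynomials
  (\<open>ev_hpf\<close>); this links \<open>W\<close> with the products that define the Wiener
  chaos.\<close>

primrec hpf :: "nat \<Rightarrow> nat \<Rightarrow> pf" where
  "hpf i 0 = 1"
| "hpf i (Suc l) = cr i (hpf i l)"

lemma pd_hpf: "pd j (hpf i l) = (if i = j then real l *\<^sub>R hpf i (l - 1) else 0)"
proof (induction l)
  case (Suc l)
  have "real l *\<^sub>R cr i (hpf i (l - 1)) = real l *\<^sub>R hpf i l" by (cases l) auto
  then show ?case using Suc by (auto simp: pd_cr cr_scaleR algebra_simps)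
qed simp

lemma ev_hpf: "ev (hpf i l) \<omega> = hermite l (\<omega> i)"
proof (induction l rule: less_induct)
  case (less l)
  show ?case
  proof (cases l)
    case (Suc k)
    have "ev (hpf i (k - 1)) \<omega> = hermite (k - 1) (\<omega> i)" "ev (hpf i k) \<omega> = hermite k (\<omega> i)"
      using less[of "k - 1"] less[of k] Suc by auto
    then show ?thesis by (simp add: Suc cr_def pd_hpf hermite_Suc)
  qed simp
qed

text \<open>By \<open>cr_mult\<close> the condition \<open>pd i Y = 0\<close> lets
  \<open>cr i\<close> act on the first factor alone.\<close>

lemma W_hpf_mult:
  assumes "W n q Y" "i < n" "pd i Y = 0" shows "W n (q + l) (hpf i l * Y)"
proof (induction l)
  case 0
  then show ?case using assms by simp
next
  case (Suc l)
  then show ?case using W_cr[OF Suc assms(2)] assms(3) by (simp add: cr_mult)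
qed

text \<open>The vanishing derivatives outside \<open>S\<close> are carried through the induction to
  feed \<open>W_hpf_mult\<close> at the next coordinate.\<close>

lemma hermite_prod_W:
  assumes "finite S"
  shows "\<exists>n Y. W n (\<Sum>i\<in>S. k i) Y \<and> (\<forall>j. j \<notin> S \<longrightarrow> pd j Y = 0) \<and> ev Y = (\<lambda>\<omega>. \<Prod>i\<in>S. hermite (k i) (\<omega> i))"
  using assms
proof induction
  case empty
  have "W 0 0 1" using W_const[of 0 1] by simp
  then show ?case by (intro exI[of _ 0] exI[of _ 1]) (auto simp: fun_eq_iff)
next
  case (insert a S)
  then obtain n Y where Y: "W n (\<Sum>i\<in>S. k i) Y" "\<And>j. j \<notin> S \<Longrightarrow> pd j Y = 0" "ev Y = (\<lambda>\<omega>. \<Prod>i\<in>S. hermite (k i) (\<omega> i))"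
    by blast
  let ?n = "max n (Suc a)" let ?Z = "hpf a (k a) * Y"
  have "W ?n ((\<Sum>i\<in>S. k i) + k a) ?Z"
    by (rule W_hpf_mult[OF W_mono[OF Y(1)]]) (use Y(2) insert in auto)
  moreover have "\<forall>j. j \<notin> insert a S \<longrightarrow> pd j ?Z = 0" using Y(2) by (auto simp: pd_mult pd_hpf)
  moreover have "ev ?Z = (\<lambda>\<omega>. \<Prod>i\<in>insert a S. hermite (k i) (\<omega> i))"
    using insert Y(3) by (auto simp: fun_eq_iff ev_hpf)
  ultimately show ?case using insert by (intro exI[of _ ?n] exI[of _ ?Z]) (auto simp: add.commute)
qed

lemma lin_span_W:
  assumes "X \<in> lin_span (hermite_products p)"
  shows "\<exists>n Y. W n p Y \<and> ev Y = X"
proof -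
  obtain A c where A: "finite A" "A \<subseteq> hermite_products p" "X = (\<lambda>\<omega>. \<Sum>\<Phi>\<in>A. c \<Phi> * \<Phi> \<omega>)"
    using assms unfolding lin_span_def by blast
  have "\<exists>n Y. W n p Y \<and> ev Y = \<Phi>" if "\<Phi> \<in> A" for \<Phi>
  proof -
    obtain k where k: "\<Phi> = (\<lambda>\<omega>. \<Prod>i | k i \<noteq> 0. hermite (k i) (\<omega> i))" "finite {i. k i \<noteq> 0}" "(\<Sum>i | k i \<noteq> 0. k i) = p"
      using A(2) \<open>\<Phi> \<in> A\<close> unfolding hermite_products_def by blast
    show ?thesis using hermite_prod_W[OF k(2), of k] k by metis
  qed
  then obtain n Y where Y: "\<And>\<Phi>. \<Phi> \<in> A \<Longrightarrow> W (n \<Phi>) p (Y \<Phi>)" "\<And>\<Phi>. \<Phi> \<in> A \<Longrightarrow> ev (Y \<Phi>) = \<Phi>" by metis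
  \<comment> \<open>The sum of the dimensions is a common upper bound for them, so
    \<open>W_mono\<close> puts all summands into one \<open>W m p\<close>.\<close>
  define m where "m = (\<Sum>\<Phi>\<in>A. n \<Phi>)"
  have "W m p (\<Sum>\<Phi>\<in>A. c \<Phi> *\<^sub>R Y \<Phi>)"
  proof (intro W_sum W_scaleR)
    fix \<Phi> assume "\<Phi> \<in> A"
    then show "W m p (Y \<Phi>)" unfolding m_def using A(1) by (intro W_mono[OF Y(1)] member_le_sum) auto
  qed
  moreover have "ev (\<Sum>\<Phi>\<in>A. c \<Phi> *\<^sub>R Y \<Phi>) = X" using Y(2) by (auto simp: A(3) fun_eq_iff intro!: sum.cong)
  ultimately show ?thesis by blast
qed

section \<open>The seminorm of square-integrable functionals, and limits of polynomial
  functionals\<close>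

definition L2n :: "((nat \<Rightarrow> real) \<Rightarrow> real) \<Rightarrow> real" where "L2n f = sqrt (E (\<lambda>\<omega>. (f \<omega>)\<^sup>2))"

lemma L2D: "f \<in> L2 \<Longrightarrow> f \<in> borel_measurable gauss_space" "f \<in> L2 \<Longrightarrow> integrable gauss_space (\<lambda>\<omega>. (f \<omega>)\<^sup>2)"
  by (auto simp: L2_def)

lemma L2n_nonneg [simp]: "0 \<le> L2n f" by (simp add: L2n_def)
lemma L2n_sq: "(L2n f)\<^sup>2 = E (\<lambda>\<omega>. (f \<omega>)\<^sup>2)" by (simp add: L2n_def)

lemma ev_L2: "ev X \<in> L2"
proof -
  have "(\<lambda>\<omega>. (ev X \<omega>)\<^sup>2) = ev (X * X)" by (simp add: fun_eq_iff power2_eq_square)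
  then show ?thesis by (simp add: L2_def)
qed

lemma L2n_ev: "L2n (ev X) = nrm X"
proof -
  have "(\<lambda>\<omega>. (ev X \<omega>)\<^sup>2) = ev (X * X)" by (simp add: fun_eq_iff power2_eq_square)
  then show ?thesis by (simp add: L2n_def nrm_def Em_def)
qed

lemma L2_mult_integrable: "f \<in> L2 \<Longrightarrow> g \<in> L2 \<Longrightarrow> integrable gauss_space (\<lambda>\<omega>. f \<omega> * g \<omega>)"
  by (intro L2_product_integrable) (auto simp: L2_def)

lemma L2_CS: "f \<in> L2 \<Longrightarrow> g \<in> L2 \<Longrightarrow> E (\<lambda>\<omega>. \<bar>f \<omega> * g \<omega>\<bar>) \<le> L2n f * L2n g"
  unfolding L2n_def by (rule L2_cauchy_schwarz) (auto simp: L2_def)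

lemma L2_CS': "f \<in> L2 \<Longrightarrow> g \<in> L2 \<Longrightarrow> \<bar>E (\<lambda>\<omega>. f \<omega> * g \<omega>)\<bar> \<le> L2n f * L2n g"
  by (rule order_trans[OF integral_abs_bound L2_CS])

lemma L2_add:
  assumes "f \<in> L2" "g \<in> L2"
  shows "(\<lambda>\<omega>. f \<omega> + g \<omega>) \<in> L2" "L2n (\<lambda>\<omega>. f \<omega> + g \<omega>) \<le> L2n f + L2n g"
proof -
  note m [measurable] = L2D(1)[OF assms(1)] L2D(1)[OF assms(2)]
  note i = L2D(2)[OF assms(1)] L2D(2)[OF assms(2)] L2_mult_integrable[OF assms]
  have e: "(\<lambda>\<omega>. (f \<omega> + g \<omega>)\<^sup>2) = (\<lambda>\<omega>. (f \<omega>)\<^sup>2 + (g \<omega>)\<^sup>2 + 2 * (f \<omega> * g \<omega>))"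
    by (simp add: fun_eq_iff power2_sum)
  show "(\<lambda>\<omega>. f \<omega> + g \<omega>) \<in> L2" unfolding L2_def using i by (simp add: e)
  show "L2n (\<lambda>\<omega>. f \<omega> + g \<omega>) \<le> L2n f + L2n g"
  proof (rule power2_le_imp_le)
    show "(L2n (\<lambda>\<omega>. f \<omega> + g \<omega>))\<^sup>2 \<le> (L2n f + L2n g)\<^sup>2"
      using L2_CS'[OF assms] i by (simp add: L2n_sq e power2_sum[of "L2n f"])
  qed simp
qed

lemma L2_scale: assumes "f \<in> L2" shows "(\<lambda>\<omega>. c * f \<omega>) \<in> L2" "L2n (\<lambda>\<omega>. c * f \<omega>) = \<bar>c\<bar> * L2n f"
  using assms by (auto simp: L2_def L2n_def power_mult_distrib real_sqrt_mult)

lemma L2_diff: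
  assumes "f \<in> L2" "g \<in> L2"
  shows "(\<lambda>\<omega>. f \<omega> - g \<omega>) \<in> L2" "L2n (\<lambda>\<omega>. f \<omega> - g \<omega>) \<le> L2n f + L2n g"
  using L2_add[OF assms(1) L2_scale(1)[OF assms(2), of "- 1"]] L2_scale(2)[OF assms(2), of "- 1"] by simp_all

lemma L2n_diff_commute: "L2n (\<lambda>\<omega>. f \<omega> - g \<omega>) = L2n (\<lambda>\<omega>. g \<omega> - f \<omega>)"
  by (simp add: L2n_def power2_commute)

lemma L2n_triangle3:
  assumes "f \<in> L2" "g \<in> L2" "h \<in> L2"
  shows "L2n (\<lambda>\<omega>. f \<omega> - h \<omega>) \<le> L2n (\<lambda>\<omega>. f \<omega> - g \<omega>) + L2n (\<lambda>\<omega>. g \<omega> - h \<omega>)"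
  using L2_add(2)[OF L2_diff(1)[OF assms(1,2)] L2_diff(1)[OF assms(2,3)]] by simp

lemma L2n_tendsto_iff:
  "((\<lambda>k. E (\<lambda>\<omega>. (f k \<omega>)\<^sup>2)) \<longlonglongrightarrow> 0) \<longleftrightarrow> ((\<lambda>k. L2n (f k)) \<longlonglongrightarrow> 0)"
proof
  assume "(\<lambda>k. E (\<lambda>\<omega>. (f k \<omega>)\<^sup>2)) \<longlonglongrightarrow> 0"
  from tendsto_real_sqrt[OF this] show "(\<lambda>k. L2n (f k)) \<longlonglongrightarrow> 0" by (simp add: L2n_def)
next
  assume "(\<lambda>k. L2n (f k)) \<longlonglongrightarrow> 0"
  from tendsto_power[OF this, of 2] show "(\<lambda>k. E (\<lambda>\<omega>. (f k \<omega>)\<^sup>2)) \<longlonglongrightarrow> 0" by (simp add: L2n_sq)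
qed

lemma wiener_chaos_approx:
  assumes "F \<in> wiener_chaos p"
  shows "\<exists>n Y. (\<forall>k. W (n k) p (Y k)) \<and> (\<lambda>k. L2n (\<lambda>\<omega>. ev (Y k) \<omega> - F \<omega>)) \<longlonglongrightarrow> 0"
proof -
  obtain G where G: "\<And>k. G k \<in> lin_span (hermite_products p)" "(\<lambda>k. E (\<lambda>\<omega>. (G k \<omega> - F \<omega>)\<^sup>2)) \<longlonglongrightarrow> 0"
    using assms unfolding wiener_chaos_def by blast
  obtain n Y where "\<And>k. W (n k) p (Y k)" "\<And>k. ev (Y k) = G k" using lin_span_W[OF G(1)] by metis
  moreover from this have "G = (\<lambda>k. ev (Y k))" by auto
  ultimately show ?thesis using G(2) unfolding L2n_tendsto_iff by blast
qed

lemma wiener_chaos_L2: "F \<in> wiener_chaos p \<Longrightarrow> F \<in> L2" by (simp add: wiener_chaos_def)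

text \<open>Approximating polynomials, viewed in a common dimension, are orthogonal by
  \<open>W_orth\<close>; Cauchy-Schwarz controls the error.\<close>

lemma wiener_chaos_orth:
  assumes F: "F \<in> wiener_chaos p" and G: "G \<in> wiener_chaos q" and pq: "p \<noteq> q"
  shows "E (\<lambda>\<omega>. F \<omega> * G \<omega>) = 0"
proof -
  obtain n Y where Y: "\<And>k. W (n k) p (Y k)" "(\<lambda>k. L2n (\<lambda>\<omega>. ev (Y k) \<omega> - F \<omega>)) \<longlonglongrightarrow> 0"
    using wiener_chaos_approx[OF F] by blast
  obtain m Z where Z: "\<And>k. W (m k) q (Z k)" "(\<lambda>k. L2n (\<lambda>\<omega>. ev (Z k) \<omega> - G \<omega>)) \<longlonglongrightarrow> 0"
    using wiener_chaos_approx[OF G] by blast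
  note L = wiener_chaos_L2[OF F] wiener_chaos_L2[OF G]
  let ?a = "\<lambda>k. L2n (\<lambda>\<omega>. ev (Y k) \<omega> - F \<omega>)" and ?b = "\<lambda>k. L2n (\<lambda>\<omega>. ev (Z k) \<omega> - G \<omega>)"
  have bd: "\<bar>E (\<lambda>\<omega>. F \<omega> * G \<omega>)\<bar> \<le> ?a k * L2n G + (L2n F + ?a k) * ?b k" for k
  proof -
    have "W (max (n k) (m k)) p (Y k)" "W (max (n k) (m k)) q (Z k)" using W_mono[OF Y(1)] W_mono[OF Z(1)] by auto
    then have "Em (Y k * Z k) = 0" using W_orth pq by blast
    then have 0: "E (\<lambda>\<omega>. ev (Y k) \<omega> * ev (Z k) \<omega>) = 0" by (simp add: Em_def ev_fun_simps)
    have yF: "(\<lambda>\<omega>. ev (Y k) \<omega> - F \<omega>) \<in> L2" and zG: "(\<lambda>\<omega>. ev (Z k) \<omega> - G \<omega>) \<in> L2"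
      using L2_diff(1)[OF ev_L2] L by auto
    have "L2n (ev (Y k)) \<le> L2n F + ?a k"
      using L2_add(2)[OF yF L(1)] by simp
    from order_trans[OF L2_CS'[OF ev_L2 zG, of "Y k"] mult_right_mono[OF this L2n_nonneg]]
    have 1: "\<bar>E (\<lambda>\<omega>. ev (Y k) \<omega> * (ev (Z k) \<omega> - G \<omega>))\<bar> \<le> (L2n F + ?a k) * ?b k"
      .
    have 2: "\<bar>E (\<lambda>\<omega>. (ev (Y k) \<omega> - F \<omega>) * G \<omega>)\<bar> \<le> ?a k * L2n G" by (rule L2_CS'[OF yF L(2)])
    have "E (\<lambda>\<omega>. F \<omega> * G \<omega>) = E (\<lambda>\<omega>. ev (Y k) \<omega> * ev (Z k) \<omega> - ev (Y k) \<omega> * (ev (Z k) \<omega> - G \<omega>) - (ev (Y k) \<omega> - F \<omega>) * G \<omega>)"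
      by (intro Bochner_Integration.integral_cong) (auto simp: algebra_simps)
    also have "\<dots> = 0 - E (\<lambda>\<omega>. ev (Y k) \<omega> * (ev (Z k) \<omega> - G \<omega>)) - E (\<lambda>\<omega>. (ev (Y k) \<omega> - F \<omega>) * G \<omega>)"
    proof -
      let ?u = "\<lambda>\<omega>. ev (Y k) \<omega> * ev (Z k) \<omega>" and ?v = "\<lambda>\<omega>. ev (Y k) \<omega> * (ev (Z k) \<omega> - G \<omega>)"
        and ?w = "\<lambda>\<omega>. (ev (Y k) \<omega> - F \<omega>) * G \<omega>"
      have i: "integrable gauss_space ?u" "integrable gauss_space ?v" "integrable gauss_space ?w"
        by (rule L2_mult_integrable[OF ev_L2 ev_L2] L2_mult_integrable[OF ev_L2 zG] L2_mult_integrable[OF yF L(2)])+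
      have "E (\<lambda>\<omega>. ?u \<omega> - ?v \<omega> - ?w \<omega>) = E (\<lambda>\<omega>. ?u \<omega> - ?v \<omega>) - E ?w"
        by (rule Bochner_Integration.integral_diff[OF Bochner_Integration.integrable_diff[OF i(1,2)] i(3)])
      also have "E (\<lambda>\<omega>. ?u \<omega> - ?v \<omega>) = E ?u - E ?v"
        by (rule Bochner_Integration.integral_diff[OF i(1,2)])
      finally show ?thesis using 0 by simp
    qed
    finally show ?thesis using 1 2 by linarith
  qed
  have "(\<lambda>k. ?a k * L2n G + (L2n F + ?a k) * ?b k) \<longlonglongrightarrow> 0 * L2n G + (L2n F + 0) * 0"
    by (intro tendsto_intros Y(2) Z(2))
  then have "\<bar>E (\<lambda>\<omega>. F \<omega> * G \<omega>)\<bar> \<le> 0 * L2n G + (L2n F + 0) * 0"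
    by (rule tendsto_lowerbound) (use bd in auto)
  then show ?thesis by simp
qed

lemma wiener_chaos_zero: "(\<lambda>_. 0) \<in> wiener_chaos p"
proof -
  have "(\<lambda>_. 0) \<in> lin_span (hermite_products p)" unfolding lin_span_def
    by (auto intro!: exI[of _ "{}"])
  then show ?thesis unfolding wiener_chaos_def L2_def by (auto intro!: exI[of _ "\<lambda>_ _. 0"])
qed

text \<open>Zero has the defining property of the projection, so \<open>SOME\<close> returns a
  genuine version. That version is orthogonal both to \<open>F\<close> and to \<open>F\<close> minus
  itself, which forces its norm to vanish.\<close>

lemma chaos_proj_other:
  assumes F: "F \<in> wiener_chaos p" and pq: "q \<noteq> p"
  shows "E (\<lambda>\<omega>. (chaos_proj q F \<omega>)\<^sup>2) = 0"
proof -
  let ?P = "\<lambda>G. G \<in> wiener_chaos q \<and> (\<forall>K\<in>wiener_chaos q. E (\<lambda>\<omega>. (F \<omega> - G \<omega>) * K \<omega>) = 0)"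
  have "?P (\<lambda>_. 0)" using wiener_chaos_zero wiener_chaos_orth[OF F] pq by auto
  then have "?P (chaos_proj q F)" unfolding chaos_proj_def by (rule someI[of ?P])
  then have G: "chaos_proj q F \<in> wiener_chaos q" "E (\<lambda>\<omega>. (F \<omega> - chaos_proj q F \<omega>) * chaos_proj q F \<omega>) = 0" by auto
  note L = wiener_chaos_L2[OF F] wiener_chaos_L2[OF G(1)]
  have "E (\<lambda>\<omega>. (F \<omega> - chaos_proj q F \<omega>) * chaos_proj q F \<omega>) = E (\<lambda>\<omega>. F \<omega> * chaos_proj q F \<omega>) - E (\<lambda>\<omega>. (chaos_proj q F \<omega>)\<^sup>2)"
    using L2_mult_integrable[OF L] L2D(2)[OF L(2)] by (simp add: left_diff_distrib power2_eq_square)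
  then show ?thesis using G wiener_chaos_orth[OF F G(1)] pq by simp
qed

lemma wiener_chaos_carre_domain:
  assumes F: "F \<in> wiener_chaos p" shows "F \<in> carre_domain"
proof -
  have "summable (\<lambda>q. real q * E (\<lambda>\<omega>. (chaos_proj q F \<omega>)\<^sup>2))"
    by (rule summable_finite[of "{p}"]) (use chaos_proj_other[OF F] in auto)
  then show ?thesis using wiener_chaos_L2[OF F] by (simp add: carre_domain_def)
qed

lemma wiener_chaos_adm_approx:
  assumes F: "F \<in> wiener_chaos p" and F1: "E (\<lambda>\<omega>. (F \<omega>)\<^sup>2) = 1"
  shows "\<exists>n Z. (\<forall>k. adm p (n k) (Z k)) \<and> (\<lambda>k. L2n (\<lambda>\<omega>. ev (Z k) \<omega> - F \<omega>)) \<longlonglongrightarrow> 0"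
proof -
  obtain n Y where Y: "\<And>k. W (n k) p (Y k)" "(\<lambda>k. L2n (\<lambda>\<omega>. ev (Y k) \<omega> - F \<omega>)) \<longlonglongrightarrow> 0"
    using wiener_chaos_approx[OF F] by blast
  note L = wiener_chaos_L2[OF F]
  let ?a = "\<lambda>k. L2n (\<lambda>\<omega>. ev (Y k) \<omega> - F \<omega>)"
  have LF: "L2n F = 1" using F1 by (simp add: L2n_def)
  have d: "\<bar>nrm (Y k) - 1\<bar> \<le> ?a k" for k
  proof -
    have "L2n (ev (Y k)) \<le> ?a k + L2n F" using L2_add(2)[OF L2_diff(1)[OF ev_L2 L] L] by simp
    moreover have "L2n F \<le> L2n (ev (Y k)) + ?a k"
      using L2_diff(2)[OF ev_L2[of "Y k"] L2_diff(1)[OF ev_L2[of "Y k"] L]] by simp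
    ultimately show ?thesis by (simp add: LF L2n_ev)
  qed
  \<comment> \<open>Dropping finitely many terms keeps the norms above 1/2, so that normalising is
    possible.\<close>
  obtain N where N: "\<And>k. N \<le> k \<Longrightarrow> ?a k < 1 / 2"
    using order_tendstoD(2)[OF Y(2), of "1/2"] unfolding eventually_sequentially by auto
  have pos: "0 < nrm (Y (k + N))" for k using N[of "k + N"] d[of "k + N"] by simp
  define Z where "Z k = (1 / nrm (Y (k + N))) *\<^sub>R Y (k + N)" for k
  have "adm p (n (k + N)) (Z k)" for k
    unfolding adm_def Z_def using Y(1) pos[of k] nrm_sq[of "Y (k + N)"]
    by (auto intro: W_scaleR simp: power2_eq_square field_simps)
  moreover have "(\<lambda>k. L2n (\<lambda>\<omega>. ev (Z k) \<omega> - F \<omega>)) \<longlonglongrightarrow> 0"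
  proof (rule tendsto_sandwich[OF _ _ tendsto_const[of 0]])
    \<comment> \<open>One copy of the error comes from the rescaling, the other from the original
      approximation.\<close>
    have "L2n (\<lambda>\<omega>. ev (Z k) \<omega> - F \<omega>) \<le> 2 * ?a (k + N)" for k
    proof -
      let ?Y = "Y (k + N)"
      have "L2n (\<lambda>\<omega>. ev (Z k) \<omega> - F \<omega>) \<le> L2n (\<lambda>\<omega>. ev (Z k) \<omega> - ev ?Y \<omega>) + ?a (k + N)"
        by (rule L2n_triangle3[OF ev_L2 ev_L2 L])
      also have "(\<lambda>\<omega>. ev (Z k) \<omega> - ev ?Y \<omega>) = ev ((1 / nrm ?Y - 1) *\<^sub>R ?Y)"
        by (simp add: Z_def fun_eq_iff algebra_simps)
      also have "L2n \<dots> = \<bar>(1 / nrm ?Y - 1) * nrm ?Y\<bar>" by (simp add: L2n_ev nrm_scaleR abs_mult)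
      also have "(1 / nrm ?Y - 1) * nrm ?Y = 1 - nrm ?Y" using pos[of k] by (simp add: field_simps)
      finally show ?thesis using d[of "k + N"] by linarith
    qed
    then show "\<forall>\<^sub>F k in sequentially. L2n (\<lambda>\<omega>. ev (Z k) \<omega> - F \<omega>) \<le> 2 * ?a (k + N)" by simp
    show "(\<lambda>k. 2 * ?a (k + N)) \<longlonglongrightarrow> 0"
      using tendsto_mult_right_zero[OF LIMSEQ_ignore_initial_segment[OF Y(2), of N], of 2] by simp
  qed simp
  ultimately show ?thesis by (intro exI[of _ "\<lambda>k. n (k + N)"] exI[of _ Z]) auto
qed

section \<open>Passage to the limit in expectations\<close>

lemma fatou_L2:
  fixes Y :: "nat \<Rightarrow> (nat \<Rightarrow> real) \<Rightarrow> real"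
  assumes m: "\<And>k. Y k \<in> borel_measurable gauss_space" "f \<in> borel_measurable gauss_space"
    and i: "\<And>k. integrable gauss_space (\<lambda>\<omega>. (Y k \<omega>)\<^sup>2)"
    and K: "\<And>k. E (\<lambda>\<omega>. (Y k \<omega>)\<^sup>2) \<le> K"
    and ae: "AE \<omega> in gauss_space. (\<lambda>k. Y k \<omega>) \<longlonglongrightarrow> f \<omega>"
  shows "integrable gauss_space (\<lambda>\<omega>. (f \<omega>)\<^sup>2)" "E (\<lambda>\<omega>. (f \<omega>)\<^sup>2) \<le> K"
proof -
  note m [measurable]
  have K0: "0 \<le> K" using K[of 0] by (rule order_trans[rotated]) (auto intro!: integral_nonneg_AE)
  have "(\<integral>\<^sup>+\<omega>. ennreal ((f \<omega>)\<^sup>2) \<partial>gauss_space) = (\<integral>\<^sup>+\<omega>. liminf (\<lambda>k. ennreal ((Y k \<omega>)\<^sup>2)) \<partial>gauss_space)"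
  proof (rule nn_integral_cong_AE)
    show "AE \<omega> in gauss_space. ennreal ((f \<omega>)\<^sup>2) = liminf (\<lambda>k. ennreal ((Y k \<omega>)\<^sup>2))"
      using ae
    proof eventually_elim
      case (elim \<omega>)
      have "(\<lambda>k. ennreal ((Y k \<omega>)\<^sup>2)) \<longlonglongrightarrow> ennreal ((f \<omega>)\<^sup>2)" by (intro tendsto_ennrealI tendsto_power elim)
      then show ?case by (intro lim_imp_Liminf[symmetric]) auto
    qed
  qed
  also have "\<dots> \<le> liminf (\<lambda>k. \<integral>\<^sup>+\<omega>. ennreal ((Y k \<omega>)\<^sup>2) \<partial>gauss_space)"
    by (rule nn_integral_liminf) measurable
  also have "\<dots> \<le> ennreal K"
  proof -
    have "(\<integral>\<^sup>+\<omega>. ennreal ((Y k \<omega>)\<^sup>2) \<partial>gauss_space) \<le> ennreal K" for k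
      using K[of k] by (subst nn_integral_eq_integral[OF i]) (auto intro: ennreal_leI)
    then show ?thesis by (intro Liminf_le) auto
  qed
  finally have le: "(\<integral>\<^sup>+\<omega>. ennreal ((f \<omega>)\<^sup>2) \<partial>gauss_space) \<le> ennreal K" .
  show int: "integrable gauss_space (\<lambda>\<omega>. (f \<omega>)\<^sup>2)"
    by (rule integrableI_bounded) (use le in \<open>auto simp: ennreal_mult_less_top intro: le_less_trans\<close>)
  show "E (\<lambda>\<omega>. (f \<omega>)\<^sup>2) \<le> K"
    using le K0 by (subst (asm) nn_integral_eq_integral[OF int]) (auto simp: ennreal_le_iff)
qed

lemma L2_integrable: assumes "f \<in> L2" shows "integrable gauss_space f"
  using L2_mult_integrable[OF assms, of "\<lambda>_. 1"] by (simp add: L2_def)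

text \<open>Bounded second moments give uniform integrability: truncation at level \<open>R\<close>
  changes an expectation by at most \<open>K / R\<close>, since the discarded part of
  \<open>x\<close> is at most \<open>x^2 / R\<close>. The truncated functions converge by dominated
  convergence.\<close>

lemma vitali_L2:
  fixes Y :: "nat \<Rightarrow> (nat \<Rightarrow> real) \<Rightarrow> real"
  assumes m: "\<And>k. Y k \<in> borel_measurable gauss_space" "f \<in> borel_measurable gauss_space"
    and i: "\<And>k. integrable gauss_space (\<lambda>\<omega>. (Y k \<omega>)\<^sup>2)"
    and K: "\<And>k. E (\<lambda>\<omega>. (Y k \<omega>)\<^sup>2) \<le> K"
    and ae: "AE \<omega> in gauss_space. (\<lambda>k. Y k \<omega>) \<longlonglongrightarrow> f \<omega>"
  shows "integrable gauss_space f" "(\<lambda>k. E (Y k)) \<longlonglongrightarrow> E f"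
proof -
  note m [measurable]
  note fat = fatou_L2[OF m i K ae]
  have fL: "f \<in> L2" and YL: "Y k \<in> L2" for k using m i fat(1) by (auto simp: L2_def)
  show fi: "integrable gauss_space f" by (rule L2_integrable[OF fL])
  have Yi: "integrable gauss_space (Y k)" for k by (rule L2_integrable[OF YL])
  define c where "c R x = max (- R) (min R x)" for R x :: real
  have cb: "\<bar>c R x\<bar> \<le> R" if "0 < R" for R x using that by (auto simp: c_def)
  have cm [measurable]: "(\<lambda>\<omega>. c R (g \<omega>)) \<in> borel_measurable gauss_space" if [measurable]: "g \<in> borel_measurable gauss_space" for R g
    unfolding c_def by measurable
  have ci: "integrable gauss_space (\<lambda>\<omega>. c R (g \<omega>))" if "0 < R" "g \<in> borel_measurable gauss_space" for R g
    by (rule GS.integrable_const_bound[where B = R]) (use cb that in auto)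
  have tr: "\<bar>x - c R x\<bar> \<le> x\<^sup>2 / R" if R: "0 < R" for x R
  proof (cases "\<bar>x\<bar> \<le> R")
    case True
    then have "c R x = x" by (auto simp: c_def)
    then show ?thesis using R by simp
  next
    case False
    then have "\<bar>x\<bar> * R \<le> \<bar>x\<bar> * \<bar>x\<bar>" by (intro mult_left_mono) auto
    then have "\<bar>x\<bar> \<le> x\<^sup>2 / R" using R by (simp add: field_simps power2_eq_square)
    moreover have "\<bar>x - c R x\<bar> \<le> \<bar>x\<bar>" using False R by (auto simp: c_def)
    ultimately show ?thesis by linarith
  qed
  have trE: "\<bar>E g - E (\<lambda>\<omega>. c R (g \<omega>))\<bar> \<le> K / R"
    if R: "0 < R" and g: "g \<in> L2" "E (\<lambda>\<omega>. (g \<omega>)\<^sup>2) \<le> K" for g R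
  proof -
    have "\<bar>E g - E (\<lambda>\<omega>. c R (g \<omega>))\<bar> = \<bar>E (\<lambda>\<omega>. g \<omega> - c R (g \<omega>))\<bar>"
      using L2_integrable[OF g(1)] ci[OF R L2D(1)[OF g(1)]] by simp
    also have "\<dots> \<le> E (\<lambda>\<omega>. (g \<omega>)\<^sup>2 / R)"
      using tr[OF R] L2_integrable[OF g(1)] ci[OF R L2D(1)[OF g(1)]] L2D(2)[OF g(1)]
      by (intro order_trans[OF integral_abs_bound] integral_mono) auto
    also have "\<dots> \<le> K / R" using g(2) R by (simp add: divide_right_mono)
    finally show ?thesis .
  qed
  have K0: "0 \<le> K" using K[of 0] by (rule order_trans[rotated]) (auto intro!: integral_nonneg_AE)
  show "(\<lambda>k. E (Y k)) \<longlonglongrightarrow> E f"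
  proof (rule LIMSEQ_I)
    fix e :: real assume e: "0 < e"
    \<comment> \<open>This makes each of the two truncation errors smaller than
      \<open>e / 3\<close>.\<close>
    define R where "R = 4 * (K + 1) / e"
    have R: "0 < R" using e K0 by (simp add: R_def)
    have KR: "K / R < e / 3"
    proof -
      have "K / R = e / 4 * (K / (K + 1))" using K0 by (simp add: R_def field_simps)
      also have "\<dots> \<le> e / 4 * 1" using K0 e by (intro mult_left_mono) auto
      finally show ?thesis using e by simp
    qed
    have "(\<lambda>k. E (\<lambda>\<omega>. c R (Y k \<omega>))) \<longlonglongrightarrow> E (\<lambda>\<omega>. c R (f \<omega>))"
    proof (rule integral_dominated_convergence[where w = "\<lambda>_. R"])
      show "AE \<omega> in gauss_space. (\<lambda>k. c R (Y k \<omega>)) \<longlonglongrightarrow> c R (f \<omega>)"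
        using ae by eventually_elim (auto simp: c_def intro!: tendsto_intros)
      show "AE \<omega> in gauss_space. norm (c R (Y k \<omega>)) \<le> R" for k using cb[OF R] by simp
    qed auto
    from LIMSEQ_D[OF this, of "e / 3"] e obtain N where N: "\<And>k. N \<le> k \<Longrightarrow> \<bar>E (\<lambda>\<omega>. c R (Y k \<omega>)) - E (\<lambda>\<omega>. c R (f \<omega>))\<bar> < e / 3"
      by auto
    have "norm (E (Y k) - E f) < e" if "N \<le> k" for k
      using N[OF that] trE[OF R YL[of k] K] trE[OF R fL fat(2)] KR unfolding real_norm_def by linarith
    then show "\<exists>N. \<forall>k\<ge>N. norm (E (Y k) - E f) < e" by blast
  qed
qed

text \<open>An almost surely Cauchy subsequence defines the limit, and Fatou's lemma transfers the
  Cauchy estimate to it.\<close>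

lemma L1_complete:
  fixes s :: "nat \<Rightarrow> (nat \<Rightarrow> real) \<Rightarrow> real"
  assumes i: "\<And>k. integrable gauss_space (s k)"
    and c: "\<And>e. 0 < e \<Longrightarrow> \<exists>N. \<forall>i\<ge>N. \<forall>j\<ge>N. E (\<lambda>\<omega>. \<bar>s i \<omega> - s j \<omega>\<bar>) < e"
  shows "\<exists>f. integrable gauss_space f \<and> (\<lambda>k. E (\<lambda>\<omega>. \<bar>s k \<omega> - f \<omega>\<bar>)) \<longlonglongrightarrow> 0"
proof -
  have m [measurable]: "s k \<in> borel_measurable gauss_space" for k using i by auto
  obtain r where r: "strict_mono r" "AE \<omega> in gauss_space. Cauchy (\<lambda>k. s (r k) \<omega>)"
    using cauchy_L1_AE_cauchy_subseq[of gauss_space s] i c by (auto simp: real_norm_def)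
  define f where "f \<omega> = lim (\<lambda>k. s (r k) \<omega>)" for \<omega>
  have fm [measurable]: "f \<in> borel_measurable gauss_space" unfolding f_def by measurable
  have ae: "AE \<omega> in gauss_space. (\<lambda>k. s (r k) \<omega>) \<longlonglongrightarrow> f \<omega>"
    using r(2) by eventually_elim (simp add: f_def Cauchy_convergent_iff convergent_LIMSEQ_iff)
  have main: "\<exists>N. \<forall>k\<ge>N. integrable gauss_space (\<lambda>\<omega>. s k \<omega> - f \<omega>) \<and> E (\<lambda>\<omega>. \<bar>s k \<omega> - f \<omega>\<bar>) \<le> e" if e: "0 < e" for e
  proof -
    obtain N where N: "\<And>i j. N \<le> i \<Longrightarrow> N \<le> j \<Longrightarrow> E (\<lambda>\<omega>. \<bar>s i \<omega> - s j \<omega>\<bar>) < e" using c[OF e] by blast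
    have "integrable gauss_space (\<lambda>\<omega>. s k \<omega> - f \<omega>) \<and> E (\<lambda>\<omega>. \<bar>s k \<omega> - f \<omega>\<bar>) \<le> e" if k: "N \<le> k" for k
    proof -
      have "(\<integral>\<^sup>+\<omega>. ennreal \<bar>s k \<omega> - f \<omega>\<bar> \<partial>gauss_space) = (\<integral>\<^sup>+\<omega>. liminf (\<lambda>j. ennreal \<bar>s k \<omega> - s (r j) \<omega>\<bar>) \<partial>gauss_space)"
      proof (rule nn_integral_cong_AE)
        show "AE \<omega> in gauss_space. ennreal \<bar>s k \<omega> - f \<omega>\<bar> = liminf (\<lambda>j. ennreal \<bar>s k \<omega> - s (r j) \<omega>\<bar>)"
          using ae
        proof eventually_elim
          case (elim \<omega>)
          have "(\<lambda>j. ennreal \<bar>s k \<omega> - s (r j) \<omega>\<bar>) \<longlonglongrightarrow> ennreal \<bar>s k \<omega> - f \<omega>\<bar>"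
            by (intro tendsto_ennrealI tendsto_rabs tendsto_diff tendsto_const elim)
          then show ?case by (intro lim_imp_Liminf[symmetric]) auto
        qed
      qed
      also have "\<dots> \<le> liminf (\<lambda>j. \<integral>\<^sup>+\<omega>. ennreal \<bar>s k \<omega> - s (r j) \<omega>\<bar> \<partial>gauss_space)"
        by (rule nn_integral_liminf) measurable
      also have "\<dots> \<le> ennreal e"
      proof -
        have "(\<integral>\<^sup>+\<omega>. ennreal \<bar>s k \<omega> - s (r j) \<omega>\<bar> \<partial>gauss_space) \<le> ennreal e" if "N \<le> j" for j
        proof -
          have "N \<le> r j" using that seq_suble[OF r(1), of j] by simp
          then have "E (\<lambda>\<omega>. \<bar>s k \<omega> - s (r j) \<omega>\<bar>) \<le> e" using N[OF k] by (intro less_imp_le)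
          then show ?thesis using i by (subst nn_integral_eq_integral) (auto intro: ennreal_leI)
        qed
        then have "\<forall>\<^sub>F j in sequentially. (\<integral>\<^sup>+\<omega>. ennreal \<bar>s k \<omega> - s (r j) \<omega>\<bar> \<partial>gauss_space) \<le> ennreal e"
          unfolding eventually_sequentially by blast
        then show ?thesis by (intro Liminf_le) auto
      qed
      finally have le: "(\<integral>\<^sup>+\<omega>. ennreal \<bar>s k \<omega> - f \<omega>\<bar> \<partial>gauss_space) \<le> ennreal e" .
      have int: "integrable gauss_space (\<lambda>\<omega>. s k \<omega> - f \<omega>)"
        by (rule integrableI_bounded) (use le in \<open>auto intro: le_less_trans\<close>)
      have "ennreal (E (\<lambda>\<omega>. \<bar>s k \<omega> - f \<omega>\<bar>)) \<le> ennreal e"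
        using le int by (subst (asm) nn_integral_eq_integral) auto
      then show ?thesis using int e by (simp add: ennreal_le_iff)
    qed
    then show ?thesis by blast
  qed
  from main[of 1] obtain N where "integrable gauss_space (\<lambda>\<omega>. s N \<omega> - f \<omega>)" by auto
  from Bochner_Integration.integrable_diff[OF i[of N] this] have fi: "integrable gauss_space f" by simp
  moreover have "(\<lambda>k. E (\<lambda>\<omega>. \<bar>s k \<omega> - f \<omega>\<bar>)) \<longlonglongrightarrow> 0"
  proof (rule LIMSEQ_I)
    fix e :: real assume e: "0 < e"
    obtain N where N: "\<And>k. N \<le> k \<Longrightarrow> E (\<lambda>\<omega>. \<bar>s k \<omega> - f \<omega>\<bar>) \<le> e / 2" using main[of "e / 2"] e by auto
    have "0 \<le> E (\<lambda>\<omega>. \<bar>s k \<omega> - f \<omega>\<bar>)" for k by (auto intro!: integral_nonneg_AE)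
    then have "norm (E (\<lambda>\<omega>. \<bar>s k \<omega> - f \<omega>\<bar>) - 0) < e" if "N \<le> k" for k using N[OF that] e by simp
    then show "\<exists>N. \<forall>k\<ge>N. norm (E (\<lambda>\<omega>. \<bar>s k \<omega> - f \<omega>\<bar>) - 0) < e" by blast
  qed
  ultimately show ?thesis by blast
qed

section \<open>Closability of the carre-du-champ\<close>

definition dep :: "nat \<Rightarrow> ((nat \<Rightarrow> real) \<Rightarrow> real) \<Rightarrow> bool" where
  "dep n u \<longleftrightarrow> (\<forall>\<omega> \<omega>'. (\<forall>i<n. \<omega> i = \<omega>' i) \<longrightarrow> u \<omega> = u \<omega>')"

lemma depD: "dep n u \<Longrightarrow> (\<And>i. i < n \<Longrightarrow> \<omega> i = \<omega>' i) \<Longrightarrow> u \<omega> = u \<omega>'"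
  by (auto simp: dep_def)

lemma test_functionsE:
  assumes "\<phi> \<in> test_functions"
  obtains n where "dep n \<phi>" "continuous_on UNIV \<phi>" "poly_growth n \<phi>"
    "\<And>i. coord_differentiable i \<phi>" "\<And>i. continuous_on UNIV (pderiv_coord i \<phi>)" "\<And>i. poly_growth n (pderiv_coord i \<phi>)"
    "\<And>i j. coord_differentiable j (pderiv_coord i \<phi>)" "\<And>i j. continuous_on UNIV (pderiv_coord j (pderiv_coord i \<phi>))"
    "\<And>i j. poly_growth n (pderiv_coord j (pderiv_coord i \<phi>))"
  using assms unfolding test_functions_def dep_def[symmetric] by blast

lemma coord_differentiableD:
  assumes "coord_differentiable k \<phi>"
  shows "((\<lambda>t. \<phi> (fun_upd \<omega> k t)) has_real_derivative pderiv_coord k \<phi> (fun_upd \<omega> k s)) (at s)"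
proof -
  have "(\<lambda>t. \<phi> (fun_upd (fun_upd \<omega> k s) k t)) differentiable (at (fun_upd \<omega> k s k))"
    using assms unfolding coord_differentiable_def by blast
  then have "(\<lambda>t. \<phi> (fun_upd \<omega> k t)) differentiable (at s)" by simp
  then obtain D where D: "((\<lambda>t. \<phi> (fun_upd \<omega> k t)) has_real_derivative D) (at s)"
    unfolding real_differentiable_def by blast
  then have "pderiv_coord k \<phi> (fun_upd \<omega> k s) = D"
    unfolding pderiv_coord_def by (simp add: DERIV_imp_deriv)
  then show ?thesis using D by simp
qed

lemma pderiv_coord_eqI:
  assumes "\<And>\<omega> s. ((\<lambda>t. \<phi> (fun_upd \<omega> k t)) has_real_derivative \<psi> (fun_upd \<omega> k s)) (at s)"
  shows "pderiv_coord k \<phi> = \<psi>" "coord_differentiable k \<phi>"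
proof -
  have d: "((\<lambda>t. \<phi> (fun_upd \<omega> k t)) has_real_derivative \<psi> \<omega>) (at (\<omega> k))" for \<omega>
    using assms[of \<omega> "\<omega> k"] by simp
  show "pderiv_coord k \<phi> = \<psi>"
    unfolding pderiv_coord_def[abs_def] by (rule ext) (rule DERIV_imp_deriv[OF d])
  show "coord_differentiable k \<phi>"
    unfolding coord_differentiable_def real_differentiable_def using d by blast
qed

lemma pderiv_coord_diff:
  assumes "coord_differentiable k \<phi>" "coord_differentiable k \<psi>"
  shows "pderiv_coord k (\<lambda>\<omega>. \<phi> \<omega> - \<psi> \<omega>) = (\<lambda>\<omega>. pderiv_coord k \<phi> \<omega> - pderiv_coord k \<psi> \<omega>)"
    "coord_differentiable k (\<lambda>\<omega>. \<phi> \<omega> - \<psi> \<omega>)"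
  using pderiv_coord_eqI[of "\<lambda>\<omega>. \<phi> \<omega> - \<psi> \<omega>" k "\<lambda>\<omega>. pderiv_coord k \<phi> \<omega> - pderiv_coord k \<psi> \<omega>"]
    DERIV_diff[OF coord_differentiableD[OF assms(1)] coord_differentiableD[OF assms(2)]] by auto

lemma poly_growth_minus: "poly_growth n u \<Longrightarrow> poly_growth n v \<Longrightarrow> poly_growth n (\<lambda>\<omega>. u \<omega> - v \<omega>)"
  using poly_growth_add[of n u "\<lambda>\<omega>. - v \<omega>"] by (simp add: poly_growth_def)

lemma test_functions_diff:
  assumes "\<phi> \<in> test_functions" "\<psi> \<in> test_functions"
  shows "(\<lambda>\<omega>. \<phi> \<omega> - \<psi> \<omega>) \<in> test_functions"
proof -
  obtain n where n: "dep n \<phi>" "continuous_on UNIV \<phi>" "poly_growth n \<phi>"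
    "\<And>i. coord_differentiable i \<phi>" "\<And>i. continuous_on UNIV (pderiv_coord i \<phi>)" "\<And>i. poly_growth n (pderiv_coord i \<phi>)"
    "\<And>i j. coord_differentiable j (pderiv_coord i \<phi>)" "\<And>i j. continuous_on UNIV (pderiv_coord j (pderiv_coord i \<phi>))"
    "\<And>i j. poly_growth n (pderiv_coord j (pderiv_coord i \<phi>))"
    using test_functionsE[OF assms(1)] by blast
  obtain m where m: "dep m \<psi>" "continuous_on UNIV \<psi>" "poly_growth m \<psi>"
    "\<And>i. coord_differentiable i \<psi>" "\<And>i. continuous_on UNIV (pderiv_coord i \<psi>)" "\<And>i. poly_growth m (pderiv_coord i \<psi>)"
    "\<And>i j. coord_differentiable j (pderiv_coord i \<psi>)" "\<And>i j. continuous_on UNIV (pderiv_coord j (pderiv_coord i \<psi>))"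
    "\<And>i j. poly_growth m (pderiv_coord j (pderiv_coord i \<psi>))"
    using test_functionsE[OF assms(2)] by blast
  let ?N = "max n m"
  have g: "poly_growth ?N (\<lambda>\<omega>. u \<omega> - v \<omega>)" if "poly_growth n u" "poly_growth m v" for u v
    by (intro poly_growth_minus poly_growth_mono[OF that(1)] poly_growth_mono[OF that(2)]) auto
  note d1 = pderiv_coord_diff[OF n(4) m(4)]
  note d2 = pderiv_coord_diff[OF n(7) m(7)]
  have dep: "dep ?N (\<lambda>\<omega>. \<phi> \<omega> - \<psi> \<omega>)"
    unfolding dep_def
  proof (intro allI impI)
    fix \<omega> \<omega>' :: "nat \<Rightarrow> real" assume "\<forall>i<?N. \<omega> i = \<omega>' i"
    then have "\<phi> \<omega> = \<phi> \<omega>'" "\<psi> \<omega> = \<psi> \<omega>'" by (auto intro!: depD[OF n(1)] depD[OF m(1)])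
    then show "\<phi> \<omega> - \<psi> \<omega> = \<phi> \<omega>' - \<psi> \<omega>'" by simp
  qed
  show ?thesis
    unfolding test_functions_def dep_def[symmetric]
    by (intro CollectI exI[of _ ?N] conjI allI)
      (simp_all add: d1 d2 dep g n m continuous_on_diff)
qed

lemma pderiv_coord_outside:
  assumes "dep n \<phi>" "n \<le> k"
  shows "pderiv_coord k \<phi> = (\<lambda>_. 0)"
proof (rule pderiv_coord_eqI(1))
  fix \<omega> s
  have "(\<lambda>t. \<phi> (fun_upd \<omega> k t)) = (\<lambda>_. \<phi> \<omega>)" using assms(2) by (intro ext depD[OF assms(1)]) auto
  then show "((\<lambda>t. \<phi> (fun_upd \<omega> k t)) has_real_derivative 0) (at s)" by simp
qed

lemma carre_test_finite:
  assumes "\<forall>k\<ge>n. pderiv_coord k \<phi> = (\<lambda>_. 0)"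
  shows "carre_test \<phi> \<psi> \<omega> = (\<Sum>k<n. pderiv_coord k \<phi> \<omega> * pderiv_coord k \<psi> \<omega>)"
  unfolding carre_test_def by (rule suminf_finite) (use assms in auto)

lemma carre_test_commute: "carre_test \<phi> \<psi> = carre_test \<psi> \<phi>"
  by (simp add: carre_test_def fun_eq_iff mult.commute)

lemma test_function_dim:
  assumes "\<phi> \<in> test_functions"
  shows "\<exists>n. \<forall>k\<ge>n. pderiv_coord k \<phi> = (\<lambda>_. 0)"
  using test_functionsE[OF assms] pderiv_coord_outside by metis

lemma carre_test_diff_left:
  assumes "\<phi> \<in> test_functions" "\<psi> \<in> test_functions" "\<theta> \<in> test_functions"
  shows "carre_test (\<lambda>\<omega>. \<phi> \<omega> - \<psi> \<omega>) \<theta> \<omega> = carre_test \<phi> \<theta> \<omega> - carre_test \<psi> \<theta> \<omega>"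
proof -
  obtain n where n: "\<forall>k\<ge>n. pderiv_coord k \<theta> = (\<lambda>_. 0)" using test_function_dim[OF assms(3)] by blast
  have d: "coord_differentiable k \<phi>" "coord_differentiable k \<psi>" for k
    using test_functionsE[OF assms(1)] test_functionsE[OF assms(2)] by metis+
  show ?thesis
    unfolding carre_test_commute[of _ \<theta>] carre_test_finite[OF n] pderiv_coord_diff(1)[OF d]
    by (simp add: right_diff_distrib sum_subtractf)
qed

lemma carre_test_measurable:
  assumes "\<phi> \<in> test_functions" "\<psi> \<in> test_functions"
  shows "integrable gauss_space (carre_test \<phi> \<psi>)" "continuous_on UNIV (carre_test \<phi> \<psi>)"
proof -
  obtain n where n: "\<forall>k\<ge>n. pderiv_coord k \<phi> = (\<lambda>_. 0)" using test_function_dim[OF assms(1)] by blast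
  have e: "carre_test \<phi> \<psi> = (\<lambda>\<omega>. \<Sum>k<n. pderiv_coord k \<phi> \<omega> * pderiv_coord k \<psi> \<omega>)"
    using carre_test_finite[OF n] by (simp add: fun_eq_iff)
  obtain a where a: "\<And>i. continuous_on UNIV (pderiv_coord i \<phi>)" "\<And>i. poly_growth a (pderiv_coord i \<phi>)"
    using test_functionsE[OF assms(1)] by metis
  obtain b where b: "\<And>i. continuous_on UNIV (pderiv_coord i \<psi>)" "\<And>i. poly_growth b (pderiv_coord i \<psi>)"
    using test_functionsE[OF assms(2)] by metis
  show "continuous_on UNIV (carre_test \<phi> \<psi>)" unfolding e by (intro continuous_intros a b)
  have "integrable gauss_space (\<lambda>\<omega>. pderiv_coord k \<phi> \<omega> * pderiv_coord k \<psi> \<omega>)" for k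
    by (rule poly_growth_integrable[of _ "max a b"])
      (intro continuous_measurable_gauss continuous_on_mult a b poly_growth_mult poly_growth_mono[OF a(2)] poly_growth_mono[OF b(2)] max.cobounded1 max.cobounded2)+
  then show "integrable gauss_space (carre_test \<phi> \<psi>)" unfolding e by simp
qed

section \<open>The energy seminorm\<close>

definition en :: "((nat \<Rightarrow> real) \<Rightarrow> real) \<Rightarrow> real" where "en \<phi> = sqrt (E (carre_test \<phi> \<phi>))"

lemma carre_test_nonneg: "\<phi> \<in> test_functions \<Longrightarrow> 0 \<le> carre_test \<phi> \<phi> \<omega>"
  using test_function_dim[of \<phi>] carre_test_finite[of _ \<phi> \<phi> \<omega>] by (force intro: sum_nonneg)

lemma carre_test_CS:
  assumes "\<phi> \<in> test_functions" "\<psi> \<in> test_functions"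
  shows "E (\<lambda>\<omega>. \<bar>carre_test \<phi> \<psi> \<omega>\<bar>) \<le> en \<phi> * en \<psi>"
proof -
  obtain n where n: "\<forall>k\<ge>n. pderiv_coord k \<phi> = (\<lambda>_. 0)" using test_function_dim[OF assms(1)] by blast
  obtain m where m: "\<forall>k\<ge>m. pderiv_coord k \<psi> = (\<lambda>_. 0)" using test_function_dim[OF assms(2)] by blast
  let ?N = "max n m"
  have N: "\<forall>k\<ge>?N. pderiv_coord k \<phi> = (\<lambda>_. 0)" "\<forall>k\<ge>?N. pderiv_coord k \<psi> = (\<lambda>_. 0)"
    using n m by auto
  have mm [measurable]: "carre_test \<phi> \<phi> \<in> borel_measurable gauss_space" "carre_test \<psi> \<psi> \<in> borel_measurable gauss_space"
    using carre_test_measurable(1) assms by auto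
  have s: "(\<lambda>\<omega>. (sqrt (carre_test \<phi> \<phi> \<omega>))\<^sup>2) = carre_test \<phi> \<phi>" "(\<lambda>\<omega>. (sqrt (carre_test \<psi> \<psi> \<omega>))\<^sup>2) = carre_test \<psi> \<psi>"
    using carre_test_nonneg assms by auto
  have "\<bar>carre_test \<phi> \<psi> \<omega>\<bar> \<le> \<bar>sqrt (carre_test \<phi> \<phi> \<omega>) * sqrt (carre_test \<psi> \<psi> \<omega>)\<bar>" for \<omega>
  proof -
    have "(carre_test \<phi> \<psi> \<omega>)\<^sup>2 \<le> carre_test \<phi> \<phi> \<omega> * carre_test \<psi> \<psi> \<omega>"
      unfolding carre_test_finite[OF N(1)] carre_test_finite[OF N(2)]
      using Cauchy_Schwarz_ineq_sum[of "\<lambda>k. pderiv_coord k \<phi> \<omega>" "\<lambda>k. pderiv_coord k \<psi> \<omega>" "{..<?N}"]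
      by (simp add: power2_eq_square)
    then have "sqrt ((carre_test \<phi> \<psi> \<omega>)\<^sup>2) \<le> sqrt (carre_test \<phi> \<phi> \<omega> * carre_test \<psi> \<psi> \<omega>)" by (rule real_sqrt_le_mono)
    then show ?thesis using carre_test_nonneg assms by (simp add: real_sqrt_mult)
  qed
  moreover have "integrable gauss_space (\<lambda>\<omega>. sqrt (carre_test \<phi> \<phi> \<omega>) * sqrt (carre_test \<psi> \<psi> \<omega>))"
    by (rule L2_product_integrable) (auto simp: s carre_test_measurable assms)
  ultimately have "E (\<lambda>\<omega>. \<bar>carre_test \<phi> \<psi> \<omega>\<bar>) \<le> E (\<lambda>\<omega>. \<bar>sqrt (carre_test \<phi> \<phi> \<omega>) * sqrt (carre_test \<psi> \<psi> \<omega>)\<bar>)"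
    using carre_test_measurable(1)[OF assms] by (intro integral_mono) auto
  also have "\<dots> \<le> sqrt (E (\<lambda>\<omega>. (sqrt (carre_test \<phi> \<phi> \<omega>))\<^sup>2)) * sqrt (E (\<lambda>\<omega>. (sqrt (carre_test \<psi> \<psi> \<omega>))\<^sup>2))"
    by (rule L2_cauchy_schwarz) (auto simp: s carre_test_measurable assms)
  finally show ?thesis by (simp add: s en_def)
qed

lemma en_nonneg: "\<phi> \<in> test_functions \<Longrightarrow> 0 \<le> en \<phi>"
  unfolding en_def using carre_test_nonneg by (simp add: integral_nonneg_AE)

lemma en_sq: "\<phi> \<in> test_functions \<Longrightarrow> (en \<phi>)\<^sup>2 = E (carre_test \<phi> \<phi>)"
  unfolding en_def using carre_test_nonneg by (simp add: integral_nonneg_AE)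

lemma en_diff_le:
  assumes "\<phi> \<in> test_functions" "\<psi> \<in> test_functions"
  shows "en (\<lambda>\<omega>. \<phi> \<omega> - \<psi> \<omega>) \<le> en \<phi> + en \<psi>"
proof (rule power2_le_imp_le)
  note D = test_functions_diff[OF assms]
  have "carre_test (\<lambda>\<omega>. \<phi> \<omega> - \<psi> \<omega>) (\<lambda>\<omega>. \<phi> \<omega> - \<psi> \<omega>) \<omega> = carre_test \<phi> \<phi> \<omega> - carre_test \<phi> \<psi> \<omega> - (carre_test \<phi> \<psi> \<omega> - carre_test \<psi> \<psi> \<omega>)" for \<omega>
    unfolding carre_test_diff_left[OF assms D] carre_test_commute[of \<phi> "\<lambda>\<omega>. \<phi> \<omega> - \<psi> \<omega>"]
      carre_test_commute[of \<psi> "\<lambda>\<omega>. \<phi> \<omega> - \<psi> \<omega>"] carre_test_diff_left[OF assms assms(1)] carre_test_diff_left[OF assms assms(2)]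
      carre_test_commute[of \<psi> \<phi>] ..
  then have "(en (\<lambda>\<omega>. \<phi> \<omega> - \<psi> \<omega>))\<^sup>2 = E (\<lambda>\<omega>. carre_test \<phi> \<phi> \<omega> - carre_test \<phi> \<psi> \<omega> - (carre_test \<phi> \<psi> \<omega> - carre_test \<psi> \<psi> \<omega>))"
    unfolding en_sq[OF D] by presburger
  also have "\<dots> = (en \<phi>)\<^sup>2 - 2 * E (carre_test \<phi> \<psi>) + (en \<psi>)\<^sup>2"
    using carre_test_measurable(1) assms by (simp add: en_sq)
  also have "\<bar>E (carre_test \<phi> \<psi>)\<bar> \<le> en \<phi> * en \<psi>" by (rule order_trans[OF integral_abs_bound carre_test_CS[OF assms]])
  then have "(en \<phi>)\<^sup>2 - 2 * E (carre_test \<phi> \<psi>) + (en \<psi>)\<^sup>2 \<le> (en \<phi> + en \<psi>)\<^sup>2" by (simp add: power2_sum abs_le_iff)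
  finally show "(en (\<lambda>\<omega>. \<phi> \<omega> - \<psi> \<omega>))\<^sup>2 \<le> (en \<phi> + en \<psi>)\<^sup>2" .
qed (simp add: en_nonneg assms)

lemma test_functions_L2: assumes "\<phi> \<in> test_functions" shows "\<phi> \<in> L2"
proof -
  obtain n where n: "continuous_on UNIV \<phi>" "poly_growth n \<phi>" using test_functionsE[OF assms] by metis
  have "integrable gauss_space (\<lambda>\<omega>. (\<phi> \<omega>)\<^sup>2)"
    by (intro poly_growth_integrable[of _ n] continuous_measurable_gauss continuous_on_power n poly_growth_power)
  then show ?thesis using continuous_measurable_gauss[OF n(1)] by (simp add: L2_def)
qed

text \<open>Closability rests on \<open>E[\<Gamma>(\<phi>, \<psi>)] = - E[L\<phi> \<psi>]\<close> with \<open>L\<phi>\<close> in \<open>L\<^sup>2\<close>, which is where second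
  derivatives of test functions are needed.\<close>

lemma carre_test_generator:
  assumes \<phi>: "\<phi> \<in> test_functions"
  shows "\<exists>g\<in>L2. \<forall>\<psi>\<in>test_functions. E (carre_test \<phi> \<psi>) = E (\<lambda>\<omega>. g \<omega> * \<psi> \<omega>)"
proof -
  obtain n where n: "dep n \<phi>" "continuous_on UNIV \<phi>" "poly_growth n \<phi>"
    "\<And>i. coord_differentiable i \<phi>" "\<And>i. continuous_on UNIV (pderiv_coord i \<phi>)" "\<And>i. poly_growth n (pderiv_coord i \<phi>)"
    "\<And>i j. coord_differentiable j (pderiv_coord i \<phi>)" "\<And>i j. continuous_on UNIV (pderiv_coord j (pderiv_coord i \<phi>))"
    "\<And>i j. poly_growth n (pderiv_coord j (pderiv_coord i \<phi>))"
    using test_functionsE[OF \<phi>] by blast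
  define g where "g i \<omega> = \<omega> i * pderiv_coord i \<phi> \<omega> - pderiv_coord i (pderiv_coord i \<phi>) \<omega>" for i \<omega>
  have gc: "continuous_on UNIV (g i)" for i
    unfolding g_def by (intro continuous_on_diff continuous_on_mult continuous_coordinate n(5,8))
  have gg: "poly_growth n (g i)" if "i < n" for i
    unfolding g_def by (intro poly_growth_minus poly_growth_mult poly_growth_coordinate that n(6,9))
  have gL: "g i \<in> L2" if "i < n" for i
    unfolding L2_def using gc gg[OF that]
    by (auto intro!: poly_growth_integrable[of _ n] continuous_measurable_gauss continuous_on_power poly_growth_power)
  have "(\<lambda>\<omega>. \<Sum>i\<in>A. g i \<omega>) \<in> L2" if "A \<subseteq> {..<n}" "finite A" for A
    using that(2,1)
  proof induction
    case empty
    then show ?case by (simp add: L2_def)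
  next
    case (insert a A)
    then show ?case using L2_add(1)[OF gL[of a], of "\<lambda>\<omega>. \<Sum>i\<in>A. g i \<omega>"] by simp
  qed
  then have L: "(\<lambda>\<omega>. \<Sum>i<n. g i \<omega>) \<in> L2" by simp
  have "E (carre_test \<phi> \<psi>) = E (\<lambda>\<omega>. (\<Sum>i<n. g i \<omega>) * \<psi> \<omega>)" if \<psi>: "\<psi> \<in> test_functions" for \<psi>
  proof -
    obtain m where m: "continuous_on UNIV \<psi>" "poly_growth m \<psi>"
      "\<And>i. coord_differentiable i \<psi>" "\<And>i. continuous_on UNIV (pderiv_coord i \<psi>)" "\<And>i. poly_growth m (pderiv_coord i \<psi>)"
      using test_functionsE[OF \<psi>] by metis
    let ?N = "max n m"
    have gn: "poly_growth n u \<Longrightarrow> poly_growth ?N u" and gm: "poly_growth m u \<Longrightarrow> poly_growth ?N u" for u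
      using poly_growth_mono by auto
    have ii: "integrable gauss_space (\<lambda>\<omega>. pderiv_coord i \<phi> \<omega> * pderiv_coord i \<psi> \<omega>)"
      "integrable gauss_space (\<lambda>\<omega>. pderiv_coord i (pderiv_coord i \<phi>) \<omega> * \<psi> \<omega>)" for i
      by (rule poly_growth_integrable[of _ ?N], intro continuous_measurable_gauss continuous_on_mult n(5,8) m(1,4),
        intro poly_growth_mult gn[OF n(6)] gn[OF n(9)] gm[OF m(2)] gm[OF m(5)])+
    have ig: "integrable gauss_space (\<lambda>\<omega>. g i \<omega> * \<psi> \<omega>)" if "i < n" for i
      using L2_mult_integrable[OF gL[OF that] test_functions_L2[OF \<psi>]] .
    have "E (\<lambda>\<omega>. g i \<omega> * \<psi> \<omega>) = E (\<lambda>\<omega>. pderiv_coord i \<phi> \<omega> * pderiv_coord i \<psi> \<omega>)" if i: "i < n" for i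
    proof -
      let ?u = "\<lambda>\<omega>. pderiv_coord i \<phi> \<omega> * \<psi> \<omega>"
      let ?u' = "\<lambda>\<omega>. pderiv_coord i (pderiv_coord i \<phi>) \<omega> * \<psi> \<omega> + pderiv_coord i \<phi> \<omega> * pderiv_coord i \<psi> \<omega>"
      have "E (\<lambda>\<omega>. \<omega> i * ?u \<omega>) = E ?u'"
      proof (rule E_ibp)
        show "continuous_on UNIV ?u" "continuous_on UNIV ?u'"
          by (intro continuous_on_add continuous_on_mult n(5,8) m(1,4))+
        show "poly_growth ?N ?u" "poly_growth ?N ?u'"
          by (intro poly_growth_add poly_growth_mult gn[OF n(6)] gn[OF n(9)] gm[OF m(2)] gm[OF m(5)])+
        show "((\<lambda>t. ?u (fun_upd \<omega> i t)) has_real_derivative ?u' (fun_upd \<omega> i s)) (at s)" for \<omega> s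
          using DERIV_mult[OF coord_differentiableD[OF n(7)[of i i], of \<omega> s] coord_differentiableD[OF m(3)[of i], of \<omega> s]]
          by (simp add: algebra_simps)
      qed
      moreover have "E (\<lambda>\<omega>. \<omega> i * ?u \<omega>) = E (\<lambda>\<omega>. g i \<omega> * \<psi> \<omega>) + E (\<lambda>\<omega>. pderiv_coord i (pderiv_coord i \<phi>) \<omega> * \<psi> \<omega>)"
        by (subst Bochner_Integration.integral_add[OF ig[OF i] ii(2), symmetric])
          (intro Bochner_Integration.integral_cong refl, simp add: g_def algebra_simps)
      moreover have "E ?u' = E (\<lambda>\<omega>. pderiv_coord i (pderiv_coord i \<phi>) \<omega> * \<psi> \<omega>) + E (\<lambda>\<omega>. pderiv_coord i \<phi> \<omega> * pderiv_coord i \<psi> \<omega>)"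
        by (rule Bochner_Integration.integral_add[OF ii(2) ii(1)])
      ultimately show ?thesis by simp
    qed
    then have "(\<Sum>i<n. E (\<lambda>\<omega>. g i \<omega> * \<psi> \<omega>)) = (\<Sum>i<n. E (\<lambda>\<omega>. pderiv_coord i \<phi> \<omega> * pderiv_coord i \<psi> \<omega>))" by simp
    moreover have "E (carre_test \<phi> \<psi>) = (\<Sum>i<n. E (\<lambda>\<omega>. pderiv_coord i \<phi> \<omega> * pderiv_coord i \<psi> \<omega>))"
    proof -
      have "carre_test \<phi> \<psi> = (\<lambda>\<omega>. \<Sum>k<n. pderiv_coord k \<phi> \<omega> * pderiv_coord k \<psi> \<omega>)"
        using carre_test_finite[of n \<phi> \<psi>] pderiv_coord_outside[OF n(1)] by (simp add: fun_eq_iff)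
      then show ?thesis using ii(1) by (simp add: Bochner_Integration.integral_sum)
    qed
    moreover have "E (\<lambda>\<omega>. (\<Sum>i<n. g i \<omega>) * \<psi> \<omega>) = (\<Sum>i<n. E (\<lambda>\<omega>. g i \<omega> * \<psi> \<omega>))"
      unfolding sum_distrib_right by (rule Bochner_Integration.integral_sum) (use ig in auto)
    ultimately show ?thesis by simp
  qed
  then show ?thesis by (intro bexI[OF _ L] ballI)
qed

text \<open>The squared energy of \<open>\<theta> i\<close> splits into
  E[Gamma(\<open>\<theta> i - \<theta> j\<close>, \<open>\<theta> i\<close>)] and
  E[Gamma(\<open>\<theta> i\<close>, \<open>\<theta> j\<close>)]. The Cauchy property bounds the
  first by a small multiple of the energy of \<open>\<theta> i\<close>. The second tends to 0 in
  \<open>j\<close> for fixed \<open>i\<close>, by \<open>carre_test_generator\<close>.\<close>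

lemma carre_closable:
  assumes \<theta>: "\<And>k. \<theta> k \<in> test_functions" and L: "(\<lambda>k. L2n (\<theta> k)) \<longlonglongrightarrow> 0"
    and c: "\<And>e. 0 < e \<Longrightarrow> \<exists>N. \<forall>i\<ge>N. \<forall>j\<ge>N. en (\<lambda>\<omega>. \<theta> i \<omega> - \<theta> j \<omega>) < e"
  shows "(\<lambda>k. en (\<theta> k)) \<longlonglongrightarrow> 0"
proof (rule LIMSEQ_I)
  fix e :: real assume e: "0 < e"
  obtain N where N: "\<And>i j. N \<le> i \<Longrightarrow> N \<le> j \<Longrightarrow> en (\<lambda>\<omega>. \<theta> i \<omega> - \<theta> j \<omega>) < e / 2" using c[of "e / 2"] e by auto
  have "en (\<theta> i) \<le> e / 2" if i: "N \<le> i" for i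
  proof -
    obtain g where g: "g \<in> L2" "\<And>\<psi>. \<psi> \<in> test_functions \<Longrightarrow> E (carre_test (\<theta> i) \<psi>) = E (\<lambda>\<omega>. g \<omega> * \<psi> \<omega>)"
      using carre_test_generator[OF \<theta>[of i]] by blast
    have le: "(en (\<theta> i))\<^sup>2 \<le> e / 2 * en (\<theta> i) + L2n g * L2n (\<theta> j)" if j: "N \<le> j" for j
    proof -
      note D = test_functions_diff[OF \<theta>[of i] \<theta>[of j]]
      have "(en (\<theta> i))\<^sup>2 = E (\<lambda>\<omega>. carre_test (\<lambda>\<omega>. \<theta> i \<omega> - \<theta> j \<omega>) (\<theta> i) \<omega> + carre_test (\<theta> i) (\<theta> j) \<omega>)"
        unfolding en_sq[OF \<theta>] carre_test_diff_left[OF \<theta> \<theta> \<theta>] by (simp add: carre_test_commute[of "\<theta> j"])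
      also have "\<dots> = E (carre_test (\<lambda>\<omega>. \<theta> i \<omega> - \<theta> j \<omega>) (\<theta> i)) + E (carre_test (\<theta> i) (\<theta> j))"
        by (rule Bochner_Integration.integral_add[OF carre_test_measurable(1)[OF D \<theta>] carre_test_measurable(1)[OF \<theta> \<theta>]])
      also have "\<dots> \<le> e / 2 * en (\<theta> i) + L2n g * L2n (\<theta> j)"
      proof (rule add_mono)
        have "E (carre_test (\<lambda>\<omega>. \<theta> i \<omega> - \<theta> j \<omega>) (\<theta> i)) \<le> en (\<lambda>\<omega>. \<theta> i \<omega> - \<theta> j \<omega>) * en (\<theta> i)"
          using order_trans[OF integral_abs_bound carre_test_CS[OF D \<theta>[of i]]] by (simp add: abs_le_iff)
        also have "\<dots> \<le> e / 2 * en (\<theta> i)" using N[OF i j] en_nonneg[OF \<theta>] by (intro mult_right_mono) auto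
        finally show "E (carre_test (\<lambda>\<omega>. \<theta> i \<omega> - \<theta> j \<omega>) (\<theta> i)) \<le> e / 2 * en (\<theta> i)" .
        show "E (carre_test (\<theta> i) (\<theta> j)) \<le> L2n g * L2n (\<theta> j)"
          unfolding g(2)[OF \<theta>] using L2_CS'[OF g(1) test_functions_L2[OF \<theta>[of j]]] by (simp add: abs_le_iff)
      qed
      finally show ?thesis .
    qed
    have "(\<lambda>j. e / 2 * en (\<theta> i) + L2n g * L2n (\<theta> j)) \<longlonglongrightarrow> e / 2 * en (\<theta> i) + L2n g * 0"
      by (intro tendsto_intros L)
    then have "(en (\<theta> i))\<^sup>2 \<le> e / 2 * en (\<theta> i) + L2n g * 0"
      by (rule tendsto_lowerbound) (use le in \<open>auto simp: eventually_sequentially\<close>)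
    then have "en (\<theta> i) * en (\<theta> i) \<le> e / 2 * en (\<theta> i)" by (simp add: power2_eq_square)
    then show ?thesis using en_nonneg[OF \<theta>[of i]] e by (cases "en (\<theta> i) = 0") (auto simp: mult_le_cancel_right)
  qed
  then have "norm (en (\<theta> k) - 0) < e" if "N \<le> k" for k using that e en_nonneg[OF \<theta>[of k]] by fastforce
  then show "\<exists>N. \<forall>k\<ge>N. norm (en (\<theta> k) - 0) < e" by blast
qed

section \<open>Polynomial functionals as test functions\<close>

lemma pderiv_coord_ev: "pderiv_coord i (ev X) = ev (pd i X)" "coord_differentiable i (ev X)"
  using pderiv_coord_eqI[of "ev X" i "ev (pd i X)"] pd_deriv by auto

text \<open>\<open>test_functions\<close> demands a single \<open>n\<close> for a function and all
  its derivatives. Setting the coordinates from \<open>n\<close> on to zero leaves \<open>u\<close>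
  unchanged and shrinks the sum in its bound.\<close>

lemma poly_growth_restrict:
  assumes "poly_growth m u" "dep n u"
  shows "poly_growth n u"
proof -
  obtain C N where b: "0 \<le> C" "\<And>\<omega>. \<bar>u \<omega>\<bar> \<le> C * (1 + (\<Sum>i<m. \<bar>\<omega> i\<bar>)) ^ N"
    using poly_growth_exponent[OF assms(1)] by (metis order_refl)
  have "\<bar>u \<omega>\<bar> \<le> C * (1 + (\<Sum>i<n. \<bar>\<omega> i\<bar>)) ^ N" for \<omega>
  proof -
    let ?w = "\<lambda>i. if i < n then \<omega> i else 0"
    have "(\<Sum>i<m. \<bar>?w i\<bar>) = (\<Sum>i\<in>{..<m} \<inter> {..<n}. \<bar>\<omega> i\<bar>)"
      by (subst sum.inter_restrict) (auto intro!: sum.cong)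
    also have "\<dots> \<le> (\<Sum>i<n. \<bar>\<omega> i\<bar>)" by (rule sum_mono2) auto
    finally have "C * (1 + (\<Sum>i<m. \<bar>?w i\<bar>)) ^ N \<le> C * (1 + (\<Sum>i<n. \<bar>\<omega> i\<bar>)) ^ N"
      using b(1) by (intro mult_left_mono power_mono add_left_mono) (auto intro: add_nonneg_nonneg sum_nonneg)
    moreover have "u \<omega> = u ?w" by (rule depD[OF assms(2)]) simp
    ultimately show ?thesis using b(2)[of ?w] by simp
  qed
  then show ?thesis unfolding poly_growth_def by blast
qed

lemma ev_pd_dep:
  assumes X: "dep n (ev X)" shows "dep n (ev (pd k X))"
proof (cases "k < n")
  case True
  show ?thesis
    unfolding dep_def
  proof (intro allI impI)
    fix \<omega> \<omega>' :: "nat \<Rightarrow> real" assume w: "\<forall>i<n. \<omega> i = \<omega>' i"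
    have "(\<lambda>t. ev X (fun_upd \<omega> k t)) = (\<lambda>t. ev X (fun_upd \<omega>' k t))"
      by (intro ext depD[OF X]) (use w in auto)
    then show "ev (pd k X) \<omega> = ev (pd k X) \<omega>'"
      unfolding pderiv_coord_ev(1)[symmetric] pderiv_coord_def using w True by simp
  qed
next
  case False
  then have "ev (pd k X) = (\<lambda>_. 0)" using pderiv_coord_outside[OF X, of k] by (simp add: pderiv_coord_ev)
  then show ?thesis by (simp add: dep_def)
qed

lemma ev_test_function: "ev X \<in> test_functions"
proof -
  obtain n where n: "poly_growth n (ev X)" "dep n (ev X)"
    using ev_finite_dim[of X] unfolding dep_def by blast
  note d1 = ev_pd_dep[OF n(2)]
  note d2 = ev_pd_dep[OF d1]
  have g1: "poly_growth n (ev (pd i X))" for i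
  proof -
    obtain m where "poly_growth m (ev (pd i X))" using ev_finite_dim by blast
    from poly_growth_restrict[OF this d1] show ?thesis .
  qed
  have g2: "poly_growth n (ev (pd j (pd i X)))" for i j
  proof -
    obtain m where "poly_growth m (ev (pd j (pd i X)))" using ev_finite_dim by blast
    from poly_growth_restrict[OF this d2] show ?thesis .
  qed
  show ?thesis
    unfolding test_functions_def dep_def[symmetric]
    by (intro CollectI exI[of _ n] conjI allI) (simp_all add: pderiv_coord_ev ev_continuous n g1 g2)
qed

lemma pd_W_outside: "W n q X \<Longrightarrow> n \<le> k \<Longrightarrow> pd k X = 0"
  by (induction rule: W.induct) (auto simp: pd_cr)

lemma carre_test_ev:
  assumes "W n q X" shows "carre_test (ev X) (ev Y) = ev (Gam n X Y)"
proof
  fix \<omega>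
  have z: "\<forall>k\<ge>n. pderiv_coord k (ev X) = (\<lambda>_. 0)"
    using pd_W_outside[OF assms] by (simp add: pderiv_coord_ev(1) fun_eq_iff)
  show "carre_test (ev X) (ev Y) \<omega> = ev (Gam n X Y) \<omega>"
    unfolding carre_test_finite[OF z] by (simp add: pderiv_coord_ev Gam_def)
qed

text \<open>On one chaos, energy is a fixed multiple of the norm, so convergence in mean square
  already makes polynomial approximations Cauchy in energy.\<close>

lemma en_ev: assumes "W n q X" shows "en (ev X) = sqrt (real q) * nrm X"
  unfolding en_def carre_test_ev[OF assms] Em_def[symmetric] Em_Num[symmetric] W_Num[OF assms]
  by (simp add: nrm_def real_sqrt_mult)

lemma en_ev_diff: assumes "W n q X" "W m q Y" shows "en (\<lambda>\<omega>. ev X \<omega> - ev Y \<omega>) = sqrt (real q) * nrm (X - Y)"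
proof -
  have "W (max n m) q (X - Y)" by (intro W_diff W_mono[OF assms(1)] W_mono[OF assms(2)]) auto
  from en_ev[OF this] show ?thesis by (simp add: ev_fun_simps)
qed

lemma carre_diff_bound:
  assumes t: "\<phi> \<in> test_functions" "\<psi> \<in> test_functions" "\<alpha> \<in> test_functions" "\<beta> \<in> test_functions"
  shows "E (\<lambda>\<omega>. \<bar>carre_test \<phi> \<psi> \<omega> - carre_test \<alpha> \<beta> \<omega>\<bar>)
    \<le> en (\<lambda>\<omega>. \<phi> \<omega> - \<alpha> \<omega>) * en \<psi> + en (\<lambda>\<omega>. \<psi> \<omega> - \<beta> \<omega>) * en \<alpha>"
proof -
  let ?a = "\<lambda>\<omega>. \<phi> \<omega> - \<alpha> \<omega>" and ?b = "\<lambda>\<omega>. \<psi> \<omega> - \<beta> \<omega>"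
  note D = test_functions_diff[OF t(1,3)] test_functions_diff[OF t(2,4)]
  have e: "carre_test \<phi> \<psi> \<omega> - carre_test \<alpha> \<beta> \<omega> = carre_test ?a \<psi> \<omega> + carre_test ?b \<alpha> \<omega>" for \<omega>
    unfolding carre_test_diff_left[OF t(1,3,2)] carre_test_diff_left[OF t(2,4,3)] carre_test_commute[of \<alpha>] by simp
  have i: "integrable gauss_space (carre_test ?a \<psi>)" "integrable gauss_space (carre_test ?b \<alpha>)"
    by (rule carre_test_measurable(1)[OF D(1) t(2)] carre_test_measurable(1)[OF D(2) t(3)])+
  have "E (\<lambda>\<omega>. \<bar>carre_test ?a \<psi> \<omega> + carre_test ?b \<alpha> \<omega>\<bar>) \<le> E (\<lambda>\<omega>. \<bar>carre_test ?a \<psi> \<omega>\<bar> + \<bar>carre_test ?b \<alpha> \<omega>\<bar>)"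
    using i by (intro integral_mono) auto
  also have "\<dots> = E (\<lambda>\<omega>. \<bar>carre_test ?a \<psi> \<omega>\<bar>) + E (\<lambda>\<omega>. \<bar>carre_test ?b \<alpha> \<omega>\<bar>)"
    using i by simp
  also have "\<dots> \<le> en ?a * en \<psi> + en ?b * en \<alpha>"
    by (intro add_mono carre_test_CS D t)
  finally show ?thesis unfolding e .
qed

lemma L2n_ev_diff: "L2n (\<lambda>\<omega>. ev X \<omega> - ev Y \<omega>) = nrm (X - Y)"
  using L2n_ev[of "X - Y"] by (simp add: ev_fun_simps)

lemma adm_en: "adm p n F \<Longrightarrow> en (ev F) = sqrt (real p)"
  using en_ev[OF adm_W] adm_nrm by simp

lemma adm_sequence_energy_Cauchy:
  assumes Z: "\<And>k. adm p (n k) (Z k)" and F: "F \<in> L2" and l: "(\<lambda>k. L2n (\<lambda>\<omega>. ev (Z k) \<omega> - F \<omega>)) \<longlonglongrightarrow> 0" and e: "0 < e"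
  shows "\<exists>N. \<forall>i\<ge>N. \<forall>j\<ge>N. en (\<lambda>\<omega>. ev (Z i) \<omega> - ev (Z j) \<omega>) < e"
proof -
  define d where "d = e / (2 * (sqrt (real p) + 1))"
  have sp: "0 \<le> sqrt (real p)" by simp
  have de: "c * (2 * (e / (2 * c))) = e" if "0 < c" for c :: real using that by simp
  have "0 < sqrt (real p) + 1" using sp by linarith
  then have d: "0 < d" unfolding d_def using e by (intro divide_pos_pos mult_pos_pos) auto
  obtain N where N: "\<And>k. N \<le> k \<Longrightarrow> L2n (\<lambda>\<omega>. ev (Z k) \<omega> - F \<omega>) < d"
    using order_tendstoD(2)[OF l d] unfolding eventually_sequentially by auto
  have "en (\<lambda>\<omega>. ev (Z i) \<omega> - ev (Z j) \<omega>) < e" if ij: "N \<le> i" "N \<le> j" for i j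
  proof -
    have "nrm (Z i - Z j) \<le> L2n (\<lambda>\<omega>. ev (Z i) \<omega> - F \<omega>) + L2n (\<lambda>\<omega>. F \<omega> - ev (Z j) \<omega>)"
      unfolding L2n_ev_diff[symmetric] by (rule L2n_triangle3[OF ev_L2 F ev_L2])
    then have "nrm (Z i - Z j) \<le> 2 * d"
      using N[OF ij(1)] N[OF ij(2)] L2n_diff_commute[of F "ev (Z j)"] by simp
    then have "en (\<lambda>\<omega>. ev (Z i) \<omega> - ev (Z j) \<omega>) \<le> sqrt (real p) * (2 * d)"
      unfolding en_ev_diff[OF adm_W[OF Z] adm_W[OF Z]] by (intro mult_left_mono) auto
    also have "\<dots> < (sqrt (real p) + 1) * (2 * d)" using d by (intro mult_strict_right_mono) auto
    also have "\<dots> = e" unfolding d_def by (rule de[OF \<open>0 < sqrt (real p) + 1\<close>])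
    finally show ?thesis .
  qed
  then show ?thesis by blast
qed

text \<open>The difference of the two approximating sequences tends to 0 in mean square and is
  Cauchy in energy, so \<open>carre_closable\<close> applies. Hence an arbitrary sequence from the
  closure can be exchanged for polynomials.\<close>

lemma closure_approx_energy:
  assumes Z: "\<And>k. adm p (n k) (Z k)" and F: "F \<in> L2" and l: "(\<lambda>k. L2n (\<lambda>\<omega>. ev (Z k) \<omega> - F \<omega>)) \<longlonglongrightarrow> 0"
    and \<phi>: "closure_approx \<phi> F"
  shows "(\<lambda>k. en (\<lambda>\<omega>. \<phi> k \<omega> - ev (Z k) \<omega>)) \<longlonglongrightarrow> 0"
proof (rule carre_closable)
  have t: "\<phi> k \<in> test_functions" for k using \<phi> by (simp add: closure_approx_def)
  show "(\<lambda>\<omega>. \<phi> k \<omega> - ev (Z k) \<omega>) \<in> test_functions" for k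
    by (rule test_functions_diff[OF t ev_test_function])
  have l\<phi>: "(\<lambda>k. L2n (\<lambda>\<omega>. \<phi> k \<omega> - F \<omega>)) \<longlonglongrightarrow> 0"
    using \<phi> unfolding closure_approx_def L2n_tendsto_iff by blast
  show "(\<lambda>k. L2n (\<lambda>\<omega>. \<phi> k \<omega> - ev (Z k) \<omega>)) \<longlonglongrightarrow> 0"
  proof (rule tendsto_sandwich[OF _ _ tendsto_const[of 0]])
    show "\<forall>\<^sub>F k in sequentially. L2n (\<lambda>\<omega>. \<phi> k \<omega> - ev (Z k) \<omega>) \<le> L2n (\<lambda>\<omega>. \<phi> k \<omega> - F \<omega>) + L2n (\<lambda>\<omega>. ev (Z k) \<omega> - F \<omega>)"
      using L2n_triangle3[OF test_functions_L2[OF t] F ev_L2] L2n_diff_commute[of F] by simp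
    show "(\<lambda>k. L2n (\<lambda>\<omega>. \<phi> k \<omega> - F \<omega>) + L2n (\<lambda>\<omega>. ev (Z k) \<omega> - F \<omega>)) \<longlonglongrightarrow> 0"
      using tendsto_add[OF l\<phi> l] by simp
  qed simp
  fix e :: real assume e: "0 < e"
  then have "0 < (e / 2)\<^sup>2" by simp
  then obtain N where N: "\<And>i j. N \<le> i \<Longrightarrow> N \<le> j \<Longrightarrow> E (carre_test (\<lambda>\<omega>. \<phi> i \<omega> - \<phi> j \<omega>) (\<lambda>\<omega>. \<phi> i \<omega> - \<phi> j \<omega>)) < (e / 2)\<^sup>2"
    using \<phi> unfolding closure_approx_def by blast
  obtain M where M: "\<And>i j. M \<le> i \<Longrightarrow> M \<le> j \<Longrightarrow> en (\<lambda>\<omega>. ev (Z i) \<omega> - ev (Z j) \<omega>) < e / 2"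
    using adm_sequence_energy_Cauchy[OF Z F l, of "e / 2"] e by auto
  have "en (\<lambda>\<omega>. (\<phi> i \<omega> - ev (Z i) \<omega>) - (\<phi> j \<omega> - ev (Z j) \<omega>)) < e" if ij: "max N M \<le> i" "max N M \<le> j" for i j
  proof -
    have "(\<lambda>\<omega>. (\<phi> i \<omega> - ev (Z i) \<omega>) - (\<phi> j \<omega> - ev (Z j) \<omega>)) = (\<lambda>\<omega>. (\<phi> i \<omega> - \<phi> j \<omega>) - (ev (Z i) \<omega> - ev (Z j) \<omega>))" by auto
    then have "en (\<lambda>\<omega>. (\<phi> i \<omega> - ev (Z i) \<omega>) - (\<phi> j \<omega> - ev (Z j) \<omega>)) \<le> en (\<lambda>\<omega>. \<phi> i \<omega> - \<phi> j \<omega>) + en (\<lambda>\<omega>. ev (Z i) \<omega> - ev (Z j) \<omega>)"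
      using en_diff_le[OF test_functions_diff[OF t t] test_functions_diff[OF ev_test_function ev_test_function]] by simp
    moreover have "en (\<lambda>\<omega>. \<phi> i \<omega> - \<phi> j \<omega>) < e / 2"
      unfolding en_def using N[of i j] ij e by (intro real_less_lsqrt) auto
    ultimately show ?thesis using M[of i j] ij by simp
  qed
  then show "\<exists>N. \<forall>i\<ge>N. \<forall>j\<ge>N. en (\<lambda>\<omega>. (\<phi> i \<omega> - ev (Z i) \<omega>) - (\<phi> j \<omega> - ev (Z j) \<omega>)) < e" by blast
qed

text \<open>The definition allows two unrelated sequences for the two arguments, and the value is
  picked by \<open>SOME\<close>. Whatever was chosen, it is recovered as a limit along the given
  polynomials.\<close>

lemma is_carre_du_champ_limit:
  assumes Z: "\<And>k. adm p (n k) (Z k)" and F: "F \<in> L2" and l: "(\<lambda>k. L2n (\<lambda>\<omega>. ev (Z k) \<omega> - F \<omega>)) \<longlonglongrightarrow> 0"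
    and G: "is_carre_du_champ F F G"
  shows "(\<lambda>k. E (\<lambda>\<omega>. \<bar>carre_test (ev (Z k)) (ev (Z k)) \<omega> - G \<omega>\<bar>)) \<longlonglongrightarrow> 0"
proof -
  obtain \<phi> \<psi> where ap: "closure_approx \<phi> F" "closure_approx \<psi> F"
    and lim: "(\<lambda>k. E (\<lambda>\<omega>. \<bar>carre_test (\<phi> k) (\<psi> k) \<omega> - G \<omega>\<bar>)) \<longlonglongrightarrow> 0" and Gi: "integrable gauss_space G"
    using G unfolding is_carre_du_champ_def by blast
  have t: "\<phi> k \<in> test_functions" "\<psi> k \<in> test_functions" for k using ap by (auto simp: closure_approx_def)
  let ?Z = "\<lambda>k. ev (Z k)"
  let ?a = "\<lambda>k. en (\<lambda>\<omega>. \<phi> k \<omega> - ?Z k \<omega>)" and ?b = "\<lambda>k. en (\<lambda>\<omega>. \<psi> k \<omega> - ?Z k \<omega>)"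
  note la = closure_approx_energy[OF Z F l ap(1)] closure_approx_energy[OF Z F l ap(2)]
  show ?thesis
  proof (rule tendsto_sandwich[OF _ _ tendsto_const[of 0]])
    have "E (\<lambda>\<omega>. \<bar>carre_test (?Z k) (?Z k) \<omega> - G \<omega>\<bar>) \<le> ?a k * (?b k + sqrt (real p)) + ?b k * sqrt (real p) + E (\<lambda>\<omega>. \<bar>carre_test (\<phi> k) (\<psi> k) \<omega> - G \<omega>\<bar>)" for k
    proof -
      have i: "integrable gauss_space (carre_test (?Z k) (?Z k))" "integrable gauss_space (carre_test (\<phi> k) (\<psi> k))"
        by (rule carre_test_measurable(1)[OF ev_test_function ev_test_function] carre_test_measurable(1)[OF t])+
      have "en (\<psi> k) \<le> ?b k + sqrt (real p)"
      proof -
        have "en (ev (- Z k)) = sqrt (real p)"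
          using en_ev[OF W_minus[OF adm_W[OF Z]], of k] adm_nrm[OF Z, of k] by simp
        moreover have "en (\<lambda>\<omega>. (\<psi> k \<omega> - ?Z k \<omega>) - ev (- Z k) \<omega>) \<le> ?b k + en (ev (- Z k))"
          by (rule en_diff_le[OF test_functions_diff[OF t(2) ev_test_function] ev_test_function])
        ultimately show ?thesis by simp
      qed
      then have 1: "?a k * en (\<psi> k) \<le> ?a k * (?b k + sqrt (real p))"
        by (intro mult_left_mono en_nonneg test_functions_diff t ev_test_function)
      have "E (\<lambda>\<omega>. \<bar>carre_test (?Z k) (?Z k) \<omega> - G \<omega>\<bar>) \<le> E (\<lambda>\<omega>. \<bar>carre_test (\<phi> k) (\<psi> k) \<omega> - carre_test (?Z k) (?Z k) \<omega>\<bar> + \<bar>carre_test (\<phi> k) (\<psi> k) \<omega> - G \<omega>\<bar>)"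
        using i Gi by (intro integral_mono) auto
      also have "\<dots> = E (\<lambda>\<omega>. \<bar>carre_test (\<phi> k) (\<psi> k) \<omega> - carre_test (?Z k) (?Z k) \<omega>\<bar>) + E (\<lambda>\<omega>. \<bar>carre_test (\<phi> k) (\<psi> k) \<omega> - G \<omega>\<bar>)"
        using i Gi by simp
      also have "E (\<lambda>\<omega>. \<bar>carre_test (\<phi> k) (\<psi> k) \<omega> - carre_test (?Z k) (?Z k) \<omega>\<bar>) \<le> ?a k * en (\<psi> k) + ?b k * sqrt (real p)"
        using carre_diff_bound[OF t[of k] ev_test_function ev_test_function, of "Z k" "Z k"] adm_en[OF Z] by simp
      finally show ?thesis using 1 by linarith
    qed
    then show "\<forall>\<^sub>F k in sequentially. E (\<lambda>\<omega>. \<bar>carre_test (?Z k) (?Z k) \<omega> - G \<omega>\<bar>) \<le> ?a k * (?b k + sqrt (real p)) + ?b k * sqrt (real p) + E (\<lambda>\<omega>. \<bar>carre_test (\<phi> k) (\<psi> k) \<omega> - G \<omega>\<bar>)"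
      by simp
    have "(\<lambda>k. ?a k * (?b k + sqrt (real p)) + ?b k * sqrt (real p) + E (\<lambda>\<omega>. \<bar>carre_test (\<phi> k) (\<psi> k) \<omega> - G \<omega>\<bar>)) \<longlonglongrightarrow> 0 * (0 + sqrt (real p)) + 0 * sqrt (real p) + 0"
      by (intro tendsto_intros la lim)
    then show "(\<lambda>k. ?a k * (?b k + sqrt (real p)) + ?b k * sqrt (real p) + E (\<lambda>\<omega>. \<bar>carre_test (\<phi> k) (\<psi> k) \<omega> - G \<omega>\<bar>)) \<longlonglongrightarrow> 0" by simp
  qed (auto intro!: always_eventually integral_nonneg_AE)
qed

text \<open>Ensures that \<open>SOME\<close> in \<open>carre_du_champ\<close> selects a genuine
  object. The bilinear estimate \<open>carre_diff_bound\<close> turns the energy Cauchy property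
  into an L1 Cauchy property.\<close>

lemma is_carre_du_champ_exists:
  assumes Fc: "F \<in> wiener_chaos p" and Z: "\<And>k. adm p (n k) (Z k)" and l: "(\<lambda>k. L2n (\<lambda>\<omega>. ev (Z k) \<omega> - F \<omega>)) \<longlonglongrightarrow> 0"
  shows "\<exists>G. is_carre_du_champ F F G"
proof -
  note F = wiener_chaos_L2[OF Fc]
  let ?Z = "\<lambda>k. ev (Z k)"
  have ap: "closure_approx ?Z F"
    unfolding closure_approx_def
  proof (intro conjI allI impI)
    show "?Z k \<in> test_functions" for k by (rule ev_test_function)
    show "(\<lambda>k. E (\<lambda>\<omega>. (?Z k \<omega> - F \<omega>)\<^sup>2)) \<longlonglongrightarrow> 0" using l unfolding L2n_tendsto_iff .
    fix e :: real assume e: "0 < e"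
    then obtain N where N: "\<And>i j. N \<le> i \<Longrightarrow> N \<le> j \<Longrightarrow> en (\<lambda>\<omega>. ?Z i \<omega> - ?Z j \<omega>) < sqrt e"
      using adm_sequence_energy_Cauchy[OF Z F l, of "sqrt e"] by auto
    have "E (carre_test (\<lambda>\<omega>. ?Z i \<omega> - ?Z j \<omega>) (\<lambda>\<omega>. ?Z i \<omega> - ?Z j \<omega>)) < e" if "N \<le> i" "N \<le> j" for i j
      using N[OF that] unfolding en_def by simp
    then show "\<exists>N. \<forall>i\<ge>N. \<forall>j\<ge>N. E (carre_test (\<lambda>\<omega>. ?Z i \<omega> - ?Z j \<omega>) (\<lambda>\<omega>. ?Z i \<omega> - ?Z j \<omega>)) < e" by blast
  qed
  have "\<exists>G. integrable gauss_space G \<and> (\<lambda>k. E (\<lambda>\<omega>. \<bar>carre_test (?Z k) (?Z k) \<omega> - G \<omega>\<bar>)) \<longlonglongrightarrow> 0"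
  proof (rule L1_complete)
    show "integrable gauss_space (carre_test (?Z k) (?Z k))" for k
      by (rule carre_test_measurable(1)[OF ev_test_function ev_test_function])
    fix e :: real assume e: "0 < e"
    define d where "d = e / (2 * sqrt (real p) + 1)"
    have sp: "0 < 2 * sqrt (real p) + 1" by (intro add_nonneg_pos) auto
    have d: "0 < d" using e sp by (simp add: d_def)
    obtain N where N: "\<And>i j. N \<le> i \<Longrightarrow> N \<le> j \<Longrightarrow> en (\<lambda>\<omega>. ?Z i \<omega> - ?Z j \<omega>) < d"
      using adm_sequence_energy_Cauchy[OF Z F l d] by auto
    have "E (\<lambda>\<omega>. \<bar>carre_test (?Z i) (?Z i) \<omega> - carre_test (?Z j) (?Z j) \<omega>\<bar>) < e" if ij: "N \<le> i" "N \<le> j" for i j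
    proof -
      have "E (\<lambda>\<omega>. \<bar>carre_test (?Z i) (?Z i) \<omega> - carre_test (?Z j) (?Z j) \<omega>\<bar>) \<le> en (\<lambda>\<omega>. ?Z i \<omega> - ?Z j \<omega>) * sqrt (real p) + en (\<lambda>\<omega>. ?Z i \<omega> - ?Z j \<omega>) * sqrt (real p)"
        using carre_diff_bound[OF ev_test_function ev_test_function ev_test_function ev_test_function, of "Z i" "Z i" "Z j" "Z j"] adm_en[OF Z] by simp
      also have "\<dots> = en (\<lambda>\<omega>. ?Z i \<omega> - ?Z j \<omega>) * (2 * sqrt (real p))" by simp
      also have "\<dots> \<le> d * (2 * sqrt (real p))" using N[OF ij] by (intro mult_right_mono) auto
      also have "\<dots> < d * (2 * sqrt (real p) + 1)" using d by (intro mult_strict_left_mono) auto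
      also have "\<dots> = e" using sp by (simp add: d_def)
      finally show ?thesis .
    qed
    then show "\<exists>N. \<forall>i\<ge>N. \<forall>j\<ge>N. E (\<lambda>\<omega>. \<bar>carre_test (?Z i) (?Z i) \<omega> - carre_test (?Z j) (?Z j) \<omega>\<bar>) < e" by blast
  qed
  then show ?thesis unfolding is_carre_du_champ_def using ap wiener_chaos_carre_domain[OF Fc] by blast
qed

text \<open>Uniform moments of admissible polynomials bound the second moments of \<open>f\<close>
  along the sequence, as \<open>vitali_L2\<close> requires; continuity carries the almost sure
  convergence through \<open>f\<close>.\<close>

lemma vitali_adm:
  assumes Z: "\<And>k. adm p (n k) (Z k)" and F: "F \<in> borel_measurable gauss_space"
    and ae: "AE \<omega> in gauss_space. (\<lambda>k. ev (Z k) \<omega>) \<longlonglongrightarrow> F \<omega>"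
    and f: "continuous_on UNIV f" "growth N C f"
  shows "integrable gauss_space (\<lambda>\<omega>. f (F \<omega>))" "(\<lambda>k. E (\<lambda>\<omega>. f (ev (Z k) \<omega>))) \<longlonglongrightarrow> E (\<lambda>\<omega>. f (F \<omega>))"
proof -
  have fm [measurable]: "f \<in> borel_measurable borel" by (rule borel_measurable_continuous_onI[OF f(1)])
  have f2: "continuous_on UNIV (\<lambda>x. f x * f x)" "growth (N + N) (C * C) (\<lambda>x. f x * f x)"
    by (intro continuous_on_mult f growth_mult)+
  obtain K where K: "\<And>n F f C X. adm p n F \<Longrightarrow> continuous_on UNIV f \<Longrightarrow> growth (N + N) C f \<Longrightarrow> \<bar>TT F f X\<bar> \<le> K * C * nrm X"
    using TT_bound[of p "N + N"] by blast
  have sq: "(\<lambda>\<omega>. (f (ev Y \<omega>))\<^sup>2) = (\<lambda>\<omega>. ev 1 \<omega> * (f (ev Y \<omega>) * f (ev Y \<omega>)))" for Y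
    by (simp add: power2_eq_square fun_eq_iff)
  have m: "(\<lambda>\<omega>. f (ev (Z k) \<omega>)) \<in> borel_measurable gauss_space" "(\<lambda>\<omega>. f (F \<omega>)) \<in> borel_measurable gauss_space" for k
    using F by measurable
  have i: "integrable gauss_space (\<lambda>\<omega>. (f (ev (Z k) \<omega>))\<^sup>2)" for k
    unfolding sq by (rule TT_integrable[OF f2])
  have b: "E (\<lambda>\<omega>. (f (ev (Z k) \<omega>))\<^sup>2) \<le> K * (C * C) * nrm 1" for k
    using K[OF Z f2, of k 1] unfolding sq TT_def by (simp add: abs_le_iff)
  have a: "AE \<omega> in gauss_space. (\<lambda>k. f (ev (Z k) \<omega>)) \<longlonglongrightarrow> f (F \<omega>)"
    using ae
  proof eventually_elim
    case (elim \<omega>)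
    have "isCont f (F \<omega>)" using f(1) by (simp add: continuous_on_eq_continuous_at)
    then show ?case using elim by (rule isCont_tendsto_compose)
  qed
  show "integrable gauss_space (\<lambda>\<omega>. f (F \<omega>))" by (rule vitali_L2(1)[OF m i b a])
  show "(\<lambda>k. E (\<lambda>\<omega>. f (ev (Z k) \<omega>))) \<longlonglongrightarrow> E (\<lambda>\<omega>. f (F \<omega>))" by (rule vitali_L2(2)[OF m i b a])
qed

lemma AE_subseq:
  assumes i: "\<And>k. integrable gauss_space (s k)" "\<And>k \<omega>. 0 \<le> s k \<omega>" and l: "(\<lambda>k. E (s k)) \<longlonglongrightarrow> (0::real)"
  shows "\<exists>r::nat\<Rightarrow>nat. strict_mono r \<and> (AE \<omega> in gauss_space. (\<lambda>k. s (r k) \<omega>) \<longlonglongrightarrow> 0)"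
  by (rule tendsto_L1_AE_subseq) (use assms in auto)

text \<open>Two successive subsequences give almost sure convergence of \<open>Z\<close> and of
  Gamma(Z, Z). The variance involves a second moment, for which L1 convergence is too weak; moment
  equivalence in degree \<open>2 * p\<close> bounds the fourth moments, so that
  \<open>vitali_L2\<close> applies to the squares.\<close>

lemma wiener_chaos_approximation:
  assumes p: "1 \<le> p" and Fc: "F \<in> wiener_chaos p" and F1: "E (\<lambda>\<omega>. (F \<omega>)\<^sup>2) = 1"
  shows "\<exists>n Z. (\<forall>k. adm p (n k) (Z k)) \<and> (AE \<omega> in gauss_space. (\<lambda>k. ev (Z k) \<omega>) \<longlonglongrightarrow> F \<omega>) \<and>
     (\<lambda>k. nrm (gg p (n k) (Z k))) \<longlonglongrightarrow> sqrt (Var (carre_du_champ F F)) / real p"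
proof -
  note F = wiener_chaos_L2[OF Fc]
  obtain n0 Z0 where Z0: "\<And>k. adm p (n0 k) (Z0 k)" and l0: "(\<lambda>k. L2n (\<lambda>\<omega>. ev (Z0 k) \<omega> - F \<omega>)) \<longlonglongrightarrow> 0"
    using wiener_chaos_adm_approx[OF Fc F1] by blast
  obtain r where r: "strict_mono r" "AE \<omega> in gauss_space. (\<lambda>k. (ev (Z0 (r k)) \<omega> - F \<omega>)\<^sup>2) \<longlonglongrightarrow> 0"
    using AE_subseq[of "\<lambda>k \<omega>. (ev (Z0 k) \<omega> - F \<omega>)\<^sup>2"] l0 L2D(2)[OF L2_diff(1)[OF ev_L2 F]] unfolding L2n_tendsto_iff by auto
  define n1 Z1 where "n1 k = n0 (r k)" and "Z1 k = Z0 (r k)" for k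
  have Z1: "adm p (n1 k) (Z1 k)" for k using Z0 by (simp add: n1_def Z1_def)
  have l1: "(\<lambda>k. L2n (\<lambda>\<omega>. ev (Z1 k) \<omega> - F \<omega>)) \<longlonglongrightarrow> 0"
    using LIMSEQ_subseq_LIMSEQ[OF l0 r(1)] by (simp add: o_def Z1_def)
  let ?G = "carre_du_champ F F"
  have G: "is_carre_du_champ F F ?G"
    unfolding carre_du_champ_def using is_carre_du_champ_exists[OF Fc Z1 l1] by (rule someI_ex)
  then have Gi: "integrable gauss_space ?G" by (simp add: is_carre_du_champ_def)
  have lG: "(\<lambda>k. E (\<lambda>\<omega>. \<bar>ev (Gam (n1 k) (Z1 k) (Z1 k)) \<omega> - ?G \<omega>\<bar>)) \<longlonglongrightarrow> 0"
    using is_carre_du_champ_limit[OF Z1 F l1 G] unfolding carre_test_ev[OF adm_W[OF Z1]] .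
  obtain s where s: "strict_mono s" "AE \<omega> in gauss_space. (\<lambda>k. \<bar>ev (Gam (n1 (s k)) (Z1 (s k)) (Z1 (s k))) \<omega> - ?G \<omega>\<bar>) \<longlonglongrightarrow> 0"
  proof -
    have "integrable gauss_space (\<lambda>\<omega>. \<bar>ev (Gam (n1 k) (Z1 k) (Z1 k)) \<omega> - ?G \<omega>\<bar>)" for k
      by (intro integrable_abs Bochner_Integration.integrable_diff ev_integrable Gi)
    from AE_subseq[OF this abs_ge_zero lG] show ?thesis using that by blast
  qed
  define n Z where "n k = n1 (s k)" and "Z k = Z1 (s k)" for k
  have Z: "adm p (n k) (Z k)" for k using Z1 by (simp add: n_def Z_def)
  let ?g = "\<lambda>k. Gam (n k) (Z k) (Z k)"
  have aeF: "AE \<omega> in gauss_space. (\<lambda>k. ev (Z k) \<omega>) \<longlonglongrightarrow> F \<omega>"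
    using r(2)
  proof eventually_elim
    case (elim \<omega>)
    from tendsto_real_sqrt[OF elim] have "(\<lambda>k. \<bar>ev (Z1 k) \<omega> - F \<omega>\<bar>) \<longlonglongrightarrow> 0" by (simp add: Z1_def)
    then have "(\<lambda>k. ev (Z1 k) \<omega> - F \<omega>) \<longlonglongrightarrow> 0" by (rule tendsto_rabs_zero_cancel)
    then have "(\<lambda>k. ev (Z1 k) \<omega>) \<longlonglongrightarrow> F \<omega>" by (rule LIM_zero_cancel)
    from LIMSEQ_subseq_LIMSEQ[OF this s(1)] show ?case by (simp add: o_def Z_def)
  qed
  have aeG: "AE \<omega> in gauss_space. (\<lambda>k. ev (?g k) \<omega>) \<longlonglongrightarrow> ?G \<omega>"
    using s(2)
  proof eventually_elim
    case (elim \<omega>)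
    then have "(\<lambda>k. ev (?g k) \<omega> - ?G \<omega>) \<longlonglongrightarrow> 0" unfolding n_def Z_def by (rule tendsto_rabs_zero_cancel)
    then show ?case by (rule LIM_zero_cancel)
  qed
  have Gm [measurable]: "?G \<in> borel_measurable gauss_space" using Gi by auto
  have W: "W (n k) p (Z k)" for k by (rule adm_W[OF Z])
  obtain B where B: "1 \<le> B" "\<And>n F. adm p n F \<Longrightarrow> eta p n F \<le> B" using eta_bounded[OF p] by blast
  have gb: "nrm (?g k) \<le> real p * (1 + B\<^sup>2)" for k
  proof -
    have "nrm (?g k) = real p * nrm (1 + gg p (n k) (Z k))" unfolding Gam_FF[OF p] by (simp add: nrm_scaleR)
    also have "\<dots> \<le> real p * (nrm 1 + nrm (gg p (n k) (Z k)))" by (intro mult_left_mono nrm_triangle) auto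
    also have "\<dots> \<le> real p * (1 + B\<^sup>2)"
    proof (intro mult_left_mono add_mono)
      show "nrm 1 \<le> 1" by (simp add: nrm_def)
      show "nrm (gg p (n k) (Z k)) \<le> B\<^sup>2" unfolding eta_sq[symmetric] using B(2)[OF Z] by (intro power_mono) auto
    qed auto
    finally show ?thesis .
  qed
  obtain L where L: "0 \<le> L" "\<And>n X. Pd n (p + p) X \<Longrightarrow> nrm (X * X) \<le> L * (nrm X)\<^sup>2" using fourth_moment_le by blast
  have Pg: "Pd (n k) (p + p) (?g k)" for k
    by (rule Pd_mono[OF Pd_Gam[OF W_Pd[OF W] W_Pd[OF W]]]) auto
  have sq: "(\<lambda>\<omega>. (ev X \<omega>)\<^sup>2) = ev (X * X)" for X by (simp add: fun_eq_iff power2_eq_square)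
  have b1: "E (\<lambda>\<omega>. (ev (?g k) \<omega>)\<^sup>2) \<le> (real p * (1 + B\<^sup>2))\<^sup>2" for k
    unfolding sq Em_def[symmetric] nrm_sq[symmetric] by (intro power_mono gb) simp
  have b2: "E (\<lambda>\<omega>. (ev (?g k * ?g k) \<omega>)\<^sup>2) \<le> (L * (real p * (1 + B\<^sup>2))\<^sup>2)\<^sup>2" for k
    unfolding sq[of "_ * _"] Em_def[symmetric] nrm_sq[symmetric]
    using order_trans[OF L(2)[OF Pg[of k]] mult_left_mono[OF power_mono[OF gb[of k]] L(1)]]
    by (intro power_mono) auto
  have "(\<lambda>k. E (ev (?g k))) \<longlonglongrightarrow> E ?G"
    by (rule vitali_L2(2)[OF _ _ _ b1 aeG]) (auto simp: sq)
  moreover have Eg: "E (ev (?g k)) = real p" for k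
    using Em_Gam_W[OF Z, of k "Z k"] adm_1[OF Z, of k] by (simp add: Em_def)
  ultimately have EG: "E ?G = real p" by (simp add: LIMSEQ_const_iff)
  have a2: "AE \<omega> in gauss_space. (\<lambda>k. ev (?g k * ?g k) \<omega>) \<longlonglongrightarrow> (?G \<omega>)\<^sup>2"
    using aeG by eventually_elim (auto simp: power2_eq_square intro: tendsto_mult)
  have i2: "integrable gauss_space (\<lambda>\<omega>. (ev (?g k * ?g k) \<omega>)\<^sup>2)" for k
    unfolding sq by (rule ev_integrable)
  have lim2: "(\<lambda>k. E (ev (?g k * ?g k))) \<longlonglongrightarrow> E (\<lambda>\<omega>. (?G \<omega>)\<^sup>2)"
    by (rule vitali_L2(2)[OF _ _ i2 b2 a2]) auto
  have iG2: "integrable gauss_space (\<lambda>\<omega>. (?G \<omega>)\<^sup>2)"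
    by (rule vitali_L2(1)[OF _ _ i2 b2 a2]) auto
  have V: "Var ?G = E (\<lambda>\<omega>. (?G \<omega>)\<^sup>2) - (real p)\<^sup>2"
    using GS.variance_eq[OF Gi iG2] by (simp add: EG)
  \<comment> \<open>Expansion of the square of Gamma(Z, Z) / p - 1, where Gamma(Z, Z) has mean
    \<open>p\<close>.\<close>
  have nsq: "nrm (gg p (n k) (Z k)) = sqrt ((E (ev (?g k * ?g k)) - (real p)\<^sup>2) / (real p)\<^sup>2)" for k
  proof -
    have "gg p (n k) (Z k) * gg p (n k) (Z k) = (1 / (real p)\<^sup>2) *\<^sub>R (?g k * ?g k) - (2 / real p) *\<^sub>R ?g k + 1"
    proof -
      have "(2 / real p) *\<^sub>R ?g k = (1 / real p) *\<^sub>R ?g k + (1 / real p) *\<^sub>R ?g k" by (simp flip: scaleR_left_distrib)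
      then show ?thesis by (simp add: gg_def algebra_simps power2_eq_square)
    qed
    then have "Em (gg p (n k) (Z k) * gg p (n k) (Z k)) = E (ev (?g k * ?g k)) / (real p)\<^sup>2 - 1"
      using Eg[of k] p by (simp add: Em_def[symmetric])
    also have "\<dots> = (E (ev (?g k * ?g k)) - (real p)\<^sup>2) / (real p)\<^sup>2" using p by (simp add: field_simps)
    finally show ?thesis by (simp add: nrm_def)
  qed
  have "(\<lambda>k. nrm (gg p (n k) (Z k))) \<longlonglongrightarrow> sqrt ((E (\<lambda>\<omega>. (?G \<omega>)\<^sup>2) - (real p)\<^sup>2) / (real p)\<^sup>2)"
    unfolding nsq by (intro tendsto_intros lim2) (use p in auto)
  then have "(\<lambda>k. nrm (gg p (n k) (Z k))) \<longlonglongrightarrow> sqrt (Var ?G) / real p"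
    unfolding V by (simp add: real_sqrt_divide)
  then show ?thesis using Z aeF by blast
qed

lemma wiener_chaos_expansion:
  assumes p: "1 \<le> p" and m: "1 \<le> m"
  shows "\<exists>K\<ge>0. \<forall>F h. F \<in> wiener_chaos p \<longrightarrow> E (\<lambda>\<omega>. (F \<omega>)\<^sup>2) = 1 \<longrightarrow> continuous_on UNIV h \<longrightarrow> (\<forall>x. \<bar>h x\<bar> \<le> 1) \<longrightarrow>
     \<bar>E (\<lambda>\<omega>. hproj (4 * m) h (F \<omega>))\<bar> \<le> K * (sqrt (Var (carre_du_champ F F)) / real p) ^ (m + 1)"
proof -
  obtain K where K: "0 \<le> K" "\<And>n F h. adm p n F \<Longrightarrow> continuous_on UNIV h \<Longrightarrow> (\<forall>x. \<bar>h x\<bar> \<le> 1) \<Longrightarrow>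
     \<bar>E (\<lambda>\<omega>. hproj (4 * m) h (ev F \<omega>))\<bar> \<le> K * nrm (gg p n F) ^ (m + 1)"
    using polynomial_expansion[OF p m] by blast
  have "\<bar>E (\<lambda>\<omega>. hproj (4 * m) h (F \<omega>))\<bar> \<le> K * (sqrt (Var (carre_du_champ F F)) / real p) ^ (m + 1)"
    if Fc: "F \<in> wiener_chaos p" and F1: "E (\<lambda>\<omega>. (F \<omega>)\<^sup>2) = 1" and h: "continuous_on UNIV h" "\<forall>x. \<bar>h x\<bar> \<le> 1" for F h
  proof -
    obtain n Z where Z: "\<And>k. adm p (n k) (Z k)" and ae: "AE \<omega> in gauss_space. (\<lambda>k. ev (Z k) \<omega>) \<longlonglongrightarrow> F \<omega>"
      and l: "(\<lambda>k. nrm (gg p (n k) (Z k))) \<longlonglongrightarrow> sqrt (Var (carre_du_champ F F)) / real p"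
      using wiener_chaos_approximation[OF p Fc F1] by blast
    obtain C where "gorth (4 * m) (4 * m) C (hproj (4 * m) h)" using hproj_gorth h by blast
    note f = gorthD[OF this]
    have "(\<lambda>k. \<bar>E (\<lambda>\<omega>. hproj (4 * m) h (ev (Z k) \<omega>))\<bar>) \<longlonglongrightarrow> \<bar>E (\<lambda>\<omega>. hproj (4 * m) h (F \<omega>))\<bar>"
      by (intro tendsto_rabs vitali_adm(2)[OF Z L2D(1)[OF wiener_chaos_L2[OF Fc]] ae f])
    moreover have "(\<lambda>k. K * nrm (gg p (n k) (Z k)) ^ (m + 1)) \<longlonglongrightarrow> K * (sqrt (Var (carre_du_champ F F)) / real p) ^ (m + 1)"
      by (intro tendsto_intros l)
    ultimately show ?thesis by (rule LIMSEQ_le) (use K(2)[OF Z h] in auto)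
  qed
  then show ?thesis using K(1) by blast
qed

text \<open>\<open>H_1(F) = F\<close> is centred because \<open>p >= 1\<close>, and
  \<open>H_2(F) = F^2 - 1\<close> is centred by normalisation. This is why the corrections in the
  density start at \<open>k = 3\<close>.\<close>

lemma wiener_chaos_hermite_moments:
  assumes p: "1 \<le> p" and Fc: "F \<in> wiener_chaos p" and F1: "E (\<lambda>\<omega>. (F \<omega>)\<^sup>2) = 1"
  shows "integrable gauss_space (\<lambda>\<omega>. hermite k (F \<omega>))"
    "E (\<lambda>\<omega>. hermite 1 (F \<omega>)) = 0" "E (\<lambda>\<omega>. hermite 2 (F \<omega>)) = 0"
proof -
  obtain n Z where Z: "\<And>k. adm p (n k) (Z k)" and ae: "AE \<omega> in gauss_space. (\<lambda>k. ev (Z k) \<omega>) \<longlonglongrightarrow> F \<omega>"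
    using wiener_chaos_approximation[OF p Fc F1] by blast
  note v = vitali_adm[OF Z L2D(1)[OF wiener_chaos_L2[OF Fc]] ae]
  obtain C where "growth k C (hermite k)" using hermite_growth by blast
  then show "integrable gauss_space (\<lambda>\<omega>. hermite k (F \<omega>))" by (rule v(1)[OF hermite_continuous])
  have "(\<lambda>k. E (\<lambda>\<omega>. ev (Z k) \<omega>)) \<longlonglongrightarrow> E (\<lambda>\<omega>. F \<omega>)" by (rule v(2)[OF continuous_on_id growth_id])
  moreover have "E (\<lambda>\<omega>. ev (Z k) \<omega>) = 0" for k
  proof -
    have "W (n k) 0 1" using W_const[of "n k" 1] by simp
    then have "Em (Z k * 1) = 0" using W_orth[OF adm_W[OF Z[of k]], of 0 1] p by simp
    then show ?thesis by (simp add: Em_def)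
  qed
  ultimately have "E (\<lambda>\<omega>. F \<omega>) = 0" by (simp add: LIMSEQ_const_iff)
  then show "E (\<lambda>\<omega>. hermite 1 (F \<omega>)) = 0" by (simp add: hermite_eq_he)
  have "hermite 2 x = x\<^sup>2 - 1" for x by (simp add: hermite_eq_he numeral_2_eq_2)
  then show "E (\<lambda>\<omega>. hermite 2 (F \<omega>)) = 0"
    using F1 L2D(2)[OF wiener_chaos_L2[OF Fc]] GS.prob_space by simp
qed

section \<open>Integration against finite signed measures\<close>

text \<open>Recognising the supremum as the values of a known measure spares a proof that it is
  countably additive.\<close>

lemma jordan_pos_eqI:
  assumes N: "finite_measure N" "sets N = sets borel"
    and sup: "\<And>A. A \<in> sets borel \<Longrightarrow> (SUP B\<in>{B \<in> sets borel. B \<subseteq> A}. \<mu> B) = measure N A"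
  shows "jordan_pos \<mu> = N"
proof -
  have sp: "space N = UNIV" using sets_eq_imp_space_eq[OF N(2)] by simp
  have "jordan_pos \<mu> = measure_of UNIV (sets borel) (emeasure N)"
    unfolding jordan_pos_def
  proof (rule measure_of_eq)
    fix A :: "real set" assume "A \<in> sigma_sets UNIV (sets borel)"
    then have "A \<in> sets borel" using sets.sigma_sets_eq[of "borel :: real measure"] by simp
    then show "ennreal (SUP B\<in>{B \<in> sets borel. B \<subseteq> A}. \<mu> B) = emeasure N A"
      using sup finite_measure.emeasure_eq_measure[OF N(1), of A] by simp
  qed simp
  also have "\<dots> = N" using measure_of_of_measure[of N] by (simp add: sp N(2))
  finally show ?thesis .
qed

lemma SUP_eq_max: "z \<in> S \<Longrightarrow> (\<And>B. B \<in> S \<Longrightarrow> \<mu> B \<le> \<mu> z) \<Longrightarrow> (SUP B\<in>S. \<mu> B) = (\<mu> z :: real)"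
  by (rule cSup_eq_maximum) auto

text \<open>For a positive measure the supremum over subsets of \<open>A\<close> is attained at
  \<open>A\<close> itself, and for its negative at the empty set.\<close>

lemma signed_integral_measure:
  assumes M: "finite_measure M" "sets M = sets borel"
  shows "signed_integral (measure M) h = (\<integral>x. h x \<partial>M)"
proof -
  interpret finite_measure M by fact
  have 1: "jordan_pos (measure M) = M"
    by (rule jordan_pos_eqI[OF M], rule SUP_eq_max) (auto intro!: finite_measure_mono simp: M(2))
  have 2: "jordan_pos (\<lambda>A. - measure M A) = null_measure borel"
  proof (rule jordan_pos_eqI)
    fix A :: "real set"
    have "(SUP B\<in>{B \<in> sets borel. B \<subseteq> A}. - measure M B) = - measure M {}"
      by (rule SUP_eq_max) auto
    then show "(SUP B\<in>{B \<in> sets borel. B \<subseteq> A}. - measure M B) = measure (null_measure borel) A"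
      by (simp add: measure_def)
  qed (auto intro!: finite_measureI)
  have "(\<integral>x. h x \<partial>(null_measure borel :: real measure)) = 0"
    by (rule integral_eq_zero_AE) (auto simp: eventually_ae_filter null_sets_def intro!: exI[of _ UNIV])
  then show ?thesis unfolding signed_integral_def 1 2 by simp
qed

text \<open>The Hahn decomposition is explicit here: the supremum is attained where the density is
  nonnegative.\<close>

lemma jordan_pos_density:
  assumes \<rho>: "integrable lborel (\<rho> :: real \<Rightarrow> real)"
  shows "jordan_pos (\<lambda>A. LINT x:A|lborel. \<rho> x) = density lborel (\<lambda>x. ennreal (max 0 (\<rho> x)))"
proof (rule jordan_pos_eqI)
  have m [measurable]: "\<rho> \<in> borel_measurable borel" using borel_measurable_integrable[OF \<rho>] by simp
  let ?r = "\<lambda>x. max 0 (\<rho> x)"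
  have ri: "integrable lborel ?r" using \<rho> by (intro integrable_max) auto
  have riA: "integrable lborel (\<lambda>x. indicator A x * ?r x)" "integrable lborel (\<lambda>x. indicator A x * \<rho> x)" if "A \<in> sets borel" for A
    using integrable_indicator_mult[OF ri that] integrable_indicator_mult[OF \<rho> that] by auto
  have em: "emeasure (density lborel (\<lambda>x. ennreal (?r x))) A = ennreal (\<integral>x. indicator A x * ?r x \<partial>lborel)" if A: "A \<in> sets borel" for A
  proof -
    have "emeasure (density lborel (\<lambda>x. ennreal (?r x))) A = (\<integral>\<^sup>+x. ennreal (indicator A x * ?r x) \<partial>lborel)"
      using A by (subst emeasure_density) (auto intro!: nn_integral_cong simp: indicator_def)
    also have "\<dots> = ennreal (\<integral>x. indicator A x * ?r x \<partial>lborel)"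
      by (rule nn_integral_eq_integral[OF riA(1)[OF A]]) auto
    finally show ?thesis .
  qed
  show "finite_measure (density lborel (\<lambda>x. ennreal (?r x)))"
    using em[of UNIV] by (intro finite_measureI) simp
  show "sets (density lborel (\<lambda>x. ennreal (?r x))) = sets borel" by simp
  fix A :: "real set" assume A: "A \<in> sets borel"
  let ?B = "A \<inter> {x. 0 \<le> \<rho> x}"
  have B: "?B \<in> sets borel" using A by measurable
  have Bv: "(LINT x:?B|lborel. \<rho> x) = (\<integral>x. indicator A x * ?r x \<partial>lborel)"
    unfolding set_lebesgue_integral_def by (intro Bochner_Integration.integral_cong) (auto simp: indicator_def)
  have "(SUP B\<in>{B \<in> sets borel. B \<subseteq> A}. LINT x:B|lborel. \<rho> x) = (LINT x:?B|lborel. \<rho> x)"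
  proof (rule SUP_eq_max)
    show "?B \<in> {B \<in> sets borel. B \<subseteq> A}" using B by auto
    fix B assume "B \<in> {B \<in> sets borel. B \<subseteq> A}"
    then have B: "B \<in> sets borel" "B \<subseteq> A" by auto
    show "(LINT x:B|lborel. \<rho> x) \<le> (LINT x:?B|lborel. \<rho> x)"
      unfolding Bv unfolding set_lebesgue_integral_def real_scaleR_def
      by (intro integral_mono riA A B(1)) (use B(2) in \<open>auto simp: indicator_def\<close>)
  qed
  also have "\<dots> = measure (density lborel (\<lambda>x. ennreal (?r x))) A"
    unfolding Bv measure_def em[OF A] by (subst enn2real_ennreal) (auto intro!: integral_nonneg_AE)
  finally show "(SUP B\<in>{B \<in> sets borel. B \<subseteq> A}. LINT x:B|lborel. \<rho> x) = measure (density lborel (\<lambda>x. ennreal (?r x))) A" .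
qed

lemma signed_integral_density:
  assumes \<rho>: "integrable lborel (\<rho> :: real \<Rightarrow> real)" and h: "h \<in> borel_measurable borel" "\<And>x. \<bar>h x\<bar> \<le> 1"
  shows "signed_integral (\<lambda>A. LINT x:A|lborel. \<rho> x) h = (\<integral>x. \<rho> x * h x \<partial>lborel)"
proof -
  have m [measurable]: "\<rho> \<in> borel_measurable borel" using borel_measurable_integrable[OF \<rho>] by simp
  note h(1) [measurable]
  have neg: "(\<lambda>A. - (LINT x:A|lborel. \<rho> x)) = (\<lambda>A. LINT x:A|lborel. - \<rho> x)"
    by (simp add: set_lebesgue_integral_def fun_eq_iff)
  have I: "integrable lborel (\<lambda>x. max 0 (r x) * h x)" if r: "integrable lborel r" for r
  proof (rule Bochner_Integration.integrable_bound)
    show "integrable lborel (\<lambda>x. max 0 (r x))" using r by (intro integrable_max) auto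
    show "(\<lambda>x. max 0 (r x) * h x) \<in> borel_measurable lborel" using borel_measurable_integrable[OF r] by measurable
    have "\<bar>max 0 (r x) * h x\<bar> \<le> \<bar>max 0 (r x)\<bar> * 1" for x
      unfolding abs_mult using h(2)[of x] by (intro mult_left_mono) auto
    then show "AE x in lborel. norm (max 0 (r x) * h x) \<le> norm (max 0 (r x))" by simp
  qed
  have D: "(\<integral>x. h x \<partial>density lborel (\<lambda>x. ennreal (max 0 (r x)))) = (\<integral>x. max 0 (r x) * h x \<partial>lborel)"
    if r: "integrable lborel r" for r
    using borel_measurable_integrable[OF r] by (subst integral_density) auto
  have n: "integrable lborel (\<lambda>x. - \<rho> x)" using \<rho> by simp
  have "signed_integral (\<lambda>A. LINT x:A|lborel. \<rho> x) h = (\<integral>x. max 0 (\<rho> x) * h x \<partial>lborel) - (\<integral>x. max 0 (- \<rho> x) * h x \<partial>lborel)"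
    unfolding signed_integral_def neg jordan_pos_density[OF \<rho>] jordan_pos_density[OF n] D[OF \<rho>] D[OF n] ..
  also have "\<dots> = (\<integral>x. max 0 (\<rho> x) * h x - max 0 (- \<rho> x) * h x \<partial>lborel)"
    by (rule Bochner_Integration.integral_diff[OF I[OF \<rho>] I[OF n], symmetric])
  also have "\<dots> = (\<integral>x. \<rho> x * h x \<partial>lborel)"
    by (intro Bochner_Integration.integral_cong) (auto simp: max_def)
  finally show ?thesis .
qed

lemma edgeworth_density_eq:
  "edgeworth_density F m x = std_normal_density x * (1 + (\<Sum>k = 3..4 * m - 1. E (\<lambda>\<omega>. hermite k (F \<omega>)) / fact k * hermite k x))"
  by (simp add: edgeworth_density_def std_normal_density_eq)

lemma signed_integral_edgeworth:
  assumes h: "continuous_on UNIV h" "\<And>x. \<bar>h x\<bar> \<le> 1"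
  shows "signed_integral (edgeworth_measure F m) h =
    (\<integral>x. h x \<partial>std_gaussian) + (\<Sum>k = 3..4 * m - 1. E (\<lambda>\<omega>. hermite k (F \<omega>)) / fact k * (\<integral>x. h x * hermite k x \<partial>std_gaussian))"
proof -
  have hm [measurable]: "h \<in> borel_measurable borel" by (rule borel_measurable_continuous_onI[OF h(1)])
  have gh: "growth 0 1 h" using h(2) by (simp add: growth_def)
  let ?a = "\<lambda>k. E (\<lambda>\<omega>. hermite k (F \<omega>)) / fact k"
  have i: "integrable std_gaussian (\<lambda>x. h x * hermite k x)" "integrable std_gaussian (hermite k)" for k
  proof -
    obtain C where C: "growth k C (hermite k)" using hermite_growth by blast
    show "integrable std_gaussian (\<lambda>x. h x * hermite k x)" "integrable std_gaussian (hermite k)"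
      by (rule growth_integrable[OF _ growth_mult[OF gh C]] growth_integrable[OF _ C]; measurable)+
  qed
  have ih: "integrable std_gaussian h" by (rule growth_integrable[OF hm gh])
  interpret S: prob_space std_gaussian by (rule prob_space_std_gaussian)
  have "integrable std_gaussian (\<lambda>x. 1 + (\<Sum>k = 3..4 * m - 1. ?a k * hermite k x))" using i(2) by simp
  then have \<rho>: "integrable lborel (edgeworth_density F m)"
    unfolding edgeworth_density_eq[abs_def] by (subst (asm) integrable_std_gaussian_iff) auto
  have "edgeworth_measure F m = (\<lambda>A. LINT x:A|lborel. edgeworth_density F m x)"
    by (simp add: edgeworth_measure_def fun_eq_iff)
  then have "signed_integral (edgeworth_measure F m) h = (\<integral>x. edgeworth_density F m x * h x \<partial>lborel)"
    using signed_integral_density[OF \<rho> hm h(2)] by simp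
  also have "\<dots> = (\<integral>x. (1 + (\<Sum>k = 3..4 * m - 1. ?a k * hermite k x)) * h x \<partial>std_gaussian)"
    by (subst integral_std_gaussian) (auto simp: edgeworth_density_eq mult.assoc)
  also have "\<dots> = (\<integral>x. h x + (\<Sum>k = 3..4 * m - 1. ?a k * (h x * hermite k x)) \<partial>std_gaussian)"
    by (intro Bochner_Integration.integral_cong) (simp_all add: distrib_left sum_distrib_left ac_simps)
  also have "\<dots> = (\<integral>x. h x \<partial>std_gaussian) + (\<Sum>k = 3..4 * m - 1. ?a k * (\<integral>x. h x * hermite k x \<partial>std_gaussian))"
    using ih i(1) by (simp add: Bochner_Integration.integral_sum)
  finally show ?thesis .
qed

text \<open>In expectation the Hermite terms removed by \<open>hproj\<close> are, in degree 0, the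
  Gaussian mean of \<open>h\<close>, in degrees 1 and 2 zero, and in the remaining degrees the
  Edgeworth corrections.\<close>

lemma expansion_difference:
  assumes p: "1 \<le> p" and m: "1 \<le> m" and Fc: "F \<in> wiener_chaos p" and F1: "E (\<lambda>\<omega>. (F \<omega>)\<^sup>2) = 1"
    and h: "continuous_on UNIV h" "\<And>x. \<bar>h x\<bar> \<le> 1"
  shows "signed_integral (law F) h - signed_integral (edgeworth_measure F m) h = E (\<lambda>\<omega>. hproj (4 * m) h (F \<omega>))"
proof -
  have Fm [measurable]: "F \<in> borel_measurable gauss_space" by (rule L2D(1)[OF wiener_chaos_L2[OF Fc]])
  have hm [measurable]: "h \<in> borel_measurable borel" by (rule borel_measurable_continuous_onI[OF h(1)])
  let ?c = "\<lambda>k. \<integral>y. h y * hermite k y \<partial>std_gaussian"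
  let ?H = "\<lambda>k. E (\<lambda>\<omega>. hermite k (F \<omega>))"
  note H = wiener_chaos_hermite_moments[OF p Fc F1]
  have H0: "?H 0 = 1" using GS.prob_space by simp
  interpret D: prob_space "distr gauss_space borel F" by (rule GS.prob_space_distr) measurable
  have "signed_integral (law F) h = (\<integral>x. h x \<partial>distr gauss_space borel F)"
    unfolding law_def by (rule signed_integral_measure) (auto intro: D.finite_measure_axioms)
  also have "\<dots> = E (\<lambda>\<omega>. h (F \<omega>))" by (rule integral_distr) measurable
  finally have 1: "signed_integral (law F) h = E (\<lambda>\<omega>. h (F \<omega>))" .
  have hi: "integrable gauss_space (\<lambda>\<omega>. h (F \<omega>))"
    by (rule GS.integrable_const_bound[where B = 1]) (use h(2) in auto)
  have "E (\<lambda>\<omega>. hproj (4 * m) h (F \<omega>)) = E (\<lambda>\<omega>. h (F \<omega>)) - (\<Sum>k<4 * m. ?c k / fact k * ?H k)"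
    unfolding hproj_def using hi H(1) by (simp add: Bochner_Integration.integral_sum)
  \<comment> \<open>The splitting of the index range relies on \<open>4 * m - 1 >= 3\<close>, that
    is, on \<open>m >= 1\<close>.\<close>
  also have "(\<Sum>k<4 * m. ?c k / fact k * ?H k) = (\<Sum>k\<in>{0, 1, 2} \<union> {3..4 * m - 1}. ?c k / fact k * ?H k)"
    by (rule sum.cong) (use m in auto)
  also have "\<dots> = (\<Sum>k\<in>{0, 1, 2}. ?c k / fact k * ?H k) + (\<Sum>k = 3..4 * m - 1. ?c k / fact k * ?H k)"
    by (rule sum.union_disjoint) auto
  also have "(\<Sum>k\<in>{0, 1, 2}. ?c k / fact k * ?H k) = (\<integral>x. h x \<partial>std_gaussian)"
    using H(2,3) H0 by simp
  finally show ?thesis unfolding 1 signed_integral_edgeworth[OF h] by (simp add: mult_ac)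
qed

theorem theorem1p2:
  fixes p m :: nat
  assumes "p \<ge> 1" and "m \<ge> 1"
  shows "\<exists>C>0. \<forall>F\<in>wiener_chaos p. E (\<lambda>\<omega>. (F \<omega>)\<^sup>2) = 1 \<longrightarrow>
    d_TV (law F) (edgeworth_measure F m) \<le> C * Var (carre_du_champ F F) powr ((real m + 1) / 2)"
proof -
  obtain K where K: "0 \<le> K" "\<And>F h. F \<in> wiener_chaos p \<Longrightarrow> E (\<lambda>\<omega>. (F \<omega>)\<^sup>2) = 1 \<Longrightarrow> continuous_on UNIV h \<Longrightarrow> (\<forall>x. \<bar>h x\<bar> \<le> 1) \<Longrightarrow>
     \<bar>E (\<lambda>\<omega>. hproj (4 * m) h (F \<omega>))\<bar> \<le> K * (sqrt (Var (carre_du_champ F F)) / real p) ^ (m + 1)"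
    using wiener_chaos_expansion[OF assms] by blast
  \<comment> \<open>\<open>K\<close> may be zero, so 1 is added to obtain a positive
    constant.\<close>
  have "d_TV (law F) (edgeworth_measure F m) \<le> (K + 1) * Var (carre_du_champ F F) powr ((real m + 1) / 2)"
    if Fc: "F \<in> wiener_chaos p" and F1: "E (\<lambda>\<omega>. (F \<omega>)\<^sup>2) = 1" for F
  proof -
    let ?V = "Var (carre_du_champ F F)"
    have V: "0 \<le> ?V" by (rule GS.variance_positive)
    have pw: "(sqrt ?V / real p) ^ (m + 1) \<le> ?V powr ((real m + 1) / 2)"
    proof -
      have "sqrt ?V / real p \<le> sqrt ?V / 1" using assms(1) V by (intro divide_left_mono) auto
      then have "(sqrt ?V / real p) ^ (m + 1) \<le> sqrt ?V ^ (m + 1)" using V by (intro power_mono) auto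
      also have "\<dots> = ?V powr ((real m + 1) / 2)"
      \<comment> \<open>For zero variance both sides are zero, as
        \<open>0 powr a = 0\<close>.\<close>
      proof (cases "?V = 0")
        case False
        with V have pos: "0 < ?V" by (rule le_neq_trans[OF _ not_sym])
        have "sqrt ?V ^ (m + 1) = sqrt ?V powr real (m + 1)" using pos by (subst powr_realpow) auto
        also have "\<dots> = ?V powr ((real m + 1) / 2)" using pos by (simp add: powr_half_sqrt[symmetric] powr_powr add.commute)
        finally show ?thesis .
      qed simp
      finally show ?thesis .
    qed
    have "(SUP h\<in>{h. continuous_on UNIV h \<and> (\<forall>x. \<bar>h x\<bar> \<le> 1)}. \<bar>signed_integral (law F) h - signed_integral (edgeworth_measure F m) h\<bar>)
       \<le> K * ?V powr ((real m + 1) / 2)"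
    proof (rule cSUP_least)
      have "(\<lambda>_. 0) \<in> {h :: real \<Rightarrow> real. continuous_on UNIV h \<and> (\<forall>x. \<bar>h x\<bar> \<le> 1)}" by simp
      then show "{h :: real \<Rightarrow> real. continuous_on UNIV h \<and> (\<forall>x. \<bar>h x\<bar> \<le> 1)} \<noteq> {}" by blast
      fix h :: "real \<Rightarrow> real" assume "h \<in> {h. continuous_on UNIV h \<and> (\<forall>x. \<bar>h x\<bar> \<le> 1)}"
      then have h: "continuous_on UNIV h" "\<forall>x. \<bar>h x\<bar> \<le> 1" by auto
      have "\<bar>signed_integral (law F) h - signed_integral (edgeworth_measure F m) h\<bar> \<le> K * (sqrt ?V / real p) ^ (m + 1)"
        using K(2)[OF Fc F1 h] expansion_difference[OF assms Fc F1 h(1)] h(2) by simp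
      also have "\<dots> \<le> K * ?V powr ((real m + 1) / 2)" by (intro mult_left_mono pw K(1))
      finally show "\<bar>signed_integral (law F) h - signed_integral (edgeworth_measure F m) h\<bar> \<le> K * ?V powr ((real m + 1) / 2)" .
    qed
    then have "d_TV (law F) (edgeworth_measure F m) \<le> 1 / 2 * (K * ?V powr ((real m + 1) / 2))"
      unfolding d_TV_def by (intro mult_left_mono) auto
    also have "\<dots> \<le> (K + 1) * ?V powr ((real m + 1) / 2)"
      using K(1) mult_nonneg_nonneg[OF K(1) powr_ge_zero[of ?V "(real m + 1) / 2"]] powr_ge_zero[of ?V "(real m + 1) / 2"]
      unfolding distrib_right by linarith
    finally show ?thesis .
  qed
  then show ?thesis using K(1) by (intro exI[of _ "K + 1"]) auto
qed

end
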